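(* Let $\rho:\mathbb{R}\to[0,\infty)$ be a fixed smooth function with $\operatorname{supp}\rho\subset[-1,1]$ and $\int_{-1}^1\rho(s)\,ds=1$. Let $(u_n)_n$ be a bounded sequence in $H^2_{rad}(\mathbb{R}^4)$ such that $$u_n\rightharpoonup 0 \ \text{ weakly in } H^2(\mathbb{R}^4)\text{ as } n\to\infty,\qquad \limsup_{n\to\infty}\|u_n\|_{\mathcal{L}}=A_0>0,$$ $$\lim_{R\to\infty}\limsup_{n\to\infty}\int_{|x|>R}|u_n(x)|^2\,dx=0.$$ Then there exist a sequence $(\alpha^{(j)})_{j\ge1}$ of pairwise orthogonal scales, $\alpha^{(j)}=(\alpha^{(j)}_n)_n$, and a sequence of profiles $(\psi^{(j)})_{j\ge1}$ in $\mathcal{P}$ such that, up to extraction of a subsequence of $(u_n)$, for all $\ell\ge1$, $$u_n(x)=\sum_{j=1}^{\ell}\sqrt{\frac{\alpha_n^{(j)}}{8\pi^2}}\,\big(\psi^{(j)}*\rho_n^{(j)}\big)\left(\frac{-\log|x|}{\alpha_n^{(j)}}\right)+r_n^{(\ell)}(x),$$ where $\rho_n^{(j)}(s)=\alpha_n^{(j)}\rho(\alpha_n^{(j)}s)$ and $$\limsup_{n\to\infty}\big\|r_n^{(\ell)}\big\|_{\mathcal{L}}\longrightarrow0\quad\text{as }\ell\to\infty.$$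
   Context: $H^2_{rad}(\mathbb{R}^4)$ is the space of radial functions in $H^2(\mathbb{R}^4)$. All functions (including profiles) take values in one common scalar field ($\mathbb{R}$ or $\mathbb{C}$). Orlicz norm: for measurable $u$ on $\mathbb{R}^4$, $$\|u\|_{\mathcal{L}}=\inf\Big\{\lambda>0:\ \int_{\mathbb{R}^4}\big(e^{|u(x)|^2/\lambda^2}-1\big)dx\le\kappa\Big\},$$ where $\kappa\in(0,\infty)$ is the constant $\kappa=\sup\{\int_{\mathbb{R}^4}(e^{32\pi^2|u|^2}-1)dx:\ u\in H^2(\mathbb{R}^4),\ \|u\|_{H^2}\le1\}$, with $\|u\|_{H^2}=\|(-\Delta+I)u\|_{L^2}$ (finite by a theorem of Ruf and Sani). $\mathcal{L}=\mathcal{L}(\mathbb{R}^4)$ is the space of $u$ with $\|u\|_{\mathcal{L}}<\infty$. A scale is a sequence $\alpha=(\alpha_n)$ of positive real numbers tending to infinity. Two scales $\alpha,\beta$ are orthogonal if $|\log(\beta_n/\alpha_n)|\to\infty$ as $n\to\infty$. The set of profiles is $$\mathcal{P}=\{\psi\in L^2(\mathbb{R},e^{-4s}ds):\ \psi'\in L^2(\mathbb{R}),\ \psi_{|]-\infty,0]}=0\}.$$ $*$ denotes convolution on $\mathbb{R}$. *)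

theory Defs
  imports "HOL-Analysis.Analysis"
begin

text \<open>
  The scalar field is a type variable of sort \<open>{real_normed_field, euclidean_space}\<close>: a
  finite-dimensional commutative real division algebra with multiplicative norm, hence, up to
  isometric isomorphism, exactly \<open>\<real>\<close> or \<open>\<complex>\<close>.  Elements of \<open>L\<^sup>2\<close> and \<open>H\<^sup>2\<close> are represented by
  functions; all notions below are invariant under changes on null sets except where noted.
\<close>

subsection \<open>Smooth functions and weak derivatives\<close>

primrec C_k :: "nat \<Rightarrow> ('m::euclidean_space \<Rightarrow> 'b::real_normed_vector) \<Rightarrow> bool" where
  "C_k 0 f \<longleftrightarrow> continuous_on UNIV f"
| "C_k (Suc k) f \<longleftrightarrow>
     f differentiable_on UNIV \<and> (\<forall>v. C_k k (\<lambda>x. frechet_derivative f (at x) v))"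

definition smooth :: "('m::euclidean_space \<Rightarrow> 'b::real_normed_vector) \<Rightarrow> bool" where
  "smooth f \<longleftrightarrow> (\<forall>k. C_k k f)"

definition supp :: "('m::euclidean_space \<Rightarrow> 'b::real_normed_vector) \<Rightarrow> 'm set" where
  "supp f = closure {x. f x \<noteq> 0}"

definition test_function :: "('m::euclidean_space \<Rightarrow> real) \<Rightarrow> bool" where
  "test_function \<phi> \<longleftrightarrow> smooth \<phi> \<and> compact (supp \<phi>)"

text \<open>
  \<open>has_weak_derivative b u v\<close>: the distributional derivative of \<open>u\<close> in direction \<open>b\<close> is \<open>v\<close>.
  It is only used for locally integrable \<open>u\<close> and \<open>v\<close>, so both integrals converge.
\<close>

definition has_weak_derivative ::
    "'m::euclidean_space \<Rightarrow> ('m \<Rightarrow> 'a::euclidean_space) \<Rightarrow> ('m \<Rightarrow> 'a) \<Rightarrow> bool" where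
  "has_weak_derivative b u v \<longleftrightarrow>
     (\<forall>\<phi>. test_function \<phi> \<longrightarrow>
        (LINT x|lebesgue. frechet_derivative \<phi> (at x) b *\<^sub>R u x)
          = - (LINT x|lebesgue. \<phi> x *\<^sub>R v x))"

subsection \<open>Lebesgue and Sobolev spaces\<close>

definition L2 :: "('m::euclidean_space \<Rightarrow> 'a::euclidean_space) set" where
  "L2 = {u. u \<in> borel_measurable lebesgue \<and> integrable lebesgue (\<lambda>x. (norm (u x))\<^sup>2)}"

definition L2_norm :: "('m::euclidean_space \<Rightarrow> 'a::euclidean_space) \<Rightarrow> real" where
  "L2_norm u = sqrt (LINT x|lebesgue. (norm (u x))\<^sup>2)"

definition weakly_differentiable_L2 ::
    "'m::euclidean_space \<Rightarrow> ('m \<Rightarrow> 'a::euclidean_space) \<Rightarrow> bool" where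
  "weakly_differentiable_L2 b u \<longleftrightarrow> (\<exists>v\<in>L2. has_weak_derivative b u v)"

text \<open>A representative of the weak derivative, which is unique up to null sets.\<close>

definition weak_derivative ::
    "'m::euclidean_space \<Rightarrow> ('m \<Rightarrow> 'a::euclidean_space) \<Rightarrow> ('m \<Rightarrow> 'a)" where
  "weak_derivative b u = (SOME v. v \<in> L2 \<and> has_weak_derivative b u v)"

definition weak_laplacian ::
    "('m::euclidean_space \<Rightarrow> 'a::euclidean_space) \<Rightarrow> ('m \<Rightarrow> 'a)" where
  "weak_laplacian u = (\<lambda>x. \<Sum>b\<in>Basis. weak_derivative b (weak_derivative b u) x)"

definition H2 :: "(real^4 \<Rightarrow> 'a::euclidean_space) set" where
  "H2 = {u \<in> L2. \<forall>b\<in>Basis. weakly_differentiable_L2 b u \<and>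
            (\<forall>c\<in>Basis. weakly_differentiable_L2 c (weak_derivative b u))}"

definition H2_norm :: "(real^4 \<Rightarrow> 'a::euclidean_space) \<Rightarrow> real" where
  "H2_norm u = L2_norm (\<lambda>x. - weak_laplacian u x + u x)"

definition radial :: "(real^4 \<Rightarrow> 'a::euclidean_space) \<Rightarrow> bool" where
  "radial u \<longleftrightarrow> (\<exists>g. AE x in lebesgue. u x = g (norm x))"

definition H2_rad :: "(real^4 \<Rightarrow> 'a::euclidean_space) set" where
  "H2_rad = {u \<in> H2. radial u}"

text \<open>
  Bounded linear functionals on \<open>H\<^sup>2\<close>, acting on representatives.  The bound forces equal values
  on functions that agree almost everywhere.
\<close>

definition H2_functional ::
    "((real^4 \<Rightarrow> 'a::{real_normed_field, euclidean_space}) \<Rightarrow> 'a) \<Rightarrow> bool" where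
  "H2_functional F \<longleftrightarrow>
     (\<forall>u\<in>H2. \<forall>v\<in>H2. F (\<lambda>x. u x + v x) = F u + F v) \<and>
     (\<forall>c. \<forall>u\<in>H2. F (\<lambda>x. c * u x) = c * F u) \<and>
     (\<exists>C. \<forall>u\<in>H2. norm (F u) \<le> C * H2_norm u)"

definition weakly_null_H2 ::
    "(nat \<Rightarrow> real^4 \<Rightarrow> 'a::{real_normed_field, euclidean_space}) \<Rightarrow> bool" where
  "weakly_null_H2 u \<longleftrightarrow> (\<forall>F. H2_functional F \<longrightarrow> (\<lambda>n. F (u n)) \<longlonglongrightarrow> 0)"

subsection \<open>The Orlicz norm\<close>

text \<open>
  The integrals are \<open>ennreal\<close>-valued, and so are the constant \<open>\<kappa>\<close> and the norm; the norm is \<open>\<infinity>\<close>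
  exactly for functions outside the Orlicz space.  The type argument of \<open>\<kappa>\<close> is the scalar field.
\<close>

definition kappa :: "'a::{real_normed_field, euclidean_space} itself \<Rightarrow> ennreal" where
  "kappa _ = (SUP u \<in> {u :: real^4 \<Rightarrow> 'a. u \<in> H2 \<and> H2_norm u \<le> 1}.
      \<integral>\<^sup>+ x. ennreal (exp (32 * pi\<^sup>2 * (norm (u x))\<^sup>2) - 1) \<partial>lebesgue)"

definition orlicz_norm ::
    "(real^4 \<Rightarrow> 'a::{real_normed_field, euclidean_space}) \<Rightarrow> ennreal" where
  "orlicz_norm u = Inf {ennreal t | t. 0 < t \<and>
      (\<integral>\<^sup>+ x. ennreal (exp ((norm (u x))\<^sup>2 / t\<^sup>2) - 1) \<partial>lebesgue) \<le> kappa TYPE('a)}"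

subsection \<open>Scales and profiles\<close>

definition is_scale :: "(nat \<Rightarrow> real) \<Rightarrow> bool" where
  "is_scale \<alpha> \<longleftrightarrow> (\<forall>n. 0 < \<alpha> n) \<and> filterlim \<alpha> at_top sequentially"

definition orthogonal_scales :: "(nat \<Rightarrow> real) \<Rightarrow> (nat \<Rightarrow> real) \<Rightarrow> bool" where
  "orthogonal_scales \<alpha> \<beta> \<longleftrightarrow> filterlim (\<lambda>n. \<bar>ln (\<beta> n / \<alpha> n)\<bar>) at_top sequentially"

text \<open>The derivative \<open>\<psi>'\<close> is distributional; profiles vanish at every point of \<open>]-\<infinity>, 0]\<close>.\<close>

definition profiles :: "(real \<Rightarrow> 'a::euclidean_space) set" where
  "profiles = {\<psi>. \<psi> \<in> borel_measurable lebesgue \<and>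
      integrable lebesgue (\<lambda>s. (norm (\<psi> s))\<^sup>2 * exp (- 4 * s)) \<and>
      weakly_differentiable_L2 1 \<psi> \<and>
      (\<forall>s\<le>0. \<psi> s = 0)}"

definition convolution :: "(real \<Rightarrow> 'a::euclidean_space) \<Rightarrow> (real \<Rightarrow> real) \<Rightarrow> real \<Rightarrow> 'a" where
  "convolution f g s = (LINT t|lebesgue. g (s - t) *\<^sub>R f t)"

end

theory Submission
  imports Defs "HOL-Library.Diagonal_Subsequence"
begin

text \<open>In the variable \<open>s = - ln \<bar>x\<bar>\<close> a radial function \<open>u\<close> in \<open>H\<^sup>2\<close> becomes a function \<open>v\<close> with
  \<open>\<integral> \<bar>v'\<bar>\<^sup>2\<close> bounded by \<open>\<parallel>\<Delta>u\<parallel>\<^sup>2\<close>: test \<open>\<Delta>u\<close> with radial functions and apply Hardy's inequality to the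
  test functions. If \<open>u\<^sub>n\<close> is weakly null then \<open>v\<^sub>n\<close> tends to \<open>0\<close> pointwise, since a limit of \<open>v\<^sub>n\<close> is a
  radial square integrable solution of \<open>\<Delta>u = u\<close>, hence \<open>0\<close>.

  Only the region where \<open>\<bar>v\<^sub>n s\<bar> \<ge> \<epsilon> sqrt s\<close> keeps the Orlicz norm away from \<open>0\<close>. On the scale
  \<open>t = ln s\<close> the points of this region form clusters, whose number is bounded by the energy because
  each cluster costs a fixed amount of it. A diagonal extraction over all \<open>\<epsilon> = 1 / m\<close> makes the
  distance of any two clusters converge or diverge. The classes of clusters at bounded distance are
  the scales; being far apart in \<open>t\<close> is orthogonality. The functions \<open>v\<^sub>n (\<alpha>\<^sub>n s) / sqrt \<alpha>\<^sub>n\<close> have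
  the same energy and are equicontinuous, and their limits are the profiles.

  Convolving a profile changes its contribution to \<open>v\<^sub>n\<close> by a bounded amount that tends to \<open>0\<close>
  pointwise, so that dominated convergence, with the tail condition far from the origin, gives the
  smallness of the remainders.\<close>

section \<open>Functions of bounded energy\<close>

text \<open>The threshold \<epsilon> sqrt s is dictated by the exponential: with s = -ln |x| >= 0, a
  bound |u| <= \<epsilon> sqrt s + B makes exp(|u|^2 / (2 \<epsilon>^2)) at most a constant times 1
  / |x|, which is integrable near 0 in dimension 4. \<open>H2_norm\<close> measures only (-\<Delta>
  + I)u, and this shapes two steps. Weak nullity is tested on the functionals w -> integral of
  \<phi> (-\<Delta>w + w), bounded by Cauchy-Schwarz; they yield a limit equation instead of a zero
  limit, hence the uniqueness argument. And the norm of \<Delta>u is estimated through the L2 norm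
  of u, which the Orlicz bound controls by y <= e^y - 1. \<open>radial\<close> provides some
  function of the radius, possibly not measurable. The profile is therefore built from smoothed
  spherical means, for which the energy bound follows by duality, and only then shown to agree with
  u almost everywhere. Energy is expressed by difference quotients so that limits of rescaled
  functions inherit it; the weak derivative of a profile is recovered separately as an L2 limit of
  dyadic slopes.\<close>

lemma common_convergent_subsequence:
  fixes f :: "'i::countable \<Rightarrow> nat \<Rightarrow> 'b::heine_borel"
  assumes bdd: "\<And>i. bounded (range (f i))"
  obtains \<sigma> :: "nat \<Rightarrow> nat" where "strict_mono \<sigma>" "\<And>i. convergent (\<lambda>n. f i (\<sigma> n))"
proof -
  interpret subseqs "\<lambda>i s. convergent (f (from_nat i) \<circ> s)"
  proof
    fix i :: nat and s :: "nat \<Rightarrow> nat"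
    assume "strict_mono s"
    have "bounded (range (f (from_nat i :: 'i) \<circ> s))"
      by (rule bounded_subset[OF bdd[of "from_nat i"]]) auto
    from bounded_imp_convergent_subsequence[OF this]
    obtain l r where r: "strict_mono (r :: nat \<Rightarrow> nat)" "((f (from_nat i :: 'i) \<circ> s) \<circ> r) \<longlonglongrightarrow> l"
      by blast
    then show "\<exists>r'. strict_mono r' \<and> convergent (f (from_nat i :: 'i) \<circ> (s \<circ> r'))"
      by (auto simp: convergent_def o_assoc)
  qed
  have "convergent (\<lambda>n. f i (diagseq n))" for i
  proof -
    have "convergent (f (from_nat (to_nat i)) \<circ> (diagseq \<circ> ((+) (Suc (to_nat i)))))"
      by (rule diagseq_holds) (simp add: convergent_subseq_convergent flip: comp_assoc)
    then have "convergent (\<lambda>n. f i (diagseq (n + Suc (to_nat i))))"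
      by (simp add: o_def add.commute)
    then show ?thesis
      using convergent_ignore_initial_segment[of "\<lambda>n. f i (diagseq n)" "Suc (to_nat i)"] by simp
  qed
  then show thesis using that subseq_diagseq by blast
qed

text \<open>A derivative-free form of \<open>\<integral>\<^sub>0\<^sup>\<infinity> \<bar>v'\<bar>\<^sup>2 \<le> K\<close>, stable under pointwise limits. The condition on \<open>b\<close> says that
  the intervals \<open>{a..b a}\<close> have disjoint interiors.\<close>

definition energy_le :: "real \<Rightarrow> (real \<Rightarrow> 'a::real_normed_vector) \<Rightarrow> bool" where
  "energy_le K v \<longleftrightarrow> (\<forall>I b. finite I \<longrightarrow> (\<forall>a\<in>I. 0 \<le> a \<and> a < b a) \<longrightarrow>
      (\<forall>a\<in>I. \<forall>a'\<in>I. a < a' \<longrightarrow> b a \<le> a') \<longrightarrow>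
      (\<Sum>a\<in>I. (norm (v (b a) - v a))\<^sup>2 / (b a - a)) \<le> K)"

lemma energy_leD:
  assumes "energy_le K v" "finite I" "\<And>a. a \<in> I \<Longrightarrow> 0 \<le> a" "\<And>a. a \<in> I \<Longrightarrow> a < b a"
    "\<And>a a'. a \<in> I \<Longrightarrow> a' \<in> I \<Longrightarrow> a < a' \<Longrightarrow> b a \<le> a'"
  shows "(\<Sum>a\<in>I. (norm (v (b a) - v a))\<^sup>2 / (b a - a)) \<le> K"
  using assms(1)[unfolded energy_le_def, rule_format, of I b] assms(2-) by simp

lemma energy_le_nonneg: "energy_le K v \<Longrightarrow> 0 \<le> K"
  using energy_leD[of K v "{}"] by simp

lemma energy_le_mono: "energy_le K v \<Longrightarrow> K \<le> K' \<Longrightarrow> energy_le K' v"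
  unfolding energy_le_def using order_trans by blast

lemma energy_le_hoelder:
  assumes "energy_le K v" "0 \<le> s" "0 \<le> t"
  shows "(norm (v t - v s))\<^sup>2 \<le> K * \<bar>t - s\<bar>"
proof -
  have *: "(norm (v t - v s))\<^sup>2 \<le> K * \<bar>t - s\<bar>" if "0 \<le> s" "s < t" for s t
    using energy_leD[OF assms(1), of "{s}" "\<lambda>_. t"] that by (simp add: divide_le_eq)
  show ?thesis
    using *[of s t] *[of t s] assms(2,3)
    by (cases s t rule: linorder_cases) (auto simp: norm_minus_commute abs_minus_commute)
qed

text \<open>Dilating a partition by \<open>\<alpha>\<close> multiplies all lengths by
  \<open>\<alpha>\<close>, which the factor \<open>1 / sqrt \<alpha>\<close> inside the square
  undoes. This invariance ties the amplitude sqrt \<alpha> of a profile to its scale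
  \<alpha>.\<close>

lemma energy_le_scale:
  assumes E: "energy_le K v" and "0 < \<alpha>"
  shows "energy_le K (\<lambda>y. (1 / sqrt \<alpha>) *\<^sub>R v (\<alpha> * y))"
  unfolding energy_le_def
proof (intro allI impI)
  fix I :: "real set" and b :: "real \<Rightarrow> real"
  assume I: "finite I" "\<forall>a\<in>I. 0 \<le> a \<and> a < b a" "\<forall>a\<in>I. \<forall>a'\<in>I. a < a' \<longrightarrow> b a \<le> a'"
  have inj: "inj_on ((*) \<alpha>) I" using \<open>0 < \<alpha>\<close> by (auto simp: inj_on_def)
  have "(\<Sum>a\<in>I. (norm ((1 / sqrt \<alpha>) *\<^sub>R v (\<alpha> * b a) - (1 / sqrt \<alpha>) *\<^sub>R v (\<alpha> * a)))\<^sup>2 / (b a - a))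
      = (\<Sum>a\<in>I. (norm (v (\<alpha> * b a) - v (\<alpha> * a)))\<^sup>2 / (\<alpha> * b a - \<alpha> * a))"
  proof (rule sum.cong[OF refl])
    fix a assume "a \<in> I"
    show "(norm ((1 / sqrt \<alpha>) *\<^sub>R v (\<alpha> * b a) - (1 / sqrt \<alpha>) *\<^sub>R v (\<alpha> * a)))\<^sup>2 / (b a - a)
        = (norm (v (\<alpha> * b a) - v (\<alpha> * a)))\<^sup>2 / (\<alpha> * b a - \<alpha> * a)"
      using \<open>0 < \<alpha>\<close> unfolding scaleR_diff_right[symmetric] norm_scaleR power_mult_distrib
      by (simp add: power_divide right_diff_distrib[symmetric] real_sqrt_pow2)
  qed
  also have "\<dots> = (\<Sum>a\<in>(*) \<alpha> ` I. (norm (v (\<alpha> * b (a / \<alpha>)) - v a))\<^sup>2 / (\<alpha> * b (a / \<alpha>) - a))"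
    using \<open>0 < \<alpha>\<close> by (subst sum.reindex[OF inj]) (simp add: o_def)
  also have "\<dots> \<le> K"
    by (rule energy_leD[OF E]) (use I \<open>0 < \<alpha>\<close> in auto)
  finally show "(\<Sum>a\<in>I. (norm ((1 / sqrt \<alpha>) *\<^sub>R v (\<alpha> * b a) - (1 / sqrt \<alpha>) *\<^sub>R v (\<alpha> * a)))\<^sup>2
      / (b a - a)) \<le> K" .
qed

lemma energy_le_limit:
  assumes E: "\<And>n. energy_le K (f n)" and lim: "\<And>y. 0 \<le> y \<Longrightarrow> (\<lambda>n. f n y) \<longlonglongrightarrow> g y"
  shows "energy_le K g"
  unfolding energy_le_def
proof (intro allI impI)
  fix I :: "real set" and b :: "real \<Rightarrow> real"
  assume I: "finite I" "\<forall>a\<in>I. 0 \<le> a \<and> a < b a" "\<forall>a\<in>I. \<forall>a'\<in>I. a < a' \<longrightarrow> b a \<le> a'"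
  have "(\<lambda>n. \<Sum>a\<in>I. (norm (f n (b a) - f n a))\<^sup>2 / (b a - a))
      \<longlonglongrightarrow> (\<Sum>a\<in>I. (norm (g (b a) - g a))\<^sup>2 / (b a - a))"
    using I by (intro tendsto_intros lim) force+
  then show "(\<Sum>a\<in>I. (norm (g (b a) - g a))\<^sup>2 / (b a - a)) \<le> K"
  proof (rule LIMSEQ_le_const2)
    show "\<exists>N. \<forall>n\<ge>N. (\<Sum>a\<in>I. (norm (f n (b a) - f n a))\<^sup>2 / (b a - a)) \<le> K"
      using I by (intro exI[of _ 0] allI impI energy_leD[OF E]) auto
  qed
qed

lemma hoelder_imp_continuous_on:
  fixes f :: "real \<Rightarrow> 'a::real_normed_vector"
  assumes H: "\<And>s t. s \<in> S \<Longrightarrow> t \<in> S \<Longrightarrow> (norm (f t - f s))\<^sup>2 \<le> K * \<bar>t - s\<bar>"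
  shows "continuous_on S f"
  unfolding continuous_on_def
proof
  fix s assume "s \<in> S"
  have "((\<lambda>t. sqrt (K * \<bar>t - s\<bar>)) \<longlongrightarrow> sqrt (K * \<bar>s - s\<bar>)) (at s within S)"
    by (intro tendsto_intros)
  then have "((\<lambda>t. sqrt (K * \<bar>t - s\<bar>)) \<longlongrightarrow> 0) (at s within S)" by simp
  then have "((\<lambda>t. f t - f s) \<longlongrightarrow> 0) (at s within S)"
  proof (rule Lim_null_comparison[rotated])
    show "\<forall>\<^sub>F t in at s within S. norm (f t - f s) \<le> sqrt (K * \<bar>t - s\<bar>)"
      unfolding eventually_at_filter
      by (rule always_eventually) (use H \<open>s \<in> S\<close> in \<open>auto intro: real_le_rsqrt\<close>)
  qed
  then show "(f \<longlongrightarrow> f s) (at s within S)" by (rule LIM_zero_cancel)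
qed

text \<open>Extension by 0 to the left is composition with \<open>max 0\<close>, which does not
  increase distances.\<close>

lemma energy_le_hoelder_UNIV:
  assumes "energy_le K v" and Z: "\<And>s. s \<le> 0 \<Longrightarrow> v s = 0"
  shows "(norm (v t - v s))\<^sup>2 \<le> K * \<bar>t - s\<bar>"
proof -
  have "v s = v (max 0 s)" "v t = v (max 0 t)" using Z by (auto simp: max_def)
  then have "(norm (v t - v s))\<^sup>2 \<le> K * \<bar>max 0 t - max 0 s\<bar>"
    using energy_le_hoelder[OF assms(1), of "max 0 s" "max 0 t"] by simp
  also have "\<dots> \<le> K * \<bar>t - s\<bar>"
    by (rule mult_left_mono) (use energy_le_nonneg[OF assms(1)] in auto)
  finally show ?thesis .
qed

text \<open>The pointwise half of Arzela-Ascoli: the Hoelder bound is uniform in \<open>n\<close>,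
  so the Cauchy property passes from nearby points of \<open>D\<close> to \<open>t\<close>.\<close>

lemma equi_hoelder_convergent:
  fixes f :: "nat \<Rightarrow> real \<Rightarrow> 'a::banach"
  assumes H: "\<And>n s t. s \<in> S \<Longrightarrow> t \<in> S \<Longrightarrow> (norm (f n t - f n s))\<^sup>2 \<le> K * \<bar>t - s\<bar>"
    and conv: "\<And>q. q \<in> D \<Longrightarrow> convergent (\<lambda>n. f n q)"
    and dense: "\<And>e. 0 < e \<Longrightarrow> \<exists>q\<in>D \<inter> S. \<bar>t - q\<bar> < e" and t: "t \<in> S"
  shows "convergent (\<lambda>n. f n t)"
proof (rule Cauchy_convergent, rule metric_CauchyI)
  fix e :: real assume "0 < e"
  \<comment> \<open>Within distance \<open>d\<close> the Hoelder bound stays below (e/3)^2;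
    \<open>\<bar>K\<bar> + 1\<close> is a positive denominator for every real
    \<open>K\<close>.\<close>
  define d where "d = (e/3)\<^sup>2 / (\<bar>K\<bar> + 1)"
  have d: "0 < d" using \<open>0 < e\<close> by (auto simp: d_def intro!: divide_pos_pos)
  obtain q where q: "q \<in> D" "q \<in> S" "\<bar>t - q\<bar> < d" using dense[OF d] by blast
  have near: "norm (f n t - f n q) < e/3" for n
  proof -
    have "(norm (f n t - f n q))\<^sup>2 \<le> K * \<bar>t - q\<bar>" using H q t by blast
    also have "\<dots> \<le> (\<bar>K\<bar> + 1) * \<bar>t - q\<bar>" by (rule mult_right_mono) auto
    also have "\<dots> < (\<bar>K\<bar> + 1) * d" using q by (intro mult_strict_left_mono) auto
    also have "\<dots> = (e/3)\<^sup>2" by (simp add: d_def)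
    finally show ?thesis by (rule power_less_imp_less_base) (use \<open>0 < e\<close> in simp)
  qed
  have "Cauchy (\<lambda>n. f n q)" using conv q convergent_Cauchy by blast
  then obtain M where M: "\<And>m n. m \<ge> M \<Longrightarrow> n \<ge> M \<Longrightarrow> dist (f m q) (f n q) < e/3"
    using metric_CauchyD \<open>0 < e\<close> by (metis divide_pos_pos zero_less_numeral)
  show "\<exists>M. \<forall>m\<ge>M. \<forall>n\<ge>M. dist (f m t) (f n t) < e"
  proof (intro exI allI impI)
    fix m n assume "m \<ge> M" "n \<ge> M"
    then have "dist (f m q) (f n q) < e/3" by (rule M)
    moreover have "dist (f m t) (f n t) \<le> dist (f m t) (f m q) + dist (f m q) (f n t)"
      "dist (f m q) (f n t) \<le> dist (f m q) (f n q) + dist (f n q) (f n t)"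
      by (rule dist_triangle)+
    moreover have "dist (f m t) (f m q) < e/3" "dist (f n q) (f n t) < e/3"
      using near[of m] near[of n] by (simp_all add: dist_norm norm_minus_commute)
    ultimately show "dist (f m t) (f n t) < e" by linarith
  qed
qed

text \<open>Only the finitely many points of a grid of mesh \<open>h\<close> have to be controlled;
  between them \<open>f n\<close> and \<open>g\<close> each move by at most a third of
  \<open>\<delta>\<close>.\<close>

lemma equi_hoelder_uniform:
  fixes f :: "nat \<Rightarrow> real \<Rightarrow> 'a::real_normed_vector"
  assumes H: "\<And>n s t. 0 \<le> s \<Longrightarrow> 0 \<le> t \<Longrightarrow> (norm (f n t - f n s))\<^sup>2 \<le> K * \<bar>t - s\<bar>"
    and lim: "\<And>s. 0 \<le> s \<Longrightarrow> (\<lambda>n. f n s) \<longlonglongrightarrow> g s" and "0 < \<delta>"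
  shows "\<forall>\<^sub>F n in sequentially. \<forall>s\<in>{0..B}. norm (f n s - g s) < \<delta>"
proof -
  define h where "h = (\<delta>/3)\<^sup>2 / (\<bar>K\<bar> + 1)"
  have h: "0 < h" using \<open>0 < \<delta>\<close> by (auto simp: h_def intro!: divide_pos_pos)
  have near: "norm (f n t - f n s) \<le> \<delta>/3" if "0 \<le> s" "0 \<le> t" "\<bar>t - s\<bar> \<le> h" for n s t
  proof -
    have "(norm (f n t - f n s))\<^sup>2 \<le> K * \<bar>t - s\<bar>" using H that by blast
    also have "\<dots> \<le> (\<bar>K\<bar> + 1) * \<bar>t - s\<bar>" by (rule mult_right_mono) auto
    also have "\<dots> \<le> (\<bar>K\<bar> + 1) * h" using that by (intro mult_left_mono) auto
    also have "\<dots> = (\<delta>/3)\<^sup>2" by (simp add: h_def)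
    finally show ?thesis by (rule power2_le_imp_le) (use \<open>0 < \<delta>\<close> in simp)
  qed
  have nearg: "norm (g t - g s) \<le> \<delta>/3" if "0 \<le> s" "0 \<le> t" "\<bar>t - s\<bar> \<le> h" for s t
  proof (rule LIMSEQ_le_const2)
    show "(\<lambda>n. norm (f n t - f n s)) \<longlonglongrightarrow> norm (g t - g s)" by (intro tendsto_intros lim that)
  qed (use near that in blast)
  have "\<forall>\<^sub>F n in sequentially. \<forall>i\<in>{..nat \<lceil>B/h\<rceil>}. norm (f n (real i * h) - g (real i * h)) < \<delta>/3"
  proof (rule eventually_ball_finite, simp, intro ballI)
    fix i
    have "(\<lambda>n. f n (real i * h) - g (real i * h)) \<longlonglongrightarrow> 0"
      using lim[of "real i * h"] h by (simp add: LIM_zero)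
    then show "\<forall>\<^sub>F n in sequentially. norm (f n (real i * h) - g (real i * h)) < \<delta>/3"
      using \<open>0 < \<delta>\<close> order_tendstoD(2)[OF tendsto_norm_zero, of _ _ "\<delta>/3"] by auto
  qed
  then show ?thesis
  proof (rule eventually_mono, intro ballI)
    fix n s assume *: "\<forall>i\<in>{..nat \<lceil>B/h\<rceil>}. norm (f n (real i * h) - g (real i * h)) < \<delta>/3"
      and s: "s \<in> {0..B}"
    define i where "i = nat \<lfloor>s/h\<rfloor>"
    have i: "real i = of_int \<lfloor>s/h\<rfloor>" using s h by (simp add: i_def)
    have "real i \<le> s/h" "s/h < real i + 1" unfolding i by linarith+
    then have si: "\<bar>s - real i * h\<bar> \<le> h" using h by (simp add: field_simps abs_le_iff)
    have "i \<le> nat \<lceil>B/h\<rceil>" unfolding i_def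
    proof (rule nat_mono)
      have "s/h \<le> B/h" using s h by (simp add: divide_right_mono)
      then show "\<lfloor>s/h\<rfloor> \<le> \<lceil>B/h\<rceil>" by linarith
    qed
    then have A: "norm (f n (real i * h) - g (real i * h)) < \<delta>/3" using * by auto
    have B1: "norm (f n s - f n (real i * h)) \<le> \<delta>/3"
      by (rule near) (use s h si in auto)
    have C: "norm (g (real i * h) - g s) \<le> \<delta>/3"
      by (rule nearg) (use s h si in \<open>auto simp: abs_minus_commute\<close>)
    have "norm (f n s - g s) \<le> norm (f n s - f n (real i * h)) + norm (f n (real i * h) - g s)"
      "norm (f n (real i * h) - g s) \<le> norm (f n (real i * h) - g (real i * h)) + norm (g (real i * h) - g s)"
      using norm_triangle_ineq[of "f n s - f n (real i * h)" "f n (real i * h) - g s"]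
        norm_triangle_ineq[of "f n (real i * h) - g (real i * h)" "g (real i * h) - g s"] by simp_all
    then show "norm (f n s - g s) < \<delta>" using A B1 C by linarith
  qed
qed

section \<open>Smooth functions and test functions\<close>

lemma integral_Cauchy_Schwarz:
  fixes f :: "'m \<Rightarrow> real" and w :: "'m \<Rightarrow> 'a::euclidean_space"
  assumes [measurable]: "f \<in> borel_measurable M" "w \<in> borel_measurable M"
    and f: "integrable M (\<lambda>x. (f x)\<^sup>2)" and w: "integrable M (\<lambda>x. (norm (w x))\<^sup>2)"
  shows "integrable M (\<lambda>x. f x *\<^sub>R w x)"
    and "(norm (LINT x|M. f x *\<^sub>R w x))\<^sup>2 \<le> (LINT x|M. (f x)\<^sup>2) * (LINT x|M. (norm (w x))\<^sup>2)"
proof -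
  have *: "\<bar>f x\<bar> * norm (w x) \<le> (f x)\<^sup>2 + (norm (w x))\<^sup>2" for x
  proof -
    have "2 * \<bar>f x\<bar> * norm (w x) \<le> (f x)\<^sup>2 + (norm (w x))\<^sup>2"
      using sum_squares_bound[of "\<bar>f x\<bar>" "norm (w x)"] by simp
    moreover have "0 \<le> \<bar>f x\<bar> * norm (w x)" by simp
    ultimately show ?thesis by linarith
  qed
  show int: "integrable M (\<lambda>x. f x *\<^sub>R w x)"
    by (rule Bochner_Integration.integrable_bound[OF Bochner_Integration.integrable_add[OF f w]])
      (use * in auto)
  define A where "A = (LINT x|M. (f x)\<^sup>2)"
  define B where "B = (LINT x|M. \<bar>f x\<bar> * norm (w x))"
  define C where "C = (LINT x|M. (norm (w x))\<^sup>2)"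
  have intB: "integrable M (\<lambda>x. \<bar>f x\<bar> * norm (w x))"
    using integrable_norm[OF int] by simp
  \<comment> \<open>The integral of a square is nonnegative for every \<open>t\<close>; the
    discriminant gives the claim, through \<open>t = B / A\<close>, while for \<open>A = 0\<close>
    the linear term is forced to vanish.\<close>
  have quad: "0 \<le> t\<^sup>2 * A - 2 * t * B + C" for t
  proof -
    have "0 \<le> (LINT x|M. (t * \<bar>f x\<bar> - norm (w x))\<^sup>2)" by simp
    also have "\<dots> = (LINT x|M. t\<^sup>2 * (f x)\<^sup>2 - 2 * t * (\<bar>f x\<bar> * norm (w x)) + (norm (w x))\<^sup>2)"
      by (rule Bochner_Integration.integral_cong[OF refl])
        (simp add: power2_diff power_mult_distrib algebra_simps)
    also have "\<dots> = t\<^sup>2 * A - 2 * t * B + C"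
      using f w intB by (simp add: A_def B_def C_def)
    finally show ?thesis .
  qed
  have "0 \<le> A" "0 \<le> B" "0 \<le> C" by (auto simp: A_def B_def C_def)
  have "B\<^sup>2 \<le> A * C"
  proof (cases "A = 0")
    case True
    have "B = 0"
    proof (rule ccontr)
      assume "B \<noteq> 0"
      then show False using quad[of "(C + 1) / (2 * B)"] \<open>0 \<le> C\<close> True by (simp add: field_simps)
    qed
    then show ?thesis using True by simp
  next
    case False
    then have "0 < A" using \<open>0 \<le> A\<close> by simp
    then have "0 \<le> A * ((B / A)\<^sup>2 * A - 2 * (B / A) * B + C)" using quad[of "B / A"] by simp
    also have "\<dots> = A * C - B\<^sup>2" using \<open>0 < A\<close> by (simp add: field_simps power2_eq_square)
    finally show ?thesis by simp
  qed
  moreover have "norm (LINT x|M. f x *\<^sub>R w x) \<le> B"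
    unfolding B_def by (rule order_trans[OF integral_norm_bound]) simp
  ultimately show "(norm (LINT x|M. f x *\<^sub>R w x))\<^sup>2 \<le> A * C"
    using power_mono[of "norm (LINT x|M. f x *\<^sub>R w x)" B 2] by auto
qed

lemma C_k_imp_continuous: "C_k k f \<Longrightarrow> continuous_on UNIV f"
  by (cases k) (auto intro: differentiable_imp_continuous_on)

lemma smooth_frechet_derivative:
  "smooth \<phi> \<Longrightarrow> smooth (\<lambda>x. frechet_derivative \<phi> (at x) b)"
  unfolding smooth_def by (metis C_k.simps(2))

lemma smooth_imp_continuous: "smooth \<phi> \<Longrightarrow> continuous_on UNIV \<phi>"
  unfolding smooth_def using C_k_imp_continuous by blast

lemma test_function_frechet_derivative:
  assumes "test_function \<phi>"
  shows "test_function (\<lambda>x. frechet_derivative \<phi> (at x) b)"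
proof -
  have "supp (\<lambda>x. frechet_derivative \<phi> (at x) b) \<subseteq> supp \<phi>"
    unfolding supp_def[of "\<lambda>x. frechet_derivative \<phi> (at x) b"]
  proof (rule closure_minimal, rule subsetI, rule ccontr)
    fix x assume "x \<in> {x. frechet_derivative \<phi> (at x) b \<noteq> 0}" "x \<notin> supp \<phi>"
    have "open (- supp \<phi>)" by (simp add: supp_def open_Compl)
    have "((\<lambda>_. 0) has_derivative (\<lambda>_. 0)) (at x)" by simp
    then have "(\<phi> has_derivative (\<lambda>_. 0)) (at x)"
    proof (rule has_derivative_transform_within_open[OF _ \<open>open (- supp \<phi>)\<close>])
      fix y assume "y \<in> - supp \<phi>"
      then show "0 = \<phi> y" using closure_subset[of "{x. \<phi> x \<noteq> 0}"] by (auto simp: supp_def)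
    qed (use \<open>x \<notin> supp \<phi>\<close> in simp)
    then have "frechet_derivative \<phi> (at x) = (\<lambda>_. 0)" by (simp add: frechet_derivative_at[symmetric])
    then show False using \<open>x \<in> _\<close> by simp
  qed (simp add: supp_def)
  then show ?thesis using assms smooth_frechet_derivative[of \<phi> b]
    unfolding test_function_def
    using compact_Int_closed[of "supp \<phi>" "supp (\<lambda>x. frechet_derivative \<phi> (at x) b)"]
    by (simp add: Int_absorb1) (simp add: supp_def)
qed

lemma test_function_vanishes:
  assumes "test_function \<phi>"
  obtains R where "0 < R" "\<And>x. R \<le> norm x \<Longrightarrow> \<phi> x = 0"
proof -
  have "bounded (supp \<phi>)" using assms by (simp add: test_function_def compact_imp_bounded)
  then obtain R where R: "\<And>x. x \<in> supp \<phi> \<Longrightarrow> norm x \<le> R" by (auto simp: bounded_iff)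
  show thesis
  proof (rule that[of "\<bar>R\<bar> + 1"])
    fix x :: 'a assume "\<bar>R\<bar> + 1 \<le> norm x"
    then have "x \<notin> supp \<phi>" using R[of x] by linarith
    then show "\<phi> x = 0" using closure_subset[of "{x. \<phi> x \<noteq> 0}"] by (auto simp: supp_def)
  qed simp
qed

lemma compactly_supported_bounded:
  fixes \<phi> :: "'m::euclidean_space \<Rightarrow> 'b::real_normed_vector"
  assumes "continuous_on UNIV \<phi>" "\<And>x. R \<le> norm x \<Longrightarrow> \<phi> x = 0"
  obtains B where "0 < B" "\<And>x. norm (\<phi> x) \<le> B"
proof -
  have "compact (\<phi> ` cball 0 R)"
    by (rule compact_continuous_image[OF continuous_on_subset[OF assms(1)]]) auto
  then have "bounded (\<phi> ` cball 0 R)" by (rule compact_imp_bounded)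
  then obtain B where B: "\<And>y. y \<in> \<phi> ` cball 0 R \<Longrightarrow> norm y \<le> B"
    unfolding bounded_iff by blast
  show thesis
  proof (rule that[of "\<bar>B\<bar> + 1"])
    fix x show "norm (\<phi> x) \<le> \<bar>B\<bar> + 1"
    proof (cases "R \<le> norm x")
      case False
      then have "norm (\<phi> x) \<le> B" by (intro B imageI) simp
      then show ?thesis by linarith
    qed (use assms(2)[of x] in simp)
  qed simp
qed

lemma test_function_integrable:
  assumes "test_function \<phi>"
  shows "\<phi> \<in> borel_measurable borel" "integrable lborel \<phi>" "integrable lborel (\<lambda>x. (\<phi> x)\<^sup>2)"
    "integrable lebesgue (\<lambda>x. (\<phi> x)\<^sup>2)"
proof -
  have cont: "continuous_on UNIV \<phi>" using assms by (simp add: test_function_def smooth_imp_continuous)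
  then show borel: "\<phi> \<in> borel_measurable borel" by (rule borel_measurable_continuous_onI)
  obtain R where R: "0 < R" "\<And>x. R \<le> norm x \<Longrightarrow> \<phi> x = 0"
    using test_function_vanishes[OF assms] by blast
  have *: "integrable lborel f" if "continuous_on UNIV f" "\<And>x. R \<le> norm x \<Longrightarrow> f x = 0" for f :: "'a \<Rightarrow> real"
  proof -
    have "integrable lborel (\<lambda>x. indicator (cball 0 R) x *\<^sub>R f x)"
      by (rule borel_integrable_compact[OF compact_cball continuous_on_subset[OF that(1)]]) auto
    moreover have "(\<lambda>x. indicator (cball 0 R) x *\<^sub>R f x) = f"
      using that(2) by (auto simp: fun_eq_iff split: split_indicator)
    ultimately show ?thesis by simp
  qed
  show "integrable lborel \<phi>" by (rule *[OF cont R(2)])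
  show sq: "integrable lborel (\<lambda>x. (\<phi> x)\<^sup>2)"
    by (rule *) (use cont R(2) in \<open>auto intro!: continuous_intros\<close>)
  have "(\<lambda>x. (\<phi> x)\<^sup>2) \<in> borel_measurable lborel" using borel by simp
  then show "integrable lebesgue (\<lambda>x. (\<phi> x)\<^sup>2)" using sq integrable_completion by blast
qed

lemma test_function_L2:
  fixes w :: "'m::euclidean_space \<Rightarrow> 'a::euclidean_space"
  assumes "test_function \<phi>" "w \<in> L2"
  shows "integrable lebesgue (\<lambda>x. \<phi> x *\<^sub>R w x)"
    and "(norm (LINT x|lebesgue. \<phi> x *\<^sub>R w x))\<^sup>2 \<le> (LINT x|lebesgue. (\<phi> x)\<^sup>2) * (L2_norm w)\<^sup>2"
proof -
  have "\<phi> \<in> borel_measurable lebesgue"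
    using test_function_integrable(1)[OF assms(1)] by (simp add: measurable_completion)
  note CS = integral_Cauchy_Schwarz[OF this _ test_function_integrable(4)[OF assms(1)], of w]
  show "integrable lebesgue (\<lambda>x. \<phi> x *\<^sub>R w x)" using CS(1) assms(2) by (simp add: L2_def)
  show "(norm (LINT x|lebesgue. \<phi> x *\<^sub>R w x))\<^sup>2 \<le> (LINT x|lebesgue. (\<phi> x)\<^sup>2) * (L2_norm w)\<^sup>2"
    using CS(2) assms(2) by (simp add: L2_def L2_norm_def)
qed

section \<open>Calculus of functions of class C^k\<close>

lemma C_k_Suc_imp_C_k: "C_k (Suc k) f \<Longrightarrow> C_k k f"
proof (induction k arbitrary: f)
  case 0
  then show ?case by (auto intro: differentiable_imp_continuous_on)
next
  case (Suc k)
  then show ?case by (auto simp del: C_k.simps simp: C_k.simps(2)[of "Suc k" f] C_k.simps(2)[of k f])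
qed

lemma C_k_const: "C_k k (\<lambda>x. c)"
  by (induction k arbitrary: c) (simp_all add: frechet_derivative_const)

lemma C_k_SucI:
  assumes "\<And>x. (f has_derivative f' x) (at x)" "\<And>v. C_k k (\<lambda>x. f' x v)"
  shows "C_k (Suc k) f"
proof -
  have "frechet_derivative f (at x) = f' x" for x using assms(1) by (simp add: frechet_derivative_at[symmetric])
  then show ?thesis using assms by (auto simp: differentiable_on_def differentiable_def)
qed

lemma C_k_SucD:
  assumes "C_k (Suc k) f"
  shows "(f has_derivative frechet_derivative f (at x)) (at x)" "C_k k (\<lambda>x. frechet_derivative f (at x) v)"
  using assms by (auto simp: differentiable_on_def frechet_derivative_works[symmetric])

lemma C_k_add: "C_k k f \<Longrightarrow> C_k k g \<Longrightarrow> C_k k (\<lambda>x. f x + g x)"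
proof (induction k arbitrary: f g)
  case 0
  then show ?case by (auto intro: continuous_intros)
next
  case (Suc k)
  show ?case
    by (rule C_k_SucI[OF has_derivative_add[OF C_k_SucD(1)[OF Suc.prems(1)] C_k_SucD(1)[OF Suc.prems(2)]]])
      (intro Suc.IH C_k_SucD Suc.prems)
qed

lemma C_k_mult:
  fixes f g :: "'m::euclidean_space \<Rightarrow> real"
  shows "C_k k f \<Longrightarrow> C_k k g \<Longrightarrow> C_k k (\<lambda>x. f x * g x)"
proof (induction k arbitrary: f g)
  case 0
  then show ?case by (auto intro: continuous_intros)
next
  case (Suc k)
  show ?case
    by (rule C_k_SucI[OF has_derivative_mult[OF C_k_SucD(1)[OF Suc.prems(1)] C_k_SucD(1)[OF Suc.prems(2)]]])
      (intro C_k_add Suc.IH C_k_SucD Suc.prems C_k_Suc_imp_C_k)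
qed

lemma C_k_inner_left: "C_k k (\<lambda>x. c * (x \<bullet> v))"
proof (cases k)
  case (Suc k)
  show ?thesis unfolding Suc
    by (rule C_k_SucI[where f' = "\<lambda>x w. c * (w \<bullet> v)"]) (auto intro!: derivative_eq_intros C_k_const)
qed (simp add: continuous_intros)

lemma has_derivative_of_real_deriv:
  assumes "C_k (Suc k) f"
  shows "(f has_real_derivative deriv f x) (at x)" "frechet_derivative f (at x) v = v * deriv f x"
proof -
  have d: "(f has_derivative frechet_derivative f (at x)) (at x)" by (rule C_k_SucD(1)[OF assms])
  have "frechet_derivative f (at x) w = frechet_derivative f (at x) 1 * w" for w
    using linear_cmul[OF has_derivative_linear[OF d], of w 1] by (simp add: mult.commute)
  then have "frechet_derivative f (at x) = (*) (frechet_derivative f (at x) 1)" by blast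
  with d have D: "(f has_real_derivative frechet_derivative f (at x) 1) (at x)"
    by (simp add: has_field_derivative_def)
  then have *: "deriv f x = frechet_derivative f (at x) 1" by (rule DERIV_imp_deriv)
  show "(f has_real_derivative deriv f x) (at x)" using D by (simp add: *)
  show "frechet_derivative f (at x) v = v * deriv f x"
    using linear_cmul[OF has_derivative_linear[OF d], of v 1] by (simp add: *)
qed

lemma C_k_Suc_real_iff:
  fixes f :: "real \<Rightarrow> real"
  shows "C_k (Suc k) f \<longleftrightarrow> (\<forall>x. (f has_real_derivative deriv f x) (at x)) \<and> C_k k (deriv f)"
proof
  assume f: "C_k (Suc k) f"
  have "C_k k (\<lambda>x. frechet_derivative f (at x) 1)" by (rule C_k_SucD(2)[OF f])
  then show "(\<forall>x. (f has_real_derivative deriv f x) (at x)) \<and> C_k k (deriv f)"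
    using has_derivative_of_real_deriv[OF f] by simp
next
  assume *: "(\<forall>x. (f has_real_derivative deriv f x) (at x)) \<and> C_k k (deriv f)"
  show "C_k (Suc k) f"
    by (rule C_k_SucI[where f' = "\<lambda>x v. deriv f x * v"])
      (use * in \<open>auto simp: has_field_derivative_def intro: C_k_mult C_k_const\<close>)
qed

lemma C_k_Suc_realI:
  fixes f :: "real \<Rightarrow> real"
  assumes "\<And>x. (f has_real_derivative f' x) (at x)" "C_k k f'"
  shows "C_k (Suc k) f"
proof -
  have "deriv f = f'" using assms(1) by (auto simp: fun_eq_iff DERIV_imp_deriv)
  then show ?thesis using assms by (simp add: C_k_Suc_real_iff del: C_k.simps)
qed

lemma smooth_realI:
  fixes f :: "real \<Rightarrow> real"
  assumes D: "\<And>x. (f has_real_derivative f' x) (at x)" and "smooth f'"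
  shows "smooth f"
  unfolding smooth_def
proof
  fix k show "C_k k f"
  proof (cases k)
    case 0
    have "continuous_on UNIV f" using D by (meson DERIV_continuous_on has_field_derivative_at_within)
    then show ?thesis using 0 by simp
  qed (use C_k_Suc_realI[OF D] assms(2) in \<open>simp add: smooth_def del: C_k.simps\<close>)
qed

lemma smooth_has_real_derivative:
  fixes f :: "real \<Rightarrow> real"
  assumes "smooth f"
  shows "(f has_real_derivative deriv f x) (at x)" "smooth (deriv f)"
  using assms C_k_Suc_real_iff unfolding smooth_def by blast+

text \<open>The derivative in direction \<open>v\<close> is
  \<open>2 * (x \<bullet> v) * deriv \<eta> (x \<bullet> x)\<close>, a linear function times a
  function of the same radial form, so the induction closes when \<open>\<eta>\<close> is allowed to
  vary.\<close>

lemma C_k_radial: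
  fixes \<eta> :: "real \<Rightarrow> real"
  shows "C_k k \<eta> \<Longrightarrow> C_k k (\<lambda>x::'m::euclidean_space. \<eta> (x \<bullet> x))"
proof (induction k arbitrary: \<eta>)
  case 0
  have "continuous_on UNIV (\<eta> \<circ> (\<lambda>x::'m. x \<bullet> x))"
    by (intro continuous_on_compose continuous_intros) (use 0 in \<open>auto intro: continuous_on_subset\<close>)
  then show ?case by (simp add: o_def)
next
  case (Suc k)
  have D: "(\<eta> has_real_derivative deriv \<eta> z) (at z)" for z using Suc.prems by (simp add: C_k_Suc_real_iff del: C_k.simps)
  show ?case
  proof (rule C_k_SucI)
    fix x :: 'm
    have "((\<lambda>x. x \<bullet> x) has_derivative (\<lambda>v. 2 * (x \<bullet> v))) (at x)"
      by (auto intro!: derivative_eq_intros simp: inner_commute)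
    then show "((\<lambda>x. \<eta> (x \<bullet> x)) has_derivative (\<lambda>v. 2 * (x \<bullet> v) * deriv \<eta> (x \<bullet> x))) (at x)"
      by (rule DERIV_compose_FDERIV[OF D, THEN has_derivative_eq_rhs]) (simp add: mult.commute)
    show "C_k k (\<lambda>x::'m. 2 * (x \<bullet> v) * deriv \<eta> (x \<bullet> x))" for v
      by (intro C_k_mult C_k_inner_left Suc.IH) (use Suc.prems in \<open>simp add: C_k_Suc_real_iff del: C_k.simps\<close>)
  qed
qed

text \<open>The derivative \<open>deriv f z / z - f z / z / z\<close> consists of quotients of the
  same kind with one order less, so the induction runs over all \<open>f\<close> that vanish up to
  \<open>p\<close>.\<close>

lemma C_k_divide_away_from_0:
  fixes f :: "real \<Rightarrow> real"
  assumes "C_k k f" "0 < p" "\<And>z. z \<le> p \<Longrightarrow> f z = 0"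
  shows "C_k k (\<lambda>z. f z / z)"
  using assms(1,3)
proof (induction k arbitrary: f)
  case 0
  have "continuous_on ({..p} \<union> {p..}) (\<lambda>z. f z / z)"
  proof (rule continuous_on_closed_Un)
    show "continuous_on {..p} (\<lambda>z. f z / z)"
      using 0(2) by (subst continuous_on_cong[where g = "\<lambda>_. 0"]) auto
    show "continuous_on {p..} (\<lambda>z. f z / z)"
      using 0(1) \<open>0 < p\<close> by (auto intro!: continuous_intros intro: continuous_on_subset)
  qed auto
  moreover have "{..p} \<union> {p..} = UNIV" by auto
  ultimately show ?case by simp
next
  case (Suc k)
  have D: "(f has_real_derivative deriv f z) (at z)" for z using Suc.prems(1) by (simp add: C_k_Suc_real_iff del: C_k.simps)
  \<comment> \<open>For z < p this is locality of the derivative; the end point z = p needs the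
    continuity of \<open>deriv f\<close> from the left.\<close>
  have D0: "deriv f z = 0" if "z \<le> p" for z
  proof -
    have cont: "continuous_on UNIV (deriv f)"
      using Suc.prems(1) C_k_imp_continuous by (auto simp: C_k_Suc_real_iff simp del: C_k.simps)
    have *: "deriv f z = 0" if "z < p" for z
    proof -
      have "((\<lambda>_. 0) has_real_derivative 0) (at z)" by simp
      then have "(f has_real_derivative 0) (at z)"
        by (rule has_field_derivative_transform_within_open[of _ _ _ "{..<p}"]) (use that Suc.prems(2) in auto)
      then show ?thesis by (rule DERIV_imp_deriv)
    qed
    show ?thesis
    proof (cases "z < p")
      case False
      then have "z = p" using that by simp
      have "(deriv f \<longlongrightarrow> deriv f p) (at_left p)"
        using cont by (simp add: continuous_on_def) (meson UNIV_I filterlim_at_split)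
      moreover have "\<forall>\<^sub>F z in at_left p. deriv f z = 0"
        using * by (auto simp: eventually_at_filter)
      then have "(deriv f \<longlongrightarrow> 0) (at_left p)" by (rule tendsto_eventually)
      ultimately show ?thesis using \<open>z = p\<close> tendsto_unique[OF trivial_limit_at_left_real] by blast
    qed (rule *)
  qed
  show ?case
  proof (rule C_k_Suc_realI)
    fix z :: real
    show "((\<lambda>z. f z / z) has_real_derivative deriv f z / z - f z / z / z) (at z)"
    proof (cases "z < p")
      case True
      have "((\<lambda>_. 0) has_real_derivative 0) (at z)" by simp
      then have "((\<lambda>z. f z / z) has_real_derivative 0) (at z)"
        by (rule has_field_derivative_transform_within_open[of _ _ _ "{..<p}"]) (use True Suc.prems(2) in auto)
      then show ?thesis using True Suc.prems(2) D0 by simp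
    next
      case False
      then show ?thesis using D[of z] \<open>0 < p\<close>
        by (auto intro!: derivative_eq_intros simp: field_simps)
    qed
    have "C_k k (\<lambda>z. deriv f z / z + (-1) * (f z / z / z))"
    proof (intro C_k_add C_k_mult C_k_const Suc.IH)
      show "C_k k (deriv f)" using Suc.prems(1) by (simp add: C_k_Suc_real_iff del: C_k.simps)
      show "C_k k f" by (rule C_k_Suc_imp_C_k[OF Suc.prems(1)])
    qed (use D0 Suc.prems(2) in auto)
    then show "C_k k (\<lambda>z. deriv f z / z - f z / z / z)" by simp
  qed
qed

lemma smooth_divide_away_from_0:
  fixes f :: "real \<Rightarrow> real"
  assumes "smooth f" "0 < p" "\<And>z. z \<le> p \<Longrightarrow> f z = 0"
  shows "smooth (\<lambda>z. f z / z)"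
  using assms C_k_divide_away_from_0 unfolding smooth_def by blast

lemma smooth_affine:
  fixes f :: "real \<Rightarrow> real"
  assumes "smooth f"
  shows "smooth (\<lambda>z. f ((z - a) / e))"
proof -
  have "C_k k f \<Longrightarrow> C_k k (\<lambda>z. f ((z - a) / e))" for k and f :: "real \<Rightarrow> real"
  proof (induction k arbitrary: f)
    case 0
    have "continuous_on UNIV (f \<circ> (\<lambda>z. (z - a) / e))"
      unfolding divide_inverse by (intro continuous_on_compose continuous_intros) (use 0 in \<open>auto intro: continuous_on_subset\<close>)
    then show ?case by (simp add: o_def)
  next
    case (Suc k)
    have D: "(f has_real_derivative deriv f z) (at z)" for z using Suc.prems by (simp add: C_k_Suc_real_iff del: C_k.simps)
    show ?case
    proof (rule C_k_Suc_realI)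
      show "((\<lambda>z. f ((z - a) / e)) has_real_derivative inverse e * deriv f ((z - a) / e)) (at z)" for z
        by (rule DERIV_chain2[OF D, THEN DERIV_cong])
          (auto intro!: derivative_eq_intros simp: divide_inverse)
      show "C_k k (\<lambda>z. inverse e * deriv f ((z - a) / e))"
        by (intro C_k_mult C_k_const Suc.IH) (use Suc.prems in \<open>simp add: C_k_Suc_real_iff del: C_k.simps\<close>)
    qed
  qed
  then show ?thesis using assms unfolding smooth_def by blast
qed

lemma smooth_const: "smooth (\<lambda>x. c)" and smooth_add: "smooth f \<Longrightarrow> smooth g \<Longrightarrow> smooth (\<lambda>x. f x + g x)"
  by (simp_all add: smooth_def C_k_const C_k_add)

lemma smooth_mult:
  fixes f g :: "'m::euclidean_space \<Rightarrow> real"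
  shows "smooth f \<Longrightarrow> smooth g \<Longrightarrow> smooth (\<lambda>x. f x * g x)"
  by (simp add: smooth_def C_k_mult)

lemma smooth_diff:
  fixes f g :: "'m::euclidean_space \<Rightarrow> real"
  shows "smooth f \<Longrightarrow> smooth g \<Longrightarrow> smooth (\<lambda>x. f x - g x)"
  using smooth_add[of f "\<lambda>x. -1 * g x"] smooth_mult[OF smooth_const, of g "-1"] by simp

lemma smooth_sum:
  assumes "\<And>i. i \<in> I \<Longrightarrow> smooth (f i)"
  shows "smooth (\<lambda>x. \<Sum>i\<in>I. f i x)"
  using assms by (induction I rule: infinite_finite_induct) (auto intro: smooth_const smooth_add)

lemma smooth_radial:
  fixes \<eta> :: "real \<Rightarrow> real"
  assumes "smooth \<eta>"
  shows "smooth (\<lambda>x::'m::euclidean_space. \<eta> (x \<bullet> x))"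
  using assms by (simp add: smooth_def C_k_radial)

lemma continuous_has_antiderivative:
  fixes f :: "real \<Rightarrow> 'a::euclidean_space"
  assumes "continuous_on UNIV f"
  obtains F where "\<And>x. (F has_vector_derivative f x) (at x)"
proof -
  have "isCont f x" for x using assms by (simp add: continuous_on_eq_continuous_at)
  then show thesis
    using einterval_antiderivative[of "-\<infinity>" \<infinity> f] that by auto
qed

section \<open>Extraction of scales and profiles\<close>

lemma sqrt_exp_half: "sqrt (exp t) = exp (t / 2)"
  by (rule real_sqrt_unique) (simp_all add: power2_eq_square flip: exp_add)

section \<open>Counting the places where a function of bounded energy is large\<close>

lemma energy_le_growth:
  assumes "energy_le K v" "0 \<le> s"
  shows "norm (v s) \<le> norm (v 0) + sqrt (K * s)"
proof -
  have "norm (v s - v 0) \<le> sqrt (K * s)"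
    using energy_le_hoelder[OF assms(1), of 0 s] assms(2) by (intro real_le_rsqrt) simp
  then show ?thesis using norm_triangle_sub[of "v s" "v 0"] by linarith
qed

text \<open>The increments of \<open>v\<close> over the disjoint intervals \<open>{exp (t - L)..exp t}\<close> each cost a
  fixed amount of energy.\<close>

lemma energy_le_card:
  assumes E: "energy_le K v" and "0 < \<epsilon>" "0 < L" and L: "K * exp (- L) \<le> (\<epsilon> / 4)\<^sup>2"
    and S: "finite S" and sep: "\<And>t t'. t \<in> S \<Longrightarrow> t' \<in> S \<Longrightarrow> t < t' \<Longrightarrow> L \<le> t' - t"
    and big: "\<And>t. t \<in> S \<Longrightarrow> \<epsilon> * exp (t / 2) \<le> norm (v (exp t))"
    and zero: "\<And>t. t \<in> S \<Longrightarrow> norm (v 0) \<le> \<epsilon> / 4 * exp (t / 2)"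
  shows "real (card S) * (\<epsilon> / 2)\<^sup>2 \<le> K"
proof -
  define I where "I = (\<lambda>t. exp (t - L)) ` S"
  define b where "b a = a * exp L" for a :: real
  have inj: "inj_on (\<lambda>t. exp (t - L)) S" by (auto simp: inj_on_def)
  have b: "b (exp (t - L)) = exp t" for t by (simp add: b_def flip: exp_add)
  have summand: "(\<epsilon> / 2)\<^sup>2 \<le> (norm (v (exp t) - v (exp (t - L))))\<^sup>2 / (exp t - exp (t - L))"
    if "t \<in> S" for t
  proof -
    \<comment> \<open>By the choice of \<open>L\<close> the growth from 0 to
      \<open>exp (t - L)\<close> is at most a quarter of the threshold
      \<open>\<epsilon> * exp (t / 2)\<close>, and \<open>v 0\<close> accounts for another quarter;
      at least half of the threshold is gained on the interval itself.\<close>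
    have "norm (v (exp (t - L))) \<le> norm (v 0) + sqrt (K * exp (t - L))"
      by (rule energy_le_growth[OF E]) simp
    also have "K * exp (t - L) = K * exp (- L) * exp t" by (simp add: exp_diff exp_minus divide_inverse)
    also have "sqrt \<dots> = sqrt (K * exp (- L)) * exp (t / 2)" by (simp add: real_sqrt_mult sqrt_exp_half)
    also have "\<dots> \<le> \<epsilon> / 4 * exp (t / 2)"
      using L \<open>0 < \<epsilon>\<close> by (intro mult_right_mono real_le_lsqrt) auto
    finally have "norm (v (exp (t - L))) \<le> \<epsilon> / 2 * exp (t / 2)"
      using zero[OF that] by linarith
    then have "\<epsilon> / 2 * exp (t / 2) \<le> norm (v (exp t) - v (exp (t - L)))"
      using big[OF that] norm_triangle_ineq2[of "v (exp t)" "v (exp (t - L))"] by linarith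
    then have "(\<epsilon> / 2 * exp (t / 2))\<^sup>2 \<le> (norm (v (exp t) - v (exp (t - L))))\<^sup>2"
      using \<open>0 < \<epsilon>\<close> by (intro power_mono) auto
    also have "(\<epsilon> / 2 * exp (t / 2))\<^sup>2 = (\<epsilon> / 2)\<^sup>2 * exp t"
      by (simp add: power_mult_distrib power2_eq_square flip: exp_add)
    finally have *: "(\<epsilon> / 2)\<^sup>2 * exp t \<le> (norm (v (exp t) - v (exp (t - L))))\<^sup>2" .
    have "(\<epsilon> / 2)\<^sup>2 * (exp t - exp (t - L)) \<le> (\<epsilon> / 2)\<^sup>2 * exp t"
      by (intro mult_left_mono) auto
    then show ?thesis using * \<open>0 < L\<close> by (subst pos_le_divide_eq) auto
  qed
  have "real (card S) * (\<epsilon> / 2)\<^sup>2 = (\<Sum>t\<in>S. (\<epsilon> / 2)\<^sup>2)" by simp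
  also have "\<dots> \<le> (\<Sum>t\<in>S. (norm (v (exp t) - v (exp (t - L))))\<^sup>2 / (exp t - exp (t - L)))"
    by (intro sum_mono summand)
  also have "\<dots> = (\<Sum>a\<in>I. (norm (v (b a) - v a))\<^sup>2 / (b a - a))"
    unfolding I_def by (subst sum.reindex[OF inj]) (simp add: b)
  also have "\<dots> \<le> K"
  proof (rule energy_leD[OF E])
    fix a a' assume "a \<in> I" "a' \<in> I" "a < a'"
    then obtain t t' where t: "t \<in> S" "t' \<in> S" "a = exp (t - L)" "a' = exp (t' - L)" "t < t'"
      by (auto simp: I_def)
    then show "b a \<le> a'" using sep[of t t'] b[of t] by simp
  next
    fix a assume "a \<in> I"
    then show "a < b a" using b \<open>0 < L\<close> by (auto simp: I_def)
  qed (use S in \<open>auto simp: I_def\<close>)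
  finally show ?thesis .
qed

lemma separation_exists:
  fixes K \<epsilon> :: real
  assumes "0 < \<epsilon>"
  obtains L where "0 < L" "K * exp (- L) \<le> (\<epsilon> / 4)\<^sup>2"
proof -
  have "((\<lambda>L::real. K * exp (- L)) \<longlongrightarrow> K * 0) at_top"
    by (intro tendsto_intros filterlim_compose[OF exp_at_bot] filterlim_uminus_at_bot_at_top)
  then have "\<forall>\<^sub>F L in at_top. K * exp (- L) < (\<epsilon> / 4)\<^sup>2"
    using assms by (intro order_tendstoD(2)) auto
  then have "\<forall>\<^sub>F L in at_top. 0 < L \<and> K * exp (- L) \<le> (\<epsilon> / 4)\<^sup>2"
    using eventually_gt_at_top[of "0::real"] by eventually_elim auto
  then obtain L where "0 < L" "K * exp (- L) \<le> (\<epsilon> / 4)\<^sup>2"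
    using eventually_happens'[OF trivial_limit_at_top_linorder] by blast
  then show thesis by (rule that)
qed

lemma unbounded_has_separated_subset:
  fixes T :: "real set"
  assumes "\<not> bounded T"
  shows "\<exists>S\<subseteq>T. finite S \<and> card S = N \<and> (\<forall>t\<in>S. \<forall>t'\<in>S. t < t' \<longrightarrow> L \<le> t' - t)"
proof (induction N)
  case 0
  show ?case by (rule exI[of _ "{}"]) auto
next
  case (Suc N)
  then obtain S where S: "S \<subseteq> T" "finite S" "card S = N" "\<forall>t\<in>S. \<forall>t'\<in>S. t < t' \<longrightarrow> L \<le> t' - t"
    by blast
  \<comment> \<open>A point farther out than the sum of all previous moduli plus
    \<open>\<bar>L\<bar>\<close> has distance more than \<open>L\<close> from each of them.\<close>
  obtain t where t: "t \<in> T" "(\<Sum>s\<in>S. \<bar>s\<bar>) + \<bar>L\<bar> < \<bar>t\<bar>"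
    using assms unfolding bounded_iff by (metis not_le real_norm_def)
  have far: "L < \<bar>t - s\<bar> \<and> t \<noteq> s" if "s \<in> S" for s
  proof -
    have "\<bar>s\<bar> \<le> (\<Sum>s\<in>S. \<bar>s\<bar>)" using that S(2) by (intro member_le_sum) auto
    then show ?thesis using t(2) by linarith
  qed
  then have "t \<notin> S" by blast
  show ?case
  proof (intro exI conjI ballI impI)
    show "card (insert t S) = Suc N" using S \<open>t \<notin> S\<close> by simp
    show "L \<le> t2 - t1" if "t1 \<in> insert t S" "t2 \<in> insert t S" "t1 < t2" for t1 t2
      using that far[of t1] far[of t2] S(4) by auto
  qed (use S t in auto)
qed

text \<open>An unbounded set of exceptional \<open>t\<close> would contain arbitrarily many
  separated points, more than the energy can pay for. As \<open>t\<close> may tend to either end, a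
  profile is o(sqrt s) at 0 as well as at infinity.\<close>

lemma energy_le_decay:
  assumes E: "energy_le K v" and "v 0 = 0" "0 < \<epsilon>"
  shows "\<exists>Y. \<forall>t. Y < \<bar>t\<bar> \<longrightarrow> norm (v (exp t)) < \<epsilon> * exp (t / 2)"
proof (rule ccontr)
  define T where "T = {t. \<epsilon> * exp (t / 2) \<le> norm (v (exp t))}"
  assume "\<not> ?thesis"
  then have "\<forall>Y. \<exists>t. Y < \<bar>t\<bar> \<and> t \<in> T" by (auto simp: T_def not_less)
  then have unb: "\<not> bounded T" unfolding bounded_iff by (metis not_le real_norm_def)
  obtain L where L: "0 < L" "K * exp (- L) \<le> (\<epsilon> / 4)\<^sup>2"
    using separation_exists[OF \<open>0 < \<epsilon>\<close>] by blast
  obtain N :: nat where N: "K / (\<epsilon> / 2)\<^sup>2 < real N" using reals_Archimedean2 by blast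
  obtain S where S: "S \<subseteq> T" "finite S" "card S = N" "\<forall>t\<in>S. \<forall>t'\<in>S. t < t' \<longrightarrow> L \<le> t' - t"
    using unbounded_has_separated_subset[OF unb] by blast
  have "real (card S) * (\<epsilon> / 2)\<^sup>2 \<le> K"
    by (rule energy_le_card[OF E \<open>0 < \<epsilon>\<close> L S(2)]) (use S assms in \<open>auto simp: T_def\<close>)
  then show False using N S(3) \<open>0 < \<epsilon>\<close> by (simp add: field_simps)
qed

text \<open>The energy bounds the size of separated families, so one of largest size exists, and a
  point at distance \<open>L\<close> or more from all its members could be added to it. For
  \<open>0 \<le> t\<close> the factor \<open>exp (t / 2)\<close> is at least 1, so
  \<open>norm (v 0) \<le> \<epsilon> / 4\<close> meets the demand of the counting bound.\<close>

lemma maximal_separated_set: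
  assumes E: "energy_le K v" and "0 < \<epsilon>" and L: "0 < L" "K * exp (- L) \<le> (\<epsilon> / 4)\<^sup>2"
    and N: "K < real N * (\<epsilon> / 2)\<^sup>2" and zero: "norm (v 0) \<le> \<epsilon> / 4"
  obtains S where "finite S" "card S < N" "\<And>t. t \<in> S \<Longrightarrow> 0 \<le> t \<and> \<epsilon> * exp (t / 2) \<le> norm (v (exp t))"
    "\<And>t. 0 \<le> t \<Longrightarrow> \<epsilon> * exp (t / 2) \<le> norm (v (exp t)) \<Longrightarrow> \<exists>s\<in>S. \<bar>t - s\<bar> < L"
proof -
  define P where "P S \<longleftrightarrow> finite S \<and> (\<forall>t\<in>S. 0 \<le> t \<and> \<epsilon> * exp (t / 2) \<le> norm (v (exp t))) \<and>
      (\<forall>t\<in>S. \<forall>t'\<in>S. t < t' \<longrightarrow> L \<le> t' - t)" for S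
  have bound: "card S < N" if "P S" for S
  proof -
    have "real (card S) * (\<epsilon> / 2)\<^sup>2 \<le> K"
    proof (rule energy_le_card[OF E \<open>0 < \<epsilon>\<close> L])
      fix t assume "t \<in> S"
      then have "0 \<le> t" using that by (auto simp: P_def)
      then have "\<epsilon> / 4 * 1 \<le> \<epsilon> / 4 * exp (t / 2)" using \<open>0 < \<epsilon>\<close> by (intro mult_left_mono) auto
      then show "norm (v 0) \<le> \<epsilon> / 4 * exp (t / 2)" using zero by simp
    qed (use that in \<open>auto simp: P_def\<close>)
    then have "real (card S) * (\<epsilon> / 2)\<^sup>2 < real N * (\<epsilon> / 2)\<^sup>2" using N by simp
    then show ?thesis by (simp add: mult_less_cancel_right)
  qed
  have "P {}" by (simp add: P_def)
  then obtain S where S: "P S" "\<And>S'. P S' \<Longrightarrow> card S' \<le> card S"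
    using ex_has_greatest_nat[of P "{}" card N] bound less_imp_le by blast
  show thesis
  proof (rule that[of S])
    fix t assume t: "0 \<le> t" "\<epsilon> * exp (t / 2) \<le> norm (v (exp t))"
    show "\<exists>s\<in>S. \<bar>t - s\<bar> < L"
    proof (rule ccontr)
      assume "\<not> ?thesis"
      then have far: "L \<le> \<bar>t - s\<bar>" if "s \<in> S" for s using that by (auto simp: not_less)
      then have "t \<notin> S" using L by force
      have "P (insert t S)"
        unfolding P_def
      proof (intro conjI ballI impI)
        fix t1 t2 assume "t1 \<in> insert t S" "t2 \<in> insert t S" "t1 < t2"
        then show "L \<le> t2 - t1" using far[of t1] far[of t2] S(1) by (auto simp: P_def)
      qed (use S(1) t in \<open>auto simp: P_def\<close>)
      then have "card (insert t S) \<le> card S" by (rule S(2))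
      then show False using \<open>t \<notin> S\<close> S(1) by (simp add: P_def)
    qed
  qed (use S(1) bound in \<open>auto simp: P_def\<close>)
qed

text \<open>The points \<open>p i\<close> enumerate a maximal separated set, padded with the dummy value \<open>x\<close>.\<close>

lemma separated_points:
  assumes E: "energy_le K v" and "0 < \<epsilon>" and L: "0 < L" "K * exp (- L) \<le> (\<epsilon> / 4)\<^sup>2"
    and N: "K < real N * (\<epsilon> / 2)\<^sup>2"
  shows "\<exists>p. (\<forall>i. p i = x \<or> 0 \<le> p i \<and> \<epsilon> * exp (p i / 2) \<le> norm (v (exp (p i)))) \<and>
    (norm (v 0) \<le> \<epsilon> / 4 \<longrightarrow>
      (\<forall>t\<ge>0. \<epsilon> * exp (t / 2) \<le> norm (v (exp t)) \<longrightarrow> (\<exists>i<N. \<bar>t - p i\<bar> < L)))"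
proof (cases "norm (v 0) \<le> \<epsilon> / 4")
  case True
  obtain S where S: "finite S" "card S < N"
    "\<And>t. t \<in> S \<Longrightarrow> 0 \<le> t \<and> \<epsilon> * exp (t / 2) \<le> norm (v (exp t))"
    "\<And>t. 0 \<le> t \<Longrightarrow> \<epsilon> * exp (t / 2) \<le> norm (v (exp t)) \<Longrightarrow> \<exists>s\<in>S. \<bar>t - s\<bar> < L"
    using maximal_separated_set[OF E \<open>0 < \<epsilon>\<close> L N True] by blast
  obtain f where f: "bij_betw f {0..<card S} S"
    using ex_bij_betw_nat_finite[OF S(1)] by blast
  have fS: "f i \<in> S" if "i < card S" for i using f that by (auto simp: bij_betw_def)
  have Sf: "\<exists>i<card S. s = f i" if "s \<in> S" for s
    using f that unfolding bij_betw_def by (metis imageE atLeastLessThan_iff)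
  define p where "p i = (if i < card S then f i else x)" for i
  show ?thesis
  proof (intro exI[of _ p] conjI allI impI)
    fix i show "p i = x \<or> 0 \<le> p i \<and> \<epsilon> * exp (p i / 2) \<le> norm (v (exp (p i)))"
      using S(3)[OF fS] by (auto simp: p_def)
  next
    fix t :: real assume "0 \<le> t" "\<epsilon> * exp (t / 2) \<le> norm (v (exp t))"
    then obtain s where s: "s \<in> S" "\<bar>t - s\<bar> < L" using S(4) by blast
    then obtain i where "i < card S" "s = f i" using Sf by blast
    then show "\<exists>i<N. \<bar>t - p i\<bar> < L" using s S(2) by (intro exI[of _ i]) (auto simp: p_def)
  qed
\<comment> \<open>If \<open>v 0\<close> is too large, the constant \<open>x\<close> serves, for the
  covering claim is then vacuous.\<close>
qed auto

text \<open>The map x -> 1 / (1 + |x|) compactifies distances: a positive limit means that they stay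
  bounded, the limit 0 that they diverge.\<close>

lemma inverse_one_plus_abs_dichotomy:
  fixes x :: "nat \<Rightarrow> real"
  assumes "convergent (\<lambda>n. 1 / (1 + \<bar>x n\<bar>))"
  shows "(\<exists>B. \<forall>n. \<bar>x n\<bar> \<le> B) \<or> filterlim (\<lambda>n. \<bar>x n\<bar>) at_top sequentially"
proof -
  obtain c where c: "(\<lambda>n. 1 / (1 + \<bar>x n\<bar>)) \<longlonglongrightarrow> c" using assms by (auto simp: convergent_def)
  have "0 \<le> c" by (rule LIMSEQ_le_const[OF c]) auto
  show ?thesis
  proof (cases "c = 0")
    case True
    have "filterlim (\<lambda>n. inverse (1 / (1 + \<bar>x n\<bar>))) at_top sequentially"
      by (rule filterlim_inverse_at_top) (use c True in \<open>auto intro!: always_eventually add_pos_nonneg\<close>)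
    then have "filterlim (\<lambda>n. 1 + \<bar>x n\<bar>) at_top sequentially" by simp
    then have "filterlim (\<lambda>n. -1 + (1 + \<bar>x n\<bar>)) at_top sequentially"
      by (rule filterlim_tendsto_add_at_top[OF tendsto_const])
    then show ?thesis unfolding add.assoc[symmetric] by simp
  next
    case False
    have "(\<lambda>n. inverse (1 / (1 + \<bar>x n\<bar>))) \<longlonglongrightarrow> inverse c" by (rule tendsto_inverse[OF c False])
    then have "convergent (\<lambda>n. 1 + \<bar>x n\<bar>)" by (auto simp: convergent_def)
    then have "Bseq (\<lambda>n. 1 + \<bar>x n\<bar>)" by (rule convergent_imp_Bseq)
    then obtain B where B: "\<And>n. norm (1 + \<bar>x n\<bar>) \<le> B" by (rule BseqE) blast
    have "\<bar>x n\<bar> \<le> B" for n using B[of n] by simp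
    then show ?thesis by blast
  qed
qed

lemma sum_one_large:
  fixes f :: "'i \<Rightarrow> 'a::real_normed_vector"
  assumes "finite A" "i \<in> A" and small: "\<And>j. j \<in> A - {i} \<Longrightarrow> norm (f j) \<le> \<delta>" and "0 \<le> \<delta>"
  shows "norm (w - sum f A) \<le> norm (w - f i) + real (card A) * \<delta>"
proof -
  have "norm (sum f (A - {i})) \<le> (\<Sum>j\<in>A - {i}. \<delta>)" by (rule sum_norm_le[OF small])
  also have "\<dots> \<le> real (card A) * \<delta>"
    using assms(1) \<open>0 \<le> \<delta>\<close> by (auto intro!: mult_right_mono card_mono)
  finally have "norm (sum f (A - {i})) \<le> real (card A) * \<delta>" .
  moreover have "norm (w - sum f A) \<le> norm (w - f i) + norm (sum f (A - {i}))"
    using norm_triangle_ineq4[of "w - f i" "sum f (A - {i})"] assms(1,2)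
    by (simp add: sum.remove[of A i] diff_diff_add)
  ultimately show ?thesis by linarith
qed

text \<open>One extraction serves all thresholds 1 / (k + 1), so scales and profiles do not depend
  on the accuracy requested afterwards. A given accuracy involves only the finitely many cluster
  families of one threshold, and \<open>l0\<close> lies beyond the indices of their classes.\<close>

theorem profile_extraction:
  fixes v :: "nat \<Rightarrow> real \<Rightarrow> 'a::euclidean_space"
  assumes E: "\<And>n. energy_le K (v n)" and Z: "\<And>s. 0 \<le> s \<Longrightarrow> (\<lambda>n. v n s) \<longlonglongrightarrow> 0"
  obtains \<alpha> :: "nat \<Rightarrow> nat \<Rightarrow> real" and \<psi> :: "nat \<Rightarrow> real \<Rightarrow> 'a" and \<sigma> :: "nat \<Rightarrow> nat"
  where "strict_mono \<sigma>" "\<And>j. is_scale (\<alpha> j)"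
    "\<And>j k. j \<noteq> k \<Longrightarrow> orthogonal_scales (\<alpha> j) (\<alpha> k)"
    "\<And>j. energy_le K (\<psi> j)" "\<And>j s. s \<le> 0 \<Longrightarrow> \<psi> j s = 0"
    "\<And>\<epsilon>. 0 < \<epsilon> \<Longrightarrow> \<exists>l0. \<forall>l\<ge>l0. \<forall>\<^sub>F n in sequentially. \<forall>s\<ge>1.
        norm (v (\<sigma> n) s - (\<Sum>j<l. sqrt (\<alpha> j n) *\<^sub>R \<psi> j (s / \<alpha> j n))) \<le> \<epsilon> * sqrt s"
proof -
  have "0 \<le> K" using energy_le_nonneg[OF E] .
  define \<epsilon> where "\<epsilon> k = 1 / (real k + 1)" for k :: nat
  have eps: "0 < \<epsilon> k" for k by (simp add: \<epsilon>_def)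
  have "\<forall>k. \<exists>L>0. K * exp (- L) \<le> (\<epsilon> k / 4)\<^sup>2"
    using separation_exists[OF eps] by metis
  then obtain L where L: "\<And>k. 0 < L k" "\<And>k. K * exp (- L k) \<le> (\<epsilon> k / 4)\<^sup>2" by metis
  have "\<exists>N::nat. K < real N * (\<epsilon> k / 2)\<^sup>2" for k
  proof -
    obtain N :: nat where "K / (\<epsilon> k / 2)\<^sup>2 < real N" using reals_Archimedean2 by blast
    then show ?thesis using eps[of k] by (intro exI[of _ N]) (simp add: field_simps)
  qed
  then obtain N :: "nat \<Rightarrow> nat" where N: "\<And>k. K < real (N k) * (\<epsilon> k / 2)\<^sup>2" by metis
  \<comment> \<open>The dummy value \<open>real n\<close> tends to infinity, so padded entries
    escape just like genuine cluster points and every family defines a scale.\<close>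
  have "\<forall>k n. \<exists>p. (\<forall>i. p i = real n \<or> 0 \<le> p i \<and> \<epsilon> k * exp (p i / 2) \<le> norm (v n (exp (p i)))) \<and>
    (norm (v n 0) \<le> \<epsilon> k / 4 \<longrightarrow>
      (\<forall>t\<ge>0. \<epsilon> k * exp (t / 2) \<le> norm (v n (exp t)) \<longrightarrow> (\<exists>i<N k. \<bar>t - p i\<bar> < L k)))"
    by (intro allI separated_points[OF E eps L N])
  then obtain p where p: "\<And>k n i. p k n i = real n \<or> 0 \<le> p k n i \<and> \<epsilon> k * exp (p k n i / 2) \<le> norm (v n (exp (p k n i)))"
    and net: "\<And>k n t. norm (v n 0) \<le> \<epsilon> k / 4 \<Longrightarrow> 0 \<le> t \<Longrightarrow> \<epsilon> k * exp (t / 2) \<le> norm (v n (exp t)) \<Longrightarrow>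
      \<exists>i<N k. \<bar>t - p k n i\<bar> < L k"
    by metis
  have p_nonneg: "0 \<le> p k n i" for k n i using p[of k n i] by auto
  \<comment> \<open>\<open>v n\<close> tends to 0 uniformly on bounded intervals, so a point where
    it reaches the threshold leaves every bounded interval.\<close>
  have p_top: "filterlim (\<lambda>n. p k n i) at_top sequentially" for k i
    unfolding filterlim_at_top_gt[where c = 0]
  proof (intro allI impI)
    fix Y :: real assume "0 < Y"
    have "\<forall>\<^sub>F n in sequentially. \<forall>s\<in>{0..exp Y}. norm (v n s - 0) < \<epsilon> k"
      by (rule equi_hoelder_uniform[OF energy_le_hoelder[OF E] Z eps])
    moreover have "\<forall>\<^sub>F n in sequentially. Y \<le> real n"
      using filterlim_real_sequentially by (simp add: filterlim_at_top)
    ultimately show "\<forall>\<^sub>F n in sequentially. Y \<le> p k n i"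
    proof eventually_elim
      case (elim n)
      show ?case
      proof (rule ccontr)
        assume "\<not> ?thesis"
        then have less: "p k n i < Y" by simp
        then have "norm (v n (exp (p k n i))) < \<epsilon> k" using elim(1) by simp
        moreover have "\<epsilon> k * exp (p k n i / 2) \<le> norm (v n (exp (p k n i)))"
          using p[of k n i] elim(2) less by auto
        moreover have "\<epsilon> k * 1 \<le> \<epsilon> k * exp (p k n i / 2)"
          using p_nonneg eps[of k] by (intro mult_left_mono) auto
        ultimately show False by simp
      qed
    qed
  qed
  \<comment> \<open>Odd indices are padding: points escaping faster than every other family, which guarantee
    infinitely many classes below.\<close>
  define r where "r q n = p (fst (prod_decode q)) n (snd (prod_decode q))" for q n
  define pad where "pad m n = (\<Sum>q\<le>n. r q n) + (real m + 1) * real n" for m n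
  define P where "P j n = (if even j then r (j div 2) n else pad (j div 2) n)" for j n
  have r_nonneg: "0 \<le> r q n" for q n by (simp add: r_def p_nonneg)
  have pad_nonneg: "0 \<le> pad m n" for m n by (auto simp: pad_def intro!: add_nonneg_nonneg sum_nonneg r_nonneg)
  have P_nonneg: "0 \<le> P j n" for j n by (simp add: P_def r_nonneg pad_nonneg)
  have pad_ge: "(real m + 1) * real n \<le> pad m n - r q n" if "q \<le> n" for m q n
  proof -
    have "r q n \<le> (\<Sum>q\<le>n. r q n)" using that r_nonneg by (intro member_le_sum) auto
    then show ?thesis by (simp add: pad_def)
  qed
  have lin_top: "filterlim (\<lambda>n. c * real n) at_top sequentially" if "0 < c" for c :: real
    using that by (intro filterlim_tendsto_pos_mult_at_top[OF tendsto_const] filterlim_real_sequentially) auto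
  have P_top: "filterlim (P j) at_top sequentially" for j
  proof (cases "even j")
    case True
    then show ?thesis using p_top by (simp add: P_def[abs_def] r_def)
  next
    case False
    have "filterlim (pad (j div 2)) at_top sequentially"
    proof (rule filterlim_at_top_mono[OF lin_top[of "real (j div 2) + 1"]])
      show "\<forall>\<^sub>F n in sequentially. (real (j div 2) + 1) * real n \<le> pad (j div 2) n"
        by (intro always_eventually allI) (auto simp: pad_def intro!: sum_nonneg r_nonneg)
    qed simp
    then show ?thesis using False by (simp add: P_def[abs_def])
  qed
  \<comment> \<open>Once q <= n, the sum in \<open>pad\<close> dominates \<open>r q n\<close> and
    leaves at least \<open>n\<close> over; two different padding families differ by a nonzero
    integer multiple of \<open>n\<close>.\<close>
  have P_pad: "filterlim (\<lambda>n. \<bar>P i n - P (2 * m + 1) n\<bar>) at_top sequentially" if "i \<noteq> 2 * m + 1" for i m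
  proof (rule filterlim_at_top_mono[OF lin_top[of 1]])
    show "\<forall>\<^sub>F n in sequentially. 1 * real n \<le> \<bar>P i n - P (2 * m + 1) n\<bar>"
      using eventually_ge_at_top[of "i div 2"]
    proof eventually_elim
      case (elim n)
      show ?case
      proof (cases "even i")
        case True
        have "1 * real n \<le> (real m + 1) * real n" by (intro mult_right_mono) auto
        then show ?thesis using pad_ge[OF elim, of m] True by (simp add: P_def)
      next
        case False
        then obtain m' where i: "i = 2 * m' + 1" by (auto elim: oddE)
        then have "1 \<le> \<bar>real m' - real m\<bar>" using that by auto
        then have "1 * real n \<le> \<bar>real m' - real m\<bar> * real n" by (intro mult_right_mono) auto
        also have "\<dots> = \<bar>(real m' - real m) * real n\<bar>" by (simp add: abs_mult)
        also have "(real m' - real m) * real n = pad m' n - pad m n" by (simp add: pad_def algebra_simps)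
        finally show ?thesis by (simp add: P_def i)
      qed
    qed
  qed simp
  \<comment> \<open>Distances may be unbounded, so the extraction is applied to their bounded images
    under \<open>1 / (1 + \<bar>x\<bar>)\<close>.\<close>
  have "bounded (range (\<lambda>n. 1 / (1 + \<bar>P (fst ij) n - P (snd ij) n\<bar>)))" for ij :: "nat \<times> nat"
    by (rule boundedI[of _ 1]) auto
  from common_convergent_subsequence[of "\<lambda>ij n. 1 / (1 + \<bar>P (fst ij) n - P (snd ij) n\<bar>)", OF this]
  obtain \<sigma>1 where \<sigma>1: "strict_mono (\<sigma>1 :: nat \<Rightarrow> nat)"
    "\<And>ij. convergent (\<lambda>n. 1 / (1 + \<bar>P (fst ij) (\<sigma>1 n) - P (snd ij) (\<sigma>1 n)\<bar>))"
    by metis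
  define f where "f j n y = (1 / sqrt (exp (P j n))) *\<^sub>R v n (exp (P j n) * y)" for j n y
  have fE: "energy_le K (f j n)" for j n
    unfolding f_def by (rule energy_le_scale[OF E]) simp
  have f0: "(\<lambda>n. f j n 0) \<longlonglongrightarrow> 0" for j
  proof (rule Lim_null_comparison[OF _ tendsto_norm_zero[OF Z[OF order_refl]]])
    have "norm (f j n 0) \<le> norm (v n 0)" for n
    proof -
      have "1 \<le> sqrt (exp (P j n))" using P_nonneg[of j n] by simp
      then have "norm (v n 0) / sqrt (exp (P j n)) \<le> norm (v n 0) / 1" by (intro divide_left_mono) auto
      then show ?thesis by (simp add: f_def)
    qed
    then show "\<forall>\<^sub>F n in sequentially. norm (f j n 0) \<le> norm (v n 0)" by simp
  qed
  \<comment> \<open>Absolute values of rationals form a countable dense set in the half-line on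
    which \<open>energy_le\<close> controls the functions.\<close>
  have bdd: "bounded (range (\<lambda>n. f (fst jq) (\<sigma>1 n) \<bar>of_rat (snd jq)\<bar>))" for jq :: "nat \<times> rat"
  proof -
    obtain j q where jq: "jq = (j, q)" by (cases jq)
    obtain B where B: "\<And>n. norm (f j n 0) \<le> B"
      using convergent_imp_Bseq[OF convergentI[OF f0]] by (rule BseqE) blast
    show ?thesis
    proof (rule boundedI, clarify)
      fix n
      have "norm (f j (\<sigma>1 n) \<bar>of_rat q\<bar>) \<le> norm (f j (\<sigma>1 n) 0) + sqrt (K * \<bar>of_rat q\<bar>)"
        by (rule energy_le_growth[OF fE]) simp
      then show "norm (f (fst jq) (\<sigma>1 n) \<bar>of_rat (snd jq)\<bar>) \<le> B + sqrt (K * \<bar>of_rat q\<bar>)"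
        using B[of "\<sigma>1 n"] by (simp add: jq)
    qed
  qed
  from common_convergent_subsequence[of "\<lambda>jq n. f (fst jq) (\<sigma>1 n) \<bar>of_rat (snd jq)\<bar>", OF bdd]
  obtain \<sigma>2 where \<sigma>2: "strict_mono (\<sigma>2 :: nat \<Rightarrow> nat)"
    "\<And>jq. convergent (\<lambda>n. f (fst jq) (\<sigma>1 (\<sigma>2 n)) \<bar>of_rat (snd jq)\<bar>)"
    by metis
  define \<sigma> where "\<sigma> = \<sigma>1 \<circ> \<sigma>2"
  have \<sigma>: "strict_mono \<sigma>" unfolding \<sigma>_def by (rule strict_mono_o[OF \<sigma>1(1) \<sigma>2(1)])
  note sub = filterlim_compose[OF _ filterlim_subseq[OF \<sigma>]]
  define near where "near i j \<longleftrightarrow> (\<exists>B. \<forall>n. \<bar>P i (\<sigma> n) - P j (\<sigma> n)\<bar> \<le> B)" for i j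
  have far: "filterlim (\<lambda>n. \<bar>P i (\<sigma> n) - P j (\<sigma> n)\<bar>) at_top sequentially" if "\<not> near i j" for i j
  proof -
    have "convergent (\<lambda>n. 1 / (1 + \<bar>P i (\<sigma> n) - P j (\<sigma> n)\<bar>))"
      using convergent_subseq_convergent[OF \<sigma>1(2)[of "(i, j)"] \<sigma>2(1)] by (simp add: \<sigma>_def o_def)
    from inverse_one_plus_abs_dichotomy[OF this] show ?thesis using that unfolding near_def by blast
  qed
  have near_refl: "near i i" for i by (auto simp: near_def)
  have near_sym: "near i j \<Longrightarrow> near j i" for i j by (auto simp: near_def abs_minus_commute)
  have near_trans: "near i k" if ij: "near i j" and jk: "near j k" for i j k
  proof -
    obtain B C where B: "\<And>n. \<bar>P i (\<sigma> n) - P j (\<sigma> n)\<bar> \<le> B" and C: "\<And>n. \<bar>P j (\<sigma> n) - P k (\<sigma> n)\<bar> \<le> C"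
      using ij jk unfolding near_def by blast
    have "\<bar>P i (\<sigma> n) - P k (\<sigma> n)\<bar> \<le> B + C" for n
      using B[of n] C[of n] by linarith
    then show ?thesis unfolding near_def by blast
  qed
  \<comment> \<open>The least index of each class.\<close>
  define R where "R = {i. \<forall>j<i. \<not> near i j}"
  have R_near: "i = j" if "i \<in> R" "j \<in> R" "near i j" for i j
  proof (cases i j rule: linorder_cases)
    case less
    then show ?thesis using that(2) near_sym[OF that(3)] by (auto simp: R_def)
  next
    case greater
    then show ?thesis using that(1,3) by (auto simp: R_def)
  qed
  have R_rep: "\<exists>j\<in>R. near i j" for i
  proof -
    define j where "j = (LEAST j. near i j)"
    have j: "near i j" unfolding j_def by (rule LeastI[of _ i]) (rule near_refl)
    have "\<not> near i k" if "k < j" for k using not_less_Least that unfolding j_def by blast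
    then have "j \<in> R" using near_trans[OF j] by (auto simp: R_def)
    then show ?thesis using j by blast
  qed
  have "2 * m + 1 \<in> R" for m
  proof -
    have "\<not> near (2 * m + 1) j" if "j < 2 * m + 1" for j
    proof
      assume "near (2 * m + 1) j"
      then obtain B where B: "\<And>n. \<bar>P j (\<sigma> n) - P (2 * m + 1) (\<sigma> n)\<bar> \<le> B"
        using near_sym unfolding near_def by blast
      have "filterlim (\<lambda>n. \<bar>P j (\<sigma> n) - P (2 * m + 1) (\<sigma> n)\<bar>) at_top sequentially"
        using that by (intro sub P_pad) auto
      then have "\<forall>\<^sub>F n in sequentially. B + 1 \<le> \<bar>P j (\<sigma> n) - P (2 * m + 1) (\<sigma> n)\<bar>"
        by (simp add: filterlim_at_top)
      then obtain n where "B + 1 \<le> \<bar>P j (\<sigma> n) - P (2 * m + 1) (\<sigma> n)\<bar>"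
        using eventually_happens'[OF sequentially_bot] by blast
      then show False using B[of n] by simp
    qed
    then show ?thesis by (simp add: R_def)
  qed
  then have "range (\<lambda>m. 2 * m + 1) \<subseteq> R" by auto
  moreover have "infinite (range (\<lambda>m::nat. 2 * m + 1))" by (rule range_inj_infinite) (auto simp: inj_on_def)
  ultimately have R_inf: "infinite R" using infinite_super by blast
  define e where "e = enumerate R"
  have eR: "e j \<in> R" for j unfolding e_def by (rule enumerate_in_set[OF R_inf])
  have e_inj: "e i = e j \<Longrightarrow> i = j" for i j
    using strict_mono_enumerate[OF R_inf] unfolding e_def by (auto dest: strict_mono_imp_inj_on injD)
  have e_surj: "\<exists>j. e j = i" if "i \<in> R" for i
    using enumerate_Ex[OF R_inf that] unfolding e_def by blast
  define \<alpha> where "\<alpha> j n = exp (P (e j) (\<sigma> n))" for j n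
  have far_e: "filterlim (\<lambda>n. \<bar>P (e i) (\<sigma> n) - P (e j) (\<sigma> n)\<bar>) at_top sequentially" if "i \<noteq> j" for i j
    using R_near eR e_inj that by (intro far) blast
  \<comment> \<open>At 0 the value 0 is also the limit, by \<open>f0\<close>, so the energy bound
    passes to the limit on the closed half-line.\<close>
  define \<psi> where "\<psi> j s = (if s \<le> 0 then 0 else lim (\<lambda>n. f (e j) (\<sigma> n) s))" for j s
  have conv: "convergent (\<lambda>n. f (e j) (\<sigma> n) s)" if "0 \<le> s" for j s
  proof (rule equi_hoelder_convergent[where S = "{0..}" and D = "range (\<lambda>q. \<bar>of_rat q\<bar>)"])
    show "(norm (f (e j) (\<sigma> n) t - f (e j) (\<sigma> n) s))\<^sup>2 \<le> K * \<bar>t - s\<bar>" if "s \<in> {0..}" "t \<in> {0..}" for n s t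
      using that by (intro energy_le_hoelder[OF fE]) auto
    show "convergent (\<lambda>n. f (e j) (\<sigma> n) q)" if "q \<in> range (\<lambda>q. \<bar>of_rat q\<bar>)" for q
      using that \<sigma>2(2)[of "(e j, _)"] by (auto simp: \<sigma>_def)
    show "\<exists>q\<in>range (\<lambda>q. \<bar>of_rat q\<bar>) \<inter> {0..}. \<bar>s - q\<bar> < d" if "0 < d" for d
    proof -
      obtain q where "s < of_rat q" "of_rat q < s + d" using of_rat_dense[of s "s + d"] \<open>0 < d\<close> by auto
      moreover from this have "(of_rat q :: real) = \<bar>of_rat q\<bar>" using \<open>0 \<le> s\<close> by linarith
      ultimately show ?thesis using \<open>0 \<le> s\<close>
        by (intro bexI[of _ "of_rat q"]) (auto intro: range_eqI)
    qed
  qed (use that in simp)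
  have lim: "(\<lambda>n. f (e j) (\<sigma> n) s) \<longlonglongrightarrow> \<psi> j s" if "0 \<le> s" for j s
  proof (cases "s = 0")
    case True
    then show ?thesis using sub[OF f0[of "e j"]] by (simp add: \<psi>_def)
  next
    case False
    then show ?thesis using conv[OF that, of j] that by (simp add: \<psi>_def convergent_LIMSEQ_iff)
  qed
  have \<psi>E: "energy_le K (\<psi> j)" for j by (rule energy_le_limit[OF fE lim])
  have \<psi>0: "\<psi> j s = 0" if "s \<le> 0" for j s using that by (simp add: \<psi>_def)
  have scaled: "sqrt (\<alpha> j n) *\<^sub>R f (e j) (\<sigma> n) (s / \<alpha> j n) = v (\<sigma> n) s" for j n s
    by (simp add: f_def \<alpha>_def)
  show thesis
  proof (rule that[OF \<sigma>])
    show "is_scale (\<alpha> j)" for j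
      using filterlim_compose[OF exp_at_top sub[OF P_top]] by (simp add: is_scale_def \<alpha>_def[abs_def])
    show "orthogonal_scales (\<alpha> j) (\<alpha> k)" if "j \<noteq> k" for j k
      using far_e[of k j] that by (simp add: orthogonal_scales_def \<alpha>_def ln_div)
    show "energy_le K (\<psi> j)" "s \<le> 0 \<Longrightarrow> \<psi> j s = 0" for j s by (rule \<psi>E, rule \<psi>0)
  next
    fix \<eta> :: real assume "0 < \<eta>"
    obtain k where "1 / (\<eta> / 2) < real k" using reals_Archimedean2 by blast
    then have k: "\<epsilon> k \<le> \<eta> / 2" using \<open>0 < \<eta>\<close> by (simp add: \<epsilon>_def field_simps)
    \<comment> \<open>Each family of cluster points of level \<open>k\<close> stays at bounded
      distance from one selected scale; \<open>J\<close> records its index and \<open>B\<close> the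
      distance.\<close>
    have "\<forall>i. \<exists>j B. \<forall>n. \<bar>p k (\<sigma> n) i - P (e j) (\<sigma> n)\<bar> \<le> B"
    proof
      fix i
      obtain j where "near (2 * prod_encode (k, i)) (e j)" using R_rep e_surj by metis
      then show "\<exists>j B. \<forall>n. \<bar>p k (\<sigma> n) i - P (e j) (\<sigma> n)\<bar> \<le> B"
        by (auto simp: near_def P_def[of "2 * _"] r_def)
    qed
    then obtain J B where JB: "\<And>i n. \<bar>p k (\<sigma> n) i - P (e (J i)) (\<sigma> n)\<bar> \<le> B i" by metis
    have B_nonneg: "0 \<le> B i" for i using JB[of 0 i] by linarith
    define l0 where "l0 = Suc (\<Sum>i<N k. J i)"
    define B' where "B' = (\<Sum>i<N k. B i)"
    have Jl: "J i < l0" if "i < N k" for i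
    proof -
      have "J i \<le> (\<Sum>i<N k. J i)" using that by (intro member_le_sum) auto
      then show ?thesis by (simp add: l0_def)
    qed
    have BB: "B i \<le> B'" if "i < N k" for i
      using that B_nonneg unfolding B'_def by (intro member_le_sum) auto
    show "\<exists>l0. \<forall>l\<ge>l0. \<forall>\<^sub>F n in sequentially. \<forall>s\<ge>1.
        norm (v (\<sigma> n) s - (\<Sum>j<l. sqrt (\<alpha> j n) *\<^sub>R \<psi> j (s / \<alpha> j n))) \<le> \<eta> * sqrt s"
    proof (intro exI[of _ l0] allI impI)
      fix l assume l: "l0 \<le> l"
      then have "0 < l" by (simp add: l0_def)
      define \<delta> where "\<delta> = \<eta> / (2 * real l)"
      have "0 < \<delta>" using \<open>0 < \<eta>\<close> \<open>0 < l\<close> by (simp add: \<delta>_def)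
      have l\<delta>: "real l * \<delta> = \<eta> / 2" using \<open>0 < l\<close> by (simp add: \<delta>_def)
      have "\<forall>j. \<exists>Y. \<forall>t. Y < \<bar>t\<bar> \<longrightarrow> norm (\<psi> j (exp t)) < \<delta> * exp (t / 2)"
        by (intro allI energy_le_decay[OF \<psi>E] \<psi>0 \<open>0 < \<delta>\<close>) simp
      then obtain Y where Y: "\<And>j t. Y j < \<bar>t\<bar> \<Longrightarrow> norm (\<psi> j (exp t)) < \<delta> * exp (t / 2)" by metis
      \<comment> \<open>Half-width of the windows around the logarithms of the scales. Outside its
        window every profile with index below \<open>l\<close> is under the \<open>\<delta>\<close>
        threshold; outside all of them \<open>t\<close> has distance at least \<open>L k\<close>
        from every cluster point of level \<open>k\<close>.\<close>
      define W where "W = (\<Sum>j<l. \<bar>Y j\<bar>) + L k + B'"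
      have YW: "Y j \<le> W" if "j < l" for j
      proof -
        have "\<bar>Y j\<bar> \<le> (\<Sum>j<l. \<bar>Y j\<bar>)" using that by (intro member_le_sum) auto
        moreover have "0 \<le> B'" using B_nonneg by (auto simp: B'_def intro!: sum_nonneg)
        ultimately show ?thesis using L(1)[of k] by (simp add: W_def)
      qed
      have LW: "L k + B' \<le> W" by (auto simp: W_def intro!: sum_nonneg)
      have ev1: "\<forall>\<^sub>F n in sequentially. norm (v (\<sigma> n) 0) \<le> \<epsilon> k / 4"
      proof -
        have "(\<lambda>n. norm (v (\<sigma> n) 0)) \<longlonglongrightarrow> 0" by (rule sub[OF tendsto_norm_zero[OF Z]]) simp
        then have "\<forall>\<^sub>F n in sequentially. norm (v (\<sigma> n) 0) < \<epsilon> k / 4"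
          by (rule order_tendstoD) (use eps in auto)
        then show ?thesis by (rule eventually_mono) simp
      qed
      have ev2: "\<forall>\<^sub>F n in sequentially. \<forall>ij\<in>{..<l} \<times> {..<l}. fst ij \<noteq> snd ij \<longrightarrow>
          2 * W < \<bar>P (e (fst ij)) (\<sigma> n) - P (e (snd ij)) (\<sigma> n)\<bar>"
      proof (rule eventually_ball_finite, simp, intro ballI)
        fix ij :: "nat \<times> nat"
        show "\<forall>\<^sub>F n in sequentially. fst ij \<noteq> snd ij \<longrightarrow>
          2 * W < \<bar>P (e (fst ij)) (\<sigma> n) - P (e (snd ij)) (\<sigma> n)\<bar>"
          using far_e[of "fst ij" "snd ij"] by (cases "fst ij = snd ij") (auto simp: filterlim_at_top_dense)
      qed
      \<comment> \<open>Inside a window s >= \<alpha> exp(-W), hence sqrt \<alpha> exp(-W / 2) <=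
        sqrt s: the factor \<open>exp (- W / 2)\<close> makes the uniform error small relative to
        sqrt s.\<close>
      have ev3: "\<forall>\<^sub>F n in sequentially. \<forall>j\<in>{..<l}. \<forall>y\<in>{0..exp W}.
          norm (f (e j) (\<sigma> n) y - \<psi> j y) < \<eta> / 2 * exp (- W / 2)"
        using \<open>0 < \<eta>\<close>
        by (intro eventually_ball_finite ballI equi_hoelder_uniform[OF energy_le_hoelder[OF fE] lim]) auto
      from ev1 ev2 ev3
      show "\<forall>\<^sub>F n in sequentially. \<forall>s\<ge>1.
        norm (v (\<sigma> n) s - (\<Sum>j<l. sqrt (\<alpha> j n) *\<^sub>R \<psi> j (s / \<alpha> j n))) \<le> \<eta> * sqrt s"
      proof (eventually_elim, intro allI impI)
        fix n and s :: real assume v0: "norm (v (\<sigma> n) 0) \<le> \<epsilon> k / 4"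
          and sepP: "\<forall>ij\<in>{..<l} \<times> {..<l}. fst ij \<noteq> snd ij \<longrightarrow>
            2 * W < \<bar>P (e (fst ij)) (\<sigma> n) - P (e (snd ij)) (\<sigma> n)\<bar>"
          and unif: "\<forall>j\<in>{..<l}. \<forall>y\<in>{0..exp W}.
            norm (f (e j) (\<sigma> n) y - \<psi> j y) < \<eta> / 2 * exp (- W / 2)" and "1 \<le> s"
        define t where "t = ln s"
        have s: "s = exp t" "0 \<le> t" using \<open>1 \<le> s\<close> by (auto simp: t_def)
        have sqrts: "sqrt s = exp (t / 2)" by (simp add: s sqrt_exp_half)
        have s\<alpha>: "s / \<alpha> j n = exp (t - P (e j) (\<sigma> n))" for j by (simp add: s \<alpha>_def exp_diff)
        have sqrt\<alpha>: "sqrt (\<alpha> j n) = exp (P (e j) (\<sigma> n) / 2)" for j by (simp add: \<alpha>_def sqrt_exp_half)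
        have small: "norm (sqrt (\<alpha> j n) *\<^sub>R \<psi> j (s / \<alpha> j n)) \<le> \<delta> * sqrt s"
          if "j < l" "W < \<bar>t - P (e j) (\<sigma> n)\<bar>" for j
        proof -
          have "norm (\<psi> j (s / \<alpha> j n)) < \<delta> * exp ((t - P (e j) (\<sigma> n)) / 2)"
            unfolding s\<alpha> using that YW[of j] by (intro Y) simp
          then have "exp (P (e j) (\<sigma> n) / 2) * norm (\<psi> j (s / \<alpha> j n))
              \<le> exp (P (e j) (\<sigma> n) / 2) * (\<delta> * exp ((t - P (e j) (\<sigma> n)) / 2))"
            by (intro mult_left_mono) auto
          also have "\<dots> = \<delta> * sqrt s"
            by (simp add: sqrts diff_divide_distrib exp_diff)
          finally show ?thesis by (simp add: sqrt\<alpha>)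
        qed
        \<comment> \<open>Near one scale its profile matches \<open>v\<close>, and the other
          profiles, whose scales are more than \<open>2 * W\<close> away from it, are small. Away
          from all scales both \<open>v\<close> and every profile are small. In each case the two
          contributions are at most \<eta> / 2.\<close>
        show "norm (v (\<sigma> n) s - (\<Sum>j<l. sqrt (\<alpha> j n) *\<^sub>R \<psi> j (s / \<alpha> j n))) \<le> \<eta> * sqrt s"
        proof (cases "\<exists>i<l. \<bar>t - P (e i) (\<sigma> n)\<bar> \<le> W")
          case True
          then obtain i where i: "i < l" "\<bar>t - P (e i) (\<sigma> n)\<bar> \<le> W" by blast
          have others: "norm (sqrt (\<alpha> j n) *\<^sub>R \<psi> j (s / \<alpha> j n)) \<le> \<delta> * sqrt s" if "j \<in> {..<l} - {i}" for j
          proof (rule small)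
            have "2 * W < \<bar>P (e i) (\<sigma> n) - P (e j) (\<sigma> n)\<bar>" using sepP i(1) that by force
            then show "W < \<bar>t - P (e j) (\<sigma> n)\<bar>" using i(2) by linarith
          qed (use that in auto)
          have "norm (v (\<sigma> n) s - sqrt (\<alpha> i n) *\<^sub>R \<psi> i (s / \<alpha> i n))
              = sqrt (\<alpha> i n) * norm (f (e i) (\<sigma> n) (s / \<alpha> i n) - \<psi> i (s / \<alpha> i n))"
            unfolding scaled[of i n s, symmetric] scaleR_diff_right[symmetric] norm_scaleR
            by (simp add: \<alpha>_def)
          also have "\<dots> \<le> sqrt (\<alpha> i n) * (\<eta> / 2 * exp (- W / 2))"
            using unif i unfolding s\<alpha> by (intro mult_left_mono less_imp_le) (auto simp: \<alpha>_def)
          also have "\<dots> = \<eta> / 2 * exp ((P (e i) (\<sigma> n) - W) / 2)"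
            by (simp add: sqrt\<alpha> diff_divide_distrib flip: exp_add)
          also have "\<dots> \<le> \<eta> / 2 * sqrt s"
            unfolding sqrts using i(2) \<open>0 < \<eta>\<close> by (intro mult_left_mono) auto
          finally have "norm (v (\<sigma> n) s - sqrt (\<alpha> i n) *\<^sub>R \<psi> i (s / \<alpha> i n)) \<le> \<eta> / 2 * sqrt s" .
          moreover have "norm (v (\<sigma> n) s - (\<Sum>j<l. sqrt (\<alpha> j n) *\<^sub>R \<psi> j (s / \<alpha> j n)))
            \<le> norm (v (\<sigma> n) s - sqrt (\<alpha> i n) *\<^sub>R \<psi> i (s / \<alpha> i n)) + real (card {..<l}) * (\<delta> * sqrt s)"
            using i(1) others \<open>0 < \<delta>\<close> s by (intro sum_one_large) auto
          moreover have "real (card {..<l}) * (\<delta> * sqrt s) = \<eta> / 2 * sqrt s"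
            using l\<delta> by (simp flip: mult.assoc)
          ultimately show ?thesis by linarith
        next
          case False
          then have away: "W < \<bar>t - P (e j) (\<sigma> n)\<bar>" if "j < l" for j using that by force
          \<comment> \<open>A larger value would put \<open>t\<close> within \<open>L k\<close> of a
            cluster point, hence within \<open>L k + B'\<close> of one of the first \<open>l\<close>
            scales.\<close>
          have "norm (v (\<sigma> n) s) < \<epsilon> k * exp (t / 2)"
          proof (rule ccontr)
            assume "\<not> ?thesis"
            then obtain i where i: "i < N k" "\<bar>t - p k (\<sigma> n) i\<bar> < L k"
              using net[OF v0 s(2)] s(1) by auto
            have "\<bar>t - P (e (J i)) (\<sigma> n)\<bar> \<le> L k + B'"
              using i(2) JB[of n i] BB[OF i(1)] by linarith
            then show False using away[of "J i"] Jl[OF i(1)] l LW by simp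
          qed
          also have "\<dots> \<le> \<eta> / 2 * sqrt s" unfolding sqrts using k by (intro mult_right_mono) auto
          finally have "norm (v (\<sigma> n) s) \<le> \<eta> / 2 * sqrt s" by simp
          moreover have "norm (\<Sum>j<l. sqrt (\<alpha> j n) *\<^sub>R \<psi> j (s / \<alpha> j n)) \<le> (\<Sum>j<l. \<delta> * sqrt s)"
            using small away by (intro sum_norm_le) auto
          moreover have "(\<Sum>j<l. \<delta> * sqrt s) = \<eta> / 2 * sqrt s"
            using l\<delta> by (simp flip: mult.assoc)
          ultimately show ?thesis
            using norm_triangle_ineq4[of "v (\<sigma> n) s" "\<Sum>j<l. sqrt (\<alpha> j n) *\<^sub>R \<psi> j (s / \<alpha> j n)"] by linarith
        qed
      qed
    qed
  qed
qed

section \<open>Weak derivatives from bounded energy\<close>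

lemma tendsto_of_rapid_increments:
  fixes a :: "nat \<Rightarrow> 'a::banach"
  assumes "summable (\<lambda>j. norm (a (Suc j) - a j))"
  shows "convergent a"
proof -
  have "summable (\<lambda>j. a (Suc j) - a j)" by (rule summable_norm_cancel[OF assms])
  then have "convergent (\<lambda>n. \<Sum>j<n. a (Suc j) - a j)" by (simp add: summable_iff_convergent)
  then have "convergent (\<lambda>n. a n - a 0)" by (simp add: sum_lessThan_telescope)
  then show ?thesis by (simp add: convergent_diff_const_right_iff)
qed

text \<open>Riesz-Fischer with the rate kept: the increments are summable almost everywhere, and
  Fatou transfers the distance bounds to the limit.\<close>

lemma L2_limit_of_rapidly_Cauchy:
  fixes g :: "nat \<Rightarrow> real \<Rightarrow> 'a::euclidean_space"
  assumes [measurable]: "\<And>j. g j \<in> borel_measurable borel"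
    and C: "\<And>i j. i \<le> j \<Longrightarrow> (\<integral>\<^sup>+x. ennreal ((norm (g j x - g i x))\<^sup>2) \<partial>lborel) \<le> ennreal ((1/4)^i)"
  obtains h where "h \<in> borel_measurable borel"
    "\<And>i. (\<integral>\<^sup>+x. ennreal ((norm (h x - g i x))\<^sup>2) \<partial>lborel) \<le> ennreal ((1/4)^i)"
proof
  define h where "h x = lim (\<lambda>j. g j x)" for x
  show [measurable]: "h \<in> borel_measurable borel" unfolding h_def by measurable
  \<comment> \<open>After the weight \<open>2^j\<close> the integrals are still bounded by the
    summable (1/2)^j, and a finite weighted sum at a point forces geometric decay of the increments
    there.\<close>
  define d where "d j x = ennreal (2^j * (norm (g (Suc j) x - g j x))\<^sup>2)" for j x
  have [measurable]: "d j \<in> borel_measurable lborel" for j unfolding d_def by measurable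
  have "(\<integral>\<^sup>+x. d j x \<partial>lborel) \<le> ennreal ((1/2)^j)" for j
  proof -
    have "(\<integral>\<^sup>+x. d j x \<partial>lborel) = ennreal (2^j) * (\<integral>\<^sup>+x. ennreal ((norm (g (Suc j) x - g j x))\<^sup>2) \<partial>lborel)"
      unfolding d_def by (simp add: ennreal_mult nn_integral_cmult)
    also have "\<dots> \<le> ennreal (2^j) * ennreal ((1/4)^j)" by (intro mult_left_mono C) auto
    also have "\<dots> = ennreal ((1/2)^j)" by (simp flip: ennreal_mult power_mult_distrib)
    finally show ?thesis .
  qed
  then have "(\<Sum>j. \<integral>\<^sup>+x. d j x \<partial>lborel) \<le> (\<Sum>j. ennreal ((1/2)^j))"
    by (intro suminf_le) auto
  also have "\<dots> = ennreal (\<Sum>j. (1/2)^j)" by (intro suminf_ennreal2) auto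
  finally have "(\<integral>\<^sup>+x. (\<Sum>j. d j x) \<partial>lborel) \<noteq> \<infinity>"
    by (subst nn_integral_suminf) (auto simp: top_unique)
  then have "AE x in lborel. (\<Sum>j. d j x) \<noteq> \<infinity>" by (intro nn_integral_noteq_infinite) auto
  then have conv: "AE x in lborel. (\<lambda>j. g j x) \<longlonglongrightarrow> h x"
  proof eventually_elim
    case (elim x)
    then obtain B where B: "(\<Sum>j. d j x) = ennreal B" "0 \<le> B" by (metis ennreal_cases infinity_ennreal_def)
    have bound: "norm (g (Suc j) x - g j x) \<le> sqrt B * (1 / sqrt 2)^j" for j
    proof -
      have "d j x \<le> (\<Sum>j. d j x)" using sum_le_suminf[of "\<lambda>j. d j x" "{j}"] by simp
      then have "2^j * (norm (g (Suc j) x - g j x))\<^sup>2 \<le> B" using B by (simp add: d_def)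
      then have "(norm (g (Suc j) x - g j x))\<^sup>2 \<le> B / 2^j" by (simp add: field_simps)
      then have "norm (g (Suc j) x - g j x) \<le> sqrt (B / 2^j)" by (rule real_le_rsqrt)
      also have "\<dots> = sqrt B / sqrt 2 ^ j" by (simp only: real_sqrt_divide real_sqrt_power)
      finally show ?thesis by (simp add: power_one_over)
    qed
    have "summable (\<lambda>j. sqrt B * (1 / sqrt 2)^j)" by (intro summable_mult summable_geometric) simp
    then have "summable (\<lambda>j. norm (g (Suc j) x - g j x))"
      by (rule summable_comparison_test') (use bound in auto)
    from tendsto_of_rapid_increments[OF this] show ?case by (simp add: h_def convergent_LIMSEQ_iff)
  qed
  fix i
  have "(\<integral>\<^sup>+x. ennreal ((norm (h x - g i x))\<^sup>2) \<partial>lborel)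
      = (\<integral>\<^sup>+x. liminf (\<lambda>j. ennreal ((norm (g j x - g i x))\<^sup>2)) \<partial>lborel)"
  proof (rule nn_integral_cong_AE)
    show "AE x in lborel. ennreal ((norm (h x - g i x))\<^sup>2) = liminf (\<lambda>j. ennreal ((norm (g j x - g i x))\<^sup>2))"
      using conv
    proof eventually_elim
      case (elim x)
      have "(\<lambda>j. ennreal ((norm (g j x - g i x))\<^sup>2)) \<longlonglongrightarrow> ennreal ((norm (h x - g i x))\<^sup>2)"
        by (intro tendsto_ennrealI tendsto_intros elim)
      from lim_imp_Liminf[OF _ this] show ?case by simp
    qed
  qed
  also have "\<dots> \<le> liminf (\<lambda>j. \<integral>\<^sup>+x. ennreal ((norm (g j x - g i x))\<^sup>2) \<partial>lborel)"
    by (rule nn_integral_liminf) measurable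
  also have "\<dots> \<le> liminf (\<lambda>j. ennreal ((1/4)^i))"
    by (rule Liminf_mono, rule eventually_mono[OF eventually_ge_at_top[of i]]) (rule C)
  also have "\<dots> = ennreal ((1/4)^i)" by (simp add: Liminf_const)
  finally show "(\<integral>\<^sup>+x. ennreal ((norm (h x - g i x))\<^sup>2) \<partial>lborel) \<le> ennreal ((1/4)^i)" .
qed

section \<open>Dyadic difference quotients\<close>

definition dyadic_floor :: "nat \<Rightarrow> real \<Rightarrow> real" where
  "dyadic_floor k x = of_int \<lfloor>2^k * x\<rfloor> / 2^k"

text \<open>The derivative of the piecewise linear interpolation of \<open>\<psi>\<close> at the
  points i / 2^k, with the value of the right-hand cell at the nodes.\<close>

definition dyadic_slope :: "(real \<Rightarrow> 'a::real_normed_vector) \<Rightarrow> nat \<Rightarrow> real \<Rightarrow> 'a" where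
  "dyadic_slope \<psi> k x = 2^k *\<^sub>R (\<psi> (dyadic_floor k x + 1/2^k) - \<psi> (dyadic_floor k x))"

lemma dyadic_floor_bounds: "dyadic_floor k x \<le> x" "x < dyadic_floor k x + 1/2^k"
proof -
  have "of_int \<lfloor>2^k * x\<rfloor> \<le> 2^k * x" "2^k * x < of_int \<lfloor>2^k * x\<rfloor> + 1" by linarith+
  then show "dyadic_floor k x \<le> x" "x < dyadic_floor k x + 1/2^k"
    by (simp_all add: dyadic_floor_def field_simps)
qed

lemma dyadic_floor_shift: "dyadic_floor k (x + 1/2^k) = dyadic_floor k x + 1/2^k"
proof -
  have "2^k * (x + 1/2^k) = 2^k * x + (1::real)" by (simp add: field_simps)
  then show ?thesis by (simp add: dyadic_floor_def add_divide_distrib)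
qed

lemma dyadic_floor_tendsto: "(\<lambda>k. dyadic_floor k x) \<longlonglongrightarrow> x"
proof (rule tendsto_sandwich[of "\<lambda>k. x - (1/2)^k" _ _ "\<lambda>_. x"])
  have "(\<lambda>k. x - (1/2)^k) \<longlonglongrightarrow> x - 0" by (intro tendsto_intros LIMSEQ_realpow_zero) auto
  then show "(\<lambda>k. x - (1/2)^k) \<longlonglongrightarrow> x" by simp
  show "\<forall>\<^sub>F k in sequentially. x - (1/2)^k \<le> dyadic_floor k x"
  proof (rule always_eventually, rule allI)
    fix k show "x - (1/2)^k \<le> dyadic_floor k x"
      using dyadic_floor_bounds(2)[of x k] by (simp add: power_one_over)
  qed
qed (use dyadic_floor_bounds in auto)

lemma dyadic_floor_eq:
  assumes "real i / 2^k \<le> x" "x < (real i + 1) / 2^k"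
  shows "dyadic_floor k x = real i / 2^k"
proof -
  have "\<lfloor>2^k * x\<rfloor> = int i" by (rule floor_unique) (use assms in \<open>simp_all add: field_simps\<close>)
  then show ?thesis by (simp add: dyadic_floor_def)
qed

lemma dyadic_slope_eq:
  assumes "real i / 2^k \<le> x" "x < (real i + 1) / 2^k"
  shows "dyadic_slope \<psi> k x = 2^k *\<^sub>R (\<psi> ((real i + 1) / 2^k) - \<psi> (real i / 2^k))"
  using dyadic_floor_eq[OF assms] by (simp add: dyadic_slope_def add_divide_distrib)

lemma dyadic_slope_neg:
  assumes "\<And>s. s \<le> 0 \<Longrightarrow> \<psi> s = 0" "x < 0"
  shows "dyadic_slope \<psi> k x = 0"
proof -
  have "\<lfloor>2^k * x\<rfloor> < 0" using mult_pos_neg[of "2^k" x] assms(2) by simp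
  then have "(of_int \<lfloor>2^k * x\<rfloor> + 1 :: real) \<le> 0" by linarith
  then have "(of_int \<lfloor>2^k * x\<rfloor> + 1 :: real) / 2^k \<le> 0" by (simp add: divide_nonpos_pos)
  moreover have "dyadic_floor k x + 1/2^k = (of_int \<lfloor>2^k * x\<rfloor> + 1) / 2^k"
    by (simp add: dyadic_floor_def add_divide_distrib)
  ultimately have *: "dyadic_floor k x + 1/2^k \<le> 0" by simp
  moreover have "0 < (1/2^k :: real)" by simp
  ultimately have "dyadic_floor k x \<le> 0" by linarith
  with * show ?thesis using assms(1) by (simp add: dyadic_slope_def)
qed

lemma dyadic_slope_measurable:
  fixes \<psi> :: "real \<Rightarrow> 'a::euclidean_space"
  assumes "continuous_on UNIV \<psi>"
  shows "dyadic_slope \<psi> k \<in> borel_measurable borel"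
proof -
  have [measurable]: "\<psi> \<in> borel_measurable borel" by (rule borel_measurable_continuous_onI[OF assms])
  have [measurable]: "dyadic_floor k \<in> borel_measurable borel" unfolding dyadic_floor_def[abs_def] by measurable
  have [measurable]: "(\<lambda>x. \<psi> (dyadic_floor k x)) \<in> borel_measurable borel"
    "(\<lambda>x. \<psi> (dyadic_floor k x + 1/2^k)) \<in> borel_measurable borel"
    by (rule measurable_compose[where N = borel]; measurable)+
  show ?thesis unfolding dyadic_slope_def[abs_def] by measurable
qed

lemma has_integral_cells:
  fixes f :: "real \<Rightarrow> 'b::banach"
  assumes "\<And>i. (f has_integral F i) {real i / c .. (real i + 1) / c}" "0 < c"
  shows "(f has_integral (\<Sum>i<m. F i)) {0..real m / c}"
proof (induction m)
  case 0
  then show ?case by (simp add: has_integral_refl)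
next
  case (Suc m)
  have "(f has_integral ((\<Sum>i<m. F i) + F m)) {0..(real m + 1) / c}"
    by (rule has_integral_combine[OF _ _ Suc assms(1)[of m]]) (use \<open>0 < c\<close> in \<open>auto simp: field_simps\<close>)
  then show ?case by (simp add: add.commute)
qed

text \<open>The half-open cell matters: at the right end point the dyadic floor has already moved to
  the next cell, a single point that the integral does not see.\<close>

lemma dyadic_cell_spike:
  assumes "(f has_integral y) {real i / 2^k .. (real i + 1) / 2^k}"
    "\<And>x. real i / 2^k \<le> x \<Longrightarrow> x < (real i + 1) / 2^k \<Longrightarrow> g x = f x"
  shows "(g has_integral y) {real i / 2^k .. (real i + 1) / 2^k}"
  by (rule has_integral_spike[OF negligible_sing[of "(real i + 1) / 2^k"] _ assms(1)]) (use assms(2) in force)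

text \<open>Martingale property: the increment over a cell is the sum of those over its halves, so
  refinement leaves the integral over a coarse cell unchanged.\<close>

lemma dyadic_slope_integral_cell:
  "(dyadic_slope \<psi> (k + d) has_integral (\<psi> ((real i + 1) / 2^k) - \<psi> (real i / 2^k)))
      {real i / 2^k .. (real i + 1) / 2^k}"
  for \<psi> :: "real \<Rightarrow> 'a::euclidean_space"
proof (induction d arbitrary: k i)
  case 0
  show ?case
  proof (rule dyadic_cell_spike)
    define c where "c = 2^k *\<^sub>R (\<psi> ((real i + 1) / 2^k) - \<psi> (real i / 2^k))"
    have "((\<lambda>x. c) has_integral ((real i + 1) / 2^k - real i / 2^k) *\<^sub>R c) {real i / 2^k .. (real i + 1) / 2^k}"
      using has_integral_const_real[of c "real i / 2^k" "(real i + 1) / 2^k"]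
      by (simp add: divide_right_mono)
    moreover have "((real i + 1) / 2^k - real i / 2^k) *\<^sub>R c = \<psi> ((real i + 1) / 2^k) - \<psi> (real i / 2^k)"
      by (simp add: c_def add_divide_distrib)
    ultimately show "((\<lambda>x. c) has_integral (\<psi> ((real i + 1) / 2^k) - \<psi> (real i / 2^k))) {real i / 2^k .. (real i + 1) / 2^k}"
      by simp
    show "dyadic_slope \<psi> (k + 0) x = c" if "real i / 2^k \<le> x" "x < (real i + 1) / 2^k" for x
      using dyadic_slope_eq[OF that] by (simp add: c_def)
  qed
next
  case (Suc d)
  have e: "real (2 * i) / 2^Suc k = real i / 2^k" "(real (2 * i + 1) + 1) / 2^Suc k = (real i + 1) / 2^k"
    "real (2 * i + 1) / 2^Suc k = (real (2 * i) + 1) / 2^Suc k"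
    by (simp_all add: field_simps)
  have le: "real i / 2^k \<le> (real (2 * i) + 1) / 2^Suc k" "(real (2 * i) + 1) / 2^Suc k \<le> (real i + 1) / 2^k"
    by (simp_all add: field_simps)
  have "(dyadic_slope \<psi> (Suc k + d) has_integral (\<psi> ((real (2 * i) + 1) / 2^Suc k) - \<psi> (real i / 2^k))
      + (\<psi> ((real i + 1) / 2^k) - \<psi> ((real (2 * i) + 1) / 2^Suc k))) {real i / 2^k .. (real i + 1) / 2^k}"
    using Suc.IH[of "Suc k" "2 * i"] Suc.IH[of "Suc k" "2 * i + 1"] le unfolding e
    by (intro has_integral_combine[of _ "(real (2 * i) + 1) / 2^Suc k"])
  then show ?case by simp
qed

text \<open>The squared L2 norm of \<open>dyadic_slope \<psi> k\<close> on {0..m}.\<close>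

definition dyadic_energy :: "(real \<Rightarrow> 'a::real_normed_vector) \<Rightarrow> nat \<Rightarrow> nat \<Rightarrow> real" where
  "dyadic_energy \<psi> k m = (\<Sum>i<m * 2^k. 2^k * (norm (\<psi> ((real i + 1) / 2^k) - \<psi> (real i / 2^k)))\<^sup>2)"

lemma dyadic_energy_le:
  assumes "energy_le K \<psi>"
  shows "dyadic_energy \<psi> k m \<le> K"
proof -
  have inj: "inj_on (\<lambda>i. real i / 2^k) {..<m * 2^k}" by (auto simp: inj_on_def)
  have "dyadic_energy \<psi> k m = (\<Sum>a\<in>(\<lambda>i. real i / 2^k) ` {..<m * 2^k}. (norm (\<psi> (a + 1/2^k) - \<psi> a))\<^sup>2 / (a + 1/2^k - a))"
    unfolding dyadic_energy_def by (subst sum.reindex[OF inj]) (simp add: add_divide_distrib mult.commute)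
  also have "\<dots> \<le> K"
  proof (rule energy_leD[OF assms])
    fix a a' :: real
    assume "a \<in> (\<lambda>i. real i / 2^k) ` {..<m * 2^k}" "a' \<in> (\<lambda>i. real i / 2^k) ` {..<m * 2^k}" "a < a'"
    then obtain i j where ij: "a = real i / 2^k" "a' = real j / 2^k" "a < a'" by auto
    then have "i < j" by (simp add: divide_less_cancel)
    then have "(real i + 1) / 2^k \<le> real j / 2^k" by (intro divide_right_mono) auto
    then show "a + 1/2^k \<le> a'" by (simp add: ij add_divide_distrib)
  qed auto
  finally show ?thesis .
qed

text \<open>The coarse slope is constant on each coarse cell, so only the integral of the finer
  slope enters. Coarse slopes are thus orthogonal projections of fine ones.\<close>

lemma dyadic_slope_pairing:
  fixes \<psi> :: "real \<Rightarrow> 'a::euclidean_space"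
  shows "((\<lambda>x. dyadic_slope \<psi> (k + d) x \<bullet> dyadic_slope \<psi> k x) has_integral dyadic_energy \<psi> k m) {0..real m}"
proof -
  have "((\<lambda>x. dyadic_slope \<psi> (k + d) x \<bullet> dyadic_slope \<psi> k x) has_integral
      2^k * (norm (\<psi> ((real i + 1) / 2^k) - \<psi> (real i / 2^k)))\<^sup>2) {real i / 2^k .. (real i + 1) / 2^k}" for i
  proof (rule dyadic_cell_spike)
    define c where "c = 2^k *\<^sub>R (\<psi> ((real i + 1) / 2^k) - \<psi> (real i / 2^k))"
    have "((\<lambda>x. dyadic_slope \<psi> (k + d) x \<bullet> c) has_integral ((\<psi> ((real i + 1) / 2^k) - \<psi> (real i / 2^k)) \<bullet> c))
        {real i / 2^k .. (real i + 1) / 2^k}"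
      by (rule has_integral_linear[OF dyadic_slope_integral_cell bounded_linear_inner_left, unfolded o_def])
    then show "((\<lambda>x. dyadic_slope \<psi> (k + d) x \<bullet> c) has_integral 2^k * (norm (\<psi> ((real i + 1) / 2^k) - \<psi> (real i / 2^k)))\<^sup>2)
        {real i / 2^k .. (real i + 1) / 2^k}"
      by (simp add: c_def power2_norm_eq_inner)
  qed (use dyadic_slope_eq in metis)
  from has_integral_cells[OF this, of "m * 2^k"] show ?thesis by (simp add: dyadic_energy_def)
qed

text \<open>Pythagoras for this projection: the mixed term equals the coarse energy.\<close>

lemma dyadic_slope_distance:
  fixes \<psi> :: "real \<Rightarrow> 'a::euclidean_space"
  assumes "k \<le> l"
  shows "((\<lambda>x. (norm (dyadic_slope \<psi> l x - dyadic_slope \<psi> k x))\<^sup>2) has_integral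
      dyadic_energy \<psi> l m - dyadic_energy \<psi> k m) {0..real m}"
proof -
  have "((\<lambda>x. dyadic_slope \<psi> l x \<bullet> dyadic_slope \<psi> l x - 2 * (dyadic_slope \<psi> l x \<bullet> dyadic_slope \<psi> k x)
      + dyadic_slope \<psi> k x \<bullet> dyadic_slope \<psi> k x) has_integral
      dyadic_energy \<psi> l m - 2 * dyadic_energy \<psi> k m + dyadic_energy \<psi> k m) {0..real m}"
    using dyadic_slope_pairing[of \<psi> l 0 m] dyadic_slope_pairing[of \<psi> k 0 m] dyadic_slope_pairing[of \<psi> k "l - k" m] assms
    by (intro has_integral_add has_integral_diff has_integral_mult_right) auto
  then show ?thesis
    by (simp add: power2_norm_eq_inner inner_diff_left inner_diff_right inner_commute algebra_simps)
qed

lemma dyadic_energy_mono: "m \<le> m' \<Longrightarrow> dyadic_energy \<psi> k m \<le> dyadic_energy \<psi> k m'"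
  unfolding dyadic_energy_def by (rule sum_mono2) auto

lemma nn_integral_le_if_integrals_le:
  fixes f :: "real \<Rightarrow> real"
  assumes [measurable]: "f \<in> borel_measurable borel" and nonneg: "\<And>x. 0 \<le> f x" and neg: "\<And>x. x < 0 \<Longrightarrow> f x = 0"
    and D: "\<And>m. (f has_integral D m) {0..real m}" and le: "\<And>m. D m \<le> C"
  shows "(\<integral>\<^sup>+x. ennreal (f x) \<partial>lborel) \<le> ennreal C"
proof -
  have "(\<integral>\<^sup>+x. ennreal (f x) \<partial>lborel) = (\<integral>\<^sup>+x. (SUP m. ennreal (f x) * indicator {0..real m} x) \<partial>lborel)"
  proof (rule nn_integral_cong)
    fix x :: real
    show "ennreal (f x) = (SUP m. ennreal (f x) * indicator {0..real m} x)"
    proof (cases "x < 0")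
      case True
      then show ?thesis by (simp add: neg)
    next
      case False
      obtain m :: nat where "x \<le> real m" using real_arch_simple by blast
      then have "ennreal (f x) \<le> ennreal (f x) * indicator {0..real m} x" using False by simp
      also have "\<dots> \<le> (SUP m. ennreal (f x) * indicator {0..real m} x)" by (rule SUP_upper) simp
      finally show ?thesis by (intro antisym SUP_least) (auto split: split_indicator)
    qed
  qed
  also have "\<dots> = (SUP m. \<integral>\<^sup>+x. ennreal (f x) * indicator {0..real m} x \<partial>lborel)"
    by (rule nn_integral_monotone_convergence_SUP)
      (auto simp: incseq_def le_fun_def split: split_indicator)
  also have "\<dots> \<le> ennreal C"
  proof (rule SUP_least)
    fix m
    have "(\<integral>\<^sup>+x. ennreal (f x) * indicator {0..real m} x \<partial>lborel) = ennreal (D m)"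
      by (rule nn_integral_has_integral_lebesgue'[OF nonneg D])
    then show "(\<integral>\<^sup>+x. ennreal (f x) * indicator {0..real m} x \<partial>lborel) \<le> ennreal C"
      using le by (simp add: ennreal_leI)
  qed
  finally show ?thesis .
qed

text \<open>Squared distances of levels are bounded by differences of total energies, which increase
  with the level and stay below \<open>K\<close>; this makes the slopes Cauchy in L2.\<close>

lemma dyadic_slope_nn_distance:
  fixes \<psi> :: "real \<Rightarrow> 'a::euclidean_space"
  assumes E: "energy_le K \<psi>" and Z: "\<And>s. s \<le> 0 \<Longrightarrow> \<psi> s = 0" and "k \<le> l"
  defines "e \<equiv> \<lambda>k. SUP m. dyadic_energy \<psi> k m"
  shows "e k \<le> e l" "e l \<le> K"
    and "(\<integral>\<^sup>+x. ennreal ((norm (dyadic_slope \<psi> l x - dyadic_slope \<psi> k x))\<^sup>2) \<partial>lborel) \<le> ennreal (e l - e k)"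
proof -
  have bdd: "bdd_above (range (dyadic_energy \<psi> k))" for k
    by (rule bdd_aboveI[of _ K]) (use dyadic_energy_le[OF E] in auto)
  have upper: "dyadic_energy \<psi> k m \<le> e k" for k m
    unfolding e_def by (rule cSUP_upper[OF _ bdd]) simp
  show "e l \<le> K" unfolding e_def by (rule cSUP_least) (use dyadic_energy_le[OF E] in auto)
  define D where "D m = dyadic_energy \<psi> l m - dyadic_energy \<psi> k m" for m
  have D: "((\<lambda>x. (norm (dyadic_slope \<psi> l x - dyadic_slope \<psi> k x))\<^sup>2) has_integral D m) {0..real m}" for m
    unfolding D_def by (rule dyadic_slope_distance[OF \<open>k \<le> l\<close>])
  have D_mono: "D m \<le> D m'" if "m \<le> m'" for m m'
    by (rule has_integral_subset_le[OF _ D D]) (use that in auto)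
  have D0: "0 \<le> D m" for m by (rule has_integral_nonneg[OF D]) simp
  \<comment> \<open>\<open>D m\<close> grows with \<open>m\<close>, so both energies are compared at
    the larger of \<open>m\<close> and \<open>m'\<close> before the supremum over \<open>m'\<close>
    is taken.\<close>
  have De: "D m \<le> e l - e k" for m
  proof -
    have e_k: "e k = (SUP m. dyadic_energy \<psi> k m)" by (simp add: e_def)
    have "e k \<le> e l - D m"
      unfolding e_k
    proof (rule cSUP_least)
      fix m'
      have "dyadic_energy \<psi> k m' \<le> dyadic_energy \<psi> k (max m m')" by (rule dyadic_energy_mono) simp
      also have "\<dots> = dyadic_energy \<psi> l (max m m') - D (max m m')" by (simp add: D_def)
      also have "\<dots> \<le> e l - D m" using upper[of l "max m m'"] D_mono[of m "max m m'"] by simp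
      finally show "dyadic_energy \<psi> k m' \<le> e l - D m" .
    qed simp
    then show ?thesis by simp
  qed
  then show "e k \<le> e l" using De[of 0] D0[of 0] by linarith
  let ?f = "\<lambda>x. (norm (dyadic_slope \<psi> l x - dyadic_slope \<psi> k x))\<^sup>2"
  have "continuous_on UNIV \<psi>"
    by (rule hoelder_imp_continuous_on[OF energy_le_hoelder_UNIV[OF E Z]])
  note [measurable] = dyadic_slope_measurable[OF this]
  show "(\<integral>\<^sup>+x. ennreal (?f x) \<partial>lborel) \<le> ennreal (e l - e k)"
    by (rule nn_integral_le_if_integrals_le[OF _ _ _ D De]) (simp_all add: dyadic_slope_neg[OF Z])
qed

lemma dyadic_slope_nn_norm:
  fixes \<psi> :: "real \<Rightarrow> 'a::euclidean_space"
  assumes E: "energy_le K \<psi>" and Z: "\<And>s. s \<le> 0 \<Longrightarrow> \<psi> s = 0"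
  shows "(\<integral>\<^sup>+x. ennreal ((norm (dyadic_slope \<psi> k x))\<^sup>2) \<partial>lborel) \<le> ennreal K"
proof -
  let ?f = "\<lambda>x. (norm (dyadic_slope \<psi> k x))\<^sup>2"
  have "continuous_on UNIV \<psi>"
    by (rule hoelder_imp_continuous_on[OF energy_le_hoelder_UNIV[OF E Z]])
  note [measurable] = dyadic_slope_measurable[OF this]
  have D: "(?f has_integral dyadic_energy \<psi> k m) {0..real m}" for m
    using dyadic_slope_pairing[of \<psi> k 0 m] by (simp add: power2_norm_eq_inner)
  show ?thesis
    by (rule nn_integral_le_if_integrals_le[OF _ _ _ D dyadic_energy_le[OF E]])
      (simp_all add: dyadic_slope_neg[OF Z])
qed

text \<open>Discrete integration by parts: the shift by 1 / 2^k commutes with the dyadic floor, so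
  the difference quotient moves from \<open>\<psi>\<close> to the test function, where it converges
  to the derivative.\<close>

lemma dyadic_slope_weakly_tendsto:
  fixes \<psi> :: "real \<Rightarrow> 'a::euclidean_space" and \<phi> :: "real \<Rightarrow> real"
  assumes H: "\<And>s t. (norm (\<psi> t - \<psi> s))\<^sup>2 \<le> K * \<bar>t - s\<bar>" and "\<psi> 0 = 0" "0 \<le> K"
    and \<phi>: "test_function \<phi>"
  shows "(\<lambda>k. LINT x|lborel. \<phi> x *\<^sub>R dyadic_slope \<psi> k x)
    \<longlonglongrightarrow> - (LINT x|lborel. frechet_derivative \<phi> (at x) 1 *\<^sub>R \<psi> x)"
proof -
  define \<phi>' where "\<phi>' x = frechet_derivative \<phi> (at x) 1" for x
  have sm: "smooth \<phi>" using \<phi> by (simp add: test_function_def)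
  have C1: "C_k (Suc 0) \<phi>" using sm unfolding smooth_def by (rule spec)
  have deriv: "(\<phi> has_real_derivative \<phi>' x) (at x)" for x
    unfolding \<phi>'_def has_derivative_of_real_deriv(2)[OF C1] mult_1_left by (rule has_derivative_of_real_deriv(1)[OF C1])
  have cont: "continuous_on UNIV \<psi>" by (rule hoelder_imp_continuous_on[OF H])
  have cont': "continuous_on UNIV \<phi>'" unfolding \<phi>'_def
    by (rule smooth_imp_continuous[OF smooth_frechet_derivative[OF sm]])
  note [measurable] = borel_measurable_continuous_onI[OF cont] borel_measurable_continuous_onI[OF cont']
    test_function_integrable(1)[OF \<phi>]
  obtain R where R: "0 < R" "\<And>x. R \<le> norm x \<Longrightarrow> \<phi> x = 0" using test_function_vanishes[OF \<phi>] by blast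
  obtain R' where R': "0 < R'" "\<And>x. R' \<le> norm x \<Longrightarrow> \<phi>' x = 0"
    using test_function_vanishes[OF test_function_frechet_derivative[OF \<phi>, of 1]] unfolding \<phi>'_def by blast
  obtain B where B: "0 < B" "\<And>x. norm (\<phi>' x) \<le> B" using compactly_supported_bounded[OF cont' R'(2)] by blast
  obtain B0 where B0: "0 < B0" "\<And>x. norm (\<phi> x) \<le> B0"
    using compactly_supported_bounded[OF smooth_imp_continuous[OF sm] R(2)] by blast
  have [measurable]: "dyadic_floor k \<in> borel_measurable borel" for k
    unfolding dyadic_floor_def[abs_def] by measurable
  have [measurable]: "(\<lambda>x. \<psi> (dyadic_floor k x)) \<in> borel_measurable borel"
    "(\<lambda>x. \<psi> (dyadic_floor k x + 1/2^k)) \<in> borel_measurable borel" for k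
    by (rule measurable_compose[where N = borel]; measurable)+
  \<comment> \<open>For \<open>\<bar>x\<bar> \<le> R + 1\<close> both nodes of the cell of
    \<open>x\<close> lie in {-(R + 3)..R + 3}, where the Hoelder bound starting from
    \<open>\<psi> 0 = 0\<close> gives \<open>C\<close>.\<close>
  define C where "C = sqrt (K * (R + 3))"
  have le1: "1 / 2^k \<le> (1::real)" for k :: nat by simp
  have \<psi>_bound: "norm (\<psi> (dyadic_floor k x)) \<le> C" "norm (\<psi> (dyadic_floor k x + 1/2^k)) \<le> C"
    if "\<bar>x\<bar> \<le> R + 1" for k x
  proof -
    have *: "norm (\<psi> y) \<le> C" if "\<bar>y\<bar> \<le> R + 3" for y
    proof -
      have "(norm (\<psi> y))\<^sup>2 \<le> K * \<bar>y\<bar>" using H[of y 0] \<open>\<psi> 0 = 0\<close> by simp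
      also have "\<dots> \<le> K * (R + 3)" using that \<open>0 \<le> K\<close> by (rule mult_left_mono)
      finally show ?thesis unfolding C_def by (rule real_le_rsqrt)
    qed
    have "0 < (1/2^k::real)" by simp
    then show "norm (\<psi> (dyadic_floor k x)) \<le> C" "norm (\<psi> (dyadic_floor k x + 1/2^k)) \<le> C"
      using dyadic_floor_bounds(1)[of k x] dyadic_floor_bounds(2)[of x k] le1[of k] that by (intro *; linarith)+
  qed
  have C0: "0 \<le> C" using \<open>0 \<le> K\<close> R by (simp add: C_def)
  have dom: "integrable lborel f" if [measurable]: "f \<in> borel_measurable lborel"
    and "\<And>x. \<bar>x\<bar> \<le> R + 1 \<Longrightarrow> norm (f x) \<le> A" "\<And>x. R + 1 < \<bar>x\<bar> \<Longrightarrow> f x = 0" for f :: "real \<Rightarrow> 'a" and A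
  proof (rule Bochner_Integration.integrable_bound[where f = "\<lambda>x. A * indicator {- (R + 1)..R + 1} x"])
    show "integrable lborel (\<lambda>x. A * indicator {- (R + 1)..R + 1} x)"
      by (intro integrable_mult_right integrable_real_indicator) (auto simp: emeasure_lborel_Icc_eq)
    show "AE x in lborel. norm (f x) \<le> norm (A * indicator {- (R + 1)..R + 1} x)"
    proof (rule AE_I2)
      fix x show "norm (f x) \<le> norm (A * indicator {- (R + 1)..R + 1} x)"
        using that(2)[of x] that(3)[of x] by (cases "\<bar>x\<bar> \<le> R + 1") (auto simp: abs_le_iff)
    qed
  qed measurable
  define F where "F k x = (2^k * (\<phi> (x - 1/2^k) - \<phi> x)) *\<^sub>R \<psi> (dyadic_floor k x)" for k x
  have "(LINT x|lborel. \<phi> x *\<^sub>R dyadic_slope \<psi> k x) = (LINT x|lborel. F k x)" for k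
  proof -
    have i1: "integrable lborel (\<lambda>x. \<phi> x *\<^sub>R \<psi> (dyadic_floor k x + 1/2^k))"
      by (rule dom[of _ "B0 * C"]) (use \<psi>_bound B0 R in \<open>auto intro!: mult_mono\<close>)
    have i2: "integrable lborel (\<lambda>x. \<phi> x *\<^sub>R \<psi> (dyadic_floor k x))"
      by (rule dom[of _ "B0 * C"]) (use \<psi>_bound B0 R in \<open>auto intro!: mult_mono\<close>)
    have i3: "integrable lborel (\<lambda>x. \<phi> (x - 1/2^k) *\<^sub>R \<psi> (dyadic_floor k x))"
    proof (rule dom[of _ "B0 * C"])
      fix x assume "R + 1 < \<bar>x\<bar>"
      moreover have "0 < (1/2^k::real)" by simp
      ultimately have "R \<le> norm (x - 1/2^k)" using le1[of k] unfolding real_norm_def by linarith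
      then show "\<phi> (x - 1/2^k) *\<^sub>R \<psi> (dyadic_floor k x) = 0" using R by simp
    qed (use \<psi>_bound B0 in \<open>auto intro!: mult_mono\<close>)
    have shift: "(LINT x|lborel. \<phi> x *\<^sub>R \<psi> (dyadic_floor k x + 1/2^k)) = (LINT x|lborel. \<phi> (x - 1/2^k) *\<^sub>R \<psi> (dyadic_floor k x))"
      by (subst lborel_integral_real_affine[of 1 "\<lambda>x. \<phi> (x - 1/2^k) *\<^sub>R \<psi> (dyadic_floor k x)" "1/2^k"])
        (simp_all add: dyadic_floor_shift[symmetric] add.commute)
    have "(LINT x|lborel. \<phi> x *\<^sub>R dyadic_slope \<psi> k x)
        = (LINT x|lborel. 2^k *\<^sub>R (\<phi> x *\<^sub>R \<psi> (dyadic_floor k x + 1/2^k) - \<phi> x *\<^sub>R \<psi> (dyadic_floor k x)))"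
      by (simp add: dyadic_slope_def scaleR_diff_right mult.commute)
    also have "\<dots> = (LINT x|lborel. 2^k *\<^sub>R (\<phi> (x - 1/2^k) *\<^sub>R \<psi> (dyadic_floor k x) - \<phi> x *\<^sub>R \<psi> (dyadic_floor k x)))"
      using i1 i2 i3 shift by simp
    also have "\<dots> = (LINT x|lborel. F k x)"
      by (simp add: F_def scaleR_diff_right scaleR_diff_left right_diff_distrib)
    finally show ?thesis .
  qed
  moreover have "(\<lambda>k. LINT x|lborel. F k x) \<longlonglongrightarrow> (LINT x|lborel. - \<phi>' x *\<^sub>R \<psi> x)"
  proof (rule integral_dominated_convergence[where w = "\<lambda>x. B * C * indicator {- (R + 1)..R + 1} x"])
    show "AE x in lborel. (\<lambda>k. F k x) \<longlonglongrightarrow> - \<phi>' x *\<^sub>R \<psi> x"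
    proof (rule AE_I2)
      fix x
      have h: "filterlim (\<lambda>k. - (1/2^k :: real)) (at 0) sequentially"
      proof (rule filterlim_atI)
        have "(\<lambda>k. - ((1/2)^k :: real)) \<longlonglongrightarrow> - 0" by (intro tendsto_intros LIMSEQ_realpow_zero) auto
        then show "(\<lambda>k. - (1/2^k :: real)) \<longlonglongrightarrow> 0" by (simp add: power_one_over)
      qed simp
      have "((\<lambda>h. (\<phi> (x + h) - \<phi> x) / h) \<longlongrightarrow> \<phi>' x) (at 0)" using deriv[of x] by (simp add: DERIV_def)
      from filterlim_compose[OF this h]
      have "(\<lambda>k. - (2^k * (\<phi> (x - 1/2^k) - \<phi> x))) \<longlonglongrightarrow> \<phi>' x" by (simp add: mult.commute)
      then have "(\<lambda>k. 2^k * (\<phi> (x - 1/2^k) - \<phi> x)) \<longlonglongrightarrow> - \<phi>' x" by (simp add: tendsto_minus_cancel_left)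
      moreover have "(\<lambda>k. \<psi> (dyadic_floor k x)) \<longlonglongrightarrow> \<psi> x"
        by (rule continuous_on_tendsto_compose[OF cont dyadic_floor_tendsto]) auto
      ultimately show "(\<lambda>k. F k x) \<longlonglongrightarrow> - \<phi>' x *\<^sub>R \<psi> x" unfolding F_def by (rule tendsto_scaleR)
    qed
    show "AE x in lborel. norm (F k x) \<le> B * C * indicator {- (R + 1)..R + 1} x" for k
    proof (rule AE_I2)
      fix x
      have quot: "norm (2^k * (\<phi> (x - 1/2^k) - \<phi> x)) \<le> B"
      proof -
        have "norm (\<phi> (x - 1/2^k) - \<phi> x) \<le> B * norm (x - 1/2^k - x)"
          by (rule field_differentiable_bound[of UNIV]) (use deriv B in auto)
        then have "2^k * norm (\<phi> (x - 1/2^k) - \<phi> x) \<le> 2^k * (B * (1/2^k))"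
          by (intro mult_left_mono) auto
        then show ?thesis by (simp add: abs_mult)
      qed
      show "norm (F k x) \<le> B * C * indicator {- (R + 1)..R + 1} x"
      proof (cases "\<bar>x\<bar> \<le> R + 1")
        case True
        then have "norm (F k x) \<le> B * C"
          unfolding F_def norm_scaleR using quot \<psi>_bound(1) B by (intro mult_mono) auto
        then show ?thesis using True by (auto simp: abs_le_iff)
      next
        case False
        moreover have "0 < (1/2^k::real)" by simp
        ultimately have "R \<le> norm (x - 1/2^k)" "R \<le> norm x"
          using le1[of k] unfolding real_norm_def by linarith+
        then have "F k x = 0" using R by (simp add: F_def)
        then show ?thesis using B C0 by simp
      qed
    qed
    show "integrable lborel (\<lambda>x. B * C * indicator {- (R + 1)..R + 1} x)"
      by (intro integrable_mult_right integrable_real_indicator) (auto simp: emeasure_lborel_Icc_eq)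
  qed (auto simp: F_def[abs_def])
  ultimately show ?thesis by (simp add: \<phi>'_def)
qed

text \<open>The linear growth of |\<psi>|^2 is beaten by the weight exp(-4 s). The weak derivative
  is the L2 limit of dyadic slopes along a sequence of levels; pairing with test functions
  identifies it.\<close>

theorem energy_le_imp_profile:
  fixes \<psi> :: "real \<Rightarrow> 'a::euclidean_space"
  assumes E: "energy_le K \<psi>" and Z: "\<And>s. s \<le> 0 \<Longrightarrow> \<psi> s = 0"
  shows "\<psi> \<in> profiles"
proof -
  have K: "0 \<le> K" using energy_le_nonneg[OF E] .
  have H: "(norm (\<psi> t - \<psi> s))\<^sup>2 \<le> K * \<bar>t - s\<bar>" for s t by (rule energy_le_hoelder_UNIV[OF E Z])
  have cont: "continuous_on UNIV \<psi>" by (rule hoelder_imp_continuous_on[OF H])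
  note [measurable] = borel_measurable_continuous_onI[OF cont] dyadic_slope_measurable[OF cont]
  have meas: "\<psi> \<in> borel_measurable lebesgue"
    by (simp add: measurable_completion borel_measurable_continuous_onI[OF cont])
  have "integrable lborel (\<lambda>s. (norm (\<psi> s))\<^sup>2 * exp (- 4 * s))"
  proof (rule Bochner_Integration.integrable_bound[where f = "\<lambda>s. indicator {0..} s *\<^sub>R (K * exp (- 3 * s))"])
    have "((\<lambda>s::real. exp (- 3 * s)) has_integral exp (- 3 * 0) / 3) {0..}"
      by (rule has_integral_exp_minus_to_infinity) simp
    then have "(\<lambda>s::real. exp (- 3 * s)) absolutely_integrable_on {0..}"
      by (intro nonnegative_absolutely_integrable_1) (auto simp: integrable_on_def)
    then have "set_integrable lborel {0..} (\<lambda>s::real. exp (- 3 * s))"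
      unfolding set_integrable_def by (subst (asm) integrable_completion) auto
    then have "integrable lborel (\<lambda>s. K * (indicator {0..} s *\<^sub>R exp (- 3 * s)))"
      unfolding set_integrable_def by simp
    then show "integrable lborel (\<lambda>s. indicator {0..} s *\<^sub>R (K * exp (- 3 * s)))" by (simp add: mult.left_commute)
    show "AE s in lborel. norm ((norm (\<psi> s))\<^sup>2 * exp (- 4 * s)) \<le> norm (indicator {0..} s *\<^sub>R (K * exp (- 3 * s)))"
    proof (rule AE_I2)
      fix s :: real
      show "norm ((norm (\<psi> s))\<^sup>2 * exp (- 4 * s)) \<le> norm (indicator {0..} s *\<^sub>R (K * exp (- 3 * s)))"
      proof (cases "s \<le> 0")
        case False
        have "(norm (\<psi> s))\<^sup>2 * exp (- 4 * s) \<le> (K * exp s) * exp (- 4 * s)"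
        proof (rule mult_right_mono)
          have "(norm (\<psi> s))\<^sup>2 \<le> K * s" using H[of s 0] Z[of 0] False by simp
          also have "\<dots> \<le> K * exp s" using K exp_ge_add_one_self[of s] by (intro mult_left_mono) linarith+
          finally show "(norm (\<psi> s))\<^sup>2 \<le> K * exp s" .
        qed simp
        also have "\<dots> = K * exp (- 3 * s)" by (simp flip: exp_add)
        finally show ?thesis using False K by simp
      qed (simp add: Z)
    qed
  qed measurable
  then have int: "integrable lebesgue (\<lambda>s. (norm (\<psi> s))\<^sup>2 * exp (- 4 * s))"
    by (subst integrable_completion) auto
  define e where "e k = (SUP m. dyadic_energy \<psi> k m)" for k
  have dist: "e k \<le> e l" "e l \<le> K"
    "(\<integral>\<^sup>+x. ennreal ((norm (dyadic_slope \<psi> l x - dyadic_slope \<psi> k x))\<^sup>2) \<partial>lborel) \<le> ennreal (e l - e k)"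
    if "k \<le> l" for k l
    using dyadic_slope_nn_distance[of K \<psi> k l] E Z that by (simp_all add: e_def)
  have e_inc: "incseq e" unfolding incseq_def by (intro allI impI dist(1))
  have "e k \<le> K" for k using dist(2)[of k k] by simp
  then obtain c where "e \<longlonglongrightarrow> c" using incseq_convergent[OF e_inc, of K] by blast
  then have "convergent e" by (rule convergentI)
  then have "Cauchy e" by (rule convergent_Cauchy)
  have "\<exists>N. \<forall>m\<ge>N. \<forall>n\<ge>N. dist (e m) (e n) < (1/4)^j" for j :: nat
    using metric_CauchyD[OF \<open>Cauchy e\<close>, of "(1/4)^j"] by simp
  then obtain N where N: "\<And>j m n. N j \<le> m \<Longrightarrow> N j \<le> n \<Longrightarrow> dist (e m) (e n) < (1/4)^j" by metis
  \<comment> \<open>Levels that are nondecreasing, tend to infinity and lie past \<open>N j\<close>,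
    so that from index \<open>j\<close> on all slopes have squared distance at most (1/4)^j from the
    one at \<open>j\<close>.\<close>
  define \<kappa> where "\<kappa> j = j + (\<Sum>i\<le>j. N i)" for j
  have \<kappa>_mono: "\<kappa> i \<le> \<kappa> j" if "i \<le> j" for i j
    unfolding \<kappa>_def using that by (intro add_mono sum_mono2) auto
  have \<kappa>_ge: "N i \<le> \<kappa> i" for i
    unfolding \<kappa>_def using member_le_sum[of i "{..i}" N] by simp
  have \<kappa>_top: "filterlim \<kappa> sequentially sequentially"
    by (rule filterlim_at_top_mono[OF filterlim_ident]) (simp add: \<kappa>_def)
  define g where "g j = dyadic_slope \<psi> (\<kappa> j)" for j
  have g_meas [measurable]: "g j \<in> borel_measurable borel" for j unfolding g_def by measurable
  have Cg: "(\<integral>\<^sup>+x. ennreal ((norm (g j x - g i x))\<^sup>2) \<partial>lborel) \<le> ennreal ((1/4)^i)" if "i \<le> j" for i j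
  proof -
    have "e (\<kappa> j) - e (\<kappa> i) \<le> (1/4)^i"
      using N[of i "\<kappa> j" "\<kappa> i"] \<kappa>_ge[of i] \<kappa>_mono[OF that] by (simp add: dist_real_def)
    then show ?thesis unfolding g_def using order_trans[OF dist(3)[OF \<kappa>_mono[OF that]] ennreal_leI] by simp
  qed
  obtain h where h [measurable]: "h \<in> borel_measurable borel"
    and hg: "\<And>i. (\<integral>\<^sup>+x. ennreal ((norm (h x - g i x))\<^sup>2) \<partial>lborel) \<le> ennreal ((1/4)^i)"
    using L2_limit_of_rapidly_Cauchy[OF g_meas Cg] by blast
  have hg_int: "integrable lborel (\<lambda>x. (norm (h x - g i x))\<^sup>2)" for i
    by (rule integrableI_bounded) (use hg[of i] in \<open>auto simp: le_less_trans\<close>)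
  have g_int: "integrable lborel (\<lambda>x. (norm (g i x))\<^sup>2)" for i
    by (rule integrableI_bounded) (use dyadic_slope_nn_norm[OF E Z, of "\<kappa> i"] in \<open>auto simp: g_def le_less_trans\<close>)
  have h_int: "integrable lborel (\<lambda>x. (norm (h x))\<^sup>2)"
  proof (rule Bochner_Integration.integrable_bound[where f = "\<lambda>x. 2 * (norm (h x - g 0 x))\<^sup>2 + 2 * (norm (g 0 x))\<^sup>2"])
    show "AE x in lborel. norm ((norm (h x))\<^sup>2) \<le> norm (2 * (norm (h x - g 0 x))\<^sup>2 + 2 * (norm (g 0 x))\<^sup>2)"
    proof (rule AE_I2)
      fix x
      have "(norm (h x))\<^sup>2 \<le> (norm (h x - g 0 x) + norm (g 0 x))\<^sup>2"
        using norm_triangle_sub[of "h x" "g 0 x"] by (intro power_mono) auto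
      also have "\<dots> \<le> 2 * (norm (h x - g 0 x))\<^sup>2 + 2 * (norm (g 0 x))\<^sup>2"
        using sum_squares_bound[of "norm (h x - g 0 x)" "norm (g 0 x)"] by (simp add: power2_sum)
      finally show "norm ((norm (h x))\<^sup>2) \<le> norm (2 * (norm (h x - g 0 x))\<^sup>2 + 2 * (norm (g 0 x))\<^sup>2)" by simp
    qed
  qed (use hg_int g_int in auto)
  have "h \<in> L2" unfolding L2_def using h_int by (auto simp: measurable_completion integrable_completion)
  moreover have "has_weak_derivative 1 \<psi> h"
    unfolding has_weak_derivative_def
  proof (intro allI impI)
    fix \<phi> :: "real \<Rightarrow> real" assume \<phi>: "test_function \<phi>"
    note [measurable] = test_function_integrable(1)[OF \<phi>] test_function_integrable(1)[OF test_function_frechet_derivative[OF \<phi>]]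
    have \<phi>2: "integrable lborel (\<lambda>x. (\<phi> x)\<^sup>2)" by (rule test_function_integrable(3)[OF \<phi>])
    have lim1: "(\<lambda>j. LINT x|lborel. \<phi> x *\<^sub>R g j x) \<longlonglongrightarrow> - (LINT x|lborel. frechet_derivative \<phi> (at x) 1 *\<^sub>R \<psi> x)"
      unfolding g_def by (rule filterlim_compose[OF dyadic_slope_weakly_tendsto[OF H Z[OF order_refl] K \<phi>] \<kappa>_top])
    have lim2: "(\<lambda>j. (LINT x|lborel. \<phi> x *\<^sub>R h x) - (LINT x|lborel. \<phi> x *\<^sub>R g j x)) \<longlonglongrightarrow> 0"
    proof (rule Lim_null_comparison)
      have "(\<lambda>j. sqrt ((LINT x|lborel. (\<phi> x)\<^sup>2) * (1/4)^j)) \<longlonglongrightarrow> sqrt ((LINT x|lborel. (\<phi> x)\<^sup>2) * 0)"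
        by (intro tendsto_intros LIMSEQ_realpow_zero) auto
      then show "(\<lambda>j. sqrt ((LINT x|lborel. (\<phi> x)\<^sup>2) * (1/4)^j)) \<longlonglongrightarrow> 0" by simp
      have "norm ((LINT x|lborel. \<phi> x *\<^sub>R h x) - (LINT x|lborel. \<phi> x *\<^sub>R g j x)) \<le> sqrt ((LINT x|lborel. (\<phi> x)\<^sup>2) * (1/4)^j)" for j
      proof (rule real_le_rsqrt)
        have "(LINT x|lborel. \<phi> x *\<^sub>R h x) - (LINT x|lborel. \<phi> x *\<^sub>R g j x) = (LINT x|lborel. \<phi> x *\<^sub>R (h x - g j x))"
          using integral_Cauchy_Schwarz(1)[OF _ _ \<phi>2 h_int] integral_Cauchy_Schwarz(1)[OF _ _ \<phi>2 g_int]
          by (simp add: scaleR_diff_right)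
        then have "(norm ((LINT x|lborel. \<phi> x *\<^sub>R h x) - (LINT x|lborel. \<phi> x *\<^sub>R g j x)))\<^sup>2
            \<le> (LINT x|lborel. (\<phi> x)\<^sup>2) * (LINT x|lborel. (norm (h x - g j x))\<^sup>2)"
          using integral_Cauchy_Schwarz(2)[OF _ _ \<phi>2 hg_int] by simp
        also have "\<dots> \<le> (LINT x|lborel. (\<phi> x)\<^sup>2) * (1/4)^j"
        proof (rule mult_left_mono)
          show "(LINT x|lborel. (norm (h x - g j x))\<^sup>2) \<le> (1/4)^j"
            using hg[of j] hg_int[of j] by (simp add: nn_integral_eq_integral)
        qed simp
        finally show "(norm ((LINT x|lborel. \<phi> x *\<^sub>R h x) - (LINT x|lborel. \<phi> x *\<^sub>R g j x)))\<^sup>2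
            \<le> (LINT x|lborel. (\<phi> x)\<^sup>2) * (1/4)^j" .
      qed
      then show "\<forall>\<^sub>F j in sequentially. norm ((LINT x|lborel. \<phi> x *\<^sub>R h x) - (LINT x|lborel. \<phi> x *\<^sub>R g j x))
          \<le> sqrt ((LINT x|lborel. (\<phi> x)\<^sup>2) * (1/4)^j)" by simp
    qed
    have "(\<lambda>j. LINT x|lborel. \<phi> x *\<^sub>R g j x) \<longlonglongrightarrow> (LINT x|lborel. \<phi> x *\<^sub>R h x)"
      using tendsto_diff[OF tendsto_const lim2, of "LINT x|lborel. \<phi> x *\<^sub>R h x"] by simp
    from LIMSEQ_unique[OF lim1 this]
    have "(LINT x|lborel. frechet_derivative \<phi> (at x) 1 *\<^sub>R \<psi> x) = - (LINT x|lborel. \<phi> x *\<^sub>R h x)"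
      by (simp add: minus_equation_iff)
    then show "(LINT x|lebesgue. frechet_derivative \<phi> (at x) 1 *\<^sub>R \<psi> x) = - (LINT x|lebesgue. \<phi> x *\<^sub>R h x)"
      by (simp add: integral_completion)
  qed
  ultimately show ?thesis
    using meas int Z by (auto simp: profiles_def weakly_differentiable_L2_def)
qed

section \<open>Energy of the radial profile\<close>

lemma has_integral_linear_0:
  assumes "0 \<le> a"
  shows "((\<lambda>z::real. c * z) has_integral c * a\<^sup>2 / 2) {0..a}"
proof -
  have "((\<lambda>z. c * z) has_integral (c * a\<^sup>2 / 2 - c * 0\<^sup>2 / 2)) {0..a}"
    by (rule fundamental_theorem_of_calculus)
      (use assms in \<open>auto intro!: derivative_eq_intros simp: has_real_derivative_iff_has_vector_derivative[symmetric]\<close>)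
  then show ?thesis by simp
qed

text \<open>The variable is \<open>z = \<bar>x\<bar>\<^sup>2\<close> rather than the radius: it is smooth at the origin.\<close>

lemma polar_measure:
  "distr lborel borel (\<lambda>x::real^4. x \<bullet> x) = density lborel (\<lambda>z. ennreal (pi\<^sup>2 * z * indicator {0..} z))"
proof (rule measure_eqI_generator_eq)
  show "Int_stable (range atMost :: real set set)" by (auto simp: Int_stable_def)
  show "sets (distr lborel borel (\<lambda>x::real^4. x \<bullet> x)) = sigma_sets UNIV (range atMost)"
    by (simp add: borel_eq_atMost)
  show "sets (density lborel (\<lambda>z::real. ennreal (pi\<^sup>2 * z * indicator {0..} z))) = sigma_sets UNIV (range atMost)"
    by (simp add: borel_eq_atMost)
  show "range (\<lambda>n::nat. {..real n}) \<subseteq> range atMost" by auto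
  show "(\<Union>n::nat. {..real n}) = UNIV" using real_arch_simple by auto
  \<comment> \<open>The ball of squared radius \<open>a\<close> has volume pi^2 a^2 / 2, whose
    derivative in \<open>a\<close> is the density pi^2 z.\<close>
  have eq: "emeasure (distr lborel borel (\<lambda>x::real^4. x \<bullet> x)) {..a} = ennreal (pi\<^sup>2 * (max 0 a)\<^sup>2 / 2)" for a
  proof -
    have "emeasure (distr lborel borel (\<lambda>x::real^4. x \<bullet> x)) {..a} = emeasure lborel {x::real^4. x \<bullet> x \<le> a}"
      by (subst emeasure_distr) (auto simp: vimage_def)
    also have "\<dots> = ennreal (pi\<^sup>2 * (max 0 a)\<^sup>2 / 2)"
    proof (cases "0 \<le> a")
      case True
      have "{x::real^4. x \<bullet> x \<le> a} = cball 0 (sqrt a)"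
        using True by (auto simp: norm_eq_sqrt_inner)
      moreover have "emeasure lborel (cball (0::real^4) (sqrt a)) = ennreal (pi\<^sup>2 / 2 * sqrt a ^ 4)"
      proof -
        have dim: "DIM(real^4) = 4" "real 4 = (4::real)" by simp_all
        have "0 \<le> sqrt a" using True by (rule real_sqrt_ge_zero)
        from emeasure_cball[OF this, of "0::real^4", unfolded dim unit_ball_vol_4] show ?thesis .
      qed
      moreover have "sqrt a ^ 4 = a\<^sup>2" using True power_mult[of "sqrt a" 2 2] by simp
      ultimately show ?thesis using True by simp
    next
      case False
      have "\<not> x \<bullet> x \<le> a" for x :: "real^4" using inner_ge_zero[of x] False by linarith
      then have "{x::real^4. x \<bullet> x \<le> a} = {}" by blast
      then show ?thesis using False by simp
    qed
    finally show ?thesis .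
  qed
  have eq': "emeasure (density lborel (\<lambda>z. ennreal (pi\<^sup>2 * z * indicator {0..} z))) {..a} = ennreal (pi\<^sup>2 * (max 0 a)\<^sup>2 / 2)" for a
  proof -
    have "emeasure (density lborel (\<lambda>z. ennreal (pi\<^sup>2 * z * indicator {0..} z))) {..a}
        = (\<integral>\<^sup>+z. ennreal (pi\<^sup>2 * z * indicator {0..} z) * indicator {..a} z \<partial>lborel)"
      by (rule emeasure_density) auto
    also have "\<dots> = (\<integral>\<^sup>+z. ennreal (pi\<^sup>2 * z) * indicator {0..max 0 a} z \<partial>lborel)"
      by (rule nn_integral_cong) (auto split: split_indicator)
    also have "\<dots> = ennreal (pi\<^sup>2 * (max 0 a)\<^sup>2 / 2)"
      by (rule nn_integral_has_integral_lebesgue'[OF _ has_integral_linear_0]) auto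
    finally show ?thesis .
  qed
  show "emeasure (distr lborel borel (\<lambda>x::real^4. x \<bullet> x)) X = emeasure (density lborel (\<lambda>z. ennreal (pi\<^sup>2 * z * indicator {0..} z))) X"
    if "X \<in> range atMost" for X
    using that eq eq' by auto
  show "emeasure (distr lborel borel (\<lambda>x::real^4. x \<bullet> x)) {..real n} \<noteq> \<infinity>" for n
    by (simp add: eq)
qed auto

lemma polar_nn_integral:
  assumes "F \<in> borel_measurable borel"
  shows "(\<integral>\<^sup>+x. F (x \<bullet> x) \<partial>(lborel :: (real^4) measure))
    = (\<integral>\<^sup>+z. ennreal (pi\<^sup>2 * z * indicator {0..} z) * F z \<partial>lborel)"
proof -
  have "(\<integral>\<^sup>+x. F (x \<bullet> x) \<partial>(lborel :: (real^4) measure)) = (\<integral>\<^sup>+z. F z \<partial>distr lborel borel (\<lambda>x::real^4. x \<bullet> x))"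
    using assms by (subst nn_integral_distr) auto
  also have "\<dots> = (\<integral>\<^sup>+z. ennreal (pi\<^sup>2 * z * indicator {0..} z) * F z \<partial>lborel)"
    unfolding polar_measure using assms by (subst nn_integral_density) auto
  finally show ?thesis .
qed

lemma polar_integral:
  fixes F :: "real \<Rightarrow> 'b::{banach, second_countable_topology}"
  assumes F: "F \<in> borel_measurable borel"
  shows "(LINT x|(lborel :: (real^4) measure). F (x \<bullet> x)) = (LINT z|lborel. (pi\<^sup>2 * z * indicator {0..} z) *\<^sub>R F z)"
    and "integrable (lborel :: (real^4) measure) (\<lambda>x. F (x \<bullet> x)) \<longleftrightarrow> integrable lborel (\<lambda>z. (pi\<^sup>2 * z * indicator {0..} z) *\<^sub>R F z)"
proof -
  have nonneg: "AE z in lborel. 0 \<le> pi\<^sup>2 * z * indicator {0..} (z::real)"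
    by (rule AE_I2) (auto split: split_indicator)
  have "(LINT x|(lborel :: (real^4) measure). F (x \<bullet> x)) = integral\<^sup>L (distr lborel borel (\<lambda>x::real^4. x \<bullet> x)) F"
    using F by (subst integral_distr) auto
  also have "\<dots> = (LINT z|lborel. (pi\<^sup>2 * z * indicator {0..} z) *\<^sub>R F z)"
    unfolding polar_measure by (rule integral_density) (use F nonneg in auto)
  finally show "(LINT x|(lborel :: (real^4) measure). F (x \<bullet> x)) = (LINT z|lborel. (pi\<^sup>2 * z * indicator {0..} z) *\<^sub>R F z)" .
  have "integrable (lborel :: (real^4) measure) (\<lambda>x. F (x \<bullet> x)) \<longleftrightarrow> integrable (distr lborel borel (\<lambda>x::real^4. x \<bullet> x)) F"
    using F by (subst integrable_distr_eq) auto
  also have "\<dots> \<longleftrightarrow> integrable lborel (\<lambda>z. (pi\<^sup>2 * z * indicator {0..} z) *\<^sub>R F z)"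
    unfolding polar_measure by (rule integrable_density) (use F nonneg in auto)
  finally show "integrable (lborel :: (real^4) measure) (\<lambda>x. F (x \<bullet> x)) \<longleftrightarrow> integrable lborel (\<lambda>z. (pi\<^sup>2 * z * indicator {0..} z) *\<^sub>R F z)" .
qed

section \<open>The weak Laplacian of an H2 function\<close>

lemma weak_derivative_works:
  assumes "weakly_differentiable_L2 b u"
  shows "weak_derivative b u \<in> L2" "has_weak_derivative b u (weak_derivative b u)"
  using someI_ex[of "\<lambda>v. v \<in> L2 \<and> has_weak_derivative b u v"] assms
  unfolding weak_derivative_def weakly_differentiable_L2_def by blast+

lemma L2_add:
  fixes f g :: "'m::euclidean_space \<Rightarrow> 'a::euclidean_space"
  assumes "f \<in> L2" "g \<in> L2"
  shows "(\<lambda>x. f x + g x) \<in> L2"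
    and "(L2_norm (\<lambda>x. f x + g x))\<^sup>2 \<le> 2 * (L2_norm f)\<^sup>2 + 2 * (L2_norm g)\<^sup>2"
proof -
  have [measurable]: "f \<in> borel_measurable lebesgue" "g \<in> borel_measurable lebesgue"
    and int: "integrable lebesgue (\<lambda>x. (norm (f x))\<^sup>2)" "integrable lebesgue (\<lambda>x. (norm (g x))\<^sup>2)"
    using assms by (auto simp: L2_def)
  have *: "(norm (f x + g x))\<^sup>2 \<le> 2 * (norm (f x))\<^sup>2 + 2 * (norm (g x))\<^sup>2" for x
  proof -
    have "(norm (f x + g x))\<^sup>2 \<le> (norm (f x) + norm (g x))\<^sup>2"
      by (intro power_mono norm_triangle_ineq) auto
    also have "\<dots> \<le> 2 * (norm (f x))\<^sup>2 + 2 * (norm (g x))\<^sup>2"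
      using sum_squares_bound[of "norm (f x)" "norm (g x)"] by (simp add: power2_sum)
    finally show ?thesis .
  qed
  have int2: "integrable lebesgue (\<lambda>x. 2 * (norm (f x))\<^sup>2 + 2 * (norm (g x))\<^sup>2)" using int by simp
  have int3: "integrable lebesgue (\<lambda>x. (norm (f x + g x))\<^sup>2)"
    by (rule Bochner_Integration.integrable_bound[OF int2]) (use * in auto)
  then show "(\<lambda>x. f x + g x) \<in> L2" by (simp add: L2_def)
  have "(LINT x|lebesgue. (norm (f x + g x))\<^sup>2) \<le> (LINT x|lebesgue. 2 * (norm (f x))\<^sup>2 + 2 * (norm (g x))\<^sup>2)"
    by (rule integral_mono[OF int3 int2 *])
  then show "(L2_norm (\<lambda>x. f x + g x))\<^sup>2 \<le> 2 * (L2_norm f)\<^sup>2 + 2 * (L2_norm g)\<^sup>2"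
    using int by (simp add: L2_norm_def)
qed

lemma L2_uminus: "f \<in> L2 \<Longrightarrow> (\<lambda>x. - f x) \<in> L2"
  by (auto simp: L2_def)

lemma L2_sum:
  fixes f :: "'i \<Rightarrow> 'm::euclidean_space \<Rightarrow> 'a::euclidean_space"
  assumes "\<And>i. i \<in> I \<Longrightarrow> f i \<in> L2"
  shows "(\<lambda>x. \<Sum>i\<in>I. f i x) \<in> L2"
proof -
  have "(\<lambda>x. 0) \<in> (L2 :: ('m \<Rightarrow> 'a) set)" by (simp add: L2_def)
  then show ?thesis using assms
    by (induction I rule: infinite_finite_induct) (auto intro!: L2_add)
qed

text \<open>\<open>H2_norm\<close> sees only the combination -\<Delta>u + u, so the Laplacian is
  recovered as u - (-\<Delta>u + u), at the price of the L2 norm of \<open>u\<close> on the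
  right.\<close>

lemma H2_weak_laplacian:
  fixes u :: "real^4 \<Rightarrow> 'a::euclidean_space"
  assumes "u \<in> H2"
  shows "weak_laplacian u \<in> L2"
    and "(L2_norm (weak_laplacian u))\<^sup>2 \<le> 2 * (L2_norm u)\<^sup>2 + 2 * (H2_norm u)\<^sup>2"
    and "test_function \<phi> \<Longrightarrow>
      (LINT x|lebesgue. (\<Sum>b\<in>Basis. frechet_derivative (\<lambda>y. frechet_derivative \<phi> (at y) b) (at x) b) *\<^sub>R u x)
      = (LINT x|lebesgue. \<phi> x *\<^sub>R weak_laplacian u x)"
proof -
  have u: "u \<in> L2" and wd: "\<And>b. b \<in> Basis \<Longrightarrow> weakly_differentiable_L2 b u"
    and wd2: "\<And>b. b \<in> Basis \<Longrightarrow> weakly_differentiable_L2 b (weak_derivative b u)"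
    using assms by (auto simp: H2_def)
  show lap: "weak_laplacian u \<in> L2"
    unfolding weak_laplacian_def by (intro L2_sum weak_derivative_works wd2)
  have "(\<lambda>x. - weak_laplacian u x + u x) \<in> L2" by (intro L2_add L2_uminus lap u)
  from L2_add(2)[OF u L2_uminus[OF this]]
  have "(L2_norm (weak_laplacian u))\<^sup>2 \<le> 2 * (L2_norm u)\<^sup>2 + 2 * (L2_norm (\<lambda>x. - (- weak_laplacian u x + u x)))\<^sup>2"
    by simp
  moreover have "L2_norm (\<lambda>x. - (- weak_laplacian u x + u x)) = H2_norm u"
    unfolding H2_norm_def L2_norm_def norm_minus_cancel ..
  ultimately show "(L2_norm (weak_laplacian u))\<^sup>2 \<le> 2 * (L2_norm u)\<^sup>2 + 2 * (H2_norm u)\<^sup>2" by simp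
  assume \<phi>: "test_function \<phi>"
  let ?d = "\<lambda>b x. frechet_derivative \<phi> (at x) b"
  let ?dd = "\<lambda>b x. frechet_derivative (?d b) (at x) b"
  have t1: "test_function (?d b)" for b by (rule test_function_frechet_derivative[OF \<phi>])
  have t2: "test_function (?dd b)" for b by (rule test_function_frechet_derivative[OF t1])
  have "(LINT x|lebesgue. (\<Sum>b\<in>Basis. ?dd b x) *\<^sub>R u x) = (\<Sum>b\<in>Basis. LINT x|lebesgue. ?dd b x *\<^sub>R u x)"
    unfolding scaleR_sum_left by (rule Bochner_Integration.integral_sum) (rule test_function_L2[OF t2 u])
  also have "\<dots> = (\<Sum>b\<in>Basis. LINT x|lebesgue. \<phi> x *\<^sub>R weak_derivative b (weak_derivative b u) x)"
  proof (rule sum.cong[OF refl])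
    fix b :: "real^4" assume b: "b \<in> Basis"
    have "(LINT x|lebesgue. ?dd b x *\<^sub>R u x) = - (LINT x|lebesgue. ?d b x *\<^sub>R weak_derivative b u x)"
      using weak_derivative_works(2)[OF wd[OF b]] t1 unfolding has_weak_derivative_def by blast
    also have "\<dots> = (LINT x|lebesgue. \<phi> x *\<^sub>R weak_derivative b (weak_derivative b u) x)"
      using weak_derivative_works(2)[OF wd2[OF b]] \<phi> unfolding has_weak_derivative_def by simp
    finally show "(LINT x|lebesgue. ?dd b x *\<^sub>R u x) = (LINT x|lebesgue. \<phi> x *\<^sub>R weak_derivative b (weak_derivative b u) x)" .
  qed
  also have "\<dots> = (LINT x|lebesgue. \<phi> x *\<^sub>R weak_laplacian u x)"
    unfolding weak_laplacian_def scaleR_sum_right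
    by (rule Bochner_Integration.integral_sum[symmetric])
      (intro test_function_L2[OF \<phi>] weak_derivative_works wd2)
  finally show "(LINT x|lebesgue. (\<Sum>b\<in>Basis. ?dd b x) *\<^sub>R u x) = (LINT x|lebesgue. \<phi> x *\<^sub>R weak_laplacian u x)" .
qed

section \<open>Radial test functions and Hardy's inequality\<close>

lemma radial_test_function:
  fixes \<eta> :: "real \<Rightarrow> real"
  assumes "smooth \<eta>" "\<And>z. q \<le> z \<Longrightarrow> \<eta> z = 0"
  shows "test_function (\<lambda>x::'m::euclidean_space. \<eta> (x \<bullet> x))"
proof -
  have "supp (\<lambda>x::'m. \<eta> (x \<bullet> x)) \<subseteq> cball 0 (sqrt \<bar>q\<bar>)"
    unfolding supp_def
  proof (rule closure_minimal, rule subsetI)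
    fix x :: 'm assume "x \<in> {x. \<eta> (x \<bullet> x) \<noteq> 0}"
    then have "x \<bullet> x \<le> \<bar>q\<bar>" using assms(2)[of "x \<bullet> x"] by force
    then show "x \<in> cball 0 (sqrt \<bar>q\<bar>)" by (simp add: norm_eq_sqrt_inner)
  qed simp
  then have "compact (supp (\<lambda>x::'m. \<eta> (x \<bullet> x)))"
    using compact_Int_closed[OF compact_cball, of "supp (\<lambda>x::'m. \<eta> (x \<bullet> x))" 0 "sqrt \<bar>q\<bar>"]
    by (simp add: Int_absorb1) (simp add: supp_def)
  then show ?thesis using smooth_radial[OF assms(1)] by (simp add: test_function_def)
qed

text \<open>Each unit direction b contributes 2 \<eta>' + 4 (x . b)^2 \<eta>''; the constant 8 is
  twice the dimension.\<close>

lemma radial_laplacian: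
  fixes \<eta> :: "real \<Rightarrow> real" and x :: "real^4"
  assumes "smooth \<eta>"
  shows "(\<Sum>b\<in>Basis. frechet_derivative (\<lambda>y::real^4. frechet_derivative (\<lambda>y. \<eta> (y \<bullet> y)) (at y) b) (at x) b)
    = 8 * deriv \<eta> (x \<bullet> x) + 4 * (x \<bullet> x) * deriv (deriv \<eta>) (x \<bullet> x)"
proof -
  have sq: "((\<lambda>x. x \<bullet> x) has_derivative (\<lambda>v. 2 * (x \<bullet> v))) (at x)" for x :: "real^4"
    by (auto intro!: derivative_eq_intros simp: inner_commute)
  have rad: "((\<lambda>x. \<theta> (x \<bullet> x)) has_derivative (\<lambda>v. 2 * (x \<bullet> v) * deriv \<theta> (x \<bullet> x))) (at x)"
    if "smooth \<theta>" for \<theta> :: "real \<Rightarrow> real" and x :: "real^4"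
    by (rule DERIV_compose_FDERIV[OF smooth_has_real_derivative(1)[OF that] sq, THEN has_derivative_eq_rhs])
      (simp add: mult.commute)
  have d1: "frechet_derivative (\<lambda>y. \<eta> (y \<bullet> y)) (at y) b = 2 * (y \<bullet> b) * deriv \<eta> (y \<bullet> y)" for y b :: "real^4"
    by (simp add: frechet_derivative_at[OF rad[OF assms, of y], symmetric])
  have d2: "((\<lambda>y. 2 * (y \<bullet> b) * deriv \<eta> (y \<bullet> y)) has_derivative
      (\<lambda>v. 2 * (x \<bullet> b) * (2 * (x \<bullet> v) * deriv (deriv \<eta>) (x \<bullet> x)) + 2 * (v \<bullet> b) * deriv \<eta> (x \<bullet> x))) (at x)" for b
    by (rule has_derivative_mult[OF _ rad[OF smooth_has_real_derivative(2)[OF assms]]])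
      (auto intro!: derivative_eq_intros)
  have "frechet_derivative (\<lambda>y. 2 * (y \<bullet> b) * deriv \<eta> (y \<bullet> y)) (at x) b
      = 4 * (x \<bullet> b)\<^sup>2 * deriv (deriv \<eta>) (x \<bullet> x) + 2 * deriv \<eta> (x \<bullet> x)" if "b \<in> Basis" for b
    unfolding frechet_derivative_at[OF d2, symmetric] using that by (simp add: power2_eq_square)
  then have "(\<Sum>b\<in>Basis. frechet_derivative (\<lambda>y. 2 * (y \<bullet> b) * deriv \<eta> (y \<bullet> y)) (at x) b)
      = (\<Sum>b\<in>(Basis :: (real^4) set). 4 * (x \<bullet> b)\<^sup>2 * deriv (deriv \<eta>) (x \<bullet> x) + 2 * deriv \<eta> (x \<bullet> x))"
    by simp
  also have "\<dots> = 4 * (\<Sum>b\<in>Basis. (x \<bullet> b)\<^sup>2) * deriv (deriv \<eta>) (x \<bullet> x) + 8 * deriv \<eta> (x \<bullet> x)"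
    by (simp add: sum.distrib sum_distrib_left sum_distrib_right)
  also have "(\<Sum>b\<in>Basis. (x \<bullet> b)\<^sup>2) = x \<bullet> x"
    by (subst (2) euclidean_inner) (simp add: power2_eq_square)
  finally show ?thesis by (simp add: d1)
qed

text \<open>\<open>H\<close> plays the role of \<open>z\<^sup>2 \<eta>'\<close>, for which the Laplacian of \<open>\<eta> (\<bar>x\<bar>\<^sup>2)\<close> is \<open>4 H'(z) / z\<close>.\<close>

lemma radial_potential:
  fixes H :: "real \<Rightarrow> real"
  assumes H: "smooth H" and "0 < p" and H0: "\<And>z. z \<le> p \<Longrightarrow> H z = 0" "\<And>z. q \<le> z \<Longrightarrow> H z = 0"
  obtains \<eta> where "smooth \<eta>" "\<And>z. (\<eta> has_real_derivative H z / z / z) (at z)" "\<And>z. q \<le> z \<Longrightarrow> \<eta> z = 0"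
    "\<And>z. 8 * deriv \<eta> z + 4 * z * deriv (deriv \<eta>) z = 4 * (deriv H z / z)"
proof -
  have G: "smooth (\<lambda>z. H z / z / z)"
    by (intro smooth_divide_away_from_0[where p = p] H \<open>0 < p\<close>) (use H0 in auto)
  obtain A where A: "\<And>z. (A has_vector_derivative H z / z / z) (at z)"
    using continuous_has_antiderivative[OF smooth_imp_continuous[OF G]] by blast
  \<comment> \<open>The antiderivative of H / z^2 normalised to vanish at \<open>q\<close>; it is
    constant below \<open>p\<close>, so nothing happens at the origin.\<close>
  define \<eta> where "\<eta> z = A z - A q" for z
  have D: "(\<eta> has_real_derivative H z / z / z) (at z)" for z
    unfolding \<eta>_def using A[of z]
    by (auto intro!: derivative_eq_intros simp: has_real_derivative_iff_has_vector_derivative)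
  have \<eta>0: "\<eta> z = 0" if "q \<le> z" for z
  proof -
    have "\<exists>c. \<forall>x\<in>{q..}. \<eta> x = c"
    proof (rule has_field_derivative_zero_constant)
      show "(\<eta> has_real_derivative 0) (at x within {q..})" if "x \<in> {q..}" for x
        using has_field_derivative_at_within[OF D[of x], of "{q..}"] H0(2)[of x] that by simp
    qed simp
    then have "\<eta> z = \<eta> q" using that by auto
    then show ?thesis by (simp add: \<eta>_def)
  qed
  have d1: "deriv \<eta> = (\<lambda>z. H z / z / z)" using D by (auto simp: fun_eq_iff DERIV_imp_deriv)
  have lap: "8 * deriv \<eta> z + 4 * z * deriv (deriv \<eta>) z = 4 * (deriv H z / z)" for z
  proof (cases "z = 0")
    case False
    then have "((\<lambda>z. H z / z / z) has_real_derivative deriv H z / z / z - 2 * (H z / z / z / z)) (at z)"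
      using smooth_has_real_derivative(1)[OF H, of z]
      by (auto intro!: derivative_eq_intros simp: field_simps)
    then have "deriv (deriv \<eta>) z = deriv H z / z / z - 2 * (H z / z / z / z)"
      unfolding d1 by (rule DERIV_imp_deriv)
    then show ?thesis using False by (simp add: d1 right_diff_distrib)
  qed (simp add: d1)
  show thesis by (rule that[of \<eta>]) (fact smooth_realI[OF D G] D \<eta>0 lap)+
qed

text \<open>As z^2 \<eta>' = H, the derivative of z^2 \<eta>^2 is 2 z \<eta>^2 + 2 \<eta> H, and its
  integral is 0. Adding H^2 / z and subtracting z \<eta>^2 gives the complete square (z \<eta> +
  H)^2 / z. The majorant \<open>f\<close> of H^2 / z allows comparison of smooth steps with
  indicators of intervals.\<close>

lemma Hardy_radial:
  fixes H \<eta> f :: "real \<Rightarrow> real"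
  assumes H: "continuous_on UNIV H" and D: "\<And>z. (\<eta> has_real_derivative H z / z / z) (at z)"
    and "H 0 = 0" "\<eta> q = 0" "0 \<le> q"
    and f: "(f has_integral X) {0..q}" "\<And>z. 0 < z \<Longrightarrow> z \<le> q \<Longrightarrow> (H z)\<^sup>2 / z \<le> f z" "0 \<le> f 0"
  shows "integral {0..q} (\<lambda>z. z * (\<eta> z)\<^sup>2) \<le> X"
proof -
  have cont: "continuous_on UNIV \<eta>" by (intro continuous_at_imp_continuous_on ballI DERIV_isCont[OF D])
  have i1: "(\<lambda>z. z * (\<eta> z)\<^sup>2) integrable_on {0..q}"
    by (intro integrable_continuous_interval continuous_intros continuous_on_subset[OF cont]) auto
  have "((\<lambda>z. 2 * z * (\<eta> z)\<^sup>2 + 2 * \<eta> z * H z) has_integral (q\<^sup>2 * (\<eta> q)\<^sup>2 - 0\<^sup>2 * (\<eta> 0)\<^sup>2)) {0..q}"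
  proof (rule fundamental_theorem_of_calculus[OF \<open>0 \<le> q\<close>])
    fix z assume "z \<in> {0..q}"
    have "((\<lambda>z. z\<^sup>2 * (\<eta> z)\<^sup>2) has_real_derivative 2 * z * (\<eta> z)\<^sup>2 + z\<^sup>2 * (2 * \<eta> z * (H z / z / z))) (at z)"
      by (auto intro!: derivative_eq_intros D simp: field_simps)
    moreover have "z\<^sup>2 * (2 * \<eta> z * (H z / z / z)) = 2 * \<eta> z * H z"
      using \<open>H 0 = 0\<close> by (cases "z = 0") (auto simp: power2_eq_square)
    ultimately show "((\<lambda>z. z\<^sup>2 * (\<eta> z)\<^sup>2) has_vector_derivative 2 * z * (\<eta> z)\<^sup>2 + 2 * \<eta> z * H z) (at z within {0..q})"
      by (simp add: has_real_derivative_iff_has_vector_derivative has_vector_derivative_at_within)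
  qed
  then have i2: "((\<lambda>z. 2 * z * (\<eta> z)\<^sup>2 + 2 * \<eta> z * H z) has_integral 0) {0..q}" using \<open>\<eta> q = 0\<close> by simp
  have "((\<lambda>z. z * (\<eta> z)\<^sup>2) has_integral integral {0..q} (\<lambda>z. z * (\<eta> z)\<^sup>2)) {0..q}"
    using i1 by (rule integrable_integral)
  then show ?thesis
  proof (rule has_integral_le)
    show "((\<lambda>z. (2 * z * (\<eta> z)\<^sup>2 + 2 * \<eta> z * H z) + f z) has_integral X) {0..q}"
      using has_integral_add[OF i2 f(1)] by simp
    fix z assume z: "z \<in> {0..q}"
    show "z * (\<eta> z)\<^sup>2 \<le> (2 * z * (\<eta> z)\<^sup>2 + 2 * \<eta> z * H z) + f z"
    proof (cases "z = 0")
      case False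
      then have "0 < z" using z by simp
      have "0 \<le> (z * \<eta> z + H z)\<^sup>2 / z" using \<open>0 < z\<close> by simp
      also have "\<dots> = z * (\<eta> z)\<^sup>2 + 2 * \<eta> z * H z + (H z)\<^sup>2 / z"
        using \<open>0 < z\<close> by (simp add: power2_eq_square field_simps)
      finally show ?thesis using f(2)[of z] z \<open>0 < z\<close> by simp
    qed (use \<open>H 0 = 0\<close> f(3) in simp)
  qed
qed

text \<open>For u(x) = F(|x|^2) and h vanishing on the left half-line this is the integral of h F:
  the variable |x|^2 has density pi^2 z, which 1 / pi^2 and 1 / (x . x) cancel. For general
  \<open>u\<close> it pairs \<open>h\<close> with the spherical means.\<close>

definition radial_pairing :: "(real^4 \<Rightarrow> 'a::euclidean_space) \<Rightarrow> (real \<Rightarrow> real) \<Rightarrow> 'a" where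
  "radial_pairing u h = (1 / pi\<^sup>2) *\<^sub>R (LINT x|lebesgue. (h (x \<bullet> x) / (x \<bullet> x)) *\<^sub>R u x)"

lemma radial_pairing_integrable:
  fixes u :: "real^4 \<Rightarrow> 'a::euclidean_space"
  assumes u: "u \<in> L2" and h: "h \<in> borel_measurable borel" and B: "\<And>z. \<bar>h z\<bar> \<le> B"
    and "0 < p" and h0: "\<And>z. z < p \<Longrightarrow> h z = 0" "\<And>z. q < z \<Longrightarrow> h z = 0"
  shows "integrable lebesgue (\<lambda>x. (h (x \<bullet> x) / (x \<bullet> x)) *\<^sub>R u x)"
proof (rule integral_Cauchy_Schwarz(1))
  note [measurable] = h
  have meas: "(\<lambda>x::real^4. h (x \<bullet> x) / (x \<bullet> x)) \<in> borel_measurable borel" by measurable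
  then show "(\<lambda>x::real^4. h (x \<bullet> x) / (x \<bullet> x)) \<in> borel_measurable lebesgue" by (simp add: measurable_completion)
  have "integrable lborel (\<lambda>x::real^4. (h (x \<bullet> x) / (x \<bullet> x))\<^sup>2)"
  proof (rule Bochner_Integration.integrable_bound[where f = "\<lambda>x. (B / p)\<^sup>2 * indicator (cball 0 (sqrt \<bar>q\<bar>)) x"])
    show "integrable lborel (\<lambda>x::real^4. (B / p)\<^sup>2 * indicator (cball 0 (sqrt \<bar>q\<bar>)) x)"
      by (intro integrable_mult_right integrable_real_indicator) (auto simp: emeasure_cball)
    show "AE x::real^4 in lborel. norm ((h (x \<bullet> x) / (x \<bullet> x))\<^sup>2) \<le> norm ((B / p)\<^sup>2 * indicator (cball 0 (sqrt \<bar>q\<bar>)) x :: real)"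
    proof (rule AE_I2)
      fix x :: "real^4"
      show "norm ((h (x \<bullet> x) / (x \<bullet> x))\<^sup>2) \<le> norm ((B / p)\<^sup>2 * indicator (cball 0 (sqrt \<bar>q\<bar>)) x :: real)"
      proof (cases "p \<le> x \<bullet> x \<and> x \<bullet> x \<le> q")
        case True
        then have "x \<bullet> x \<le> \<bar>q\<bar>" by linarith
        then have "x \<in> cball 0 (sqrt \<bar>q\<bar>)" by (simp add: norm_eq_sqrt_inner)
        moreover have "\<bar>h (x \<bullet> x)\<bar> / (x \<bullet> x) \<le> B / p"
          using True B[of "x \<bullet> x"] \<open>0 < p\<close> by (intro frac_le) auto
        then have "(\<bar>h (x \<bullet> x)\<bar> / (x \<bullet> x))\<^sup>2 \<le> (B / p)\<^sup>2"
          by (intro power_mono) auto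
        ultimately show ?thesis by (simp add: power_divide)
      next
        case False
        then have "h (x \<bullet> x) = 0" using h0 by (meson not_le)
        then show ?thesis by simp
      qed
    qed
  qed measurable
  then show "integrable lebesgue (\<lambda>x::real^4. (h (x \<bullet> x) / (x \<bullet> x))\<^sup>2)"
    using meas by (subst integrable_completion) auto
qed (use u in \<open>auto simp: L2_def\<close>)

text \<open>By duality this says \<open>\<integral> z \<bar>u'\<bar>\<^sup>2 dz \<le> \<parallel>\<Delta>u\<parallel>\<^sup>2 / (16 \<pi>\<^sup>2)\<close> for a radial \<open>u\<close>.\<close>

lemma radial_pairing_deriv_bound:
  fixes u :: "real^4 \<Rightarrow> 'a::euclidean_space" and H f :: "real \<Rightarrow> real"
  assumes u: "u \<in> H2" and H: "smooth H" and "0 < p" "p \<le> q"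
    and H0: "\<And>z. z \<le> p \<Longrightarrow> H z = 0" "\<And>z. q \<le> z \<Longrightarrow> H z = 0"
    and f: "(f has_integral X) {0..q}" "\<And>z. 0 < z \<Longrightarrow> z \<le> q \<Longrightarrow> (H z)\<^sup>2 / z \<le> f z" "0 \<le> f 0"
  shows "(norm (radial_pairing u (deriv H)))\<^sup>2 \<le> (L2_norm (weak_laplacian u))\<^sup>2 / (16 * pi\<^sup>2) * X"
proof -
  obtain \<eta> where \<eta>: "smooth \<eta>" "\<And>z. (\<eta> has_real_derivative H z / z / z) (at z)" "\<And>z. q \<le> z \<Longrightarrow> \<eta> z = 0"
    "\<And>z. 8 * deriv \<eta> z + 4 * z * deriv (deriv \<eta>) z = 4 * (deriv H z / z)"
    using radial_potential[OF H \<open>0 < p\<close> H0] by blast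
  let ?\<phi> = "\<lambda>x::real^4. \<eta> (x \<bullet> x)"
  let ?N = "L2_norm (weak_laplacian u)"
  have \<phi>: "test_function ?\<phi>" by (rule radial_test_function[OF \<eta>(1,3)])
  have "(LINT x|lebesgue. ?\<phi> x *\<^sub>R weak_laplacian u x) = (LINT x|lebesgue. (4 * (deriv H (x \<bullet> x) / (x \<bullet> x))) *\<^sub>R u x)"
    using H2_weak_laplacian(3)[OF u \<phi>] by (simp add: radial_laplacian[OF \<eta>(1)] \<eta>(4))
  also have "\<dots> = (4 * pi\<^sup>2) *\<^sub>R radial_pairing u (deriv H)"
  proof -
    have "(LINT x|lebesgue. (4 * (deriv H (x \<bullet> x) / (x \<bullet> x))) *\<^sub>R u x)
        = 4 *\<^sub>R (LINT x|lebesgue. (deriv H (x \<bullet> x) / (x \<bullet> x)) *\<^sub>R u x)"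
      by (simp only: scaleR_scaleR[symmetric] integral_scaleR_right)
    then show ?thesis by (simp add: radial_pairing_def)
  qed
  finally have "(4 * pi\<^sup>2 * norm (radial_pairing u (deriv H)))\<^sup>2 = (norm (LINT x|lebesgue. ?\<phi> x *\<^sub>R weak_laplacian u x))\<^sup>2"
    by simp
  also have "\<dots> \<le> (LINT x|lebesgue. (?\<phi> x)\<^sup>2) * ?N\<^sup>2"
    by (rule test_function_L2(2)[OF \<phi> H2_weak_laplacian(1)[OF u]])
  \<comment> \<open>In polar coordinates the squared L2 norm of the test function is pi^2 times the
    integral of z \<eta>^2, to which Hardy's inequality applies.\<close>
  also have "\<dots> \<le> (pi\<^sup>2 * X) * ?N\<^sup>2"
  proof (rule mult_right_mono)
    have [measurable]: "\<eta> \<in> borel_measurable borel"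
      by (rule borel_measurable_continuous_onI[OF smooth_imp_continuous[OF \<eta>(1)]])
    have "(LINT x|lebesgue. (?\<phi> x)\<^sup>2) = (LINT x|lborel. (?\<phi> x)\<^sup>2)" by (rule integral_completion) measurable
    also have "\<dots> = (LINT z|lborel. (pi\<^sup>2 * z * indicator {0..} z) *\<^sub>R (\<eta> z)\<^sup>2)"
      by (rule polar_integral(1)) measurable
    also have "\<dots> = (LINT z:{0..q}|lborel. pi\<^sup>2 * (z * (\<eta> z)\<^sup>2))"
      unfolding set_lebesgue_integral_def
      by (rule Bochner_Integration.integral_cong[OF refl]) (use \<eta>(3) in \<open>auto split: split_indicator\<close>)
    also have "\<dots> = integral {0..q} (\<lambda>z. pi\<^sup>2 * (z * (\<eta> z)\<^sup>2))"
      by (intro set_borel_integral_eq_integral borel_integrable_atLeastAtMost' continuous_intros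
          continuous_on_subset[OF smooth_imp_continuous[OF \<eta>(1)]]) auto
    also have "\<dots> \<le> pi\<^sup>2 * X"
      unfolding integral_mult_right using \<open>0 < p\<close> \<open>p \<le> q\<close> H0 f \<eta>(3)
      by (intro mult_left_mono Hardy_radial[OF smooth_imp_continuous[OF H] \<eta>(2), of q f]) auto
    finally show "(LINT x|lebesgue. (?\<phi> x)\<^sup>2) \<le> pi\<^sup>2 * X" .
  qed simp
  finally show ?thesis by (simp add: field_simps power2_eq_square)
qed

lemma square_sum_eq_sum_squares:
  fixes x :: "'i \<Rightarrow> real"
  assumes "finite I" "\<And>i j. i \<in> I \<Longrightarrow> j \<in> I \<Longrightarrow> i \<noteq> j \<Longrightarrow> x i * x j = 0"
  shows "(\<Sum>i\<in>I. x i)\<^sup>2 = (\<Sum>i\<in>I. (x i)\<^sup>2)"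
proof -
  have "(\<Sum>i\<in>I. x i)\<^sup>2 = (\<Sum>i\<in>I. \<Sum>j\<in>I. x i * x j)"
    by (simp add: power2_eq_square sum_product)
  also have "\<dots> = (\<Sum>i\<in>I. \<Sum>j\<in>I. if i = j then (x i)\<^sup>2 else 0)"
    using assms(2) by (intro sum.cong refl) (auto simp: power2_eq_square)
  also have "\<dots> = (\<Sum>i\<in>I. (x i)\<^sup>2)" using assms(1) by simp
  finally show ?thesis .
qed

lemma has_integral_inverse_indicator:
  assumes "0 < a" "a \<le> b" "b \<le> q"
  shows "((\<lambda>z. indicator {a..b} z * (1 / z)) has_integral ln (b / a)) {0..q::real}"
proof -
  have "((\<lambda>z. 1 / z) has_integral (ln b - ln a)) {a..b}"
    by (rule fundamental_theorem_of_calculus)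
      (use assms in \<open>auto intro!: derivative_eq_intros simp: has_real_derivative_iff_has_vector_derivative[symmetric]\<close>)
  then have "((\<lambda>z. if z \<in> {a..b} then 1 / z else 0) has_integral (ln b - ln a)) {0..q}"
    by (subst has_integral_restrict) (use assms in auto)
  moreover have "(\<lambda>z. if z \<in> {a..b} then 1 / z else 0) = (\<lambda>z. indicator {a..b} z * (1 / z))"
    by (auto simp: fun_eq_iff)
  ultimately show ?thesis using assms by (simp add: ln_div)
qed

section \<open>Smooth steps built from the mollifier\<close>

locale mollifier =
  fixes \<rho> :: "real \<Rightarrow> real"
  assumes smooth_rho: "smooth \<rho>"
    and rho_nonneg: "\<And>s. 0 \<le> \<rho> s"
    and rho_supp: "supp \<rho> \<subseteq> {-1..1}"
    and rho_mass: "(LINT s:{-1..1}|lebesgue. \<rho> s) = 1"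
begin

lemma rho_eq_0: "1 < \<bar>s\<bar> \<Longrightarrow> \<rho> s = 0"
  using rho_supp closure_subset[of "{s. \<rho> s \<noteq> 0}"] unfolding supp_def by force

lemma rho_continuous: "continuous_on UNIV \<rho>"
  by (rule smooth_imp_continuous[OF smooth_rho])

lemma rho_measurable [measurable]: "\<rho> \<in> borel_measurable borel"
  by (rule borel_measurable_continuous_onI[OF rho_continuous])

lemma rho_bounded: obtains B where "0 < B" "\<And>s. \<rho> s \<le> B"
proof -
  have "\<rho> s = 0" if "2 \<le> norm s" for s using rho_eq_0[of s] that by simp
  from compactly_supported_bounded[OF rho_continuous this]
  obtain B where B: "0 < B" "\<And>x. norm (\<rho> x) \<le> B" by blast
  have "\<rho> s \<le> B" for s using B(2)[of s] by simp
  then show thesis using that B(1) by blast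
qed

lemma rho_integral: "(LINT s|lborel. \<rho> s) = 1" and rho_integrable: "integrable lborel \<rho>"
proof -
  have eq: "(\<lambda>s. indicator {-1..1} s *\<^sub>R \<rho> s) = \<rho>"
    using rho_eq_0 by (auto simp: fun_eq_iff split: split_indicator)
  have "(LINT s:{-1..1}|lebesgue. \<rho> s) = (LINT s|lborel. \<rho> s)"
    unfolding set_lebesgue_integral_def eq by (rule integral_completion) simp
  then show "(LINT s|lborel. \<rho> s) = 1" using rho_mass by simp
  then show "integrable lborel \<rho>" using not_integrable_integral_eq by fastforce
qed

text \<open>The antiderivative of \<open>\<rho>\<close> is a smooth Heaviside function. Differences
  of its rescaled translates are admissible \<open>H\<close> in the duality bound, and their
  derivatives are differences of rescaled mollifiers.\<close>

lemma smooth_step: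
  obtains \<Phi> where "smooth \<Phi>" "\<And>z. (\<Phi> has_real_derivative \<rho> z) (at z)"
    "\<And>z. z \<le> -1 \<Longrightarrow> \<Phi> z = 0" "\<And>z. 1 \<le> z \<Longrightarrow> \<Phi> z = 1" "\<And>z. 0 \<le> \<Phi> z" "\<And>z. \<Phi> z \<le> 1"
proof -
  obtain A where A: "\<And>z. (A has_vector_derivative \<rho> z) (at z)"
    using continuous_has_antiderivative[OF rho_continuous] by blast
  define \<Phi> where "\<Phi> z = A z - A (-1)" for z
  have D: "(\<Phi> has_real_derivative \<rho> z) (at z)" for z
    unfolding \<Phi>_def using A[of z]
    by (auto intro!: derivative_eq_intros simp: has_real_derivative_iff_has_vector_derivative)
  have mono: "\<Phi> y \<le> \<Phi> z" if "y \<le> z" for y z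
    by (rule DERIV_nonneg_imp_nondecreasing[OF that]) (use D rho_nonneg in blast)
  have left: "\<Phi> z = 0" if "z \<le> -1" for z
  proof (cases "z = -1")
    case False
    have "\<Phi> (-1) = \<Phi> z"
      by (rule DERIV_isconst_end)
        (use False that D rho_eq_0 in \<open>auto intro!: continuous_at_imp_continuous_on DERIV_isCont[OF D] intro: DERIV_cong[OF D]\<close>)
    then show ?thesis by (simp add: \<Phi>_def)
  qed (simp add: \<Phi>_def)
  have \<Phi>1: "\<Phi> 1 = 1"
  proof -
    have "(\<rho> has_integral (\<Phi> 1 - \<Phi> (-1))) {-1..1}"
      by (rule fundamental_theorem_of_calculus)
        (auto simp: has_real_derivative_iff_has_vector_derivative[symmetric] intro: has_field_derivative_at_within D)
    moreover have "(LINT s:{-1..1}|lebesgue. \<rho> s) = integral {-1..1} \<rho>"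
      by (intro set_lebesgue_integral_eq_integral absolutely_integrable_continuous_real continuous_on_subset[OF rho_continuous]) auto
    ultimately show ?thesis using rho_mass left[of "-1"] by (simp add: integral_unique)
  qed
  have right: "\<Phi> z = 1" if "1 \<le> z" for z
  proof (cases "z = 1")
    case False
    have "\<Phi> z = \<Phi> 1"
      by (rule DERIV_isconst_end)
        (use False that D rho_eq_0 in \<open>auto intro!: continuous_at_imp_continuous_on DERIV_isCont[OF D] intro: DERIV_cong[OF D]\<close>)
    then show ?thesis by (simp add: \<Phi>1)
  qed (simp add: \<Phi>1)
  have b: "0 \<le> \<Phi> z" "\<Phi> z \<le> 1" for z
    using mono[of "min z (-1)" z] left[of "min z (-1)"] mono[of z "max z 1"] right[of "max z 1"] by auto
  show thesis by (rule that[of \<Phi>]) (fact smooth_realI[OF D smooth_rho] D left right b)+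
qed

lemma rescaled_rho:
  assumes "0 < \<epsilon>"
  obtains B where "\<And>z. \<bar>\<rho> ((z - a) / \<epsilon>) / \<epsilon>\<bar> \<le> B"
    "\<And>z. z < a - \<epsilon> \<Longrightarrow> \<rho> ((z - a) / \<epsilon>) / \<epsilon> = 0" "\<And>z. a + \<epsilon> < z \<Longrightarrow> \<rho> ((z - a) / \<epsilon>) / \<epsilon> = 0"
proof -
  obtain B where B: "0 < B" "\<And>s. \<rho> s \<le> B" using rho_bounded by blast
  show thesis
  proof (rule that[of "B / \<epsilon>"])
    show "\<bar>\<rho> ((z - a) / \<epsilon>) / \<epsilon>\<bar> \<le> B / \<epsilon>" for z
      using B(2) rho_nonneg assms by (simp add: divide_right_mono)
    show "\<rho> ((z - a) / \<epsilon>) / \<epsilon> = 0" if "z < a - \<epsilon>" for z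
    proof -
      have "(z - a) / \<epsilon> < -1" using that assms by (simp add: divide_less_eq)
      then have "1 < \<bar>(z - a) / \<epsilon>\<bar>" by linarith
      then have "\<rho> ((z - a) / \<epsilon>) = 0" by (rule rho_eq_0)
      then show ?thesis by simp
    qed
    show "\<rho> ((z - a) / \<epsilon>) / \<epsilon> = 0" if "a + \<epsilon> < z" for z
    proof -
      have "1 < (z - a) / \<epsilon>" using that assms by (simp add: less_divide_eq)
      then have "1 < \<bar>(z - a) / \<epsilon>\<bar>" by linarith
      then have "\<rho> ((z - a) / \<epsilon>) = 0" by (rule rho_eq_0)
      then show ?thesis by simp
    qed
  qed
qed

lemma rescaled_step_deriv:
  assumes "0 < \<epsilon>" "\<And>z. (\<Phi> has_real_derivative \<rho> z) (at z)"
  shows "((\<lambda>z. \<Phi> ((z - a) / \<epsilon>)) has_real_derivative \<rho> ((z - a) / \<epsilon>) / \<epsilon>) (at z)"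
  by (rule DERIV_chain2[OF assms(2), THEN DERIV_cong])
    (use assms(1) in \<open>auto intro!: derivative_eq_intros\<close>)

end

section \<open>Smoothed spherical means of an H2 function\<close>

locale H2_function = mollifier \<rho> for \<rho> :: "real \<Rightarrow> real" +
  fixes u :: "real^4 \<Rightarrow> 'a::euclidean_space"
  assumes u_H2: "u \<in> H2"
begin

lemma u_L2: "u \<in> L2" using u_H2 by (simp add: H2_def)

text \<open>A smoothed spherical mean of \<open>u\<close> over |x|^2 close to \<open>a\<close>. It
  depends on \<open>u\<close> only up to null sets and makes sense before any continuity in the
  radius is known.\<close>

definition mol :: "real \<Rightarrow> real \<Rightarrow> 'a" where
  "mol \<epsilon> a = radial_pairing u (\<lambda>z. \<rho> ((z - a) / \<epsilon>) / \<epsilon>)"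

text \<open>The constant of \<open>radial_pairing_deriv_bound\<close>, that is, a bound for the
  integral of z |V'(z)|^2 when u(x) = V(|x|^2).\<close>

definition energy :: real where
  "energy = (L2_norm (weak_laplacian u))\<^sup>2 / (16 * pi\<^sup>2)"

lemma energy_nonneg: "0 \<le> energy" by (simp add: energy_def)

lemma mol_integrable:
  assumes "0 < \<epsilon>" "\<epsilon> < a"
  shows "integrable lebesgue (\<lambda>x. (\<rho> ((x \<bullet> x - a) / \<epsilon>) / \<epsilon> / (x \<bullet> x)) *\<^sub>R u x)"
proof -
  obtain B where B: "\<And>z. \<bar>\<rho> ((z - a) / \<epsilon>) / \<epsilon>\<bar> \<le> B"
    "\<And>z. z < a - \<epsilon> \<Longrightarrow> \<rho> ((z - a) / \<epsilon>) / \<epsilon> = 0" "\<And>z. a + \<epsilon> < z \<Longrightarrow> \<rho> ((z - a) / \<epsilon>) / \<epsilon> = 0"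
    using rescaled_rho[OF assms(1)] by blast
  show ?thesis
    by (rule radial_pairing_integrable[where p = "a - \<epsilon>" and q = "a + \<epsilon>", OF u_L2 _ B(1)])
      (use assms B in \<open>auto intro: B\<close>)
qed

text \<open>The function \<open>H\<close> of the duality bound is the same combination of smooth
  steps; its derivative is the combination of mollifiers behind the left-hand side.\<close>

lemma mol_combination_bound:
  assumes "finite I" and \<epsilon>: "\<And>i. i \<in> I \<Longrightarrow> 0 < \<epsilon> i" "\<And>i. i \<in> I \<Longrightarrow> 0 < \<delta> i"
    and "0 < p" and p: "\<And>i. i \<in> I \<Longrightarrow> p \<le> a i - \<epsilon> i" "\<And>i. i \<in> I \<Longrightarrow> p \<le> b i - \<delta> i"
    and q: "\<And>i. i \<in> I \<Longrightarrow> a i + \<epsilon> i \<le> q" "\<And>i. i \<in> I \<Longrightarrow> b i + \<delta> i \<le> q" "p \<le> q"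
    and \<Phi>: "smooth \<Phi>" "\<And>z. (\<Phi> has_real_derivative \<rho> z) (at z)"
      "\<And>z. z \<le> -1 \<Longrightarrow> \<Phi> z = 0" "\<And>z. 1 \<le> z \<Longrightarrow> \<Phi> z = 1"
    and f: "(f has_integral X) {0..q}" "0 \<le> f 0"
      "\<And>z. 0 < z \<Longrightarrow> z \<le> q \<Longrightarrow> (\<Sum>i\<in>I. c i * (\<Phi> ((z - a i) / \<epsilon> i) - \<Phi> ((z - b i) / \<delta> i)))\<^sup>2 / z \<le> f z"
  shows "(norm (\<Sum>i\<in>I. c i *\<^sub>R (mol (\<epsilon> i) (a i) - mol (\<delta> i) (b i))))\<^sup>2 \<le> energy * X"
proof -
  define H where "H z = (\<Sum>i\<in>I. c i * (\<Phi> ((z - a i) / \<epsilon> i) - \<Phi> ((z - b i) / \<delta> i)))" for z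
  have H: "smooth H" unfolding H_def
    by (intro smooth_sum smooth_mult smooth_const smooth_diff smooth_affine \<Phi>(1))
  have *: "deriv H z = (\<Sum>i\<in>I. c i * (\<rho> ((z - a i) / \<epsilon> i) / \<epsilon> i - \<rho> ((z - b i) / \<delta> i) / \<delta> i))" for z
    unfolding H_def
    by (intro DERIV_imp_deriv DERIV_sum DERIV_cmult DERIV_diff rescaled_step_deriv \<epsilon> \<Phi>(2))
  have dH: "(deriv H z / z) *\<^sub>R w = (\<Sum>i\<in>I. c i *\<^sub>R ((\<rho> ((z - a i) / \<epsilon> i) / \<epsilon> i / z) *\<^sub>R w - (\<rho> ((z - b i) / \<delta> i) / \<delta> i / z) *\<^sub>R w))"
    for z and w :: 'a
  proof -
    have "deriv H z / z = (\<Sum>i\<in>I. c i * (\<rho> ((z - a i) / \<epsilon> i) / \<epsilon> i / z - \<rho> ((z - b i) / \<delta> i) / \<delta> i / z))"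
      unfolding * by (simp add: sum_divide_distrib diff_divide_distrib right_diff_distrib)
    then show ?thesis by (simp only: scaleR_sum_left scaleR_scaleR[symmetric] scaleR_diff_left)
  qed
  define F where "F i x = (\<rho> ((x \<bullet> x - a i) / \<epsilon> i) / \<epsilon> i / (x \<bullet> x)) *\<^sub>R u x" for i x
  define G where "G i x = (\<rho> ((x \<bullet> x - b i) / \<delta> i) / \<delta> i / (x \<bullet> x)) *\<^sub>R u x" for i x
  have int: "integrable lebesgue (F i)" "integrable lebesgue (G i)" if "i \<in> I" for i
    unfolding F_def G_def using p[OF that] \<open>0 < p\<close> by (intro mol_integrable \<epsilon> that; simp)+
  have "(LINT x|lebesgue. (deriv H (x \<bullet> x) / (x \<bullet> x)) *\<^sub>R u x) = (LINT x|lebesgue. (\<Sum>i\<in>I. c i *\<^sub>R (F i x - G i x)))"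
    unfolding dH F_def G_def ..
  also have "\<dots> = (\<Sum>i\<in>I. c i *\<^sub>R ((LINT x|lebesgue. F i x) - (LINT x|lebesgue. G i x)))"
    using int by (subst Bochner_Integration.integral_sum) auto
  finally have "radial_pairing u (deriv H) = (\<Sum>i\<in>I. c i *\<^sub>R (mol (\<epsilon> i) (a i) - mol (\<delta> i) (b i)))"
    unfolding mol_def radial_pairing_def F_def G_def
    by (simp only: scaleR_sum_right scaleR_diff_right scaleR_left_commute[of "1 / pi\<^sup>2"])
  moreover have "(norm (radial_pairing u (deriv H)))\<^sup>2 \<le> energy * X"
    unfolding energy_def
  proof (rule radial_pairing_deriv_bound[OF u_H2 H \<open>0 < p\<close> \<open>p \<le> q\<close> _ _ f(1) _ f(2)])
    show "H z = 0" if "z \<le> p" for z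
      unfolding H_def
    proof (rule sum.neutral, rule ballI)
      fix i assume i: "i \<in> I"
      have "(z - a i) / \<epsilon> i \<le> -1" "(z - b i) / \<delta> i \<le> -1"
        using that p[OF i] \<epsilon>[OF i] by (simp_all add: divide_le_eq)
      then show "c i * (\<Phi> ((z - a i) / \<epsilon> i) - \<Phi> ((z - b i) / \<delta> i)) = 0" using \<Phi>(3) by simp
    qed
    show "H z = 0" if "q \<le> z" for z
      unfolding H_def
    proof (rule sum.neutral, rule ballI)
      fix i assume i: "i \<in> I"
      have "1 \<le> (z - a i) / \<epsilon> i" "1 \<le> (z - b i) / \<delta> i"
        using that q(1,2)[OF i] \<epsilon>[OF i] by (simp_all add: le_divide_eq)
      then show "c i * (\<Phi> ((z - a i) / \<epsilon> i) - \<Phi> ((z - b i) / \<delta> i)) = 0" using \<Phi>(4) by simp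
    qed
    show "(H z)\<^sup>2 / z \<le> f z" if "0 < z" "z \<le> q" for z using f(3)[OF that] by (simp add: H_def)
  qed
  ultimately show ?thesis by simp
qed

text \<open>For one pair of steps, \<open>H\<close> has values in {-1..1} and support in {p..q}, so
  H^2 / z is dominated by 1 / z there, with integral ln (q / p).\<close>

lemma mol_close:
  assumes "0 < \<epsilon>" "0 < \<delta>" "0 < p" "p \<le> a - \<epsilon>" "p \<le> b - \<delta>" "a + \<epsilon> \<le> q" "b + \<delta> \<le> q"
  shows "(norm (mol \<epsilon> a - mol \<delta> b))\<^sup>2 \<le> energy * ln (q / p)"
proof -
  obtain \<Phi> where \<Phi>: "smooth \<Phi>" "\<And>z. (\<Phi> has_real_derivative \<rho> z) (at z)"
    "\<And>z. z \<le> -1 \<Longrightarrow> \<Phi> z = 0" "\<And>z. 1 \<le> z \<Longrightarrow> \<Phi> z = 1" "\<And>z. 0 \<le> \<Phi> z" "\<And>z. \<Phi> z \<le> 1"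
    using smooth_step by blast
  have "p \<le> q" using assms by linarith
  have "(norm (\<Sum>i\<in>{()}. 1 *\<^sub>R (mol \<epsilon> a - mol \<delta> b)))\<^sup>2 \<le> energy * ln (q / p)"
  proof (rule mol_combination_bound[OF _ _ _ \<open>0 < p\<close> _ _ _ _ \<open>p \<le> q\<close> \<Phi>(1-4)
        has_integral_inverse_indicator[OF \<open>0 < p\<close> \<open>p \<le> q\<close> order_refl]])
    fix z :: real assume z: "0 < z" "z \<le> q"
    let ?t = "\<Phi> ((z - a) / \<epsilon>) - \<Phi> ((z - b) / \<delta>)"
    show "(\<Sum>i\<in>{()}. 1 * ?t)\<^sup>2 / z \<le> indicator {p..q} z * (1 / z)"
    proof (cases "p \<le> z")
      case True
      have "\<bar>?t\<bar> \<le> 1" using \<Phi>(5,6)[of "(z - a) / \<epsilon>"] \<Phi>(5,6)[of "(z - b) / \<delta>"] by linarith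
      then have "?t\<^sup>2 \<le> 1" by (simp add: abs_square_le_1)
      then show ?thesis using True z by (simp add: divide_right_mono)
    next
      case False
      then have "(z - a) / \<epsilon> \<le> -1" "(z - b) / \<delta> \<le> -1" using assms by (simp_all add: divide_le_eq)
      then have "?t = 0" using \<Phi>(3) by simp
      then show ?thesis using z by simp
    qed
  qed (use assms in auto)
  then show ?thesis by simp
qed

text \<open>The continuous version of the spherical mean; the limit exists for
  \<open>0 < a\<close>.\<close>

definition prof :: "real \<Rightarrow> 'a" where
  "prof a = lim (\<lambda>m. mol (inverse (real (Suc m))) a)"

lemma ln_ratio_small:
  assumes "0 < a" "0 < e"
  obtains t where "0 < t" "t < a" "energy * ln ((a + t) / (a - t)) < e"
proof -
  have "((\<lambda>t. energy * ln ((a + t) / (a - t))) \<longlongrightarrow> energy * ln ((a + 0) / (a - 0))) (at_right 0)"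
    using assms by (intro tendsto_intros) auto
  then have "\<forall>\<^sub>F t in at_right 0. energy * ln ((a + t) / (a - t)) < e"
    using assms by (intro order_tendstoD(2)) auto
  moreover have "\<forall>\<^sub>F t in at_right 0. t < a" "\<forall>\<^sub>F t in at_right 0. 0 < (t::real)"
    using assms by (auto simp: eventually_at_right_less intro: eventually_at_right_less eventually_at_rightI[of 0 a])
  ultimately have "\<forall>\<^sub>F t in at_right 0. 0 < t \<and> t < a \<and> energy * ln ((a + t) / (a - t)) < e"
    by eventually_elim auto
  from eventually_happens'[OF trivial_limit_at_right_real this] show thesis using that by blast
qed

lemma inverse_Suc_small: "0 < t \<Longrightarrow> \<forall>\<^sub>F m in sequentially. inverse (real (Suc m)) < t"
  by (rule order_tendstoD(2)[OF LIMSEQ_inverse_real_of_nat])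

lemma prof_tendsto:
  assumes "0 < a"
  shows "(\<lambda>m. mol (inverse (real (Suc m))) a) \<longlonglongrightarrow> prof a"
proof -
  have "Cauchy (\<lambda>m. mol (inverse (real (Suc m))) a)"
  proof (rule metric_CauchyI)
    fix e :: real assume "0 < e"
    then obtain t where t: "0 < t" "t < a" "energy * ln ((a + t) / (a - t)) < e\<^sup>2"
      using ln_ratio_small[OF assms, of "e\<^sup>2"] by auto
    obtain M where M: "\<And>m. M \<le> m \<Longrightarrow> inverse (real (Suc m)) < t"
      using inverse_Suc_small[OF t(1)] by (auto simp: eventually_sequentially)
    show "\<exists>M. \<forall>m\<ge>M. \<forall>n\<ge>M. dist (mol (inverse (real (Suc m))) a) (mol (inverse (real (Suc n))) a) < e"
    proof (intro exI[of _ M] allI impI)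
      fix m n assume "M \<le> m" "M \<le> n"
      then have "(norm (mol (inverse (real (Suc m))) a - mol (inverse (real (Suc n))) a))\<^sup>2 \<le> energy * ln ((a + t) / (a - t))"
        using t M[of m] M[of n] by (intro mol_close) auto
      then have "(norm (mol (inverse (real (Suc m))) a - mol (inverse (real (Suc n))) a))\<^sup>2 < e\<^sup>2" using t(3) by linarith
      then show "dist (mol (inverse (real (Suc m))) a) (mol (inverse (real (Suc n))) a) < e"
        unfolding dist_norm by (rule power_less_imp_less_base) (use \<open>0 < e\<close> in simp)
    qed
  qed
  then show ?thesis unfolding prof_def by (simp add: Cauchy_convergent_iff convergent_LIMSEQ_iff)
qed

lemma mol_prof_close:
  assumes "0 < \<epsilon>" "0 < p" "p \<le> a - \<epsilon>" "a + \<epsilon> \<le> q" "p < b" "b < q"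
  shows "(norm (mol \<epsilon> a - prof b))\<^sup>2 \<le> energy * ln (q / p)"
proof (rule tendsto_upperbound[OF _ _ sequentially_bot])
  show "(\<lambda>m. (norm (mol \<epsilon> a - mol (inverse (real (Suc m))) b))\<^sup>2) \<longlonglongrightarrow> (norm (mol \<epsilon> a - prof b))\<^sup>2"
    using assms by (intro tendsto_intros prof_tendsto) auto
  have "0 < min (b - p) (q - b)" using assms by simp
  from inverse_Suc_small[OF this]
  show "\<forall>\<^sub>F m in sequentially. (norm (mol \<epsilon> a - mol (inverse (real (Suc m))) b))\<^sup>2 \<le> energy * ln (q / p)"
    by eventually_elim (rule mol_close; use assms in auto)
qed

text \<open>Narrow mollifiers around \<open>a\<close> and \<open>b\<close> fit into {a - t..b + t};
  letting t tend to 0 leaves ln (b / a). In the variable ln z this is Hoelder continuity of order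
  1/2.\<close>

lemma prof_hoelder:
  assumes "0 < a" "a \<le> b"
  shows "(norm (prof b - prof a))\<^sup>2 \<le> energy * ln (b / a)"
proof (rule tendsto_lowerbound)
  show "((\<lambda>t. energy * ln ((b + t) / (a - t))) \<longlongrightarrow> energy * ln (b / a)) (at_right 0)"
  proof -
    have "((\<lambda>t. energy * ln ((b + t) / (a - t))) \<longlongrightarrow> energy * ln ((b + 0) / (a - 0))) (at_right 0)"
      using assms by (intro tendsto_intros) auto
    then show ?thesis by simp
  qed
  have "\<forall>\<^sub>F t in at_right 0. t < a" "\<forall>\<^sub>F t in at_right 0. 0 < (t::real)"
    using assms by (auto simp: eventually_at_right_less intro: eventually_at_right_less eventually_at_rightI[of 0 a])
  then show "\<forall>\<^sub>F t in at_right 0. (norm (prof b - prof a))\<^sup>2 \<le> energy * ln ((b + t) / (a - t))"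
  proof eventually_elim
    case (elim t)
    show ?case
    proof (rule tendsto_upperbound[OF _ _ sequentially_bot])
      show "(\<lambda>m. (norm (mol (inverse (real (Suc m))) b - prof a))\<^sup>2) \<longlonglongrightarrow> (norm (prof b - prof a))\<^sup>2"
        using assms by (intro tendsto_intros prof_tendsto) auto
      from inverse_Suc_small[OF elim(2)]
      show "\<forall>\<^sub>F m in sequentially. (norm (mol (inverse (real (Suc m))) b - prof a))\<^sup>2 \<le> energy * ln ((b + t) / (a - t))"
        by eventually_elim (rule mol_prof_close; use assms elim in auto)
    qed
  qed
qed simp

lemma mol_tendsto_prof:
  assumes "0 < a" and pos: "\<And>m. 0 < \<epsilon> m" and "\<epsilon> \<longlonglongrightarrow> 0" and "b \<longlonglongrightarrow> a"
  shows "(\<lambda>m. mol (\<epsilon> m) (b m)) \<longlonglongrightarrow> prof a"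
proof (rule metric_LIMSEQ_I)
  fix e :: real assume "0 < e"
  then obtain t where t: "0 < t" "t < a" "energy * ln ((a + t) / (a - t)) < e\<^sup>2"
    using ln_ratio_small[OF assms(1), of "e\<^sup>2"] by auto
  have "\<forall>\<^sub>F m in sequentially. \<epsilon> m < t / 2" using t by (intro order_tendstoD[OF assms(3)]) auto
  moreover have "\<forall>\<^sub>F m in sequentially. dist (b m) a < t / 2" using t by (intro tendstoD[OF assms(4)]) auto
  ultimately have "\<forall>\<^sub>F m in sequentially. dist (mol (\<epsilon> m) (b m)) (prof a) < e"
  proof eventually_elim
    case (elim m)
    have "\<bar>b m - a\<bar> < t / 2" using elim(2) by (simp add: dist_real_def)
    then have "a - t \<le> b m - \<epsilon> m" "b m + \<epsilon> m \<le> a + t" using elim(1) by linarith+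
    then have "(norm (mol (\<epsilon> m) (b m) - prof a))\<^sup>2 \<le> energy * ln ((a + t) / (a - t))"
      by (intro mol_prof_close[OF pos]) (use t in auto)
    then have "(norm (mol (\<epsilon> m) (b m) - prof a))\<^sup>2 < e\<^sup>2" using t(3) by linarith
    then show ?case unfolding dist_norm by (rule power_less_imp_less_base) (use \<open>0 < e\<close> in simp)
  qed
  then show "\<exists>M. \<forall>m\<ge>M. dist (mol (\<epsilon> m) (b m)) (prof a) < e" by (simp add: eventually_sequentially)
qed

text \<open>Smoothed indicators of intervals with disjoint interiors have pairwise products 0, so
  the square of their combination is the sum of the squares and the logarithms add up.\<close>

lemma prof_combination_bound:
  assumes "finite I" and ab: "\<And>i. i \<in> I \<Longrightarrow> 0 < a i" "\<And>i. i \<in> I \<Longrightarrow> a i < b i"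
    and disj: "\<And>i j. i \<in> I \<Longrightarrow> j \<in> I \<Longrightarrow> i \<noteq> j \<Longrightarrow> b i \<le> a j \<or> b j \<le> a i"
  shows "(norm (\<Sum>i\<in>I. c i *\<^sub>R (prof (a i) - prof (b i))))\<^sup>2 \<le> energy * (\<Sum>i\<in>I. (c i)\<^sup>2 * ln (b i / a i))"
proof (cases "I = {}")
  case False
  obtain \<Phi> where \<Phi>: "smooth \<Phi>" "\<And>z. (\<Phi> has_real_derivative \<rho> z) (at z)"
    "\<And>z. z \<le> -1 \<Longrightarrow> \<Phi> z = 0" "\<And>z. 1 \<le> z \<Longrightarrow> \<Phi> z = 1" "\<And>z. 0 \<le> \<Phi> z" "\<And>z. \<Phi> z \<le> 1"
    using smooth_step by blast
  define p where "p = Min (a ` I)"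
  define q where "q = Max (b ` I)"
  have p: "0 < p" "\<And>i. i \<in> I \<Longrightarrow> p \<le> a i" and q: "\<And>i. i \<in> I \<Longrightarrow> b i \<le> q"
    using assms(1) False ab(1) by (auto simp: p_def q_def)
  have "p \<le> q" using p(2) q ab(2) False by (meson all_not_in_conv less_imp_le order_trans)
  define e where "e m = inverse (real (Suc m))" for m
  have e_pos: "0 < e m" for m by (simp add: e_def)
  have e0: "e \<longlonglongrightarrow> 0" unfolding e_def[abs_def] by (rule LIMSEQ_inverse_real_of_nat)
  show ?thesis
  proof (rule tendsto_upperbound[OF _ _ sequentially_bot])
    \<comment> \<open>The centres are moved inwards by \<open>e m\<close>, so that the smoothed
      indicator of {a i..b i} vanishes outside this very interval.\<close>
    show "(\<lambda>m. (norm (\<Sum>i\<in>I. c i *\<^sub>R (mol (e m) (a i + e m) - mol (e m) (b i - e m))))\<^sup>2)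
        \<longlonglongrightarrow> (norm (\<Sum>i\<in>I. c i *\<^sub>R (prof (a i) - prof (b i))))\<^sup>2"
    proof (intro tendsto_intros mol_tendsto_prof e_pos e0)
      fix i assume i: "i \<in> I"
      show "0 < a i" "0 < b i" using ab[OF i] by auto
      show "(\<lambda>m. a i + e m) \<longlonglongrightarrow> a i" using tendsto_add[OF tendsto_const e0, of "a i"] by simp
      show "(\<lambda>m. b i - e m) \<longlonglongrightarrow> b i" using tendsto_diff[OF tendsto_const e0, of "b i"] by simp
    qed
    have "\<forall>\<^sub>F m in sequentially. \<forall>i\<in>I. e m < (b i - a i) / 2"
      using ab by (intro eventually_ball_finite assms(1) ballI order_tendstoD[OF e0]) auto
    then show "\<forall>\<^sub>F m in sequentially. (norm (\<Sum>i\<in>I. c i *\<^sub>R (mol (e m) (a i + e m) - mol (e m) (b i - e m))))\<^sup>2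
        \<le> energy * (\<Sum>i\<in>I. (c i)\<^sup>2 * ln (b i / a i))"
    proof eventually_elim
      case (elim m)
      define T where "T i z = \<Phi> ((z - (a i + e m)) / e m) - \<Phi> ((z - (b i - e m)) / e m)" for i z
      have T0: "T i z = 0" if "z \<le> a i \<or> b i \<le> z" "i \<in> I" for i z
        using that(1)
      proof
        assume "z \<le> a i"
        then have "(z - (a i + e m)) / e m \<le> -1" "(z - (b i - e m)) / e m \<le> -1"
          using e_pos[of m] elim that(2) by (auto simp: divide_le_eq)
        then show ?thesis using \<Phi>(3) by (simp add: T_def)
      next
        assume "b i \<le> z"
        then have "1 \<le> (z - (a i + e m)) / e m" "1 \<le> (z - (b i - e m)) / e m"
          using e_pos[of m] elim that(2) by (auto simp: le_divide_eq)
        then show ?thesis using \<Phi>(4) by (simp add: T_def)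
      qed
      have T1: "(T i z)\<^sup>2 \<le> 1" for i z
      proof -
        have "\<bar>T i z\<bar> \<le> 1" using \<Phi>(5,6)[of "(z - (a i + e m)) / e m"] \<Phi>(5,6)[of "(z - (b i - e m)) / e m"]
          unfolding T_def by linarith
        then show ?thesis by (simp add: abs_square_le_1)
      qed
      show ?case
      proof (rule mol_combination_bound[OF assms(1) e_pos e_pos p(1) _ _ _ _ \<open>p \<le> q\<close> \<Phi>(1-4)])
        show "((\<lambda>z. \<Sum>i\<in>I. (c i)\<^sup>2 * (indicator {a i..b i} z * (1 / z))) has_integral (\<Sum>i\<in>I. (c i)\<^sup>2 * ln (b i / a i))) {0..q}"
          using ab q by (intro has_integral_sum assms(1) has_integral_mult_right has_integral_inverse_indicator) (auto intro: less_imp_le)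
        fix z :: real assume z: "0 < z" "z \<le> q"
        have "(\<Sum>i\<in>I. c i * T i z)\<^sup>2 = (\<Sum>i\<in>I. (c i * T i z)\<^sup>2)"
        proof (rule square_sum_eq_sum_squares[OF assms(1)])
          fix i j assume ij: "i \<in> I" "j \<in> I" "i \<noteq> j"
          have "T i z = 0 \<or> T j z = 0"
            using disj[OF ij] T0[of z i] T0[of z j] ij(1,2) by linarith
          then show "c i * T i z * (c j * T j z) = 0" by auto
        qed
        also have "\<dots> / z \<le> (\<Sum>i\<in>I. (c i)\<^sup>2 * (indicator {a i..b i} z * (1 / z)))"
          unfolding sum_divide_distrib
        proof (rule sum_mono)
          fix i assume i: "i \<in> I"
          show "(c i * T i z)\<^sup>2 / z \<le> (c i)\<^sup>2 * (indicator {a i..b i} z * (1 / z))"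
          proof (cases "z \<in> {a i..b i}")
            case True
            have "(c i)\<^sup>2 * (T i z)\<^sup>2 / z \<le> (c i)\<^sup>2 * 1 / z"
              using z T1 by (intro divide_right_mono mult_left_mono) auto
            then show ?thesis using True by (simp add: power_mult_distrib)
          next
            case False
            then have "T i z = 0" using T0[OF _ i] by force
            then show ?thesis using False by simp
          qed
        qed
        finally show "(\<Sum>i\<in>I. c i * (\<Phi> ((z - (a i + e m)) / e m) - \<Phi> ((z - (b i - e m)) / e m)))\<^sup>2 / z
          \<le> (\<Sum>i\<in>I. (c i)\<^sup>2 * (indicator {a i..b i} z * (1 / z)))" unfolding T_def .
      next
        show "p \<le> a i + e m - e m" "p \<le> b i - e m - e m" "a i + e m + e m \<le> q" "b i - e m + e m \<le> q" if "i \<in> I" for i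
          using p(2)[OF that] q[OF that] elim that by (auto simp: field_simps)
      qed auto
    qed
  qed
qed simp

text \<open>Testing one coordinate with the coefficients (\<Delta> . e) / L turns the duality bound
  into S^2 <= energy S, hence S <= energy. Summation over the coordinates gives the factor
  \<open>DIM('a)\<close>.\<close>

lemma prof_energy:
  assumes "finite I" and ab: "\<And>i. i \<in> I \<Longrightarrow> 0 < a i" "\<And>i. i \<in> I \<Longrightarrow> a i < b i"
    and disj: "\<And>i j. i \<in> I \<Longrightarrow> j \<in> I \<Longrightarrow> i \<noteq> j \<Longrightarrow> b i \<le> a j \<or> b j \<le> a i"
  shows "(\<Sum>i\<in>I. (norm (prof (a i) - prof (b i)))\<^sup>2 / ln (b i / a i)) \<le> real DIM('a) * energy"
proof -
  define \<Delta> where "\<Delta> i = prof (a i) - prof (b i)" for i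
  define L where "L i = ln (b i / a i)" for i
  have L: "0 < L i" if "i \<in> I" for i using ab[OF that] by (simp add: L_def)
  have comp: "(\<Sum>i\<in>I. (\<Delta> i \<bullet> e)\<^sup>2 / L i) \<le> energy" if e: "e \<in> Basis" for e :: 'a
  proof -
    define S where "S = (\<Sum>i\<in>I. (\<Delta> i \<bullet> e)\<^sup>2 / L i)"
    define c where "c i = (\<Delta> i \<bullet> e) / L i" for i
    have "S = (\<Sum>i\<in>I. c i *\<^sub>R \<Delta> i) \<bullet> e"
      by (simp add: S_def c_def inner_sum_left power2_eq_square)
    also have "\<dots> \<le> norm (\<Sum>i\<in>I. c i *\<^sub>R \<Delta> i)"
      using Basis_le_norm[OF e, of "\<Sum>i\<in>I. c i *\<^sub>R \<Delta> i"] by linarith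
    finally have le: "S \<le> norm (\<Sum>i\<in>I. c i *\<^sub>R \<Delta> i)" .
    have S0: "0 \<le> S" unfolding S_def using L by (intro sum_nonneg) (simp add: less_imp_le)
    have "S\<^sup>2 \<le> (norm (\<Sum>i\<in>I. c i *\<^sub>R \<Delta> i))\<^sup>2" by (rule power_mono[OF le S0])
    also have "\<dots> \<le> energy * (\<Sum>i\<in>I. (c i)\<^sup>2 * L i)"
      unfolding \<Delta>_def L_def by (rule prof_combination_bound[OF assms])
    also have "(\<Sum>i\<in>I. (c i)\<^sup>2 * L i) = S"
      unfolding S_def
    proof (rule sum.cong[OF refl])
      fix i assume "i \<in> I"
      then show "(c i)\<^sup>2 * L i = (\<Delta> i \<bullet> e)\<^sup>2 / L i" using L[of i] by (simp add: c_def power2_eq_square)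
    qed
    finally have "S * S \<le> energy * S" by (simp add: power2_eq_square)
    then show ?thesis using S0 energy_nonneg unfolding S_def[symmetric] by (cases "S = 0") auto
  qed
  have "(\<Sum>i\<in>I. (norm (\<Delta> i))\<^sup>2 / L i) = (\<Sum>e\<in>Basis. \<Sum>i\<in>I. (\<Delta> i \<bullet> e)\<^sup>2 / L i)"
  proof (subst sum.swap, rule sum.cong[OF refl])
    fix i
    have "(norm (\<Delta> i))\<^sup>2 = (\<Sum>e\<in>Basis. (\<Delta> i \<bullet> e)\<^sup>2)"
      unfolding power2_norm_eq_inner by (subst euclidean_inner) (simp add: power2_eq_square)
    then show "(norm (\<Delta> i))\<^sup>2 / L i = (\<Sum>e\<in>Basis. (\<Delta> i \<bullet> e)\<^sup>2 / L i)" by (simp add: sum_divide_distrib)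
  qed
  also have "\<dots> \<le> (\<Sum>e\<in>(Basis :: 'a set). energy)" by (rule sum_mono[OF comp])
  finally show ?thesis by (simp add: \<Delta>_def L_def)
qed

end

section \<open>Radial functions coincide with their profile\<close>

lemma sigma_finite_lebesgue: "sigma_finite_measure (lebesgue :: 'm::euclidean_space measure)"
proof
  from sigma_finite_measure.sigma_finite_countable[OF sigma_finite_lborel]
  obtain A :: "'m set set" where A: "countable A \<and> A \<subseteq> sets lborel \<and> \<Union>A = space lborel \<and> (\<forall>a\<in>A. emeasure lborel a \<noteq> \<infinity>)"
    by (rule exE)
  then show "\<exists>A. countable A \<and> A \<subseteq> sets (lebesgue :: 'm measure) \<and> \<Union>A = space lebesgue \<and>
      (\<forall>a\<in>A. emeasure lebesgue a \<noteq> \<infinity>)"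
    by (intro exI[of _ A]) (auto simp: subset_iff)
qed

lemma radial_pairing_radial:
  fixes F :: "real \<Rightarrow> 'a::euclidean_space"
  assumes [measurable]: "F \<in> borel_measurable borel" "h \<in> borel_measurable borel"
    and h0: "\<And>z. z \<le> 0 \<Longrightarrow> h z = 0"
  shows "radial_pairing (\<lambda>x. F (x \<bullet> x)) h = (LINT z|lborel. h z *\<^sub>R F z)"
    and "integrable lborel (\<lambda>z. h z *\<^sub>R F z) \<Longrightarrow> integrable lebesgue (\<lambda>x::real^4. (h (x \<bullet> x) / (x \<bullet> x)) *\<^sub>R F (x \<bullet> x))"
proof -
  have eq: "(\<lambda>z. (pi\<^sup>2 * z * indicator {0..} z) *\<^sub>R ((h z / z) *\<^sub>R F z)) = (\<lambda>z. pi\<^sup>2 *\<^sub>R (h z *\<^sub>R F z))"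
    using h0 by (auto simp: fun_eq_iff split: split_indicator)
  have [measurable]: "(\<lambda>x::real^4. (h (x \<bullet> x) / (x \<bullet> x)) *\<^sub>R F (x \<bullet> x)) \<in> borel_measurable borel" by measurable
  have m: "(\<lambda>z. (h z / z) *\<^sub>R F z) \<in> borel_measurable borel" by measurable
  have "(LINT x|lebesgue. (h (x \<bullet> x) / (x \<bullet> x)) *\<^sub>R F (x \<bullet> (x::real^4)))
      = (LINT x|lborel. (h (x \<bullet> x) / (x \<bullet> x)) *\<^sub>R F (x \<bullet> (x::real^4)))"
    by (rule integral_completion) measurable
  also have "\<dots> = pi\<^sup>2 *\<^sub>R (LINT z|lborel. h z *\<^sub>R F z)"
    unfolding polar_integral(1)[OF m] eq by (rule integral_scaleR_right)
  finally show "radial_pairing (\<lambda>x. F (x \<bullet> x)) h = (LINT z|lborel. h z *\<^sub>R F z)"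
    by (simp add: radial_pairing_def)
  assume "integrable lborel (\<lambda>z. h z *\<^sub>R F z)"
  then have "integrable lborel (\<lambda>x::real^4. (h (x \<bullet> x) / (x \<bullet> x)) *\<^sub>R F (x \<bullet> x))"
    unfolding polar_integral(2)[OF m] eq by (intro integrable_scaleR_right)
  then show "integrable lebesgue (\<lambda>x::real^4. (h (x \<bullet> x) / (x \<bullet> x)) *\<^sub>R F (x \<bullet> x))"
    by (subst integrable_completion) auto
qed

section \<open>Smoothing of radial weights and passage to the limit\<close>

context mollifier
begin

text \<open>Convolution with the mollifier of width \<epsilon>, written after substitution so that
  the probability weight \<open>\<rho>\<close> stays fixed while \<epsilon> varies.\<close>

definition smoothen :: "real \<Rightarrow> (real \<Rightarrow> real) \<Rightarrow> real \<Rightarrow> real" where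
  "smoothen \<epsilon> h z = (LINT t|lborel. \<rho> t * h (z - \<epsilon> * t))"

lemma smoothen_measurable [measurable]:
  assumes [measurable]: "h \<in> borel_measurable borel"
  shows "smoothen \<epsilon> h \<in> borel_measurable borel"
  unfolding smoothen_def[abs_def] by measurable

lemma smoothen_integrable:
  assumes [measurable]: "h \<in> borel_measurable borel" and B: "\<And>z. \<bar>h z\<bar> \<le> B"
  shows "integrable lborel (\<lambda>t. \<rho> t * h (z - \<epsilon> * t))"
  by (rule Bochner_Integration.integrable_bound[OF integrable_mult_right[OF rho_integrable, of B]])
    (use B rho_nonneg order_trans[OF abs_ge_zero B] in
      \<open>auto simp: abs_mult mult.commute[of B] intro!: AE_I2 mult_left_mono\<close>)

lemma smoothen_bounded:
  assumes [measurable]: "h \<in> borel_measurable borel" and B: "\<And>z. \<bar>h z\<bar> \<le> B"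
  shows "\<bar>smoothen \<epsilon> h z\<bar> \<le> B"
proof -
  have "\<bar>smoothen \<epsilon> h z\<bar> \<le> (LINT t|lborel. \<bar>\<rho> t * h (z - \<epsilon> * t)\<bar>)"
    unfolding smoothen_def by (rule integral_abs_bound)
  also have "\<dots> \<le> (LINT t|lborel. \<rho> t * B)"
  proof (rule integral_mono)
    show "integrable lborel (\<lambda>t. \<bar>\<rho> t * h (z - \<epsilon> * t)\<bar>)"
      using integrable_abs[OF smoothen_integrable[OF assms]] .
  qed (use B rho_nonneg rho_integrable in \<open>auto simp: abs_mult intro!: mult_left_mono\<close>)
  also have "\<dots> = B" by (simp add: rho_integral)
  finally show ?thesis .
qed

lemma smoothen_eq_0:
  assumes "0 < \<epsilon>" "\<And>z. z < p \<Longrightarrow> h z = 0" "\<And>z. q < z \<Longrightarrow> h z = 0" "z < p - \<epsilon> \<or> q + \<epsilon> < z"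
  shows "smoothen \<epsilon> h z = 0"
proof -
  have "\<rho> t * h (z - \<epsilon> * t) = 0" for t
  proof (cases "\<bar>t\<bar> \<le> 1")
    case True
    then have "\<bar>\<epsilon> * t\<bar> \<le> \<epsilon> * 1" unfolding abs_mult using assms(1) by (intro mult_mono) auto
    then have "z - \<epsilon> * t < p \<or> q < z - \<epsilon> * t" using assms(4) by linarith
    then show ?thesis using assms(2,3) by auto
  qed (use rho_eq_0 in simp)
  then show ?thesis unfolding smoothen_def by (simp only: integral_zero)
qed

lemma smoothen_tendsto:
  assumes h: "continuous_on UNIV h" and B: "\<And>z. \<bar>h z\<bar> \<le> B" and "e \<longlonglongrightarrow> 0"
  shows "(\<lambda>m. smoothen (e m) h z) \<longlonglongrightarrow> h z"
proof -
  note [measurable] = borel_measurable_continuous_onI[OF h]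
  have "(\<lambda>m. smoothen (e m) h z) \<longlonglongrightarrow> (LINT t|lborel. \<rho> t * h z)"
    unfolding smoothen_def
  proof (rule integral_dominated_convergence[where w = "\<lambda>t. B * \<rho> t"])
    show "AE t in lborel. (\<lambda>m. \<rho> t * h (z - e m * t)) \<longlonglongrightarrow> \<rho> t * h z"
    proof (rule AE_I2)
      fix t
      have "(\<lambda>m. z - e m * t) \<longlonglongrightarrow> z - 0 * t" by (intro tendsto_intros assms)
      then have "(\<lambda>m. h (z - e m * t)) \<longlonglongrightarrow> h z"
        by (intro continuous_on_tendsto_compose[OF h]) auto
      then show "(\<lambda>m. \<rho> t * h (z - e m * t)) \<longlonglongrightarrow> \<rho> t * h z" by (intro tendsto_intros)
    qed
    show "AE t in lborel. norm (\<rho> t * h (z - e m * t)) \<le> B * \<rho> t" for m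
      using B rho_nonneg by (auto simp: abs_mult mult.commute[of B] intro!: AE_I2 mult_left_mono)
  qed (use rho_integrable in auto)
  then show ?thesis by (simp add: rho_integral)
qed

lemma smoothen_eq:
  assumes "0 < \<epsilon>"
  shows "(LINT a|lborel. \<rho> ((z - a) / \<epsilon>) / \<epsilon> * h a) = smoothen \<epsilon> h z"
    and "integrable lborel (\<lambda>t. \<rho> t * h (z - \<epsilon> * t)) \<Longrightarrow> integrable lborel (\<lambda>a. \<rho> ((z - a) / \<epsilon>) / \<epsilon> * h a)"
proof -
  have e: "(\<lambda>t. \<rho> ((z - (z + - \<epsilon> * t)) / \<epsilon>) / \<epsilon> * h (z + - \<epsilon> * t)) = (\<lambda>t. (\<rho> t * h (z - \<epsilon> * t)) / \<epsilon>)"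
    using assms by (simp add: fun_eq_iff)
  have "(LINT a|lborel. \<rho> ((z - a) / \<epsilon>) / \<epsilon> * h a) = \<bar>- \<epsilon>\<bar> *\<^sub>R (LINT t|lborel. \<rho> ((z - (z + - \<epsilon> * t)) / \<epsilon>) / \<epsilon> * h (z + - \<epsilon> * t))"
    by (rule lborel_integral_real_affine) (use assms in simp)
  also have "\<dots> = smoothen \<epsilon> h z" unfolding e smoothen_def using assms by simp
  finally show "(LINT a|lborel. \<rho> ((z - a) / \<epsilon>) / \<epsilon> * h a) = smoothen \<epsilon> h z" .
  assume i: "integrable lborel (\<lambda>t. \<rho> t * h (z - \<epsilon> * t))"
  have "integrable lborel (\<lambda>t. \<rho> ((z - (z + - \<epsilon> * t)) / \<epsilon>) / \<epsilon> * h (z + - \<epsilon> * t))"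
    unfolding e using i by simp
  then show "integrable lborel (\<lambda>a. \<rho> ((z - a) / \<epsilon>) / \<epsilon> * h a)"
    using lborel_integrable_real_affine_iff[of "- \<epsilon>" "\<lambda>a. \<rho> ((z - a) / \<epsilon>) / \<epsilon> * h a" z] assms by simp
qed

end

context H2_function
begin

text \<open>Fubini: pairing \<open>u\<close> with a smoothed weight amounts to smoothing the
  spherical means and integrating them against the original weight.\<close>

lemma radial_pairing_smoothen:
  assumes [measurable]: "h \<in> borel_measurable borel" and B: "\<And>z. \<bar>h z\<bar> \<le> B"
    and h0: "\<And>z. z < p \<Longrightarrow> h z = 0" "\<And>z. q < z \<Longrightarrow> h z = 0" and \<epsilon>: "0 < \<epsilon>" "\<epsilon> < p"
  shows "radial_pairing u (smoothen \<epsilon> h) = (LINT a|lborel. h a *\<^sub>R mol \<epsilon> a)"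
    and "integrable lborel (\<lambda>a. h a *\<^sub>R mol \<epsilon> a)"
proof -
  interpret pair_sigma_finite "lebesgue :: (real^4) measure" "lborel :: real measure"
    by (intro pair_sigma_finite.intro sigma_finite_lebesgue sigma_finite_lborel)
  have [measurable]: "u \<in> borel_measurable lebesgue" using u_L2 by (simp add: L2_def)
  have [measurable]: "(\<lambda>x::real^4. x \<bullet> x) \<in> borel_measurable lebesgue" by (simp add: measurable_completion)
  define k where "k x a = (\<rho> ((x \<bullet> x - a) / \<epsilon>) / \<epsilon> * h a / (x \<bullet> x)) *\<^sub>R u x" for x a
  have k_meas [measurable]: "case_prod k \<in> borel_measurable (lebesgue \<Otimes>\<^sub>M lborel)"
    unfolding k_def[abs_def] by measurable
  have slice: "(LINT a|lborel. k x a) = (smoothen \<epsilon> h (x \<bullet> x) / (x \<bullet> x)) *\<^sub>R u x" "integrable lborel (k x)" for x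
  proof -
    have i: "integrable lborel (\<lambda>a. \<rho> ((x \<bullet> x - a) / \<epsilon>) / \<epsilon> * h a)"
      by (rule smoothen_eq(2)[OF \<epsilon>(1) smoothen_integrable[OF _ B]]) measurable
    then show "integrable lborel (k x)" unfolding k_def[abs_def] by (intro integrable_scaleR_left integrable_divide) simp
    show "(LINT a|lborel. k x a) = (smoothen \<epsilon> h (x \<bullet> x) / (x \<bullet> x)) *\<^sub>R u x"
    proof -
      have "(LINT a|lborel. k x a) = (LINT a|lborel. \<rho> ((x \<bullet> x - a) / \<epsilon>) / \<epsilon> * h a / (x \<bullet> x)) *\<^sub>R u x"
        unfolding k_def by (rule integral_scaleR_left) (intro integrable_divide i)
      then show ?thesis by (simp only: integral_divide_zero smoothen_eq(1)[OF \<epsilon>(1)])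
    qed
  qed
  \<comment> \<open>The absolute inner integral is the same expression with |h|, so joint
    integrability reduces to the integrability of one radial pairing.\<close>
  have nslice: "(LINT a|lborel. norm (k x a)) = norm ((smoothen \<epsilon> (\<lambda>z. \<bar>h z\<bar>) (x \<bullet> x) / (x \<bullet> x)) *\<^sub>R u x)" for x
  proof -
    have "(LINT a|lborel. norm (k x a)) = (LINT a|lborel. (\<rho> ((x \<bullet> x - a) / \<epsilon>) / \<epsilon> * \<bar>h a\<bar>) * (norm (u x) / (x \<bullet> x)))"
      unfolding k_def using rho_nonneg \<epsilon>(1)
      by (intro Bochner_Integration.integral_cong refl) (simp add: abs_mult)
    also have "\<dots> = smoothen \<epsilon> (\<lambda>z. \<bar>h z\<bar>) (x \<bullet> x) * (norm (u x) / (x \<bullet> x))"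
      by (simp only: integral_mult_left_zero smoothen_eq(1)[OF \<epsilon>(1), of "x \<bullet> x" "\<lambda>z. \<bar>h z\<bar>"])
    also have "0 \<le> smoothen \<epsilon> (\<lambda>z. \<bar>h z\<bar>) (x \<bullet> x)"
      unfolding smoothen_def using rho_nonneg by (intro Bochner_Integration.integral_nonneg) simp
    then have "smoothen \<epsilon> (\<lambda>z. \<bar>h z\<bar>) (x \<bullet> x) * (norm (u x) / (x \<bullet> x)) = norm ((smoothen \<epsilon> (\<lambda>z. \<bar>h z\<bar>) (x \<bullet> x) / (x \<bullet> x)) *\<^sub>R u x)"
      by simp
    finally show ?thesis .
  qed
  have p: "0 < p - \<epsilon>" using \<epsilon> by simp
  have int: "integrable (lebesgue \<Otimes>\<^sub>M lborel) (case_prod k)"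
  proof (rule Fubini_integrable)
    have "integrable lebesgue (\<lambda>x. (smoothen \<epsilon> (\<lambda>z. \<bar>h z\<bar>) (x \<bullet> x) / (x \<bullet> x)) *\<^sub>R u x)"
      by (rule radial_pairing_integrable[OF u_L2 smoothen_measurable smoothen_bounded p, where q = "q + \<epsilon>"])
        (use B h0 \<epsilon> in \<open>auto intro: smoothen_eq_0[of \<epsilon> p _ q]\<close>)
    then show "integrable lebesgue (\<lambda>x. LINT a|lborel. norm (case (x, a) of (x, a) \<Rightarrow> k x a))"
      unfolding prod.case nslice by (rule integrable_norm)
    show "AE x in lebesgue. integrable lborel (\<lambda>a. case (x, a) of (x, a) \<Rightarrow> k x a)"
      using slice(2) by simp
  qed measurable
  have mol: "(LINT x|lebesgue. k x a) = pi\<^sup>2 *\<^sub>R (h a *\<^sub>R mol \<epsilon> a)" for a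
  proof -
    have "(LINT x|lebesgue. k x a) = (LINT x|lebesgue. h a *\<^sub>R ((\<rho> ((x \<bullet> x - a) / \<epsilon>) / \<epsilon> / (x \<bullet> x)) *\<^sub>R u x))"
      unfolding k_def by (intro Bochner_Integration.integral_cong refl) simp
    also have "\<dots> = h a *\<^sub>R (LINT x|lebesgue. (\<rho> ((x \<bullet> x - a) / \<epsilon>) / \<epsilon> / (x \<bullet> x)) *\<^sub>R u x)"
      by (rule integral_scaleR_right)
    finally show ?thesis by (simp add: mol_def radial_pairing_def)
  qed
  have "(LINT a|lborel. LINT x|lebesgue. k x a) = (LINT x|lebesgue. LINT a|lborel. k x a)"
    by (rule Fubini_integral[OF int])
  then have "pi\<^sup>2 *\<^sub>R (LINT a|lborel. h a *\<^sub>R mol \<epsilon> a) = (LINT x|lebesgue. (smoothen \<epsilon> h (x \<bullet> x) / (x \<bullet> x)) *\<^sub>R u x)"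
    unfolding mol slice integral_scaleR_right .
  then show "radial_pairing u (smoothen \<epsilon> h) = (LINT a|lborel. h a *\<^sub>R mol \<epsilon> a)"
    by (simp add: radial_pairing_def flip: \<open>pi\<^sup>2 *\<^sub>R _ = _\<close>)
  have "integrable lborel (\<lambda>a. LINT x|lebesgue. k x a)" using integrable_snd[OF int] by simp
  then have "integrable lborel (\<lambda>a. (1 / pi\<^sup>2) *\<^sub>R (pi\<^sup>2 *\<^sub>R (h a *\<^sub>R mol \<epsilon> a)))"
    unfolding mol by (rule integrable_scaleR_right)
  then show "integrable lborel (\<lambda>a. h a *\<^sub>R mol \<epsilon> a)" by simp
qed

lemma prof_continuous: "continuous_on {0<..} prof"
  unfolding continuous_on_eq_continuous_at[OF open_greaterThan]
proof
  fix a :: real assume "a \<in> {0<..}"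
  then have "0 < a" by simp
  have lim: "((\<lambda>t. sqrt (energy * ln (max t a / min t a))) \<longlongrightarrow> sqrt (energy * ln (max a a / min a a))) (at a)"
    using \<open>0 < a\<close> by (intro tendsto_intros) auto
  have "((\<lambda>t. prof t - prof a) \<longlongrightarrow> 0) (at a)"
  proof (rule Lim_null_comparison)
    show "((\<lambda>t. sqrt (energy * ln (max t a / min t a))) \<longlongrightarrow> 0) (at a)" using lim \<open>0 < a\<close> by simp
    have "\<forall>\<^sub>F t in at a. 0 < t" using \<open>0 < a\<close> by (intro order_tendstoD(1)[OF tendsto_ident_at])
    then show "\<forall>\<^sub>F t in at a. norm (prof t - prof a) \<le> sqrt (energy * ln (max t a / min t a))"
    proof eventually_elim
      case (elim t)
      show ?case
        using prof_hoelder[of t a] prof_hoelder[of a t] elim \<open>0 < a\<close>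
        by (intro real_le_rsqrt, cases "t \<le> a") (auto simp: norm_minus_commute max_def min_def)
    qed
  qed
  then show "isCont prof a" unfolding isCont_def by (rule LIM_zero_cancel)
qed

text \<open>Spherical means make sense only for z > 0; the value 0 elsewhere gives a Borel function
  on the whole line.\<close>

definition prof0 :: "real \<Rightarrow> 'a" where
  "prof0 z = (if 0 < z then prof z else 0)"

lemma prof0_measurable [measurable]: "prof0 \<in> borel_measurable borel"
proof -
  have "prof0 = (\<lambda>z. indicator {0<..} z *\<^sub>R prof z)" by (auto simp: prof0_def fun_eq_iff)
  then show ?thesis using borel_measurable_continuous_on_indicator[OF _ prof_continuous] by simp
qed

lemma prof_bounded_on:
  assumes "0 < p"
  obtains B where "\<And>z. p \<le> z \<Longrightarrow> z \<le> q \<Longrightarrow> norm (prof z) \<le> B"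
proof -
  have "compact (prof ` {p..q})"
    by (intro compact_continuous_image continuous_on_subset[OF prof_continuous]) (use assms in auto)
  then have "bounded (prof ` {p..q})" by (rule compact_imp_bounded)
  then obtain B where "\<forall>x\<in>prof ` {p..q}. norm x \<le> B" unfolding bounded_iff by blast
  then show thesis by (intro that[of B]) auto
qed

lemma pairing_prof0_integrable:
  assumes [measurable]: "h \<in> borel_measurable borel" and B: "\<And>z. \<bar>h z\<bar> \<le> B" and "0 < p"
    and h0: "\<And>z. z < p \<Longrightarrow> h z = 0" "\<And>z. q < z \<Longrightarrow> h z = 0"
  shows "integrable lborel (\<lambda>z. h z *\<^sub>R prof0 z)"
proof -
  obtain C where C: "\<And>z. p \<le> z \<Longrightarrow> z \<le> q \<Longrightarrow> norm (prof z) \<le> C" using prof_bounded_on[OF \<open>0 < p\<close>, of q] by blast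
  show ?thesis
  proof (rule Bochner_Integration.integrable_bound[where f = "\<lambda>z. B * C * indicator {p..q} z"])
    show "integrable lborel (\<lambda>z. B * C * indicator {p..q} z)"
      by (intro integrable_mult_right integrable_real_indicator) (auto simp: emeasure_lborel_Icc_eq)
    show "AE z in lborel. norm (h z *\<^sub>R prof0 z) \<le> norm (B * C * indicator {p..q} z)"
    proof (rule AE_I2)
      fix z show "norm (h z *\<^sub>R prof0 z) \<le> norm (B * C * indicator {p..q} z)"
      proof (cases "z \<in> {p..q}")
        case True
        then have "norm (h z *\<^sub>R prof0 z) \<le> B * C"
          using B[of z] C[of z] \<open>0 < p\<close> unfolding norm_scaleR prof0_def by (intro mult_mono) auto
        then show ?thesis using True by simp
      qed (use h0 in \<open>auto simp: not_le\<close>)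
    qed
  qed measurable
qed

text \<open>Both sides of \<open>radial_pairing_smoothen\<close> converge as the width tends to 0:
  \<open>smoothen\<close> to \<open>h\<close>, and \<open>mol\<close> to
  \<open>prof\<close>.\<close>

lemma radial_pairing_continuous:
  assumes h: "continuous_on UNIV h" and B: "\<And>z. \<bar>h z\<bar> \<le> B" and "0 < p"
    and h0: "\<And>z. z < p \<Longrightarrow> h z = 0" "\<And>z. q < z \<Longrightarrow> h z = 0"
  shows "radial_pairing u h = (LINT z|lborel. h z *\<^sub>R prof0 z)"
proof -
  note [measurable] = borel_measurable_continuous_onI[OF h]
  have [measurable]: "u \<in> borel_measurable lebesgue" using u_L2 by (simp add: L2_def)
  have [measurable]: "(\<lambda>x::real^4. x \<bullet> x) \<in> borel_measurable lebesgue" by (simp add: measurable_completion)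
  have B0: "0 \<le> B" using order_trans[OF abs_ge_zero B] .
  define e where "e m = p / 2 * inverse (real (Suc m))" for m
  have e_pos: "0 < e m" for m using \<open>0 < p\<close> by (simp add: e_def)
  have e_less: "e m \<le> p / 2" for m
    using \<open>0 < p\<close> unfolding e_def by (intro mult_left_le) (auto simp: inverse_le_1_iff)
  have e0: "e \<longlonglongrightarrow> 0"
    using tendsto_mult_left[OF LIMSEQ_inverse_real_of_nat, of "p / 2"] by (simp add: e_def[abs_def])
  have lim1: "(\<lambda>m. radial_pairing u (smoothen (e m) h)) \<longlonglongrightarrow> radial_pairing u h"
    unfolding radial_pairing_def
  proof (intro tendsto_intros integral_dominated_convergence)
    let ?w = "\<lambda>x::real^4. norm (((B * indicator {p / 2..q + p / 2} (x \<bullet> x)) / (x \<bullet> x)) *\<^sub>R u x)"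
    show "integrable lebesgue ?w"
      by (intro integrable_norm radial_pairing_integrable[OF u_L2, where B = B and p = "p / 2" and q = "q + p / 2"])
        (use B0 \<open>0 < p\<close> in \<open>auto split: split_indicator\<close>)
    show "AE x in lebesgue. (\<lambda>m. (smoothen (e m) h (x \<bullet> x) / (x \<bullet> x)) *\<^sub>R u x) \<longlonglongrightarrow> (h (x \<bullet> x) / (x \<bullet> x)) *\<^sub>R u x"
      unfolding divide_inverse by (intro AE_I2 tendsto_intros smoothen_tendsto[OF h B e0])
    show "AE x in lebesgue. norm ((smoothen (e m) h (x \<bullet> x) / (x \<bullet> x)) *\<^sub>R u x) \<le> ?w x" for m
    proof (rule AE_I2)
      fix x :: "real^4"
      have "\<bar>smoothen (e m) h (x \<bullet> x)\<bar> \<le> B * indicator {p / 2..q + p / 2} (x \<bullet> x)"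
      proof (cases "x \<bullet> x \<in> {p / 2..q + p / 2}")
        case False
        then have "x \<bullet> x < p - e m \<or> q + e m < x \<bullet> x" using e_less[of m] by (auto simp: not_le)
        then have "smoothen (e m) h (x \<bullet> x) = 0" by (intro smoothen_eq_0[OF e_pos h0])
        then show ?thesis by (simp add: B0)
      qed (use smoothen_bounded[OF _ B] in simp)
      then have "\<bar>smoothen (e m) h (x \<bullet> x)\<bar> / (x \<bullet> x) * norm (u x) \<le> (B * indicator {p / 2..q + p / 2} (x \<bullet> x)) / (x \<bullet> x) * norm (u x)"
        by (intro mult_right_mono divide_right_mono) auto
      then show "norm ((smoothen (e m) h (x \<bullet> x) / (x \<bullet> x)) *\<^sub>R u x) \<le> ?w x"
        using B0 by (simp add: abs_mult)
    qed
  qed measurable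
  obtain C where C: "\<And>z. p \<le> z \<Longrightarrow> z \<le> q \<Longrightarrow> norm (prof z) \<le> C" using prof_bounded_on[OF \<open>0 < p\<close>, of q] by blast
  \<comment> \<open>Bound for \<open>mol (e m) z\<close> with z in {p..q}: the width is at most p /
    2, so {p / 4..q + p} contains both \<open>z\<close> and the support of the mollifier.\<close>
  define C' where "C' = C + sqrt (energy * ln ((q + p) / (p / 4)))"
  have eq: "radial_pairing u (smoothen (e m) h) = (LINT a|lborel. h a *\<^sub>R mol (e m) a)"
    and int: "integrable lborel (\<lambda>a. h a *\<^sub>R mol (e m) a)" for m
    using radial_pairing_smoothen[OF _ B h0 e_pos[of m]] e_less[of m] \<open>0 < p\<close> by auto
  have lim2: "(\<lambda>m. LINT a|lborel. h a *\<^sub>R mol (e m) a) \<longlonglongrightarrow> (LINT z|lborel. h z *\<^sub>R prof0 z)"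
  proof (rule integral_dominated_convergence[where w = "\<lambda>z. B * C' * indicator {p..q} z"])
    show "integrable lborel (\<lambda>z. B * C' * indicator {p..q} z)"
      by (intro integrable_mult_right integrable_real_indicator) (auto simp: emeasure_lborel_Icc_eq)
    show "(\<lambda>a. h a *\<^sub>R mol (e m) a) \<in> borel_measurable lborel" for m using int[of m] by auto
    show "AE z in lborel. (\<lambda>m. h z *\<^sub>R mol (e m) z) \<longlonglongrightarrow> h z *\<^sub>R prof0 z"
    proof (rule AE_I2)
      fix z show "(\<lambda>m. h z *\<^sub>R mol (e m) z) \<longlonglongrightarrow> h z *\<^sub>R prof0 z"
      proof (cases "p \<le> z")
        case True
        then show ?thesis using \<open>0 < p\<close>
          by (auto simp: prof0_def intro!: tendsto_intros mol_tendsto_prof e_pos e0)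
      qed (use h0 in simp)
    qed
    show "AE z in lborel. norm (h z *\<^sub>R mol (e m) z) \<le> B * C' * indicator {p..q} z" for m
    proof (rule AE_I2)
      fix z show "norm (h z *\<^sub>R mol (e m) z) \<le> B * C' * indicator {p..q} z"
      proof (cases "z \<in> {p..q}")
        case True
        have "(norm (mol (e m) z - prof z))\<^sup>2 \<le> energy * ln ((q + p) / (p / 4))"
          by (rule mol_prof_close[OF e_pos]) (use True \<open>0 < p\<close> e_less[of m] in auto)
        then have "norm (mol (e m) z - prof z) \<le> sqrt (energy * ln ((q + p) / (p / 4)))" by (rule real_le_rsqrt)
        then have "norm (mol (e m) z) \<le> C'"
          using C[of z] True norm_triangle_sub[of "mol (e m) z" "prof z"] by (simp add: C'_def)
        then have "norm (h z *\<^sub>R mol (e m) z) \<le> B * C'"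
          unfolding norm_scaleR using B[of z] B0 by (intro mult_mono) auto
        then show ?thesis using True by simp
      qed (use h0 in \<open>auto simp: not_le\<close>)
    qed
  qed measurable
  show ?thesis using LIMSEQ_unique[OF lim1] lim2 unfolding eq by blast
qed

text \<open>A radial function differing from \<open>prof0 (\<bar>x\<bar>\<^sup>2)\<close> on a set of positive measure differs from it
  on all spheres \<open>\<bar>x\<bar>\<^sup>2 \<in> B\<close> for some compact \<open>B\<close>; no measurability of the radial profile is needed.\<close>

lemma radial_pairing_compact:
  assumes "compact B" "B \<subseteq> {p..q}" "0 < p"
  shows "radial_pairing u (indicator B) = (LINT z|lborel. indicator B z *\<^sub>R prof0 z)"
proof (cases "B = {}")
  case True
  then show ?thesis by (simp add: radial_pairing_def)
next
  case False
  have [measurable]: "B \<in> sets borel" using assms(1) by (simp add: compact_imp_closed)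
  have [measurable]: "u \<in> borel_measurable lebesgue" using u_L2 by (simp add: L2_def)
  have [measurable]: "(\<lambda>x::real^4. x \<bullet> x) \<in> borel_measurable lebesgue" by (simp add: measurable_completion)
  \<comment> \<open>Continuous cut-offs decreasing to the indicator of \<open>B\<close>. Their slope
    is at least 2 / p, so they vanish at distance p / 2 from \<open>B\<close> and stay away from
    0.\<close>
  define h where "h m z = max 0 (1 - (real m + 2 / p) * infdist z B)" for m z
  have cont: "continuous_on UNIV (h m)" for m
    unfolding h_def[abs_def] by (intro continuous_intros)
  note [measurable] = borel_measurable_continuous_onI[OF cont]
  have bound: "\<bar>h m z\<bar> \<le> 1" for m z using \<open>0 < p\<close> infdist_nonneg[of z B] by (simp add: h_def)
  have h0: "h m z = 0" if "z < p / 2 \<or> q + p / 2 < z" for m z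
  proof -
    obtain b where b: "b \<in> B" "infdist z B = dist z b"
      using infdist_attains_inf[OF compact_imp_closed[OF assms(1)] False, of z] by blast
    have "b \<in> {p..q}" using assms(2) b(1) by blast
    then have "p \<le> b" "b \<le> q" by auto
    then have "p / 2 \<le> infdist z B" unfolding b(2) dist_real_def using that by linarith
    then have "(2 / p) * (p / 2) \<le> (real m + 2 / p) * infdist z B"
      using \<open>0 < p\<close> by (intro mult_mono) auto
    then show ?thesis using \<open>0 < p\<close> by (simp add: h_def)
  qed
  have lim: "(\<lambda>m. h m z) \<longlonglongrightarrow> indicator B z" for z
  proof (cases "z \<in> B")
    case True
    then have "h m z = 1" for m by (simp add: h_def)
    then show ?thesis using True by simp
  next
    case zB: False
    then have pos: "0 < infdist z B"
      using infdist_pos_not_in_closed[OF compact_imp_closed[OF assms(1)] False] by blast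
    obtain M :: nat where M: "1 / infdist z B < real M" using reals_Archimedean2 by blast
    have "\<forall>\<^sub>F m in sequentially. h m z = 0"
      using eventually_ge_at_top[of M]
    proof eventually_elim
      case (elim m)
      have "1 = (1 / infdist z B) * infdist z B" using pos by simp
      also have "\<dots> \<le> (real m + 2 / p) * infdist z B"
      proof (rule mult_right_mono)
        have "real M \<le> real m" "0 < 2 / p" using elim \<open>0 < p\<close> by auto
        then show "1 / infdist z B \<le> real m + 2 / p" using M by linarith
      qed (use pos in simp)
      finally show ?case by (simp add: h_def)
    qed
    then show ?thesis using zB by (simp add: tendsto_eventually)
  qed
  have p2: "0 < p / 2" using \<open>0 < p\<close> by simp
  have "indicator {p / 2..q + p / 2} \<in> borel_measurable (borel :: real measure)" by measurable
  note ind = this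
  have bound': "\<bar>h m z\<bar> \<le> indicator {p / 2..q + p / 2} z" for m z
    using bound[of m z] h0[of z m] by (cases "z \<in> {p / 2..q + p / 2}") (auto simp: not_le)
  have lim1: "(\<lambda>m. radial_pairing u (h m)) \<longlonglongrightarrow> radial_pairing u (indicator B)"
    unfolding radial_pairing_def
  proof (intro tendsto_intros integral_dominated_convergence)
    let ?w = "\<lambda>x::real^4. norm ((indicator {p / 2..q + p / 2} (x \<bullet> x) / (x \<bullet> x)) *\<^sub>R u x)"
    show "integrable lebesgue ?w"
      by (intro integrable_norm radial_pairing_integrable[OF u_L2 ind, where B = 1 and p = "p / 2" and q = "q + p / 2"])
        (use p2 in \<open>auto split: split_indicator\<close>)
    show "AE x in lebesgue. (\<lambda>m. (h m (x \<bullet> x) / (x \<bullet> x)) *\<^sub>R u x) \<longlonglongrightarrow> (indicator B (x \<bullet> x) / (x \<bullet> x)) *\<^sub>R u x"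
      unfolding divide_inverse by (intro AE_I2 tendsto_intros lim)
    show "AE x in lebesgue. norm ((h m (x \<bullet> x) / (x \<bullet> x)) *\<^sub>R u x) \<le> ?w x" for m
    proof (rule AE_I2)
      fix x :: "real^4"
      have "\<bar>h m (x \<bullet> x)\<bar> / (x \<bullet> x) * norm (u x) \<le> indicator {p / 2..q + p / 2} (x \<bullet> x) / (x \<bullet> x) * norm (u x)"
        using bound'[of m "x \<bullet> x"] by (intro mult_right_mono divide_right_mono) auto
      then show "norm ((h m (x \<bullet> x) / (x \<bullet> x)) *\<^sub>R u x) \<le> ?w x" by (simp add: abs_mult)
    qed
  qed measurable
  have lim2: "(\<lambda>m. LINT z|lborel. h m z *\<^sub>R prof0 z) \<longlonglongrightarrow> (LINT z|lborel. indicator B z *\<^sub>R prof0 z)"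
  proof (rule integral_dominated_convergence[where w = "\<lambda>z. norm ((indicator {p / 2..q + p / 2} z :: real) *\<^sub>R prof0 z)"])
    show "integrable lborel (\<lambda>z. norm ((indicator {p / 2..q + p / 2} z :: real) *\<^sub>R prof0 z))"
      by (intro integrable_norm pairing_prof0_integrable[OF ind, where B = 1 and p = "p / 2" and q = "q + p / 2"])
        (use p2 in \<open>auto split: split_indicator\<close>)
    show "AE z in lborel. (\<lambda>m. h m z *\<^sub>R prof0 z) \<longlonglongrightarrow> indicator B z *\<^sub>R prof0 z"
      by (intro AE_I2 tendsto_intros lim)
    show "AE z in lborel. norm (h m z *\<^sub>R prof0 z) \<le> norm ((indicator {p / 2..q + p / 2} z :: real) *\<^sub>R prof0 z)" for m
    proof (rule AE_I2)
      fix z show "norm (h m z *\<^sub>R prof0 z) \<le> norm ((indicator {p / 2..q + p / 2} z :: real) *\<^sub>R prof0 z)"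
        unfolding norm_scaleR by (intro mult_right_mono order_trans[OF bound']) auto
    qed
  qed measurable
  have "radial_pairing u (h m) = (LINT z|lborel. h m z *\<^sub>R prof0 z)" for m
    by (rule radial_pairing_continuous[OF cont bound p2]) (use h0 in auto)
  then show ?thesis using LIMSEQ_unique[OF lim1] lim2 by simp
qed

text \<open>If a component of the difference had a strict sign on a non-null part of a shell, this
  sign would persist on almost all points of the spheres over a compact set of squared radii, while
  the weighted integrals of \<open>u\<close> and of its profile over these spheres agree.\<close>

lemma AE_eq_prof0:
  assumes "radial u"
  shows "AE x in lebesgue. u x = prof0 (x \<bullet> x)"
proof -
  obtain g where g: "AE x in lebesgue. u x = g (norm x)" using assms unfolding radial_def by blast
  obtain N where N: "N \<in> null_sets lebesgue" "\<And>x. x \<notin> N \<Longrightarrow> u x = g (norm x)"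
    using AE_E3[OF g] by (auto simp: subset_iff)
  have [measurable]: "u \<in> borel_measurable lebesgue" using u_L2 by (simp add: L2_def)
  have sq [measurable]: "(\<lambda>x::real^4. x \<bullet> x) \<in> borel_measurable lebesgue" by (simp add: measurable_completion)
  have [measurable]: "(\<lambda>x. prof0 (x \<bullet> x)) \<in> borel_measurable (lebesgue :: (real^4) measure)" by measurable
  have [measurable]: "N \<in> sets lebesgue" using N(1) by auto
  have nonpos: "AE x in lebesgue. \<not> (x \<bullet> x \<in> {p..q} \<and> 0 < s * ((u x - prof0 (x \<bullet> x)) \<bullet> e))"
    if "0 < p" for p q s and e :: 'a
  proof (rule ccontr)
    assume not_AE: "\<not> ?thesis"
    define Q where "Q = {x \<in> space lebesgue. x \<bullet> x \<in> {p..q} \<and> 0 < s * ((u x - prof0 (x \<bullet> x)) \<bullet> e)}"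
    have Q: "Q \<in> sets lebesgue" unfolding Q_def by measurable
    define P where "P = Q - N"
    have PD: "x \<bullet> x \<in> {p..q}" "0 < s * ((u x - prof0 (x \<bullet> x)) \<bullet> e)" "x \<notin> N" if "x \<in> P" for x
      using that unfolding P_def Q_def by blast+
    have P: "P \<in> sets lebesgue" unfolding P_def using Q N(1) by blast
    note [measurable] = P
    have P0: "emeasure lebesgue P \<noteq> 0"
    proof
      assume "emeasure lebesgue P = 0"
      then have "P \<in> null_sets lebesgue" using P by blast
      then have null: "P \<union> N \<in> null_sets lebesgue" using N(1) by (rule null_sets.Un)
      have "AE x in lebesgue. \<not> (x \<bullet> x \<in> {p..q} \<and> 0 < s * ((u x - prof0 (x \<bullet> x)) \<bullet> e))"
        by (rule AE_I'[OF null]) (auto simp: P_def Q_def)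
      with not_AE show False by (rule notE)
    qed
    then have "0 < emeasure lebesgue P" by (simp add: zero_less_iff_neq_zero)
    then obtain \<delta> where \<delta>: "0 < \<delta>" "ennreal \<delta> \<le> emeasure lebesgue P"
    proof (cases "emeasure lebesgue P")
      case (real r)
      then show ?thesis using that[of r] \<open>0 < emeasure lebesgue P\<close> by simp
    next
      case top
      then show ?thesis using that[of 1] by simp
    qed
    \<comment> \<open>Inner regularity supplies a closed, hence compact, subset. Its image under
      \<open>x \<bullet> x\<close> is compact and thus Borel, which is not clear for the image of
      \<open>P\<close>.\<close>
    obtain T where T: "closed T" "T \<subseteq> P" "emeasure lebesgue (P - T) < ennreal \<delta>"
      by (rule sets_lebesgue_inner_closed[OF P \<delta>(1)])
    have [measurable]: "T \<in> sets lebesgue" using T(1) by auto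
    have "emeasure lebesgue P \<le> emeasure lebesgue (P - T) + emeasure lebesgue T"
    proof -
      have "P \<subseteq> (P - T) \<union> T" by blast
      then have "emeasure lebesgue P \<le> emeasure lebesgue ((P - T) \<union> T)" by (rule emeasure_mono) auto
      also have "\<dots> \<le> emeasure lebesgue (P - T) + emeasure lebesgue T" by (rule emeasure_subadditive) auto
      finally show ?thesis .
    qed
    then have T0: "emeasure lebesgue T \<noteq> 0" using T(3) \<delta>(2) by auto
    have "bounded T"
      unfolding bounded_iff
    proof (intro exI ballI)
      fix x assume "x \<in> T"
      then have "x \<bullet> x \<le> q" using T(2) PD(1)[of x] by auto
      then show "norm x \<le> sqrt q" by (simp add: norm_eq_sqrt_inner)
    qed
    then have "compact T" using T(1) by (simp add: compact_eq_bounded_closed)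
    define B where "B = (\<lambda>x. x \<bullet> x) ` T"
    have B: "compact B" "B \<subseteq> {p..q}"
      unfolding B_def using T(2) PD(1)
      by (intro compact_continuous_image continuous_intros \<open>compact T\<close>, blast)
    have [measurable]: "B \<in> sets borel" using B(1) by (simp add: compact_imp_closed)
    \<comment> \<open>Off the null set \<open>N\<close> the function depends on the norm only, so
      one point of \<open>T\<close> decides the sign on its sphere.\<close>
    have sphere: "0 < s * ((u x - prof0 (x \<bullet> x)) \<bullet> e)" if "x \<bullet> x \<in> B" "x \<notin> N" for x
    proof -
      obtain y where y: "y \<in> T" "x \<bullet> x = y \<bullet> y" using \<open>x \<bullet> x \<in> B\<close> by (auto simp: B_def)
      then have "y \<in> P" using T(2) by blast
      have "y \<notin> N" by (rule PD(3)[OF \<open>y \<in> P\<close>])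
      have "norm x = norm y" using y(2) by (simp add: norm_eq_sqrt_inner)
      then have "u x = u y" using N(2)[OF that(2)] N(2)[OF \<open>y \<notin> N\<close>] by simp
      then show ?thesis using PD(2)[OF \<open>y \<in> P\<close>] y(2) by simp
    qed
    let ?k = "\<lambda>x::real^4. indicator B (x \<bullet> x) / (x \<bullet> x) :: real"
    have ind0: "indicator B z = (0::real)" if "z < p \<or> q < z" for z
      using B(2) that by (auto split: split_indicator)
    have i1: "integrable lebesgue (\<lambda>x. ?k x *\<^sub>R u x)"
      by (rule radial_pairing_integrable[OF u_L2 _ _ \<open>0 < p\<close>, where B = 1 and q = q])
        (use ind0 in \<open>auto split: split_indicator\<close>)
    have i2: "integrable lborel (\<lambda>z. indicator B z *\<^sub>R prof0 z)"
      by (rule pairing_prof0_integrable[OF _ _ \<open>0 < p\<close>, where B = 1 and q = q])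
        (use ind0 in \<open>auto split: split_indicator\<close>)
    have B0: "indicator B z = (0::real)" if "z \<le> 0" for z using ind0[of z] that \<open>0 < p\<close> by simp
    have "radial_pairing (\<lambda>x. prof0 (x \<bullet> x)) (indicator B) = (LINT z|lborel. indicator B z *\<^sub>R prof0 z)"
      by (rule radial_pairing_radial(1)) (use B0 in auto)
    then have "radial_pairing u (indicator B) = radial_pairing (\<lambda>x. prof0 (x \<bullet> x)) (indicator B)"
      using radial_pairing_compact[OF B \<open>0 < p\<close>] by simp
    then have eq: "(LINT x|lebesgue. ?k x *\<^sub>R u x) = (LINT x|lebesgue. ?k x *\<^sub>R prof0 (x \<bullet> x))"
      by (simp add: radial_pairing_def)
    have i3: "integrable lebesgue (\<lambda>x::real^4. ?k x *\<^sub>R prof0 (x \<bullet> x))"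
      by (rule radial_pairing_radial(2)) (use B0 i2 in auto)
    define d where "d x = s * ((?k x *\<^sub>R u x - ?k x *\<^sub>R prof0 (x \<bullet> x)) \<bullet> e)" for x
    have d_eq: "d x = ?k x * (s * ((u x - prof0 (x \<bullet> x)) \<bullet> e))" for x
      by (simp add: d_def algebra_simps flip: scaleR_diff_right)
    have di: "integrable lebesgue d" unfolding d_def
      by (intro integrable_mult_right integrable_inner_left Bochner_Integration.integrable_diff i1 i3)
    have "(LINT x|lebesgue. d x) = s * (((LINT x|lebesgue. ?k x *\<^sub>R u x) - (LINT x|lebesgue. ?k x *\<^sub>R prof0 (x \<bullet> x))) \<bullet> e)"
      unfolding d_def using i1 i3 by (simp only: integral_mult_right_zero integral_inner_left Bochner_Integration.integrable_diff Bochner_Integration.integral_diff)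
    then have "(LINT x|lebesgue. d x) = 0" using eq by simp
    moreover have ae_N: "AE x in lebesgue. x \<notin> N" by (rule AE_not_in[OF N(1)])
    then have "AE x in lebesgue. 0 \<le> d x"
    proof eventually_elim
      case (elim x)
      show ?case using sphere[OF _ elim] unfolding d_eq by (cases "x \<bullet> x \<in> B") (auto intro: mult_nonneg_nonneg less_imp_le)
    qed
    ultimately have "AE x in lebesgue. d x = 0" using integral_nonneg_eq_0_iff_AE[OF di] by simp
    then have "AE x in lebesgue. x \<notin> T"
      using ae_N
    proof eventually_elim
      case (elim x)
      show ?case
      proof
        assume "x \<in> T"
        then have "x \<bullet> x \<in> B" by (auto simp: B_def)
        moreover have "0 < x \<bullet> x" using \<open>x \<bullet> x \<in> B\<close> B(2) \<open>0 < p\<close> by auto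
        ultimately show False using sphere[OF \<open>x \<bullet> x \<in> B\<close> elim(2)] elim(1) unfolding d_eq by auto
      qed
    qed
    then have "T \<in> null_sets lebesgue" by (subst AE_iff_null_sets) auto
    then have "emeasure lebesgue T = 0" by (rule null_setsD1)
    then show False using T0 by simp
  qed
  \<comment> \<open>Finitely many components and signs and countably many shells exhaust all points
    but the origin.\<close>
  have "AE x in lebesgue. \<forall>e\<in>Basis. \<forall>s\<in>{-1, 1::real}. \<forall>n::nat.
      \<not> (x \<bullet> x \<in> {inverse (real (Suc n))..real n} \<and> 0 < s * ((u x - prof0 (x \<bullet> x)) \<bullet> e))"
    by (intro AE_finite_allI finite_Basis AE_all_countable[THEN iffD2] allI nonpos) auto
  moreover have "AE x::real^4 in lebesgue. x \<noteq> 0"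
    using AE_not_in[of "{0::real^4}" lebesgue] by (simp add: AE_completion)
  ultimately show ?thesis
  proof eventually_elim
    case (elim x)
    have "0 < x \<bullet> x" using elim(2) by simp
    obtain n1 :: nat where n1: "inverse (real (Suc n1)) < x \<bullet> x" using reals_Archimedean[OF \<open>0 < x \<bullet> x\<close>] by blast
    obtain n2 :: nat where n2: "x \<bullet> x \<le> real n2" using real_arch_simple by blast
    define n where "n = max n1 n2"
    have "inverse (real (Suc n)) \<le> inverse (real (Suc n1))" by (rule le_imp_inverse_le) (auto simp: n_def)
    then have "inverse (real (Suc n)) \<le> x \<bullet> x" using n1 by linarith
    moreover have "real n2 \<le> real n" by (simp add: n_def)
    ultimately have n: "x \<bullet> x \<in> {inverse (real (Suc n))..real n}" using n2 by simp
    have "(u x - prof0 (x \<bullet> x)) \<bullet> e = 0" if "e \<in> Basis" for e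
      using elim(1)[rule_format, OF that, of 1 n] elim(1)[rule_format, OF that, of "-1" n] n by auto
    then have "u x - prof0 (x \<bullet> x) = 0" using euclidean_all_zero_iff by blast
    then show ?case by simp
  qed
qed

end

section \<open>Weakly null sequences\<close>

context mollifier
begin

lemma mollify_tendsto:
  fixes V :: "real \<Rightarrow> 'a::euclidean_space"
  assumes cont: "continuous_on {0<..} V" and [measurable]: "V \<in> borel_measurable borel" and "0 < a"
    and e: "\<And>m. 0 < e m" "\<And>m. e m \<le> a / 2" "e \<longlonglongrightarrow> 0"
  shows "(\<lambda>m. LINT z|lborel. (\<rho> ((z - a) / e m) / e m) *\<^sub>R V z) \<longlonglongrightarrow> V a"
proof -
  have "compact (V ` {a / 2..a + a / 2})"
    by (intro compact_continuous_image continuous_on_subset[OF cont]) (use \<open>0 < a\<close> in auto)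
  then have "bounded (V ` {a / 2..a + a / 2})" by (rule compact_imp_bounded)
  then obtain B where B: "\<forall>x\<in>V ` {a / 2..a + a / 2}. norm x \<le> B" unfolding bounded_iff by blast
  have eq: "(LINT z|lborel. (\<rho> ((z - a) / e m) / e m) *\<^sub>R V z) = (LINT t|lborel. \<rho> t *\<^sub>R V (a + e m * t))" for m
  proof -
    have "(LINT z|lborel. (\<rho> ((z - a) / e m) / e m) *\<^sub>R V z)
        = \<bar>e m\<bar> *\<^sub>R (LINT t|lborel. (\<rho> ((a + e m * t - a) / e m) / e m) *\<^sub>R V (a + e m * t))"
      by (rule lborel_integral_real_affine) (use e(1)[of m] in simp)
    also have "\<dots> = (LINT t|lborel. \<bar>e m\<bar> *\<^sub>R ((\<rho> ((a + e m * t - a) / e m) / e m) *\<^sub>R V (a + e m * t)))"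
      by (rule integral_scaleR_right[symmetric])
    also have "\<dots> = (LINT t|lborel. \<rho> t *\<^sub>R V (a + e m * t))"
      using e(1)[of m] by (intro Bochner_Integration.integral_cong refl) simp
    finally show ?thesis .
  qed
  have "(\<lambda>m. LINT t|lborel. \<rho> t *\<^sub>R V (a + e m * t)) \<longlonglongrightarrow> (LINT t|lborel. \<rho> t *\<^sub>R V a)"
  proof (rule integral_dominated_convergence[where w = "\<lambda>t. \<rho> t * B"])
    show "integrable lborel (\<lambda>t. \<rho> t * B)" by (intro integrable_mult_left) (rule rho_integrable)
    show "AE t in lborel. (\<lambda>m. \<rho> t *\<^sub>R V (a + e m * t)) \<longlonglongrightarrow> \<rho> t *\<^sub>R V a"
    proof (rule AE_I2)
      fix t
      have "(\<lambda>m. a + e m * t) \<longlonglongrightarrow> a + 0 * t" by (intro tendsto_intros e)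
      moreover have "isCont V a" using cont \<open>0 < a\<close> by (simp add: continuous_on_eq_continuous_at)
      ultimately have "(\<lambda>m. V (a + e m * t)) \<longlonglongrightarrow> V a" by (intro isCont_tendsto_compose[of a V]) simp_all
      then show "(\<lambda>m. \<rho> t *\<^sub>R V (a + e m * t)) \<longlonglongrightarrow> \<rho> t *\<^sub>R V a" by (rule tendsto_scaleR[OF tendsto_const])
    qed
    show "AE t in lborel. norm (\<rho> t *\<^sub>R V (a + e m * t)) \<le> \<rho> t * B" for m
    proof (rule AE_I2)
      fix t show "norm (\<rho> t *\<^sub>R V (a + e m * t)) \<le> \<rho> t * B"
      proof (cases "\<bar>t\<bar> \<le> 1")
        case True
        then have "\<bar>e m * t\<bar> \<le> a / 2 * 1"
          unfolding abs_mult using e(1,2)[of m] by (intro mult_mono) auto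
        then have "\<bar>e m * t\<bar> \<le> a / 2" by simp
        then have "a + e m * t \<in> {a / 2..a + a / 2}" unfolding atLeastAtMost_iff by linarith
        then have "norm (V (a + e m * t)) \<le> B" using B by blast
        then show ?thesis using rho_nonneg[of t] by (simp add: mult_left_mono)
      qed (use rho_eq_0[of t] in simp)
    qed
  qed measurable
  moreover have "(LINT t|lborel. \<rho> t *\<^sub>R V a) = V a" using rho_integrable by (simp add: rho_integral)
  ultimately show ?thesis unfolding eq by simp
qed

lemma rescaled_rho_integrable:
  fixes V :: "real \<Rightarrow> 'a::euclidean_space"
  assumes cont: "continuous_on {0<..} V" and [measurable]: "V \<in> borel_measurable borel"
    and "0 < a" "0 < \<epsilon>" "\<epsilon> \<le> a / 2"
  shows "integrable lborel (\<lambda>z. (\<rho> ((z - a) / \<epsilon>) / \<epsilon>) *\<^sub>R V z)"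
proof -
  have "compact (V ` {a - \<epsilon>..a + \<epsilon>})"
    by (intro compact_continuous_image continuous_on_subset[OF cont]) (use assms in auto)
  then have "bounded (V ` {a - \<epsilon>..a + \<epsilon>})" by (rule compact_imp_bounded)
  then obtain C where C: "\<forall>x\<in>V ` {a - \<epsilon>..a + \<epsilon>}. norm x \<le> C" unfolding bounded_iff by blast
  obtain B where B: "\<And>z. \<bar>\<rho> ((z - a) / \<epsilon>) / \<epsilon>\<bar> \<le> B"
    "\<And>z. z < a - \<epsilon> \<Longrightarrow> \<rho> ((z - a) / \<epsilon>) / \<epsilon> = 0" "\<And>z. a + \<epsilon> < z \<Longrightarrow> \<rho> ((z - a) / \<epsilon>) / \<epsilon> = 0"
    using rescaled_rho[OF \<open>0 < \<epsilon>\<close>] by blast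
  show ?thesis
  proof (rule Bochner_Integration.integrable_bound[where f = "\<lambda>z. B * C * indicator {a - \<epsilon>..a + \<epsilon>} z"])
    show "integrable lborel (\<lambda>z. B * C * indicator {a - \<epsilon>..a + \<epsilon>} z)"
      by (intro integrable_mult_right integrable_real_indicator) (auto simp: emeasure_lborel_Icc_eq)
    show "AE z in lborel. norm ((\<rho> ((z - a) / \<epsilon>) / \<epsilon>) *\<^sub>R V z) \<le> norm (B * C * indicator {a - \<epsilon>..a + \<epsilon>} z)"
    proof (rule AE_I2)
      fix z show "norm ((\<rho> ((z - a) / \<epsilon>) / \<epsilon>) *\<^sub>R V z) \<le> norm (B * C * indicator {a - \<epsilon>..a + \<epsilon>} z)"
      proof (cases "z \<in> {a - \<epsilon>..a + \<epsilon>}")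
        case True
        then have "norm (V z) \<le> C" using C by blast
        then have "norm ((\<rho> ((z - a) / \<epsilon>) / \<epsilon>) *\<^sub>R V z) \<le> B * C"
          unfolding norm_scaleR real_norm_def using B(1)[of z] order_trans[OF abs_ge_zero B(1)[of z]]
          by (intro mult_mono) auto
        then show ?thesis using True by simp
      next
        case False
        then have "\<rho> ((z - a) / \<epsilon>) / \<epsilon> = 0" using B(2,3)[of z] by (auto simp: not_le)
        then show ?thesis by (simp only: scaleR_zero_left norm_zero norm_ge_zero)
      qed
    qed
  qed measurable
qed

text \<open>For \<open>V\<close> square integrable with weight \<open>z\<close>, the equation \<open>4 V' = z\<^sup>-\<^sup>2 \<integral>\<^sub>0\<^sup>z y V(y) dy\<close>, which is \<open>\<Delta>u = u\<close> for
  \<open>u x = V (\<bar>x\<bar>\<^sup>2)\<close>, forces \<open>V = 0\<close>: with \<open>M z = \<integral>\<^sub>0\<^sup>z y V(y) dy\<close>, the product \<open>M \<bullet> V\<close> is nondecreasing from \<open>0\<close>, and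
  were it positive somewhere then \<open>z \<bar>V\<bar>\<^sup>2\<close> would dominate a multiple of \<open>1 / z\<close> at infinity.\<close>

lemma radial_eigenfunction_eq_0:
  fixes V :: "real \<Rightarrow> 'a::euclidean_space"
  assumes cont: "continuous_on {0<..} V" and V0: "\<And>z. z \<le> 0 \<Longrightarrow> V z = 0"
    and bound: "\<And>z. 0 < z \<Longrightarrow> norm (V z) \<le> A + sqrt (E * (z + 1 / z))" and AE: "0 \<le> A" "0 \<le> E"
    and L2: "integrable lborel (\<lambda>z. z * (norm (V z))\<^sup>2)"
    and eq: "\<And>H \<eta> p q. smooth H \<Longrightarrow> 0 < p \<Longrightarrow> p \<le> q \<Longrightarrow> (\<And>z. z \<le> p \<Longrightarrow> H z = 0) \<Longrightarrow> (\<And>z. q \<le> z \<Longrightarrow> H z = 0) \<Longrightarrow>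
      smooth \<eta> \<Longrightarrow> (\<And>z. (\<eta> has_real_derivative H z / z / z) (at z)) \<Longrightarrow> (\<And>z. q \<le> z \<Longrightarrow> \<eta> z = 0) \<Longrightarrow>
      (\<And>z. 8 * deriv \<eta> z + 4 * z * deriv (deriv \<eta>) z = 4 * (deriv H z / z)) \<Longrightarrow>
      (LINT z|lborel. (z * \<eta> z) *\<^sub>R V z) = 4 *\<^sub>R (LINT z|lborel. deriv H z *\<^sub>R V z)"
  shows "V z = 0"
proof -
  have V_borel [measurable]: "V \<in> borel_measurable borel"
  proof -
    have "V z = indicator {0<..} z *\<^sub>R V z" for z using V0[of z] by (cases "z \<le> 0") auto
    then have "V = (\<lambda>z. indicator {0<..} z *\<^sub>R V z)" by (rule ext)
    then show ?thesis using borel_measurable_continuous_on_indicator[OF _ cont] by simp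
  qed
  define f where "f z = z *\<^sub>R V z" for z
  \<comment> \<open>The right-hand side tends to 0 at the origin, so \<open>f\<close> is continuous
    on the closed half-line and its integral \<open>M\<close> can start from 0.\<close>
  have f_bound: "norm (f z) \<le> A * z + sqrt (E * (z ^ 3 + z))" if "0 \<le> z" for z
  proof (cases "z = 0")
    case False
    then have "0 < z" using that by simp
    have "norm (f z) \<le> z * (A + sqrt (E * (z + 1 / z)))"
      using bound[OF \<open>0 < z\<close>] \<open>0 < z\<close> by (simp add: f_def)
    also have "\<dots> = A * z + sqrt (z\<^sup>2 * (E * (z + 1 / z)))"
      unfolding real_sqrt_mult[of "z\<^sup>2"] using \<open>0 < z\<close> by (simp only: real_sqrt_abs distrib_left) simp
    also have "z\<^sup>2 * (E * (z + 1 / z)) = E * (z ^ 3 + z)"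
      using \<open>0 < z\<close> by (simp add: field_simps power2_eq_square power3_eq_cube)
    finally show ?thesis .
  qed (simp add: f_def)
  have f_cont: "continuous_on {0..} f"
    unfolding continuous_on_eq_continuous_within
  proof
    fix z :: real assume "z \<in> {0..}"
    show "continuous (at z within {0..}) f"
    proof (cases "z = 0")
      case True
      have "((\<lambda>z. A * z + sqrt (E * (z ^ 3 + z))) \<longlongrightarrow> A * 0 + sqrt (E * (0 ^ 3 + 0))) (at 0 within {0..})"
        by (intro tendsto_intros)
      then have "(f \<longlongrightarrow> 0) (at 0 within {0..})"
        by (intro Lim_null_comparison[of f "\<lambda>z. A * z + sqrt (E * (z ^ 3 + z))"])
          (auto simp: eventually_at_filter f_bound)
      then show ?thesis by (simp add: continuous_within True f_def)
    next
      case False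
      then have "0 < z" using \<open>z \<in> {0..}\<close> by simp
      then have "isCont V z" using cont by (simp add: continuous_on_eq_continuous_at)
      then have "isCont f z" unfolding f_def[abs_def] by (intro isCont_scaleR continuous_ident)
      then show ?thesis by (rule continuous_at_imp_continuous_at_within)
    qed
  qed
  define M where "M y = integral {0..y} f" for y
  have M_deriv: "(M has_vector_derivative f y) (at y)" if "0 < y" for y
  proof -
    have "(M has_vector_derivative f y) (at y within {0..2 * y})"
      unfolding M_def[abs_def]
      by (rule integral_has_vector_derivative[OF continuous_on_subset[OF f_cont]]) (use that in auto)
    then show ?thesis using at_within_interior[of y "{0..2 * y}"] that by simp
  qed
  have M0: "M 0 = 0" by (simp add: M_def)
  have M_cont: "continuous_on {0..} M"
    unfolding continuous_on_eq_continuous_within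
  proof
    fix z :: real assume "z \<in> {0..}"
    have "(M has_vector_derivative f z) (at z within {0..z + 1})"
      unfolding M_def[abs_def]
      by (rule integral_has_vector_derivative[OF continuous_on_subset[OF f_cont]]) (use \<open>z \<in> {0..}\<close> in auto)
    then have c: "continuous (at z within {0..z + 1}) M" by (rule has_vector_derivative_continuous)
    have "at z within {0..z + 1} = at z within {0..}"
      by (rule at_within_nhd[of z "{..<z + 1}"]) auto
    then show "continuous (at z within {0..}) M" using c by simp
  qed
  \<comment> \<open>Testing with mollified indicators of \<open>{a..b}\<close> gives the integrated equation.\<close>
  have V_diff: "V b - V a = integral {a..b} (\<lambda>z. (1 / (4 * z\<^sup>2)) *\<^sub>R M z)" if "0 < a" "a < b" for a b
  proof -
    obtain \<Phi> where \<Phi>: "smooth \<Phi>" "\<And>z. (\<Phi> has_real_derivative \<rho> z) (at z)"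
      "\<And>z. z \<le> -1 \<Longrightarrow> \<Phi> z = 0" "\<And>z. 1 \<le> z \<Longrightarrow> \<Phi> z = 1" "\<And>z. 0 \<le> \<Phi> z" "\<And>z. \<Phi> z \<le> 1"
      using smooth_step by blast
    define e where "e m = a / 2 * inverse (real (Suc m))" for m
    have e_pos: "0 < e m" for m using that by (simp add: e_def)
    have e_le: "e m \<le> a / 2" for m
      using that unfolding e_def by (intro mult_left_le) (auto simp: inverse_le_1_iff)
    have e_le': "e m \<le> b / 2" for m using e_le[of m] that by linarith
    have e0: "e \<longlonglongrightarrow> 0"
      using tendsto_mult_left[OF LIMSEQ_inverse_real_of_nat, of "a / 2"] by (simp add: e_def[abs_def])
    define p where "p = a / 2"
    define q where "q = b + a / 2"
    have pq: "0 < p" "p \<le> q" using that by (auto simp: p_def q_def)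
    define H where "H m z = \<Phi> ((z - a) / e m) - \<Phi> ((z - b) / e m)" for m z
    have H: "smooth (H m)" for m unfolding H_def[abs_def] by (intro smooth_diff smooth_affine \<Phi>(1))
    have H0: "H m z = 0" if "z \<le> p" for m z
    proof -
      have "(z - a) / e m \<le> -1" "(z - b) / e m \<le> -1"
        using that e_le[of m] e_pos[of m] \<open>a < b\<close> by (simp_all add: divide_le_eq p_def)
      then show ?thesis using \<Phi>(3) by (simp add: H_def)
    qed
    have H1: "H m z = 0" if "q \<le> z" for m z
    proof -
      have "1 \<le> (z - a) / e m" "1 \<le> (z - b) / e m"
        using that e_le[of m] e_pos[of m] \<open>a < b\<close> by (simp_all add: le_divide_eq q_def)
      then show ?thesis using \<Phi>(4) by (simp add: H_def)
    qed
    have H_le: "\<bar>H m z\<bar> \<le> 1" for m z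
      using \<Phi>(5,6)[of "(z - a) / e m"] \<Phi>(5,6)[of "(z - b) / e m"] unfolding H_def by linarith
    have dH: "deriv (H m) z = \<rho> ((z - a) / e m) / e m - \<rho> ((z - b) / e m) / e m" for m z
      unfolding H_def by (intro DERIV_imp_deriv DERIV_diff rescaled_step_deriv e_pos \<Phi>(2))
    \<comment> \<open>Integration by parts with M' = f and \<eta>' = H / z^2; the boundary terms
      vanish because \<open>M 0 = 0\<close> and \<open>\<eta> q = 0\<close>.\<close>
    have weak: "4 *\<^sub>R (LINT z|lborel. deriv (H m) z *\<^sub>R V z) = - integral {0..q} (\<lambda>z. (H m z / z / z) *\<^sub>R M z)" for m
    proof -
      obtain \<eta> where \<eta>: "smooth \<eta>" "\<And>z. (\<eta> has_real_derivative H m z / z / z) (at z)" "\<And>z. q \<le> z \<Longrightarrow> \<eta> z = 0"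
        "\<And>z. 8 * deriv \<eta> z + 4 * z * deriv (deriv \<eta>) z = 4 * (deriv (H m) z / z)"
        using radial_potential[OF H pq(1) H0 H1] by metis
      have "4 *\<^sub>R (LINT z|lborel. deriv (H m) z *\<^sub>R V z) = (LINT z|lborel. (z * \<eta> z) *\<^sub>R V z)"
        by (rule eq[symmetric, OF H pq H0 H1 \<eta>])
      also have "\<dots> = (LINT z:{0..q}|lborel. \<eta> z *\<^sub>R f z)"
        unfolding set_lebesgue_integral_def f_def
        by (rule Bochner_Integration.integral_cong[OF refl])
          (use \<eta>(3) V0 in \<open>auto simp: not_le mult.commute split: split_indicator\<close>)
      also have "\<dots> = integral {0..q} (\<lambda>z. \<eta> z *\<^sub>R f z)"
        by (intro set_borel_integral_eq_integral borel_integrable_atLeastAtMost' continuous_intros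
            continuous_on_subset[OF smooth_imp_continuous[OF \<eta>(1)]] continuous_on_subset[OF f_cont]) auto
      also have "\<dots> = - integral {0..q} (\<lambda>z. (H m z / z / z) *\<^sub>R M z)"
      proof -
        have "((\<lambda>z. \<eta> z *\<^sub>R f z + (H m z / z / z) *\<^sub>R M z) has_integral (\<eta> q *\<^sub>R M q - \<eta> 0 *\<^sub>R M 0)) {0..q}"
        proof (rule fundamental_theorem_of_calculus_interior)
          show "continuous_on {0..q} (\<lambda>z. \<eta> z *\<^sub>R M z)"
            by (intro continuous_intros continuous_on_subset[OF smooth_imp_continuous[OF \<eta>(1)]] continuous_on_subset[OF M_cont]) auto
          show "((\<lambda>z. \<eta> z *\<^sub>R M z) has_vector_derivative \<eta> z *\<^sub>R f z + (H m z / z / z) *\<^sub>R M z) (at z)"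
            if "z \<in> {0<..<q}" for z
            using that by (intro has_vector_derivative_scaleR \<eta>(2) M_deriv) auto
        qed (use pq in simp)
        then have I: "((\<lambda>z. \<eta> z *\<^sub>R f z + (H m z / z / z) *\<^sub>R M z) has_integral 0) {0..q}" using \<eta>(3) M0 by simp
        have i1: "(\<lambda>z. \<eta> z *\<^sub>R f z) integrable_on {0..q}"
          by (intro integrable_continuous_interval continuous_intros
              continuous_on_subset[OF smooth_imp_continuous[OF \<eta>(1)]] continuous_on_subset[OF f_cont]) auto
        have "((\<lambda>z. (\<eta> z *\<^sub>R f z + (H m z / z / z) *\<^sub>R M z) - \<eta> z *\<^sub>R f z) has_integral 0 - integral {0..q} (\<lambda>z. \<eta> z *\<^sub>R f z)) {0..q}"
          by (intro has_integral_diff I integrable_integral i1)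
        then have "((\<lambda>z. (H m z / z / z) *\<^sub>R M z) has_integral - integral {0..q} (\<lambda>z. \<eta> z *\<^sub>R f z)) {0..q}" by simp
        then show ?thesis by (simp add: integral_unique)
      qed
      finally show ?thesis .
    qed
    have lim1: "(\<lambda>m. 4 *\<^sub>R (LINT z|lborel. deriv (H m) z *\<^sub>R V z)) \<longlonglongrightarrow> 4 *\<^sub>R (V a - V b)"
    proof -
      have "(LINT z|lborel. deriv (H m) z *\<^sub>R V z)
          = (LINT z|lborel. (\<rho> ((z - a) / e m) / e m) *\<^sub>R V z) - (LINT z|lborel. (\<rho> ((z - b) / e m) / e m) *\<^sub>R V z)" for m
        unfolding dH scaleR_diff_left using that
        by (intro Bochner_Integration.integral_diff rescaled_rho_integrable[OF cont V_borel] e_pos e_le e_le') auto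
      moreover have "(\<lambda>m. (LINT z|lborel. (\<rho> ((z - a) / e m) / e m) *\<^sub>R V z) - (LINT z|lborel. (\<rho> ((z - b) / e m) / e m) *\<^sub>R V z)) \<longlonglongrightarrow> V a - V b"
        using that by (intro tendsto_diff mollify_tendsto[OF cont V_borel] e_pos e_le e_le' e0) auto
      ultimately show ?thesis by (simp add: tendsto_scaleR)
    qed
    \<comment> \<open>The smooth indicators tend to the indicator of {a..b}, up to the values that
      the smooth step leaves at the two end points.\<close>
    define k where "k z = (if z = a then \<Phi> 0 else if z = b then 1 - \<Phi> 0 else if a < z \<and> z < b then 1 else 0)" for z
    have scale_lim: "(\<lambda>m. \<Phi> ((z - c) / e m)) \<longlonglongrightarrow> (if z < c then 0 else if z = c then \<Phi> 0 else 1)" for z c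
    proof (cases "z = c")
      case False
      have "\<forall>\<^sub>F m in sequentially. e m < \<bar>z - c\<bar>" using False by (intro order_tendstoD[OF e0]) simp
      then have "\<forall>\<^sub>F m in sequentially. \<Phi> ((z - c) / e m) = (if z < c then 0 else 1)"
      proof eventually_elim
        case (elim m)
        show ?case
        proof (cases "z < c")
          case True
          then have "(z - c) / e m \<le> -1" using elim e_pos[of m] by (simp add: divide_le_eq)
          then show ?thesis using True \<Phi>(3) by simp
        next
          case nless: False
          then have "1 \<le> (z - c) / e m" using elim e_pos[of m] by (simp add: le_divide_eq)
          then show ?thesis using nless \<Phi>(4) by simp
        qed
      qed
      then have "(\<lambda>m. \<Phi> ((z - c) / e m)) \<longlonglongrightarrow> (if z < c then 0 else 1)" by (rule tendsto_eventually)
      then show ?thesis using False by (cases "z < c") simp_all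
    qed simp
    have H_lim: "(\<lambda>m. H m z) \<longlonglongrightarrow> k z" for z
    proof -
      have "(\<lambda>m. H m z) \<longlonglongrightarrow> (if z < a then 0 else if z = a then \<Phi> 0 else 1) - (if z < b then 0 else if z = b then \<Phi> 0 else 1)"
        unfolding H_def by (intro tendsto_diff scale_lim)
      moreover have "(if z < a then 0 else if z = a then \<Phi> 0 else 1) - (if z < b then 0 else if z = b then \<Phi> 0 else 1) = k z"
        using \<open>a < b\<close> by (auto simp: k_def)
      ultimately show ?thesis by simp
    qed
    have lim2: "(\<lambda>m. integral {0..q} (\<lambda>z. (H m z / z / z) *\<^sub>R M z)) \<longlonglongrightarrow> integral {0..q} (\<lambda>z. (k z / z / z) *\<^sub>R M z)"
    proof (rule dominated_convergence(2))
      show "(\<lambda>z. (H m z / z / z) *\<^sub>R M z) integrable_on {0..q}" for m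
      proof -
        have "smooth (\<lambda>z. H m z / z / z)"
          by (intro smooth_divide_away_from_0[where p = p] H pq(1)) (auto simp: H0)
        then show ?thesis
          by (intro integrable_continuous_interval continuous_intros continuous_on_subset[OF M_cont]
              continuous_on_subset[OF smooth_imp_continuous]) auto
      qed
      show "(\<lambda>z. 1 / p / p * norm (M z)) integrable_on {0..q}"
        by (intro integrable_continuous_interval continuous_intros continuous_on_subset[OF M_cont]) auto
      show "norm ((H m z / z / z) *\<^sub>R M z) \<le> 1 / p / p * norm (M z)" if "z \<in> {0..q}" for m z
      proof (cases "z \<le> p")
        case False
        then have "\<bar>H m z / z / z\<bar> \<le> 1 / p / p"
          using H_le[of m z] pq(1) by (simp add: abs_mult frac_le mult_mono)
        then show ?thesis unfolding norm_scaleR by (intro mult_right_mono) auto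
      qed (simp add: H0)
      show "(\<lambda>m. (H m z / z / z) *\<^sub>R M z) \<longlonglongrightarrow> (k z / z / z) *\<^sub>R M z" if "z \<in> {0..q}" for z
        unfolding divide_inverse by (intro tendsto_intros H_lim)
    qed
    have "integral {0..q} (\<lambda>z. (k z / z / z) *\<^sub>R M z) = integral {0..q} (\<lambda>z. if z \<in> {a..b} then (1 / z\<^sup>2) *\<^sub>R M z else 0)"
      by (rule integral_spike[of "{a, b}"]) (auto simp: k_def power2_eq_square)
    also have "\<dots> = integral {a..b} (\<lambda>z. (1 / z\<^sup>2) *\<^sub>R M z)"
    proof -
      have "{a..b} \<inter> {0..q} = {a..b}" using that by (auto simp: q_def)
      then show ?thesis unfolding integral_restrict_Int by (simp only:)
    qed
    finally have int_k: "integral {0..q} (\<lambda>z. (k z / z / z) *\<^sub>R M z) = integral {a..b} (\<lambda>z. (1 / z\<^sup>2) *\<^sub>R M z)" .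
    have "(\<lambda>m. 4 *\<^sub>R (LINT z|lborel. deriv (H m) z *\<^sub>R V z)) \<longlonglongrightarrow> - integral {a..b} (\<lambda>z. (1 / z\<^sup>2) *\<^sub>R M z)"
      unfolding weak int_k[symmetric] by (rule tendsto_minus[OF lim2])
    from LIMSEQ_unique[OF lim1 this]
    have I: "4 *\<^sub>R (V a - V b) = - integral {a..b} (\<lambda>z. (1 / z\<^sup>2) *\<^sub>R M z)" .
    have "V b - V a = (- 1 / 4) *\<^sub>R (4 *\<^sub>R (V a - V b))" by simp
    also have "\<dots> = (1 / 4) *\<^sub>R integral {a..b} (\<lambda>z. (1 / z\<^sup>2) *\<^sub>R M z)" unfolding I by simp
    also have "\<dots> = integral {a..b} (\<lambda>z. (1 / 4) *\<^sub>R ((1 / z\<^sup>2) *\<^sub>R M z))" by (rule integral_cmul[symmetric])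
    finally show ?thesis by simp
  qed
  have V_deriv: "(V has_vector_derivative (1 / (4 * y\<^sup>2)) *\<^sub>R M y) (at y)" if "0 < y" for y
  proof -
    have "continuous_on {y / 2..2 * y} (\<lambda>z. (1 / (4 * z\<^sup>2)) *\<^sub>R M z)"
      by (intro continuous_intros continuous_on_subset[OF M_cont]) (use that in auto)
    then have "((\<lambda>x. integral {y / 2..x} (\<lambda>z. (1 / (4 * z\<^sup>2)) *\<^sub>R M z)) has_vector_derivative (1 / (4 * y\<^sup>2)) *\<^sub>R M y)
        (at y within {y / 2..2 * y})"
      by (rule integral_has_vector_derivative) (use that in auto)
    then have "((\<lambda>x. integral {y / 2..x} (\<lambda>z. (1 / (4 * z\<^sup>2)) *\<^sub>R M z)) has_vector_derivative (1 / (4 * y\<^sup>2)) *\<^sub>R M y) (at y)"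
      using at_within_interior[of y "{y / 2..2 * y}"] that by simp
    then have "((\<lambda>x. V (y / 2) + integral {y / 2..x} (\<lambda>z. (1 / (4 * z\<^sup>2)) *\<^sub>R M z)) has_vector_derivative (1 / (4 * y\<^sup>2)) *\<^sub>R M y) (at y)"
      using has_vector_derivative_add[OF has_vector_derivative_const] by fastforce
    then show ?thesis
    proof (rule has_vector_derivative_transform_within_open)
      show "y \<in> {y / 2<..<2 * y}" using that by simp
      fix x assume "x \<in> {y / 2<..<2 * y}"
      then show "V (y / 2) + integral {y / 2..x} (\<lambda>z. (1 / (4 * z\<^sup>2)) *\<^sub>R M z) = V x"
        using V_diff[of "y / 2" x] that by (simp add: algebra_simps)
    qed simp
  qed
  define G where "G y = M y \<bullet> V y" for y
  have G_deriv: "(G has_real_derivative (norm (M y))\<^sup>2 / (4 * y\<^sup>2) + y * (norm (V y))\<^sup>2) (at y)" if "0 < y" for y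
  proof -
    have "(G has_vector_derivative M y \<bullet> ((1 / (4 * y\<^sup>2)) *\<^sub>R M y) + f y \<bullet> V y) (at y)"
      unfolding G_def[abs_def]
      by (rule bounded_bilinear.has_vector_derivative[OF bounded_bilinear_inner M_deriv[OF that] V_deriv[OF that]])
    then show ?thesis
      by (simp add: has_real_derivative_iff_has_vector_derivative f_def power2_norm_eq_inner)
  qed
  have G_mono: "G x \<le> G y" if "0 < x" "x \<le> y" for x y
  proof (rule DERIV_nonneg_imp_nondecreasing[OF that(2)])
    fix t assume "x \<le> t" "t \<le> y"
    then have "0 < t" using that by simp
    then show "\<exists>D. (G has_real_derivative D) (at t) \<and> 0 \<le> D"
      using G_deriv[OF \<open>0 < t\<close>] by (intro exI conjI) auto
  qed
  \<comment> \<open>Near 0 the norm of \<open>M t\<close> is at most B t, and t times the norm of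
    \<open>V t\<close> is the norm of \<open>f t\<close>, which tends to 0; hence \<open>G\<close>
    starts from 0 and increases.\<close>
  have G_nonneg: "0 \<le> G y" if "0 < y" for y
  proof -
    have "bounded (f ` {0..1})"
      by (intro compact_imp_bounded compact_continuous_image continuous_on_subset[OF f_cont]) auto
    then obtain B where B: "\<forall>x\<in>f ` {0..1}. norm x \<le> B" unfolding bounded_iff by blast
    have M_le: "norm (M t) \<le> B * (t - 0)" if "0 \<le> t" "t \<le> 1" for t
      unfolding M_def using that B
      by (intro integral_bound continuous_on_subset[OF f_cont]) auto
    have "((\<lambda>t. B * norm (f t)) \<longlongrightarrow> B * norm (f 0)) (at 0 within {0..})"
      using f_cont by (intro tendsto_intros) (simp add: continuous_on_def)
    then have "((\<lambda>t. B * norm (f t)) \<longlongrightarrow> B * norm (f 0)) (at_right 0)"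
      by (rule tendsto_within_subset) auto
    then have f0: "((\<lambda>t. B * norm (f t)) \<longlongrightarrow> 0) (at_right 0)" by (simp add: f_def)
    have "(G \<longlongrightarrow> 0) (at_right 0)"
    proof (rule Lim_null_comparison[OF _ f0])
      have "\<forall>\<^sub>F t in at_right 0. (t::real) < 1" "\<forall>\<^sub>F t in at_right 0. 0 < (t::real)"
        by (auto intro: eventually_at_rightI[of 0 1])
      then show "\<forall>\<^sub>F t in at_right 0. norm (G t) \<le> B * norm (f t)"
      proof eventually_elim
        case (elim t)
        have "norm (G t) \<le> norm (M t) * norm (V t)" unfolding G_def by (simp add: Cauchy_Schwarz_ineq2)
        also have "\<dots> \<le> B * (t - 0) * norm (V t)" using elim by (intro mult_right_mono M_le) auto
        finally show ?case using elim by (simp add: f_def mult.assoc)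
      qed
    qed
    moreover have "\<forall>\<^sub>F t in at_right 0. G t \<le> G y"
      using that by (intro eventually_at_rightI[of 0 y] G_mono) auto
    ultimately show ?thesis by (rule tendsto_upperbound) simp
  qed
  define C where "C = (LINT z|lborel. z * (norm (V z))\<^sup>2)"
  have zV: "0 \<le> z * (norm (V z))\<^sup>2" for z using V0[of z] by (cases "z \<le> 0") auto
  have C0: "0 \<le> C" unfolding C_def by (intro Bochner_Integration.integral_nonneg zV)
  define C1 where "C1 = 1 / 4 + C / 2"
  have C1: "0 < C1" using C0 by (simp add: C1_def)
  \<comment> \<open>Young's inequality with weight \<open>y\<close>: z |V| <= z / (2 y) + (y / 2) z
    |V|^2. Integration over {0..y} yields at most y / 4 + y C / 2 = \<open>C1 * y\<close>.\<close>
  have M_growth: "norm (M y) \<le> C1 * y" if "0 < y" for y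
  proof -
    have fi: "set_integrable lborel {0..y} f"
      by (intro borel_integrable_atLeastAtMost' continuous_on_subset[OF f_cont]) auto
    have li: "set_integrable lborel {0..y} (\<lambda>z. (1 / (2 * y)) * z)"
      by (intro borel_integrable_atLeastAtMost' continuous_intros)
    have "M y = (LINT z:{0..y}|lborel. f z)"
      unfolding M_def by (rule set_borel_integral_eq_integral(2)[OF fi, symmetric])
    then have "norm (M y) \<le> (LINT z|lborel. norm (indicator {0..y} z *\<^sub>R f z))"
      unfolding set_lebesgue_integral_def by (simp only: integral_norm_bound)
    also have "\<dots> \<le> (LINT z|lborel. indicator {0..y} z *\<^sub>R ((1 / (2 * y)) * z) + y / 2 * (z * (norm (V z))\<^sup>2))"
    proof (rule integral_mono)
      show "integrable lborel (\<lambda>z. norm (indicator {0..y} z *\<^sub>R f z))"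
        using fi unfolding set_integrable_def by (rule integrable_norm)
      show "integrable lborel (\<lambda>z. indicator {0..y} z *\<^sub>R ((1 / (2 * y)) * z) + y / 2 * (z * (norm (V z))\<^sup>2))"
        using li L2 unfolding set_integrable_def by (intro Bochner_Integration.integrable_add integrable_mult_right)
      fix z
      show "norm (indicator {0..y} z *\<^sub>R f z) \<le> indicator {0..y} z *\<^sub>R ((1 / (2 * y)) * z) + y / 2 * (z * (norm (V z))\<^sup>2)"
      proof (cases "z \<in> {0..y}")
        case True
        have "0 \<le> z * (1 - y * norm (V z))\<^sup>2 / (2 * y)" using True that by auto
        also have "\<dots> = (1 / (2 * y)) * z + y / 2 * (z * (norm (V z))\<^sup>2) - z * norm (V z)"
          using that by (simp add: field_simps power2_eq_square)
        finally show ?thesis using True by (simp add: f_def)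
      next
        case False
        have "0 \<le> y / 2 * (z * (norm (V z))\<^sup>2)" by (rule mult_nonneg_nonneg[OF _ zV]) (use that in simp)
        then show ?thesis using False by simp
      qed
    qed
    also have "\<dots> = (LINT z:{0..y}|lborel. (1 / (2 * y)) * z) + y / 2 * C"
      unfolding set_lebesgue_integral_def C_def using li L2 unfolding set_integrable_def
      by (subst Bochner_Integration.integral_add) auto
    also have "(LINT z:{0..y}|lborel. (1 / (2 * y)) * z) = y / 4"
      using set_borel_integral_eq_integral(2)[OF li] integral_unique[OF has_integral_linear_0[of y "1 / (2 * y)"]] that
      by (simp add: power2_eq_square)
    finally show ?thesis by (simp add: C1_def field_simps)
  qed
  have G_zero: "G y = 0" if "0 < y" for y
  proof (rule ccontr)
    assume "G y \<noteq> 0"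
    then have c: "0 < G y" using G_nonneg[OF that] by simp
    define k where "k = (G y / C1)\<^sup>2"
    have k: "0 < k" using c C1 by (simp add: k_def)
    \<comment> \<open>Monotonicity of \<open>G\<close> and linear growth of \<open>M\<close> give G
      y <= C1 z |V z| for all z >= y.\<close>
    have low: "k * (1 / z) \<le> z * (norm (V z))\<^sup>2" if "y \<le> z" for z
    proof -
      have "0 < z" using \<open>0 < y\<close> that by simp
      have "G y \<le> G z" by (rule G_mono[OF \<open>0 < y\<close> that])
      also have "\<dots> \<le> norm (M z) * norm (V z)" unfolding G_def using norm_cauchy_schwarz by blast
      also have "\<dots> \<le> C1 * z * norm (V z)" by (intro mult_right_mono M_growth \<open>0 < z\<close>) auto
      finally have "G y / C1 \<le> z * norm (V z)" using C1 by (simp add: divide_le_eq mult_ac)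
      then have "k \<le> (z * norm (V z))\<^sup>2" unfolding k_def using c C1 by (intro power_mono) auto
      then have "k / z \<le> (z * norm (V z))\<^sup>2 / z" using \<open>0 < z\<close> by (intro divide_right_mono) auto
      then show ?thesis using \<open>0 < z\<close> by (simp add: power2_eq_square mult_ac)
    qed
    \<comment> \<open>The integral of k / z over {y..y exp n} is k n, while \<open>low\<close>
      bounds it by \<open>C\<close> for every \<open>n\<close>.\<close>
    have "k * real n \<le> C" for n
    proof -
      define R where "R = y * exp (real n)"
      have R: "y \<le> R" using \<open>0 < y\<close> by (simp add: R_def)
      have si: "set_integrable lborel {y..R} (\<lambda>z. k * (1 / z))"
        by (intro borel_integrable_atLeastAtMost' continuous_intros) (use \<open>0 < y\<close> in auto)
      have "((\<lambda>z. k * (1 / z)) has_integral k * ln R - k * ln y) {y..R}"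
        by (rule fundamental_theorem_of_calculus[OF R])
          (use \<open>0 < y\<close> in \<open>auto intro!: derivative_eq_intros simp: has_real_derivative_iff_has_vector_derivative[symmetric]\<close>)
      then have "(LINT z:{y..R}|lborel. k * (1 / z)) = k * ln R - k * ln y"
        using set_borel_integral_eq_integral(2)[OF si] by (simp add: integral_unique)
      also have "\<dots> = k * real n" using \<open>0 < y\<close> by (simp add: R_def ln_mult algebra_simps)
      finally have "k * real n = (LINT z:{y..R}|lborel. k * (1 / z))" by simp
      also have "\<dots> \<le> C"
        unfolding set_lebesgue_integral_def C_def
        by (rule integral_mono) (use si L2 low zV in \<open>auto simp: set_integrable_def split: split_indicator\<close>)
      finally show ?thesis .
    qed
    moreover obtain n :: nat where "C / k < real n" using reals_Archimedean2 by blast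
    then have "C < k * real n" using k by (simp add: divide_less_eq mult.commute)
    ultimately show False by (meson not_le)
  qed
  show ?thesis
  proof (cases "z \<le> 0")
    case False
    then have "0 < z" by simp
    have "(G has_real_derivative 0) (at z)"
    proof (rule has_field_derivative_transform_within_open[of "\<lambda>_. 0" _ _ "{0<..}"])
      show "\<And>x. x \<in> {0<..} \<Longrightarrow> 0 = G x" using G_zero by simp
    qed (use \<open>0 < z\<close> in auto)
    then have "(norm (M z))\<^sup>2 / (4 * z\<^sup>2) + z * (norm (V z))\<^sup>2 = 0"
      using DERIV_unique[OF G_deriv[OF \<open>0 < z\<close>]] by blast
    moreover have "0 \<le> (norm (M z))\<^sup>2 / (4 * z\<^sup>2)" by simp
    ultimately have "z * (norm (V z))\<^sup>2 = 0" using zV[of z] by linarith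
    then show ?thesis using \<open>0 < z\<close> by simp
  qed (rule V0)
qed

end

text \<open>With the Laplacian moved to \<open>w\<close>, the functional is the integral of \<phi>
  (-\<Delta>w + w), which Cauchy-Schwarz bounds by \<open>H2_norm w\<close> directly. Testing with
  \<phi> alone would call for an estimate of the L2 norm of \<open>w\<close> by
  \<open>H2_norm w\<close>.\<close>

lemma test_functional_H2:
  assumes \<phi>: "test_function \<phi>"
  defines "\<Delta>\<phi> \<equiv> \<lambda>x. \<Sum>b\<in>Basis. frechet_derivative (\<lambda>y. frechet_derivative \<phi> (at y) b) (at x) b"
  shows "H2_functional (\<lambda>w :: real^4 \<Rightarrow> 'a::{real_normed_field, euclidean_space}.
    (LINT x|lebesgue. \<phi> x *\<^sub>R w x) - (LINT x|lebesgue. \<Delta>\<phi> x *\<^sub>R w x))"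
proof -
  have i1: "integrable lebesgue (\<lambda>x. \<phi> x *\<^sub>R w x)" if "w \<in> H2" for w :: "real^4 \<Rightarrow> 'a"
    by (rule test_function_L2(1)[OF \<phi>]) (use that in \<open>simp add: H2_def\<close>)
  have i2: "integrable lebesgue (\<lambda>x. \<Delta>\<phi> x *\<^sub>R w x)" if "w \<in> H2" for w :: "real^4 \<Rightarrow> 'a"
  proof -
    have "integrable lebesgue (\<lambda>x. \<Sum>b\<in>Basis. frechet_derivative (\<lambda>y. frechet_derivative \<phi> (at y) b) (at x) b *\<^sub>R w x)"
      using that by (intro Bochner_Integration.integrable_sum test_function_L2(1) test_function_frechet_derivative \<phi>) (simp add: H2_def)
    then show ?thesis by (simp add: \<Delta>\<phi>_def scaleR_sum_left)
  qed
  have bound: "norm ((LINT x|lebesgue. \<phi> x *\<^sub>R w x) - (LINT x|lebesgue. \<Delta>\<phi> x *\<^sub>R w x))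
      \<le> sqrt (LINT x|lebesgue. (\<phi> x)\<^sup>2) * H2_norm w" if w: "w \<in> H2" for w :: "real^4 \<Rightarrow> 'a"
  proof -
    have wl: "w \<in> L2" "weak_laplacian w \<in> L2" using w H2_weak_laplacian(1)[OF w] by (auto simp: H2_def)
    then have l2: "(\<lambda>x. - weak_laplacian w x + w x) \<in> L2" by (intro L2_add L2_uminus)
    have "(LINT x|lebesgue. \<phi> x *\<^sub>R w x) - (LINT x|lebesgue. \<Delta>\<phi> x *\<^sub>R w x)
        = (LINT x|lebesgue. \<phi> x *\<^sub>R w x) - (LINT x|lebesgue. \<phi> x *\<^sub>R weak_laplacian w x)"
      using H2_weak_laplacian(3)[OF w \<phi>] by (simp add: \<Delta>\<phi>_def)
    also have "\<dots> = (LINT x|lebesgue. \<phi> x *\<^sub>R w x - \<phi> x *\<^sub>R weak_laplacian w x)"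
      by (rule Bochner_Integration.integral_diff[symmetric]) (intro test_function_L2(1)[OF \<phi>] wl)+
    also have "\<dots> = (LINT x|lebesgue. \<phi> x *\<^sub>R (- weak_laplacian w x + w x))"
      by (simp add: scaleR_diff_right[symmetric])
    finally have "(norm ((LINT x|lebesgue. \<phi> x *\<^sub>R w x) - (LINT x|lebesgue. \<Delta>\<phi> x *\<^sub>R w x)))\<^sup>2
        \<le> (LINT x|lebesgue. (\<phi> x)\<^sup>2) * (H2_norm w)\<^sup>2"
      using test_function_L2(2)[OF \<phi> l2] by (simp add: H2_norm_def)
    then have "norm ((LINT x|lebesgue. \<phi> x *\<^sub>R w x) - (LINT x|lebesgue. \<Delta>\<phi> x *\<^sub>R w x))
        \<le> sqrt ((LINT x|lebesgue. (\<phi> x)\<^sup>2) * (H2_norm w)\<^sup>2)" by (rule real_le_rsqrt)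
    moreover have "0 \<le> H2_norm w" by (simp add: H2_norm_def L2_norm_def)
    ultimately show ?thesis by (simp add: real_sqrt_mult)
  qed
  show ?thesis
    unfolding H2_functional_def
  proof (intro conjI ballI allI exI)
    fix v w :: "real^4 \<Rightarrow> 'a" assume "v \<in> H2" "w \<in> H2"
    then show "(LINT x|lebesgue. \<phi> x *\<^sub>R (v x + w x)) - (LINT x|lebesgue. \<Delta>\<phi> x *\<^sub>R (v x + w x))
        = (LINT x|lebesgue. \<phi> x *\<^sub>R v x) - (LINT x|lebesgue. \<Delta>\<phi> x *\<^sub>R v x)
        + ((LINT x|lebesgue. \<phi> x *\<^sub>R w x) - (LINT x|lebesgue. \<Delta>\<phi> x *\<^sub>R w x))"
      using i1 i2 by (simp add: scaleR_add_right)
  next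
    fix c :: 'a and w :: "real^4 \<Rightarrow> 'a" assume "w \<in> H2"
    have "(LINT x|lebesgue. g x *\<^sub>R (c * w x)) = c * (LINT x|lebesgue. g x *\<^sub>R w x)" for g
      by (simp only: mult_scaleR_right[symmetric] integral_mult_right_zero)
    then show "(LINT x|lebesgue. \<phi> x *\<^sub>R (c * w x)) - (LINT x|lebesgue. \<Delta>\<phi> x *\<^sub>R (c * w x))
        = c * ((LINT x|lebesgue. \<phi> x *\<^sub>R w x) - (LINT x|lebesgue. \<Delta>\<phi> x *\<^sub>R w x))"
      by (simp add: right_diff_distrib)
  next
    fix w :: "real^4 \<Rightarrow> 'a" assume "w \<in> H2"
    then show "norm ((LINT x|lebesgue. \<phi> x *\<^sub>R w x) - (LINT x|lebesgue. \<Delta>\<phi> x *\<^sub>R w x))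
        \<le> sqrt (LINT x|lebesgue. (\<phi> x)\<^sup>2) * H2_norm w" by (rule bound)
  qed
qed

section \<open>Size of the profile of a radial H2 function\<close>

locale radial_H2_function = H2_function +
  assumes u_radial: "radial u"
begin

lemma L2_norm_polar:
  shows "integrable lborel (\<lambda>z. z * (norm (prof0 z))\<^sup>2)"
    and "pi\<^sup>2 * (LINT z|lborel. z * (norm (prof0 z))\<^sup>2) = (L2_norm u)\<^sup>2"
proof -
  have [measurable]: "u \<in> borel_measurable lebesgue" using u_L2 by (simp add: L2_def)
  have m1: "(\<lambda>x::real^4. (norm (prof0 (x \<bullet> x)))\<^sup>2) \<in> borel_measurable lborel" by measurable
  have m2 [measurable]: "(\<lambda>x::real^4. (norm (prof0 (x \<bullet> x)))\<^sup>2) \<in> borel_measurable lebesgue"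
    using m1 by (rule measurable_completion)
  have m3: "(\<lambda>z. (norm (prof0 z))\<^sup>2) \<in> borel_measurable borel" by measurable
  have ae: "AE x in lebesgue. (norm (u x))\<^sup>2 = (norm (prof0 (x \<bullet> x)))\<^sup>2"
    using AE_eq_prof0[OF u_radial] by eventually_elim simp
  have eq: "(\<lambda>z. (pi\<^sup>2 * z * indicator {0..} z) *\<^sub>R (norm (prof0 z))\<^sup>2) = (\<lambda>z. pi\<^sup>2 * (z * (norm (prof0 z))\<^sup>2))"
    by (auto simp: fun_eq_iff prof0_def split: split_indicator)
  have "integrable lebesgue (\<lambda>x. (norm (u x))\<^sup>2)" using u_L2 by (simp add: L2_def)
  then have "integrable lebesgue (\<lambda>x::real^4. (norm (prof0 (x \<bullet> x)))\<^sup>2)"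
    using integrable_cong_AE[OF _ m2 ae] by simp
  then have "integrable lborel (\<lambda>x::real^4. (norm (prof0 (x \<bullet> x)))\<^sup>2)"
    using integrable_completion[OF m1] by simp
  then have "integrable lborel (\<lambda>z. pi\<^sup>2 * (z * (norm (prof0 z))\<^sup>2))"
    unfolding polar_integral(2)[OF m3] eq .
  then have "integrable lborel (\<lambda>z. (1 / pi\<^sup>2) * (pi\<^sup>2 * (z * (norm (prof0 z))\<^sup>2)))" by (rule integrable_mult_right)
  then show "integrable lborel (\<lambda>z. z * (norm (prof0 z))\<^sup>2)" by simp
  have "(L2_norm u)\<^sup>2 = (LINT x|lebesgue. (norm (u x))\<^sup>2)" by (simp add: L2_norm_def)
  also have "\<dots> = (LINT x|lebesgue. (norm (prof0 (x \<bullet> (x::real^4))))\<^sup>2)"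
    by (rule integral_cong_AE[OF _ m2 ae]) measurable
  also have "\<dots> = (LINT x|lborel. (norm (prof0 (x \<bullet> (x::real^4))))\<^sup>2)" by (rule integral_completion[OF m1])
  also have "\<dots> = (LINT z|lborel. pi\<^sup>2 * (z * (norm (prof0 z))\<^sup>2))" unfolding polar_integral(1)[OF m3] eq ..
  also have "\<dots> = pi\<^sup>2 * (LINT z|lborel. z * (norm (prof0 z))\<^sup>2)" by (rule integral_mult_right_zero)
  finally show "pi\<^sup>2 * (LINT z|lborel. z * (norm (prof0 z))\<^sup>2) = (L2_norm u)\<^sup>2" by simp
qed

text \<open>A large value at \<open>z\<close> persists on {z..2 * z}, where the squared oscillation
  is at most \<open>energy\<close>. This interval has length at least 1 and would contribute too
  much to the L2 norm.\<close>

lemma prof_bound: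
  assumes "1 \<le> z"
  shows "(norm (prof z))\<^sup>2 \<le> (L2_norm u)\<^sup>2 + 2 * energy"
proof (rule ccontr)
  define c where "c = ((norm (prof z))\<^sup>2 - 2 * energy) / 2"
  define J where "J = (LINT z|lborel. z * (norm (prof0 z))\<^sup>2)"
  assume "\<not> ?thesis"
  then have big: "(L2_norm u)\<^sup>2 < 2 * c" by (simp add: c_def)
  have "0 \<le> c" using big zero_le_power2[of "L2_norm u"] by linarith
  have low: "c \<le> y * (norm (prof0 y))\<^sup>2" if "y \<in> {z..2 * z}" for y
  proof -
    have y: "1 \<le> y" "0 < y" using that assms by auto
    have "(norm (prof y - prof z))\<^sup>2 \<le> energy * ln (y / z)" by (rule prof_hoelder) (use that assms in auto)
    also have "\<dots> \<le> energy * 1"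
    proof (rule mult_left_mono[OF _ energy_nonneg])
      have "ln (y / z) \<le> y / z - 1" by (rule ln_le_minus_one) (use y assms in auto)
      also have "\<dots> \<le> 1" using that assms by (simp add: divide_le_eq)
      finally show "ln (y / z) \<le> 1" .
    qed
    finally have d: "(norm (prof z - prof y))\<^sup>2 \<le> energy" by (simp add: norm_minus_commute)
    have "(norm (prof z))\<^sup>2 \<le> (norm (prof y) + norm (prof z - prof y))\<^sup>2"
      using norm_triangle_sub[of "prof z" "prof y"] by (intro power_mono) auto
    also have "\<dots> \<le> 2 * (norm (prof y))\<^sup>2 + 2 * (norm (prof z - prof y))\<^sup>2"
      using sum_squares_bound[of "norm (prof y)" "norm (prof z - prof y)"] by (simp add: power2_sum)
    finally have "c \<le> (norm (prof y))\<^sup>2" using d by (simp add: c_def)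
    also have "\<dots> \<le> y * (norm (prof y))\<^sup>2" using y(1) mult_right_mono[of 1 y "(norm (prof y))\<^sup>2"] by simp
    finally show ?thesis using y(2) by (simp add: prof0_def)
  qed
  have nonneg: "0 \<le> y * (norm (prof0 y))\<^sup>2" for y by (auto simp: prof0_def)
  have "c * 1 \<le> c * z" using \<open>0 \<le> c\<close> assms by (intro mult_left_mono)
  also have "c * z = (LINT y|lborel. c * indicator {z..2 * z} y)" using assms by simp
  also have "\<dots> \<le> J"
    unfolding J_def
  proof (rule integral_mono[OF _ L2_norm_polar(1)])
    show "integrable lborel (\<lambda>y. c * indicator {z..2 * z} y)"
      by (intro integrable_mult_right integrable_real_indicator) (auto simp: emeasure_lborel_Icc_eq)
    show "c * indicator {z..2 * z} y \<le> y * (norm (prof0 y))\<^sup>2" for y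
      using low nonneg by (auto split: split_indicator)
  qed
  finally have "c \<le> J" by simp
  \<comment> \<open>The bound 2 <= pi^2 absorbs the factor lost in squaring the triangle
    inequality.\<close>
  moreover have "2 * J \<le> pi\<^sup>2 * J"
  proof (rule mult_right_mono)
    have "(2::real)\<^sup>2 \<le> pi\<^sup>2" using pi_ge_two by (intro power_mono) auto
    then show "2 \<le> pi\<^sup>2" by simp
    show "0 \<le> J" unfolding J_def by (intro Bochner_Integration.integral_nonneg nonneg)
  qed
  ultimately show False using big L2_norm_polar(2) unfolding J_def[symmetric] by linarith
qed

lemma prof0_growth:
  assumes "0 < z" "energy \<le> E" "(L2_norm u)\<^sup>2 \<le> M"
  shows "norm (prof0 z) \<le> sqrt (M + 2 * E) + sqrt (E * (z + 1 / z))"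
proof -
  have E0: "0 \<le> E" using energy_nonneg assms(2) by linarith
  have "(norm (prof 1))\<^sup>2 \<le> M + 2 * E" using prof_bound[of 1] assms by simp
  then have one: "norm (prof 1) \<le> sqrt (M + 2 * E)" by (rule real_le_rsqrt)
  have "(norm (prof z - prof 1))\<^sup>2 \<le> energy * \<bar>ln z\<bar>"
    using prof_hoelder[of z 1] prof_hoelder[of 1 z] \<open>0 < z\<close>
    by (cases "z \<le> 1") (auto simp: norm_minus_commute ln_div abs_if)
  also have "\<dots> \<le> E * \<bar>ln z\<bar>" using assms(2) by (rule mult_right_mono) simp
  also have "\<dots> \<le> E * (z + 1 / z)"
  proof (rule mult_left_mono[OF _ E0])
    have "ln z \<le> z - 1" by (rule ln_le_minus_one[OF \<open>0 < z\<close>])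
    moreover have "ln (1 / z) \<le> 1 / z - 1" by (rule ln_le_minus_one) (use \<open>0 < z\<close> in simp)
    moreover have "0 < 1 / z" using \<open>0 < z\<close> by simp
    moreover have "ln (1 / z) = - ln z" using \<open>0 < z\<close> by (simp add: ln_div)
    ultimately show "\<bar>ln z\<bar> \<le> z + 1 / z" using \<open>0 < z\<close> unfolding abs_le_iff by linarith
  qed
  finally have "norm (prof z - prof 1) \<le> sqrt (E * (z + 1 / z))" by (rule real_le_rsqrt)
  then show ?thesis using one norm_triangle_sub[of "prof z" "prof 1"] \<open>0 < z\<close> by (simp add: prof0_def)
qed

text \<open>The functionals of \<open>test_functional_H2\<close> in polar form: for radial \<phi>
  they depend on the profile only.\<close>

lemma test_identity:
  assumes H: "smooth H" and pq: "0 < p" "p \<le> q" and H0: "\<And>z. z \<le> p \<Longrightarrow> H z = 0" "\<And>z. q \<le> z \<Longrightarrow> H z = 0"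
    and \<eta>: "smooth \<eta>" "\<And>z. q \<le> z \<Longrightarrow> \<eta> z = 0"
      "\<And>z. 8 * deriv \<eta> z + 4 * z * deriv (deriv \<eta>) z = 4 * (deriv H z / z)"
  defines "\<phi> \<equiv> \<lambda>x::real^4. \<eta> (x \<bullet> x)"
  shows "(LINT x|lebesgue. \<phi> x *\<^sub>R u x)
      - (LINT x|lebesgue. (\<Sum>b\<in>Basis. frechet_derivative (\<lambda>y. frechet_derivative \<phi> (at y) b) (at x) b) *\<^sub>R u x)
    = pi\<^sup>2 *\<^sub>R ((LINT z|lborel. (z * \<eta> z) *\<^sub>R prof0 z) - 4 *\<^sub>R (LINT z|lborel. deriv H z *\<^sub>R prof0 z))"
proof -
  have [measurable]: "u \<in> borel_measurable lebesgue" using u_L2 by (simp add: L2_def)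
  have [measurable]: "(\<lambda>x::real^4. x \<bullet> x) \<in> borel_measurable lebesgue" by (simp add: measurable_completion)
  note [measurable] = borel_measurable_continuous_onI[OF smooth_imp_continuous[OF \<eta>(1)]]
  have m: "(\<lambda>x::real^4. \<eta> (x \<bullet> x) *\<^sub>R prof0 (x \<bullet> x)) \<in> borel_measurable lborel" by measurable
  have "(LINT x|lebesgue. \<phi> x *\<^sub>R u x) = (LINT x|lebesgue. \<eta> (x \<bullet> x) *\<^sub>R prof0 (x \<bullet> (x::real^4)))"
    unfolding \<phi>_def
  proof (rule integral_cong_AE)
    show "AE x in lebesgue. \<eta> (x \<bullet> x) *\<^sub>R u x = \<eta> (x \<bullet> x) *\<^sub>R prof0 (x \<bullet> x)"
      using AE_eq_prof0[OF u_radial] by eventually_elim simp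
  qed measurable
  also have "\<dots> = (LINT x|lborel. \<eta> (x \<bullet> x) *\<^sub>R prof0 (x \<bullet> (x::real^4)))" by (rule integral_completion[OF m])
  also have "\<dots> = (LINT z|lborel. (pi\<^sup>2 * z * indicator {0..} z) *\<^sub>R (\<eta> z *\<^sub>R prof0 z))"
    by (rule polar_integral(1)) measurable
  also have "\<dots> = (LINT z|lborel. pi\<^sup>2 *\<^sub>R ((z * \<eta> z) *\<^sub>R prof0 z))"
    by (rule Bochner_Integration.integral_cong[OF refl]) (auto simp: prof0_def split: split_indicator)
  also have "\<dots> = pi\<^sup>2 *\<^sub>R (LINT z|lborel. (z * \<eta> z) *\<^sub>R prof0 z)" by (rule integral_scaleR_right)
  finally have 1: "(LINT x|lebesgue. \<phi> x *\<^sub>R u x) = pi\<^sup>2 *\<^sub>R (LINT z|lborel. (z * \<eta> z) *\<^sub>R prof0 z)" .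
  have dH: "continuous_on UNIV (deriv H)" using smooth_has_real_derivative(2)[OF H] by (rule smooth_imp_continuous)
  have dH0: "deriv H z = 0" if "z < p \<or> q < z" for z
  proof -
    have "(H has_real_derivative 0) (at z)"
    proof (rule has_field_derivative_transform_within_open[of "\<lambda>_. 0" _ _ "{..<p} \<union> {q<..}"])
      show "\<And>x. x \<in> {..<p} \<union> {q<..} \<Longrightarrow> 0 = H x" using H0 by auto
    qed (use that in auto)
    then show ?thesis by (rule DERIV_imp_deriv)
  qed
  obtain B where B: "\<And>z. norm (deriv H z) \<le> B"
  proof (rule compactly_supported_bounded[OF dH, of "\<bar>q\<bar> + p + 1"])
    show "deriv H z = 0" if "\<bar>q\<bar> + p + 1 \<le> norm z" for z using that pq by (intro dH0) auto
  qed blast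
  have "(LINT x|lebesgue. (\<Sum>b\<in>Basis. frechet_derivative (\<lambda>y. frechet_derivative \<phi> (at y) b) (at x) b) *\<^sub>R u x)
      = (LINT x|lebesgue. 4 *\<^sub>R ((deriv H (x \<bullet> x) / (x \<bullet> x)) *\<^sub>R u x))"
    unfolding \<phi>_def radial_laplacian[OF \<eta>(1)] \<eta>(3) by simp
  also have "\<dots> = 4 *\<^sub>R (LINT x|lebesgue. (deriv H (x \<bullet> x) / (x \<bullet> x)) *\<^sub>R u x)" by (rule integral_scaleR_right)
  also have "\<dots> = (4 * pi\<^sup>2) *\<^sub>R radial_pairing u (deriv H)" by (simp add: radial_pairing_def)
  also have "radial_pairing u (deriv H) = (LINT z|lborel. deriv H z *\<^sub>R prof0 z)"
    by (rule radial_pairing_continuous[OF dH _ pq(1)]) (use B dH0 in auto)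
  finally show ?thesis unfolding 1 by (simp add: scaleR_diff_right mult.commute)
qed

end

lemma not_tendsto_subsequence:
  fixes X :: "nat \<Rightarrow> 'a::real_normed_vector"
  assumes "\<not> X \<longlonglongrightarrow> 0"
  obtains \<delta> r where "0 < \<delta>" "strict_mono (r :: nat \<Rightarrow> nat)" "\<And>n. \<delta> \<le> norm (X (r n))"
proof -
  obtain \<delta> where \<delta>: "0 < \<delta>" "\<not> (\<forall>\<^sub>F n in sequentially. norm (X n) < \<delta>)"
    using assms unfolding tendsto_iff by (auto simp: dist_norm)
  from not_eventually_sequentiallyD[OF \<delta>(2)] obtain r :: "nat \<Rightarrow> nat"
    where "strict_mono r" "\<forall>n. \<not> norm (X (r n)) < \<delta>" by blast
  then show thesis using that[OF \<delta>(1)] by (simp add: not_less)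
qed

context mollifier
begin

text \<open>Equicontinuity in ln z provides a pointwise convergent subsequence; Fatou preserves
  square integrability, and dominated convergence preserves the tested equation, so the uniqueness
  result applies to the limit.\<close>

lemma weakly_null_imp_prof_tendsto_0:
  fixes u :: "nat \<Rightarrow> real^4 \<Rightarrow> 'a::{real_normed_field, euclidean_space}"
  assumes u_rad: "\<And>n. u n \<in> H2_rad" and weak: "weakly_null_H2 u"
    and E: "\<And>n. H2_function.energy (u n) \<le> E" and M: "\<And>n. (L2_norm (u n))\<^sup>2 \<le> M"
  shows "(\<lambda>n. H2_function.prof0 \<rho> (u n) z) \<longlonglongrightarrow> 0"
proof (rule ccontr)
  have loc: "radial_H2_function \<rho> (u n)" for n
    using u_rad[of n] mollifier_axioms
    by (auto simp: H2_rad_def radial_H2_function_def H2_function_def H2_function_axioms_def radial_H2_function_axioms_def)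
  then have loc': "H2_function \<rho> (u n)" for n by (simp add: radial_H2_function_def)
  define P where "P n = H2_function.prof0 \<rho> (u n)" for n
  have E0: "0 \<le> E" using H2_function.energy_nonneg[OF loc'] E order_trans by blast
  have M0: "0 \<le> M" using M[of 0] zero_le_power2 order_trans by blast
  have P_neg: "P n z = 0" if "z \<le> 0" for n z
    using that by (simp add: P_def H2_function.prof0_def[OF loc'])
  define A where "A = sqrt (M + 2 * E)"
  have A0: "0 \<le> A" using M0 E0 by (simp add: A_def)
  have growth: "norm (P n z) \<le> A + sqrt (E * (z + 1 / z))" if "0 < z" for n z
    unfolding P_def A_def by (rule radial_H2_function.prof0_growth[OF loc that E M])
  have hoelder: "(norm (P n (exp t) - P n (exp s)))\<^sup>2 \<le> E * \<bar>t - s\<bar>" for n s t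
  proof -
    have *: "(norm (P n (exp t) - P n (exp s)))\<^sup>2 \<le> E * \<bar>t - s\<bar>" if "s \<le> t" for s t
    proof -
      have "(norm (P n (exp t) - P n (exp s)))\<^sup>2 \<le> H2_function.energy (u n) * ln (exp t / exp s)"
        using H2_function.prof_hoelder[OF loc', of "exp s" "exp t"] that
        by (simp add: P_def H2_function.prof0_def[OF loc'])
      also have "\<dots> = H2_function.energy (u n) * (t - s)" by (simp add: ln_div)
      also have "\<dots> \<le> E * (t - s)" by (rule mult_right_mono[OF E]) (use that in simp)
      finally show ?thesis using that by simp
    qed
    show ?thesis using *[of s t] *[of t s] by (cases "s \<le> t") (auto simp: norm_minus_commute abs_minus_commute)
  qed
  assume "\<not> (\<lambda>n. H2_function.prof0 \<rho> (u n) z) \<longlonglongrightarrow> 0"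
  then have "\<not> (\<lambda>n. P n z) \<longlonglongrightarrow> 0" by (simp add: P_def)
  then obtain \<delta> r where \<delta>: "0 < \<delta>" and r: "strict_mono (r :: nat \<Rightarrow> nat)" "\<And>n. \<delta> \<le> norm (P (r n) z)"
    using not_tendsto_subsequence by blast
  have "bounded (range (\<lambda>n. P (r n) (exp (of_rat q))))" for q :: rat
    using growth by (intro boundedI[of _ "A + sqrt (E * (exp (of_rat q) + 1 / exp (of_rat q)))"]) auto
  from common_convergent_subsequence[of "\<lambda>q n. P (r n) (exp (of_rat q))", OF this]
  obtain \<sigma> where \<sigma>: "strict_mono (\<sigma> :: nat \<Rightarrow> nat)" "\<And>q::rat. convergent (\<lambda>n. P (r (\<sigma> n)) (exp (of_rat q)))"
    by metis
  define Q where "Q n = P (r (\<sigma> n))" for n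
  have conv: "convergent (\<lambda>n. Q n (exp t))" for t
  proof (rule equi_hoelder_convergent[where f = "\<lambda>n t. Q n (exp t)" and S = UNIV and D = "range of_rat" and K = E])
    show "(norm (Q n (exp t) - Q n (exp s)))\<^sup>2 \<le> E * \<bar>t - s\<bar>" for n s t unfolding Q_def by (rule hoelder)
    show "convergent (\<lambda>n. Q n (exp q))" if "q \<in> range of_rat" for q using that \<sigma>(2) by (auto simp: Q_def)
    show "\<exists>q\<in>range of_rat \<inter> UNIV. \<bar>t - q\<bar> < d" if "0 < d" for d
    proof -
      obtain q where "t < of_rat q" "of_rat q < t + d" using of_rat_dense[of t "t + d"] \<open>0 < d\<close> by auto
      then show ?thesis by (intro bexI[of _ "of_rat q"]) auto
    qed
  qed simp
  define V where "V y = lim (\<lambda>n. Q n y)" for y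
  have lim: "(\<lambda>n. Q n y) \<longlonglongrightarrow> V y" for y
  proof (cases "y \<le> 0")
    case True
    then have "Q n y = 0" for n by (simp add: Q_def P_neg)
    then show ?thesis by (simp add: V_def)
  next
    case False
    then show ?thesis using conv[of "ln y"] by (simp add: V_def convergent_LIMSEQ_iff)
  qed
  have V0: "V y = 0" if "y \<le> 0" for y
    using lim[of y] that by (simp add: Q_def P_neg LIMSEQ_const_iff)
  have Q_borel [measurable]: "Q n \<in> borel_measurable borel" for n
    unfolding Q_def P_def by (rule H2_function.prof0_measurable[OF loc'])
  have [measurable]: "V \<in> borel_measurable borel" unfolding V_def[abs_def] by measurable
  have Q_growth: "norm (Q n y) \<le> A + sqrt (E * (y + 1 / y))" if "0 < y" for n y
    unfolding Q_def using growth[OF that] .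
  have V_growth: "norm (V y) \<le> A + sqrt (E * (y + 1 / y))" if "0 < y" for y
    by (rule LIMSEQ_le_const2[OF tendsto_norm[OF lim]]) (use Q_growth[OF that] in blast)
  have V_cont: "continuous_on {0<..} V"
  proof -
    have "(norm (V (exp t) - V (exp s)))\<^sup>2 \<le> E * \<bar>t - s\<bar>" for s t
    proof (rule LIMSEQ_le_const2)
      show "(\<lambda>n. (norm (Q n (exp t) - Q n (exp s)))\<^sup>2) \<longlonglongrightarrow> (norm (V (exp t) - V (exp s)))\<^sup>2"
        by (intro tendsto_intros lim)
    qed (use hoelder in \<open>auto simp: Q_def\<close>)
    then have "continuous_on UNIV (\<lambda>t. V (exp t))" by (rule hoelder_imp_continuous_on)
    then have "continuous_on {0<..} ((\<lambda>t. V (exp t)) \<circ> ln)"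
      by (intro continuous_on_compose continuous_on_ln continuous_on_id) (auto intro: continuous_on_subset)
    then show ?thesis by (rule continuous_on_eq) simp
  qed
  have Q_L2: "integrable lborel (\<lambda>y. y * (norm (Q n y))\<^sup>2)" "(LINT y|lborel. y * (norm (Q n y))\<^sup>2) \<le> M" for n
  proof -
    show i: "integrable lborel (\<lambda>y. y * (norm (Q n y))\<^sup>2)"
      unfolding Q_def P_def by (rule radial_H2_function.L2_norm_polar(1)[OF loc])
    have nn: "0 \<le> y * (norm (Q n y))\<^sup>2" for y using P_neg[of y "r (\<sigma> n)"] by (cases "y \<le> 0") (auto simp: Q_def)
    have "1 * (LINT y|lborel. y * (norm (Q n y))\<^sup>2) \<le> pi\<^sup>2 * (LINT y|lborel. y * (norm (Q n y))\<^sup>2)"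
    proof (rule mult_right_mono)
      show "1 \<le> pi\<^sup>2" using pi_ge_two by (intro one_le_power) linarith
    qed (intro Bochner_Integration.integral_nonneg nn)
    also have "\<dots> \<le> M" unfolding Q_def P_def radial_H2_function.L2_norm_polar(2)[OF loc] by (rule M)
    finally show "(LINT y|lborel. y * (norm (Q n y))\<^sup>2) \<le> M" by simp
  qed
  have V_L2: "integrable lborel (\<lambda>y. y * (norm (V y))\<^sup>2)"
  proof (rule integrableI_bounded)
    have nn: "0 \<le> y * (norm (V y))\<^sup>2" for y using V0[of y] by (cases "y \<le> 0") auto
    have nnQ: "0 \<le> y * (norm (Q n y))\<^sup>2" for y n using P_neg[of y "r (\<sigma> n)"] by (cases "y \<le> 0") (auto simp: Q_def)
    have "(\<integral>\<^sup>+y. ennreal (norm (y * (norm (V y))\<^sup>2)) \<partial>lborel) = (\<integral>\<^sup>+y. liminf (\<lambda>n. ennreal (y * (norm (Q n y))\<^sup>2)) \<partial>lborel)"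
    proof (rule nn_integral_cong)
      fix y :: real
      have "(\<lambda>n. ennreal (y * (norm (Q n y))\<^sup>2)) \<longlonglongrightarrow> ennreal (y * (norm (V y))\<^sup>2)"
        by (intro tendsto_ennrealI tendsto_intros lim)
      from lim_imp_Liminf[OF _ this] nn[of y]
      show "ennreal (norm (y * (norm (V y))\<^sup>2)) = liminf (\<lambda>n. ennreal (y * (norm (Q n y))\<^sup>2))"
        by (simp only: real_norm_def abs_of_nonneg sequentially_bot not_False_eq_True)
    qed
    also have "\<dots> \<le> liminf (\<lambda>n. \<integral>\<^sup>+y. ennreal (y * (norm (Q n y))\<^sup>2) \<partial>lborel)" by (rule nn_integral_liminf) measurable
    also have "\<dots> \<le> liminf (\<lambda>n::nat. ennreal M)"
    proof (intro Liminf_mono always_eventually allI)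
      fix n
      have "(\<integral>\<^sup>+y. ennreal (y * (norm (Q n y))\<^sup>2) \<partial>lborel) = ennreal (LINT y|lborel. y * (norm (Q n y))\<^sup>2)"
        by (rule nn_integral_eq_integral[OF Q_L2(1)]) (use nnQ in auto)
      then show "(\<integral>\<^sup>+y. ennreal (y * (norm (Q n y))\<^sup>2) \<partial>lborel) \<le> ennreal M" using Q_L2(2) by (simp add: ennreal_leI)
    qed
    also have "\<dots> < \<infinity>" by (simp add: Liminf_const)
    finally show "(\<integral>\<^sup>+y. ennreal (norm (y * (norm (V y))\<^sup>2)) \<partial>lborel) < \<infinity>" .
  qed measurable
  have "V z = 0"
  proof (rule radial_eigenfunction_eq_0[OF V_cont V0 V_growth A0 E0 V_L2])
    fix H \<eta> :: "real \<Rightarrow> real" and p q :: real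
    assume H: "smooth H" and pq: "0 < p" "p \<le> q" and H0: "\<And>z. z \<le> p \<Longrightarrow> H z = 0" "\<And>z. q \<le> z \<Longrightarrow> H z = 0"
      and \<eta>: "smooth \<eta>" and \<eta>0: "\<And>z. q \<le> z \<Longrightarrow> \<eta> z = 0"
      and lap: "\<And>z. 8 * deriv \<eta> z + 4 * z * deriv (deriv \<eta>) z = 4 * (deriv H z / z)"
    define I where "I n = (LINT z|lborel. (z * \<eta> z) *\<^sub>R P n z) - 4 *\<^sub>R (LINT z|lborel. deriv H z *\<^sub>R P n z)" for n
    have I_eq: "pi\<^sup>2 *\<^sub>R I n = (LINT x|lebesgue. \<eta> (x \<bullet> x) *\<^sub>R u n x)
      - (LINT x|lebesgue. (\<Sum>b\<in>Basis. frechet_derivative (\<lambda>y. frechet_derivative (\<lambda>x. \<eta> (x \<bullet> x)) (at y) b) (at x) b) *\<^sub>R u n x)"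
      for n unfolding I_def P_def by (rule radial_H2_function.test_identity[OF loc H pq H0 \<eta> \<eta>0 lap, symmetric])
    have "(\<lambda>n. pi\<^sup>2 *\<^sub>R I n) \<longlonglongrightarrow> 0"
      unfolding I_eq
      by (rule weak[unfolded weakly_null_H2_def, rule_format, OF test_functional_H2[OF radial_test_function[OF \<eta> \<eta>0]]])
    from tendsto_scaleR[OF tendsto_const this, of "1 / pi\<^sup>2"] have I0: "I \<longlonglongrightarrow> 0" by simp
    have I_sub: "(\<lambda>n. (LINT z|lborel. (z * \<eta> z) *\<^sub>R Q n z) - 4 *\<^sub>R (LINT z|lborel. deriv H z *\<^sub>R Q n z)) \<longlonglongrightarrow> 0"
      using filterlim_compose[OF I0 filterlim_subseq[OF strict_mono_o[OF r(1) \<sigma>(1)]]]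
      by (simp add: I_def Q_def o_def)
    have dH: "continuous_on UNIV (deriv H)" using smooth_has_real_derivative(2)[OF H] by (rule smooth_imp_continuous)
    have dH0: "deriv H z = 0" if "z < p \<or> q < z" for z
    proof -
      have "(H has_real_derivative 0) (at z)"
      proof (rule has_field_derivative_transform_within_open[of "\<lambda>_. 0" _ _ "{..<p} \<union> {q<..}"])
        show "\<And>x. x \<in> {..<p} \<union> {q<..} \<Longrightarrow> 0 = H x" using H0 by auto
      qed (use that in auto)
      then show ?thesis by (rule DERIV_imp_deriv)
    qed
    \<comment> \<open>Near 0 the functions \<open>Q n\<close> are controlled only by a multiple of
      z^(-1/2); weights that vanish linearly there give a bounded majorant.\<close>
    have cv: "(\<lambda>n. LINT z|lborel. g z *\<^sub>R Q n z) \<longlonglongrightarrow> (LINT z|lborel. g z *\<^sub>R V z)"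
      if g: "continuous_on UNIV g" and g0: "\<And>z. q < z \<Longrightarrow> g z = 0"
        and gB: "\<And>z. 0 \<le> z \<Longrightarrow> z \<le> q \<Longrightarrow> \<bar>g z\<bar> \<le> B * z" and "0 \<le> B" for g :: "real \<Rightarrow> real" and B
    proof (rule integral_dominated_convergence[where w = "\<lambda>z. B * (A * q + sqrt (E * (q ^ 3 + q))) * indicator {0..q} z"])
      note [measurable] = borel_measurable_continuous_onI[OF g]
      show "(\<lambda>z. g z *\<^sub>R V z) \<in> borel_measurable lborel" "(\<lambda>z. g z *\<^sub>R Q n z) \<in> borel_measurable lborel" for n
        by measurable
      show "integrable lborel (\<lambda>z. B * (A * q + sqrt (E * (q ^ 3 + q))) * indicator {0..q} z)"
        by (intro integrable_mult_right integrable_real_indicator) (auto simp: emeasure_lborel_Icc_eq)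
      show "AE z in lborel. (\<lambda>n. g z *\<^sub>R Q n z) \<longlonglongrightarrow> g z *\<^sub>R V z" by (intro AE_I2 tendsto_intros lim)
      show "AE z in lborel. norm (g z *\<^sub>R Q n z) \<le> B * (A * q + sqrt (E * (q ^ 3 + q))) * indicator {0..q} z" for n
      proof (rule AE_I2)
        fix z show "norm (g z *\<^sub>R Q n z) \<le> B * (A * q + sqrt (E * (q ^ 3 + q))) * indicator {0..q} z"
        proof (cases "z \<le> 0 \<or> q < z")
          case True
          then have "g z *\<^sub>R Q n z = 0" using g0 P_neg[of z] by (auto simp: Q_def)
          moreover have "0 \<le> B * (A * q + sqrt (E * (q ^ 3 + q)))" using \<open>0 \<le> B\<close> A0 E0 pq by simp
          ultimately show ?thesis by (simp only: norm_zero) (auto split: split_indicator)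
        next
          case False
          then have z: "0 < z" "z \<le> q" by auto
          have "norm (g z *\<^sub>R Q n z) \<le> (B * z) * (A + sqrt (E * (z + 1 / z)))"
            unfolding norm_scaleR real_norm_def using z gB[of z] Q_growth[OF z(1)] \<open>0 \<le> B\<close> by (intro mult_mono) auto
          also have "\<dots> = B * (A * z + z * sqrt (E * (z + 1 / z)))" by (simp add: algebra_simps)
          also have "z * sqrt (E * (z + 1 / z)) = sqrt (z\<^sup>2 * (E * (z + 1 / z)))"
            unfolding real_sqrt_mult[of "z\<^sup>2"] using z by simp
          also have "z\<^sup>2 * (E * (z + 1 / z)) = E * (z ^ 3 + z)"
            using z by (simp add: field_simps power2_eq_square power3_eq_cube)
          also have "B * (A * z + sqrt (E * (z ^ 3 + z))) \<le> B * (A * q + sqrt (E * (q ^ 3 + q)))"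
            using z \<open>0 \<le> B\<close> A0 E0 by (intro mult_left_mono add_mono real_sqrt_le_mono power_mono) auto
          finally show ?thesis using z by simp
        qed
      qed
    qed
    have \<eta>_cont: "continuous_on UNIV \<eta>" by (rule smooth_imp_continuous[OF \<eta>])
    have "bounded (\<eta> ` {0..q})"
      by (intro compact_imp_bounded compact_continuous_image continuous_on_subset[OF \<eta>_cont]) auto
    then obtain B1 where B1: "\<forall>y\<in>\<eta> ` {0..q}. norm y \<le> B1" unfolding bounded_iff by blast
    have "norm (\<eta> 0) \<le> B1" using B1 pq by auto
    then have "0 \<le> B1" using norm_ge_zero[of "\<eta> 0"] by linarith
    have c1: "(\<lambda>n. LINT z|lborel. (z * \<eta> z) *\<^sub>R Q n z) \<longlonglongrightarrow> (LINT z|lborel. (z * \<eta> z) *\<^sub>R V z)"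
    proof (rule cv[OF _ _ _ \<open>0 \<le> B1\<close>])
      show "continuous_on UNIV (\<lambda>z. z * \<eta> z)" by (intro continuous_intros \<eta>_cont)
      fix z :: real
      show "z * \<eta> z = 0" if "q < z" using \<eta>0[of z] that by simp
      show "\<bar>z * \<eta> z\<bar> \<le> B1 * z" if "0 \<le> z" "z \<le> q"
      proof -
        have "\<bar>\<eta> z\<bar> \<le> B1" using B1 that by auto
        then have "z * \<bar>\<eta> z\<bar> \<le> z * B1" using that by (intro mult_left_mono)
        then show ?thesis using that by (simp add: abs_mult mult.commute)
      qed
    qed
    have "bounded (deriv H ` {0..q})"
      by (intro compact_imp_bounded compact_continuous_image continuous_on_subset[OF dH]) auto
    then obtain B2 where B2: "\<forall>y\<in>deriv H ` {0..q}. norm y \<le> B2" unfolding bounded_iff by blast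
    have "norm (deriv H 0) \<le> B2" using B2 pq by auto
    then have "0 \<le> B2" using norm_ge_zero[of "deriv H 0"] by linarith
    have c2: "(\<lambda>n. LINT z|lborel. deriv H z *\<^sub>R Q n z) \<longlonglongrightarrow> (LINT z|lborel. deriv H z *\<^sub>R V z)"
    proof (rule cv[OF dH])
      show "0 \<le> B2 / p" using \<open>0 \<le> B2\<close> pq by simp
      fix z :: real
      show "deriv H z = 0" if "q < z" using dH0 that by simp
      show "\<bar>deriv H z\<bar> \<le> B2 / p * z" if "0 \<le> z" "z \<le> q"
      proof (cases "z < p")
        case True
        then show ?thesis using dH0 that pq \<open>0 \<le> B2\<close> by simp
      next
        case False
        have "\<bar>deriv H z\<bar> \<le> B2" using B2 that by auto
        also have "B2 = B2 / p * p" using pq by simp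
        also have "\<dots> \<le> B2 / p * z" using False pq \<open>0 \<le> B2\<close> by (intro mult_left_mono) auto
        finally show ?thesis .
      qed
    qed
    have "(LINT z|lborel. (z * \<eta> z) *\<^sub>R V z) - 4 *\<^sub>R (LINT z|lborel. deriv H z *\<^sub>R V z) = 0"
      by (rule LIMSEQ_unique[OF tendsto_diff[OF c1 tendsto_scaleR[OF tendsto_const c2]] I_sub])
    then show "(LINT z|lborel. (z * \<eta> z) *\<^sub>R V z) = 4 *\<^sub>R (LINT z|lborel. deriv H z *\<^sub>R V z)" by simp
  qed
  then have "(\<lambda>n. norm (Q n z)) \<longlonglongrightarrow> 0" using tendsto_norm[OF lim[of z]] by simp
  moreover have "\<delta> \<le> norm (Q n z)" for n using r(2) by (simp add: Q_def)
  ultimately have "\<delta> \<le> 0" by (intro LIMSEQ_le_const) auto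
  then show False using \<delta> by simp
qed

end

section \<open>Convolution with rescaled mollifiers\<close>

lemma energy_le_scaleR:
  assumes "energy_le K v"
  shows "energy_le (c\<^sup>2 * K) (\<lambda>s. c *\<^sub>R v s)"
  unfolding energy_le_def
proof (intro allI impI)
  fix I :: "real set" and b :: "real \<Rightarrow> real"
  assume I: "finite I" "\<forall>a\<in>I. 0 \<le> a \<and> a < b a" "\<forall>a\<in>I. \<forall>a'\<in>I. a < a' \<longrightarrow> b a \<le> a'"
  have "(\<Sum>a\<in>I. (norm (c *\<^sub>R v (b a) - c *\<^sub>R v a))\<^sup>2 / (b a - a))
      = c\<^sup>2 * (\<Sum>a\<in>I. (norm (v (b a) - v a))\<^sup>2 / (b a - a))"
    unfolding sum_distrib_left by (rule sum.cong[OF refl])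
      (simp add: power_mult_distrib flip: scaleR_diff_right)
  also have "\<dots> \<le> c\<^sup>2 * K"
    by (intro mult_left_mono energy_leD[OF assms]) (use I in auto)
  finally show "(\<Sum>a\<in>I. (norm (c *\<^sub>R v (b a) - c *\<^sub>R v a))\<^sup>2 / (b a - a)) \<le> c\<^sup>2 * K" .
qed

context mollifier
begin

lemma convolution_eq:
  fixes \<psi> :: "real \<Rightarrow> 'a::euclidean_space"
  assumes cont: "continuous_on UNIV \<psi>" and "0 < \<alpha>"
  shows "convolution \<psi> (\<lambda>s. \<alpha> * \<rho> (\<alpha> * s)) y = (LINT t|lborel. \<rho> t *\<^sub>R \<psi> (y - t / \<alpha>))"
proof -
  note [measurable] = borel_measurable_continuous_onI[OF cont]
  have "convolution \<psi> (\<lambda>s. \<alpha> * \<rho> (\<alpha> * s)) y = (LINT t|lborel. (\<alpha> * \<rho> (\<alpha> * (y - t))) *\<^sub>R \<psi> t)"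
    unfolding convolution_def by (rule integral_completion) measurable
  also have "\<dots> = \<bar>- (1 / \<alpha>)\<bar> *\<^sub>R (LINT t|lborel. (\<alpha> * \<rho> (\<alpha> * (y - (y + - (1 / \<alpha>) * t)))) *\<^sub>R \<psi> (y + - (1 / \<alpha>) * t))"
    by (rule lborel_integral_real_affine) (use \<open>0 < \<alpha>\<close> in simp)
  also have "\<dots> = (LINT t|lborel. \<bar>- (1 / \<alpha>)\<bar> *\<^sub>R ((\<alpha> * \<rho> (\<alpha> * (y - (y + - (1 / \<alpha>) * t)))) *\<^sub>R \<psi> (y + - (1 / \<alpha>) * t)))"
    by (rule integral_scaleR_right[symmetric])
  also have "\<dots> = (LINT t|lborel. \<rho> t *\<^sub>R \<psi> (y - t / \<alpha>))"
    using \<open>0 < \<alpha>\<close> by (intro Bochner_Integration.integral_cong refl) simp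
  finally show ?thesis .
qed

lemma convolution_measurable:
  fixes \<psi> :: "real \<Rightarrow> 'a::euclidean_space"
  assumes cont: "continuous_on UNIV \<psi>" and "0 < \<alpha>"
  shows "convolution \<psi> (\<lambda>s. \<alpha> * \<rho> (\<alpha> * s)) \<in> borel_measurable borel"
proof -
  note [measurable] = borel_measurable_continuous_onI[OF cont]
  have "convolution \<psi> (\<lambda>s. \<alpha> * \<rho> (\<alpha> * s)) = (\<lambda>y. LINT t|lborel. \<rho> t *\<^sub>R \<psi> (y - t / \<alpha>))"
    using convolution_eq[OF assms] by (rule ext)
  also have "\<dots> \<in> borel_measurable borel" by measurable
  finally show ?thesis .
qed

text \<open>Convolution is an average of \<open>\<psi>\<close> over an interval of radius 1 /
  \<alpha> with probability weight \<open>\<rho>\<close>, and averages stay in balls.\<close>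

lemma convolution_near:
  fixes \<psi> :: "real \<Rightarrow> 'a::euclidean_space"
  assumes cont: "continuous_on UNIV \<psi>" and "0 < \<alpha>"
    and near: "\<And>t. \<bar>t\<bar> \<le> 1 \<Longrightarrow> norm (\<psi> (y - t / \<alpha>) - w) \<le> B"
  shows "norm (convolution \<psi> (\<lambda>s. \<alpha> * \<rho> (\<alpha> * s)) y - w) \<le> B"
proof -
  note [measurable] = borel_measurable_continuous_onI[OF cont]
  have le: "norm (\<rho> t *\<^sub>R (\<psi> (y - t / \<alpha>) - w)) \<le> \<rho> t * B" for t
    using near[of t] rho_eq_0[of t] rho_nonneg[of t] by (cases "\<bar>t\<bar> \<le> 1") (auto intro: mult_left_mono)
  have i1: "integrable lborel (\<lambda>t. \<rho> t *\<^sub>R (\<psi> (y - t / \<alpha>) - w))"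
    by (rule Bochner_Integration.integrable_bound[OF integrable_mult_left[of B, OF rho_integrable]])
      (use le order_trans[OF le abs_ge_self] in auto)
  have i2: "integrable lborel (\<lambda>t. \<rho> t *\<^sub>R w)" using rho_integrable by simp
  have "(LINT t|lborel. \<rho> t *\<^sub>R \<psi> (y - t / \<alpha>)) = (LINT t|lborel. \<rho> t *\<^sub>R (\<psi> (y - t / \<alpha>) - w) + \<rho> t *\<^sub>R w)"
    by (simp add: scaleR_diff_right)
  also have "\<dots> = (LINT t|lborel. \<rho> t *\<^sub>R (\<psi> (y - t / \<alpha>) - w)) + w"
    using i1 i2 rho_integrable by (simp add: rho_integral)
  finally have "convolution \<psi> (\<lambda>s. \<alpha> * \<rho> (\<alpha> * s)) y - w = (LINT t|lborel. \<rho> t *\<^sub>R (\<psi> (y - t / \<alpha>) - w))"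
    by (simp add: convolution_eq[OF cont \<open>0 < \<alpha>\<close>])
  also have "norm \<dots> \<le> (LINT t|lborel. norm (\<rho> t *\<^sub>R (\<psi> (y - t / \<alpha>) - w)))" by (rule integral_norm_bound)
  also have "\<dots> \<le> (LINT t|lborel. \<rho> t * B)"
    by (rule integral_mono[OF integrable_norm[OF i1] integrable_mult_left[OF rho_integrable] le])
  also have "\<dots> = B" by (simp add: rho_integral)
  finally show ?thesis .
qed

context
  fixes \<psi> :: "real \<Rightarrow> 'a::euclidean_space" and K :: real
  assumes E: "energy_le K \<psi>" and Z: "\<And>s. s \<le> 0 \<Longrightarrow> \<psi> s = 0"
begin

lemma profile_continuous: "continuous_on UNIV \<psi>"
  by (rule hoelder_imp_continuous_on[OF energy_le_hoelder_UNIV[OF E Z]])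

text \<open>Over the mollifier radius 1 / \<alpha> the profile moves by at most sqrt (K / \<alpha>);
  the amplitude sqrt \<alpha> turns this into a bound free of \<alpha>.\<close>

lemma rescaled_convolution_near:
  assumes "0 < \<alpha>"
  shows "norm (sqrt \<alpha> *\<^sub>R convolution \<psi> (\<lambda>s. \<alpha> * \<rho> (\<alpha> * s)) (s / \<alpha>) - sqrt \<alpha> *\<^sub>R \<psi> (s / \<alpha>)) \<le> sqrt K"
proof -
  have "norm (convolution \<psi> (\<lambda>s. \<alpha> * \<rho> (\<alpha> * s)) (s / \<alpha>) - \<psi> (s / \<alpha>)) \<le> sqrt (K / \<alpha>)"
  proof (rule convolution_near[OF profile_continuous assms])
    fix t :: real assume t: "\<bar>t\<bar> \<le> 1"
    have "(norm (\<psi> (s / \<alpha> - t / \<alpha>) - \<psi> (s / \<alpha>)))\<^sup>2 \<le> K * \<bar>s / \<alpha> - t / \<alpha> - s / \<alpha>\<bar>"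
      by (rule energy_le_hoelder_UNIV[OF E Z])
    also have "\<dots> \<le> K * (1 / \<alpha>)"
      using t assms energy_le_nonneg[OF E] by (intro mult_left_mono) (auto simp: divide_right_mono)
    finally show "norm (\<psi> (s / \<alpha> - t / \<alpha>) - \<psi> (s / \<alpha>)) \<le> sqrt (K / \<alpha>)" by (intro real_le_rsqrt) simp
  qed
  then have "sqrt \<alpha> * norm (convolution \<psi> (\<lambda>s. \<alpha> * \<rho> (\<alpha> * s)) (s / \<alpha>) - \<psi> (s / \<alpha>)) \<le> sqrt \<alpha> * sqrt (K / \<alpha>)"
    by (rule mult_left_mono) (use assms in simp)
  then show ?thesis using assms by (simp add: real_sqrt_divide flip: scaleR_diff_right)
qed

lemma rescaled_profile_bound:
  assumes "0 < \<alpha>" "s \<le> 1"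
  shows "norm (sqrt \<alpha> *\<^sub>R \<psi> (s / \<alpha>)) \<le> sqrt K"
proof (cases "s \<le> 0")
  case True
  then show ?thesis using Z[of "s / \<alpha>"] assms energy_le_nonneg[OF E] by (simp add: divide_nonpos_pos)
next
  case False
  have "(norm (\<psi> (s / \<alpha>)))\<^sup>2 \<le> K * (s / \<alpha>)"
    using energy_le_hoelder_UNIV[OF E Z, of "s / \<alpha>" 0] Z[of 0] False assms by simp
  also have "\<dots> \<le> K * (1 / \<alpha>)"
    using assms energy_le_nonneg[OF E] by (intro mult_left_mono) (auto simp: divide_right_mono)
  finally have "norm (\<psi> (s / \<alpha>)) \<le> sqrt (K / \<alpha>)" by (intro real_le_rsqrt) simp
  then have "sqrt \<alpha> * norm (\<psi> (s / \<alpha>)) \<le> sqrt \<alpha> * sqrt (K / \<alpha>)" by (rule mult_left_mono) (use assms in simp)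
  then show ?thesis using assms by (simp add: real_sqrt_divide)
qed

text \<open>The mollifier has radius 1 in \<open>s\<close>, so it sees only the zero part of the
  profile. This covers |x| >= e, where the remainder is therefore \<open>u\<close> itself and the
  tail condition applies.\<close>

lemma convolution_eq_0:
  assumes "0 < \<alpha>" "s \<le> -1"
  shows "convolution \<psi> (\<lambda>s. \<alpha> * \<rho> (\<alpha> * s)) (s / \<alpha>) = 0"
proof -
  have "norm (convolution \<psi> (\<lambda>s. \<alpha> * \<rho> (\<alpha> * s)) (s / \<alpha>) - 0) \<le> 0"
  proof (rule convolution_near[OF profile_continuous assms(1)])
    fix t :: real assume "\<bar>t\<bar> \<le> 1"
    then have "(s - t) / \<alpha> \<le> 0" using assms by (intro divide_nonpos_pos) auto
    then show "norm (\<psi> (s / \<alpha> - t / \<alpha>) - 0) \<le> 0" using Z by (simp add: diff_divide_distrib)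
  qed
  then show ?thesis by simp
qed

text \<open>For fixed \<open>s\<close> the arguments of the profile tend to 0, where it is o(sqrt
  y); multiplication by sqrt \<alpha> leaves o(1).\<close>

lemma rescaled_convolution_tendsto_0:
  assumes \<alpha>: "is_scale \<alpha>"
  shows "(\<lambda>n. sqrt (\<alpha> n) *\<^sub>R convolution \<psi> (\<lambda>s. \<alpha> n * \<rho> (\<alpha> n * s)) (s / \<alpha> n)) \<longlonglongrightarrow> 0"
proof (rule tendstoI)
  fix e :: real assume "0 < e"
  \<comment> \<open>Makes sqrt \<alpha> times the final bound equal to e / 2;
    \<open>\<bar>s\<bar> + 1\<close> dominates s - t on the support of
    \<open>\<rho>\<close>.\<close>
  define \<eta> where "\<eta> = e / 2 / sqrt (\<bar>s\<bar> + 1)"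
  have \<eta>: "0 < \<eta>" using \<open>0 < e\<close> by (auto simp: \<eta>_def intro!: divide_pos_pos)
  obtain Y where Y: "\<And>t. Y < \<bar>t\<bar> \<Longrightarrow> norm (\<psi> (exp t)) < \<eta> * exp (t / 2)"
    using energy_le_decay[OF E _ \<eta>] Z by blast
  have pos: "0 < \<alpha> n" for n using \<alpha> by (simp add: is_scale_def)
  have "\<forall>\<^sub>F n in sequentially. (\<bar>s\<bar> + 1) * exp \<bar>Y\<bar> < \<alpha> n"
    using \<alpha> by (simp add: is_scale_def filterlim_at_top_dense)
  then show "\<forall>\<^sub>F n in sequentially. dist (sqrt (\<alpha> n) *\<^sub>R convolution \<psi> (\<lambda>s. \<alpha> n * \<rho> (\<alpha> n * s)) (s / \<alpha> n)) 0 < e"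
  proof eventually_elim
    case (elim n)
    have "norm (convolution \<psi> (\<lambda>s. \<alpha> n * \<rho> (\<alpha> n * s)) (s / \<alpha> n) - 0) \<le> \<eta> * sqrt ((\<bar>s\<bar> + 1) / \<alpha> n)"
    proof (rule convolution_near[OF profile_continuous pos])
      fix t :: real assume t: "\<bar>t\<bar> \<le> 1"
      define y where "y = (s - t) / \<alpha> n"
      have y: "y \<le> (\<bar>s\<bar> + 1) / \<alpha> n" unfolding y_def using t pos[of n] by (intro divide_right_mono) auto
      have "norm (\<psi> y) \<le> \<eta> * sqrt ((\<bar>s\<bar> + 1) / \<alpha> n)"
      proof (cases "y \<le> 0")
        case True
        then show ?thesis using Z \<eta> pos[of n] by simp
      next
        case False
        have "(\<bar>s\<bar> + 1) / \<alpha> n < exp (- \<bar>Y\<bar>)" using elim pos[of n] by (simp add: exp_minus field_simps)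
        then have "ln y < ln (exp (- \<bar>Y\<bar>))" using y False by (subst ln_less_cancel_iff) auto
        then have "Y < \<bar>ln y\<bar>" by simp
        from Y[OF this] have "norm (\<psi> y) \<le> \<eta> * exp (ln y / 2)" using False by simp
        also have "exp (ln y / 2) = sqrt y" using False sqrt_exp_half[of "ln y"] by simp
        also have "\<eta> * sqrt y \<le> \<eta> * sqrt ((\<bar>s\<bar> + 1) / \<alpha> n)"
          using y \<eta> by (intro mult_left_mono real_sqrt_le_mono) auto
        finally show ?thesis .
      qed
      then show "norm (\<psi> (s / \<alpha> n - t / \<alpha> n) - 0) \<le> \<eta> * sqrt ((\<bar>s\<bar> + 1) / \<alpha> n)"
        by (simp add: y_def diff_divide_distrib)
    qed
    then have "sqrt (\<alpha> n) * norm (convolution \<psi> (\<lambda>s. \<alpha> n * \<rho> (\<alpha> n * s)) (s / \<alpha> n)) \<le> sqrt (\<alpha> n) * (\<eta> * sqrt ((\<bar>s\<bar> + 1) / \<alpha> n))"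
      using pos[of n] by (intro mult_left_mono) auto
    also have "\<dots> = e / 2"
      using pos[of n] by (simp add: \<eta>_def real_sqrt_divide)
    also have "\<dots> < e" using \<open>0 < e\<close> by simp
    finally show ?case using pos[of n] by simp
  qed
qed

end

end

section \<open>The Orlicz norm\<close>

lemma orlicz_norm_le:
  fixes w :: "real^4 \<Rightarrow> 'a::{real_normed_field, euclidean_space}"
  assumes "0 < t" "(\<integral>\<^sup>+x. ennreal (exp ((norm (w x))\<^sup>2 / t\<^sup>2) - 1) \<partial>lebesgue) \<le> kappa TYPE('a)"
  shows "orlicz_norm w \<le> ennreal t"
  unfolding orlicz_norm_def by (rule Inf_lower) (use assms in blast)

lemma orlicz_norm_less:
  fixes w :: "real^4 \<Rightarrow> 'a::{real_normed_field, euclidean_space}"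
  assumes "orlicz_norm w < c"
  obtains t where "0 < t" "ennreal t < c"
    "(\<integral>\<^sup>+x. ennreal (exp ((norm (w x))\<^sup>2 / t\<^sup>2) - 1) \<partial>lebesgue) \<le> kappa TYPE('a)"
  using assms unfolding orlicz_norm_def Inf_less_iff by blast

lemma ennreal_eq_0_if_le_all:
  assumes "\<And>t. 0 < t \<Longrightarrow> (x::ennreal) \<le> ennreal t"
  shows "x = 0"
proof (rule ccontr)
  assume "x \<noteq> 0"
  show False
  proof (cases x)
    case (real r)
    then show False using assms[of "r / 2"] \<open>x \<noteq> 0\<close> by (auto simp: ennreal_le_iff2)
  next
    case top
    then show False using assms[of 1] by (simp add: top_unique)
  qed
qed

text \<open>If \<open>\<kappa>\<close> were \<open>0\<close> or \<open>\<infinity>\<close>, the Orlicz norm would only take the values \<open>0\<close> and \<open>\<infinity>\<close>; so the finiteness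
  theorem of Ruf and Sani is not needed.\<close>

lemma kappa_nondegenerate:
  fixes u :: "nat \<Rightarrow> real^4 \<Rightarrow> 'a::{real_normed_field, euclidean_space}"
  assumes meas: "\<And>n. u n \<in> borel_measurable lebesgue"
    and lim: "limsup (\<lambda>n. orlicz_norm (u n)) = ennreal A" and "0 < A"
  shows "0 < kappa TYPE('a)" "kappa TYPE('a) < \<infinity>"
proof -
  have zero: "kappa TYPE('a) = 0 \<or> kappa TYPE('a) = \<infinity> \<Longrightarrow> orlicz_norm (u n) < \<infinity> \<Longrightarrow> orlicz_norm (u n) = 0" for n
  proof -
    assume \<kappa>: "kappa TYPE('a) = 0 \<or> kappa TYPE('a) = \<infinity>" and fin: "orlicz_norm (u n) < \<infinity>"
    note [measurable] = meas[of n]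
    have "(\<integral>\<^sup>+x. ennreal (exp ((norm (u n x))\<^sup>2 / t\<^sup>2) - 1) \<partial>lebesgue) \<le> kappa TYPE('a)" if "0 < t" for t
    proof (cases "kappa TYPE('a) = 0")
      case True
      \<comment> \<open>One admissible \<open>t0\<close> has integral 0, so the function vanishes
        almost everywhere and every positive \<open>t\<close> is admissible.\<close>
      obtain t0 where t0: "0 < t0" "(\<integral>\<^sup>+x. ennreal (exp ((norm (u n x))\<^sup>2 / t0\<^sup>2) - 1) \<partial>lebesgue) \<le> 0"
        using orlicz_norm_less[OF fin] True by metis
      then have "AE x in lebesgue. ennreal (exp ((norm (u n x))\<^sup>2 / t0\<^sup>2) - 1) = 0"
        by (subst (asm) le_zero_eq, subst (asm) nn_integral_0_iff_AE) auto
      then have "AE x in lebesgue. ennreal (exp ((norm (u n x))\<^sup>2 / t\<^sup>2) - 1) = 0"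
      proof eventually_elim
        case (elim x)
        then have "(norm (u n x))\<^sup>2 / t0\<^sup>2 \<le> 0" by (simp add: ennreal_eq_0_iff)
        then have "u n x = 0" using t0(1) by (simp add: divide_le_0_iff)
        then show ?case by simp
      qed
      then have "(\<integral>\<^sup>+x. ennreal (exp ((norm (u n x))\<^sup>2 / t\<^sup>2) - 1) \<partial>lebesgue) = 0"
        by (subst nn_integral_0_iff_AE) auto
      then show ?thesis by simp
    qed (use \<kappa> in simp)
    then show "orlicz_norm (u n) = 0" by (intro ennreal_eq_0_if_le_all orlicz_norm_le)
  qed
  have "\<not> (kappa TYPE('a) = 0 \<or> kappa TYPE('a) = \<infinity>)"
  proof
    assume \<kappa>: "kappa TYPE('a) = 0 \<or> kappa TYPE('a) = \<infinity>"
    have "\<forall>\<^sub>F n in sequentially. orlicz_norm (u n) < \<infinity>"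
      by (rule Limsup_lessD) (simp add: lim)
    then have "\<forall>\<^sub>F n in sequentially. orlicz_norm (u n) \<le> 0"
      by eventually_elim (use zero[OF \<kappa>] in simp)
    then have "limsup (\<lambda>n. orlicz_norm (u n)) \<le> 0" by (rule Limsup_bounded)
    then show False using lim \<open>0 < A\<close> by simp
  qed
  then show "0 < kappa TYPE('a)" "kappa TYPE('a) < \<infinity>"
    by (auto simp: zero_less_iff_neq_zero less_top)
qed

text \<open>The inequality y <= exp y - 1 at y = |w|^2 / t^2. This supplies the L2 bound that the
  estimate of the Laplacian asks for.\<close>

lemma L2_norm_le_orlicz:
  fixes w :: "real^4 \<Rightarrow> 'a::{real_normed_field, euclidean_space}"
  assumes w: "w \<in> L2" and "orlicz_norm w < ennreal c" and \<kappa>: "kappa TYPE('a) = ennreal k" "0 \<le> k"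
  shows "(L2_norm w)\<^sup>2 \<le> c\<^sup>2 * k"
proof -
  have [measurable]: "w \<in> borel_measurable lebesgue" using w by (simp add: L2_def)
  obtain t where t: "0 < t" "ennreal t < ennreal c"
    "(\<integral>\<^sup>+x. ennreal (exp ((norm (w x))\<^sup>2 / t\<^sup>2) - 1) \<partial>lebesgue) \<le> kappa TYPE('a)"
    using orlicz_norm_less[OF assms(2)] by blast
  have tc: "t \<le> c" using t by (simp add: ennreal_less_iff less_imp_le)
  have "ennreal ((L2_norm w)\<^sup>2) = (\<integral>\<^sup>+x. ennreal ((norm (w x))\<^sup>2) \<partial>lebesgue)"
    using w by (simp add: L2_def L2_norm_def nn_integral_eq_integral)
  also have "\<dots> \<le> (\<integral>\<^sup>+x. ennreal (t\<^sup>2) * ennreal (exp ((norm (w x))\<^sup>2 / t\<^sup>2) - 1) \<partial>lebesgue)"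
  proof (rule nn_integral_mono)
    fix x
    have "(norm (w x))\<^sup>2 = t\<^sup>2 * ((norm (w x))\<^sup>2 / t\<^sup>2)" using t(1) by simp
    also have "\<dots> \<le> t\<^sup>2 * (exp ((norm (w x))\<^sup>2 / t\<^sup>2) - 1)"
    proof (rule mult_left_mono)
      show "(norm (w x))\<^sup>2 / t\<^sup>2 \<le> exp ((norm (w x))\<^sup>2 / t\<^sup>2) - 1"
        using exp_ge_add_one_self[of "(norm (w x))\<^sup>2 / t\<^sup>2"] by linarith
    qed simp
    finally show "ennreal ((norm (w x))\<^sup>2) \<le> ennreal (t\<^sup>2) * ennreal (exp ((norm (w x))\<^sup>2 / t\<^sup>2) - 1)"
      by (subst ennreal_mult[symmetric]) (auto intro: ennreal_leI)
  qed
  also have "\<dots> = ennreal (t\<^sup>2) * (\<integral>\<^sup>+x. ennreal (exp ((norm (w x))\<^sup>2 / t\<^sup>2) - 1) \<partial>lebesgue)"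
    by (rule nn_integral_cmult) measurable
  also have "\<dots> \<le> ennreal (t\<^sup>2) * ennreal k" using t(3) unfolding \<kappa>(1) by (rule mult_left_mono) simp
  also have "\<dots> = ennreal (t\<^sup>2 * k)" using \<kappa>(2) by (simp add: ennreal_mult)
  finally have "(L2_norm w)\<^sup>2 \<le> t\<^sup>2 * k" using \<kappa>(2) by (simp add: ennreal_le_iff)
  also have "\<dots> \<le> c\<^sup>2 * k" using t(1) tc \<kappa>(2) by (intro mult_right_mono power_mono) auto
  finally show ?thesis .
qed

text \<open>The factor z of the polar density absorbs the singularity 1 / sqrt z. The integrand is
  the majorant for exp (max 0 (-ln |x|)) on a ball.\<close>

lemma nn_integral_inverse_norm_finite:
  "(\<integral>\<^sup>+x. ennreal ((1 + 1 / norm x) * indicator (cball 0 R) x) \<partial>(lebesgue :: (real^4) measure)) < \<infinity>"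
proof -
  have [measurable]: "(\<lambda>z::real. ennreal ((1 + 1 / sqrt z) * indicator {..R\<^sup>2} z)) \<in> borel_measurable borel" by measurable
  have "(\<integral>\<^sup>+x. ennreal ((1 + 1 / norm x) * indicator (cball 0 R) x) \<partial>(lebesgue :: (real^4) measure))
      \<le> (\<integral>\<^sup>+x. ennreal ((1 + 1 / sqrt (x \<bullet> x)) * indicator {..R\<^sup>2} (x \<bullet> x)) \<partial>(lebesgue :: (real^4) measure))"
  proof (rule nn_integral_mono)
    fix x :: "real^4"
    have "x \<bullet> x \<le> R\<^sup>2" if "norm x \<le> R"
      using power_mono[OF that norm_ge_zero, of 2] by (simp add: power2_norm_eq_inner)
    then show "ennreal ((1 + 1 / norm x) * indicator (cball 0 R) x) \<le> ennreal ((1 + 1 / sqrt (x \<bullet> x)) * indicator {..R\<^sup>2} (x \<bullet> x))"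
      by (auto simp: norm_eq_sqrt_inner split: split_indicator)
  qed
  also have "\<dots> = (\<integral>\<^sup>+x. ennreal ((1 + 1 / sqrt (x \<bullet> x)) * indicator {..R\<^sup>2} (x \<bullet> x)) \<partial>(lborel :: (real^4) measure))"
    by (rule nn_integral_completion)
  also have "\<dots> = (\<integral>\<^sup>+z. ennreal (pi\<^sup>2 * z * indicator {0..} z) * ennreal ((1 + 1 / sqrt z) * indicator {..R\<^sup>2} z) \<partial>lborel)"
    by (rule polar_nn_integral) measurable
  also have "\<dots> \<le> (\<integral>\<^sup>+z. ennreal (pi\<^sup>2 * (R\<^sup>2 + \<bar>R\<bar>)) * indicator {0..R\<^sup>2} z \<partial>lborel)"
  proof (rule nn_integral_mono)
    fix z :: real
    show "ennreal (pi\<^sup>2 * z * indicator {0..} z) * ennreal ((1 + 1 / sqrt z) * indicator {..R\<^sup>2} z)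
        \<le> ennreal (pi\<^sup>2 * (R\<^sup>2 + \<bar>R\<bar>)) * indicator {0..R\<^sup>2} z"
    proof (cases "0 < z \<and> z \<le> R\<^sup>2")
      case True
      have "sqrt z \<le> \<bar>R\<bar>" using True real_sqrt_le_mono[of z "R\<^sup>2"] by simp
      moreover have "z * (1 + 1 / sqrt z) = z + sqrt z" using True by (simp add: distrib_left real_div_sqrt)
      ultimately have "pi\<^sup>2 * (z * (1 + 1 / sqrt z)) \<le> pi\<^sup>2 * (R\<^sup>2 + \<bar>R\<bar>)"
        using True by (intro mult_left_mono) auto
      then have "ennreal (pi\<^sup>2 * (z * (1 + 1 / sqrt z))) \<le> ennreal (pi\<^sup>2 * (R\<^sup>2 + \<bar>R\<bar>))" by (rule ennreal_leI)
      moreover have "ennreal (pi\<^sup>2 * (z * (1 + 1 / sqrt z))) = ennreal (pi\<^sup>2 * z) * ennreal (1 + 1 / sqrt z)"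
        unfolding mult.assoc[symmetric] by (rule ennreal_mult) (use True in auto)
      ultimately show ?thesis using True by (simp del: ennreal_plus)
    next
      case False
      then show ?thesis by (cases "z = 0") (auto split: split_indicator)
    qed
  qed
  also have "\<dots> < \<infinity>" by (simp add: nn_integral_cmult_indicator ennreal_mult_less_top)
  finally show ?thesis .
qed

text \<open>The factor sqrt 2 pays for (a + b)^2 <= 2 a^2 + 2 b^2: the exponent is at most max 0
  (-ln |x|) plus a constant, so a multiple of 1 + 1 / |x| dominates the integrand on a ball. Farther
  out the exponent is bounded, and the integrand is at most a multiple of |r|^2.\<close>

lemma orlicz_norm_eventually_small:
  fixes r :: "nat \<Rightarrow> real^4 \<Rightarrow> 'a::{real_normed_field, euclidean_space}"
  assumes \<kappa>: "0 < kappa TYPE('a)" and meas: "\<And>n. r n \<in> borel_measurable lebesgue" and "0 < \<epsilon>" "0 \<le> B"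
    and bound: "\<And>n. AE x in lebesgue. norm (r n x) \<le> \<epsilon> * sqrt (max 0 (- ln (norm x))) + B"
    and lim: "AE x in lebesgue. (\<lambda>n. r n x) \<longlonglongrightarrow> 0"
    and tail: "\<And>\<delta>. 0 < \<delta> \<Longrightarrow> \<exists>R. \<forall>\<^sub>F n in sequentially. (\<integral>\<^sup>+x\<in>{x. R < norm x}. ennreal ((norm (r n x))\<^sup>2) \<partial>lebesgue) \<le> ennreal \<delta>"
  shows "\<forall>\<^sub>F n in sequentially. orlicz_norm (r n) \<le> ennreal (sqrt 2 * \<epsilon>)"
proof -
  note [measurable] = meas
  have [measurable]: "(\<lambda>x::real^4. x) \<in> borel_measurable lebesgue" by (simp add: measurable_completion)
  define \<tau> where "\<tau> = sqrt 2 * \<epsilon>"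
  have \<tau>: "0 < \<tau>" "\<tau>\<^sup>2 = 2 * \<epsilon>\<^sup>2" using \<open>0 < \<epsilon>\<close> by (auto simp: \<tau>_def power_mult_distrib)
  define T where "T = exp (B\<^sup>2 / \<epsilon>\<^sup>2)"
  have T: "0 < T" by (simp add: T_def)
  define g where "g n x = exp ((norm (r n x))\<^sup>2 / \<tau>\<^sup>2) - 1" for n x
  have g0: "0 \<le> g n x" for n x by (simp add: g_def)
  have [measurable]: "g n \<in> borel_measurable lebesgue" for n unfolding g_def[abs_def] by measurable
  obtain c where c: "0 < c" "ennreal c \<le> kappa TYPE('a)"
  proof (cases "kappa TYPE('a)")
    case (real k)
    then show ?thesis using that[of k] \<kappa> by simp
  next
    case top
    then show ?thesis using that[of 1] by simp
  qed
  have exp_bound: "(norm (r n x))\<^sup>2 / \<tau>\<^sup>2 \<le> max 0 (- ln (norm x)) + B\<^sup>2 / \<epsilon>\<^sup>2"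
    if "norm (r n x) \<le> \<epsilon> * sqrt (max 0 (- ln (norm x))) + B" for n x
  proof -
    let ?m = "max 0 (- ln (norm x))"
    have "(norm (r n x))\<^sup>2 \<le> (\<epsilon> * sqrt ?m + B)\<^sup>2" using that by (intro power_mono) auto
    also have "\<dots> \<le> 2 * (\<epsilon> * sqrt ?m)\<^sup>2 + 2 * B\<^sup>2"
      using sum_squares_bound[of "\<epsilon> * sqrt ?m" B] by (simp add: power2_sum)
    also have "(\<epsilon> * sqrt ?m)\<^sup>2 = \<epsilon>\<^sup>2 * ?m" by (simp add: power_mult_distrib)
    finally have "(norm (r n x))\<^sup>2 / \<tau>\<^sup>2 \<le> (2 * (\<epsilon>\<^sup>2 * ?m) + 2 * B\<^sup>2) / (2 * \<epsilon>\<^sup>2)"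
      unfolding \<tau>(2) by (intro divide_right_mono) auto
    also have "\<dots> = ?m + B\<^sup>2 / \<epsilon>\<^sup>2" using \<open>0 < \<epsilon>\<close> by (simp add: field_simps)
    finally show ?thesis .
  qed
  \<comment> \<open>Far from the origin the integrand is at most T / \<tau>^2 times the square of
    \<open>norm (r n x)\<close>; this \<open>\<delta>\<close> brings its integral down to c /
    2.\<close>
  define \<delta> where "\<delta> = c / 2 * \<tau>\<^sup>2 / T"
  have \<delta>: "0 < \<delta>" using c \<tau>(1) T by (simp add: \<delta>_def)
  obtain R0 where R0: "\<forall>\<^sub>F n in sequentially. (\<integral>\<^sup>+x\<in>{x. R0 < norm x}. ennreal ((norm (r n x))\<^sup>2) \<partial>lebesgue) \<le> ennreal \<delta>"
    using tail[OF \<delta>] by blast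
  define R where "R = max 1 R0"
  have [measurable]: "cball (0::real^4) R \<in> sets borel" by simp
  have far: "\<forall>\<^sub>F n in sequentially. (\<integral>\<^sup>+x. ennreal (g n x) * indicator {x. R < norm x} x \<partial>lebesgue) \<le> ennreal (c / 2)"
    using R0
  proof eventually_elim
    case (elim n)
    have "(\<integral>\<^sup>+x. ennreal (g n x) * indicator {x. R < norm x} x \<partial>lebesgue)
        \<le> (\<integral>\<^sup>+x. ennreal (T / \<tau>\<^sup>2) * (ennreal ((norm (r n x))\<^sup>2) * indicator {x. R0 < norm x} x) \<partial>lebesgue)"
    proof (rule nn_integral_mono_AE)
      show "AE x in lebesgue. ennreal (g n x) * indicator {x. R < norm x} x
          \<le> ennreal (T / \<tau>\<^sup>2) * (ennreal ((norm (r n x))\<^sup>2) * indicator {x. R0 < norm x} x)"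
        using bound[of n]
      proof eventually_elim
        case (elim x)
        show ?case
        proof (cases "R < norm x")
          case True
          define s where "s = (norm (r n x))\<^sup>2 / \<tau>\<^sup>2"
          have "0 \<le> s" by (simp add: s_def)
          have "1 \<le> norm x" "R0 < norm x" using True by (auto simp: R_def)
          then have "max 0 (- ln (norm x)) = 0" by simp
          then have "s \<le> B\<^sup>2 / \<epsilon>\<^sup>2" using exp_bound[OF elim] by (simp add: s_def)
          have "g n x \<le> s * exp s"
          proof -
            have "1 - s \<le> exp (- s)" using exp_ge_add_one_self[of "- s"] by simp
            then have "(1 - s) * exp s \<le> exp (- s) * exp s" by (intro mult_right_mono) auto
            then show ?thesis by (simp add: g_def s_def[symmetric] left_diff_distrib exp_minus)
          qed
          also have "\<dots> \<le> s * T" unfolding T_def using \<open>s \<le> _\<close> \<open>0 \<le> s\<close> by (intro mult_left_mono) auto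
          also have "\<dots> = T / \<tau>\<^sup>2 * (norm (r n x))\<^sup>2" by (simp add: s_def)
          finally have "ennreal (g n x) \<le> ennreal (T / \<tau>\<^sup>2 * (norm (r n x))\<^sup>2)" by (rule ennreal_leI)
          also have "\<dots> = ennreal (T / \<tau>\<^sup>2) * ennreal ((norm (r n x))\<^sup>2)" using T by (intro ennreal_mult) auto
          finally show ?thesis using True \<open>R0 < norm x\<close> by simp
        qed simp
      qed
    qed
    also have "\<dots> = ennreal (T / \<tau>\<^sup>2) * (\<integral>\<^sup>+x\<in>{x. R0 < norm x}. ennreal ((norm (r n x))\<^sup>2) \<partial>lebesgue)"
      by (rule nn_integral_cmult) measurable
    also have "\<dots> \<le> ennreal (T / \<tau>\<^sup>2) * ennreal \<delta>" by (rule mult_left_mono[OF elim]) simp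
    also have "\<dots> = ennreal (T / \<tau>\<^sup>2 * \<delta>)" using T \<delta> by (intro ennreal_mult[symmetric]) auto
    also have "T / \<tau>\<^sup>2 * \<delta> = c / 2" using T \<tau>(1) by (simp add: \<delta>_def)
    finally show ?case .
  qed
  have "(\<lambda>n. \<integral>\<^sup>+x. ennreal (g n x) * indicator {x. norm x \<le> R} x \<partial>lebesgue) \<longlonglongrightarrow> (\<integral>\<^sup>+x. 0 \<partial>(lebesgue :: (real^4) measure))"
  proof (rule nn_integral_dominated_convergence[where w = "\<lambda>x. ennreal T * ennreal ((1 + 1 / norm x) * indicator (cball 0 R) x)"])
    show "(\<integral>\<^sup>+x. ennreal T * ennreal ((1 + 1 / norm x) * indicator (cball 0 R) x) \<partial>(lebesgue :: (real^4) measure)) < \<infinity>"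
    proof (subst nn_integral_cmult)
      have "(\<lambda>x::real^4. ennreal ((1 + 1 / norm x) * indicator (cball 0 R) x)) \<in> borel_measurable borel" by measurable
      then show "(\<lambda>x::real^4. ennreal ((1 + 1 / norm x) * indicator (cball 0 R) x)) \<in> borel_measurable lebesgue"
        by (simp add: measurable_completion)
      show "ennreal T * (\<integral>\<^sup>+x. ennreal ((1 + 1 / norm x) * indicator (cball 0 R) x) \<partial>(lebesgue :: (real^4) measure)) < \<infinity>"
        using nn_integral_inverse_norm_finite[of R] by (simp add: ennreal_mult_less_top)
    qed
    have "(\<lambda>x::real^4. ennreal T * ennreal ((1 + 1 / norm x) * indicator (cball 0 R) x)) \<in> borel_measurable borel" by measurable
    then show "(\<lambda>x::real^4. ennreal T * ennreal ((1 + 1 / norm x) * indicator (cball 0 R) x)) \<in> borel_measurable lebesgue"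
      by (simp add: measurable_completion)
    show "AE x in lebesgue. ennreal (g n x) * indicator {x. norm x \<le> R} x \<le> ennreal T * ennreal ((1 + 1 / norm x) * indicator (cball 0 R) x)" for n
    proof -
      have "AE x::real^4 in lebesgue. x \<noteq> 0"
        using AE_not_in[of "{0::real^4}" lebesgue] by (simp add: AE_completion)
      with bound[of n] show ?thesis
      proof eventually_elim
        case (elim x)
        show ?case
        proof (cases "norm x \<le> R")
          case True
          have "g n x \<le> exp (max 0 (- ln (norm x)) + B\<^sup>2 / \<epsilon>\<^sup>2)"
            using exp_bound[OF elim(1)] by (simp add: g_def le_diff_eq add_increasing2)
              (smt (verit) exp_le_cancel_iff)
          also have "\<dots> = T * exp (max 0 (- ln (norm x)))" by (simp add: T_def exp_add mult.commute)
          also have "exp (max 0 (- ln (norm x))) \<le> 1 + 1 / norm x"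
            using elim(2) by (auto simp: max_def exp_minus inverse_eq_divide)
          finally have "g n x \<le> T * (1 + 1 / norm x)" using T by simp
          then have "ennreal (g n x) \<le> ennreal (T * (1 + 1 / norm x))" by (rule ennreal_leI)
          then show ?thesis using True T by (simp add: ennreal_mult)
        qed simp
      qed
    qed
    show "AE x in lebesgue. (\<lambda>n. ennreal (g n x) * indicator {x. norm x \<le> R} x) \<longlonglongrightarrow> 0"
      using lim
    proof eventually_elim
      case (elim x)
      have "(\<lambda>n. exp ((norm (r n x))\<^sup>2 / \<tau>\<^sup>2) - 1) \<longlonglongrightarrow> exp ((norm (0::'a))\<^sup>2 / \<tau>\<^sup>2) - 1"
        using \<tau>(1) by (intro tendsto_intros elim) auto
      then have "(\<lambda>n. g n x) \<longlonglongrightarrow> 0" by (simp add: g_def)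
      then have "(\<lambda>n. ennreal (g n x)) \<longlonglongrightarrow> ennreal 0" by (rule tendsto_ennrealI)
      then show ?case by (simp split: split_indicator)
    qed
  qed measurable
  then have "(\<lambda>n. \<integral>\<^sup>+x. ennreal (g n x) * indicator {x. norm x \<le> R} x \<partial>lebesgue) \<longlonglongrightarrow> 0" by simp
  then have near: "\<forall>\<^sub>F n in sequentially. (\<integral>\<^sup>+x. ennreal (g n x) * indicator {x. norm x \<le> R} x \<partial>lebesgue) < ennreal (c / 2)"
    by (rule order_tendstoD) (use c in simp)
  from far near show ?thesis
  proof eventually_elim
    case (elim n)
    have "(\<integral>\<^sup>+x. ennreal (g n x) \<partial>lebesgue)
        = (\<integral>\<^sup>+x. ennreal (g n x) * indicator {x. norm x \<le> R} x + ennreal (g n x) * indicator {x. R < norm x} x \<partial>lebesgue)"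
      by (rule nn_integral_cong) (auto split: split_indicator)
    also have "\<dots> = (\<integral>\<^sup>+x. ennreal (g n x) * indicator {x. norm x \<le> R} x \<partial>lebesgue)
        + (\<integral>\<^sup>+x. ennreal (g n x) * indicator {x. R < norm x} x \<partial>lebesgue)"
      by (rule nn_integral_add) measurable
    also have "\<dots> \<le> ennreal (c / 2) + ennreal (c / 2)" using elim by (intro add_mono) auto
    also have "\<dots> = ennreal c" using c(1) by (subst ennreal_plus[symmetric]) auto
    also have "\<dots> \<le> kappa TYPE('a)" by (rule c(2))
    finally show ?case unfolding g_def \<tau>_def[symmetric] by (rule orlicz_norm_le[OF \<tau>(1)])
  qed
qed

section \<open>Logarithmic profiles and the decomposition\<close>

context radial_H2_function
begin

text \<open>For s = -ln |x| the argument exp (-2 s) is |x|^2.\<close>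

definition log_prof :: "real \<Rightarrow> 'a" where
  "log_prof s = prof0 (exp (- 2 * s))"

lemma AE_eq_log_prof: "AE x in lebesgue. u x = log_prof (- ln (norm x))"
proof -
  have "AE x::real^4 in lebesgue. x \<noteq> 0"
    using AE_not_in[of "{0::real^4}" lebesgue] by (simp add: AE_completion)
  with AE_eq_prof0[OF u_radial] show ?thesis
  proof eventually_elim
    case (elim x)
    have "exp (- 2 * - ln (norm x)) = exp (ln (norm x)) * exp (ln (norm x))" by (simp flip: exp_add)
    also have "\<dots> = x \<bullet> x" using elim(2) by (simp add: power2_norm_eq_inner flip: power2_eq_square)
    finally show ?case using elim(1) by (simp add: log_prof_def)
  qed
qed

lemma log_prof_hoelder:
  assumes "s \<le> t"
  shows "(norm (log_prof t - log_prof s))\<^sup>2 \<le> 2 * energy * (t - s)"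
proof -
  have "(norm (prof (exp (- 2 * s)) - prof (exp (- 2 * t))))\<^sup>2 \<le> energy * ln (exp (- 2 * s) / exp (- 2 * t))"
    by (rule prof_hoelder) (use assms in auto)
  then show ?thesis by (simp add: log_prof_def prof0_def ln_div norm_minus_commute algebra_simps)
qed

text \<open>Differences of ln z are twice those of s in absolute value, which is the origin of the
  factor 2. The substitution reverses intervals but keeps their interiors disjoint.\<close>

lemma log_prof_energy: "energy_le (2 * (real DIM('a) * energy)) log_prof"
  unfolding energy_le_def
proof (intro allI impI)
  fix I :: "real set" and b :: "real \<Rightarrow> real"
  assume I: "finite I" "\<forall>a\<in>I. 0 \<le> a \<and> a < b a" "\<forall>a\<in>I. \<forall>a'\<in>I. a < a' \<longrightarrow> b a \<le> a'"
  let ?z = "\<lambda>s. exp (- 2 * s) :: real"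
  have "(\<Sum>a\<in>I. (norm (log_prof (b a) - log_prof a))\<^sup>2 / (b a - a))
      = 2 * (\<Sum>a\<in>I. (norm (prof (?z (b a)) - prof (?z a)))\<^sup>2 / ln (?z a / ?z (b a)))"
    unfolding sum_distrib_left
  proof (rule sum.cong[OF refl])
    fix a assume "a \<in> I"
    have ln: "ln (?z a / ?z (b a)) = 2 * (b a - a)" by (simp add: ln_div)
    show "(norm (log_prof (b a) - log_prof a))\<^sup>2 / (b a - a) = 2 * ((norm (prof (?z (b a)) - prof (?z a)))\<^sup>2 / ln (?z a / ?z (b a)))"
      unfolding ln log_prof_def prof0_def by (simp del: right_diff_distrib_numeral)
  qed
  also have "\<dots> \<le> 2 * (real DIM('a) * energy)"
  proof (intro mult_left_mono prof_energy I(1))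
    fix a a' assume "a \<in> I" "a' \<in> I" "a \<noteq> a'"
    then have "b a \<le> a' \<or> b a' \<le> a" using I(3) by (metis linorder_neqE)
    then show "?z a \<le> ?z (b a') \<or> ?z a' \<le> ?z (b a)" by auto
  qed (use I(2) in auto)
  finally show "(\<Sum>a\<in>I. (norm (log_prof (b a) - log_prof a))\<^sup>2 / (b a - a)) \<le> 2 * (real DIM('a) * energy)" .
qed

lemma log_prof_bound: "s \<le> 0 \<Longrightarrow> (norm (log_prof s))\<^sup>2 \<le> (L2_norm u)\<^sup>2 + 2 * energy"
  using prof_bound[of "exp (- 2 * s)"] by (simp add: log_prof_def prof0_def)

end

lemma nn_integral_far_subsequence:
  fixes u :: "nat \<Rightarrow> real^4 \<Rightarrow> 'a::euclidean_space"
  assumes tail: "((\<lambda>R::real. limsup (\<lambda>n.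
        \<integral>\<^sup>+ x \<in> {x. R < norm x}. ennreal ((norm (u n x))\<^sup>2) \<partial>lebesgue)) \<longlongrightarrow> 0) at_top"
    and "strict_mono \<sigma>" "0 < \<delta>"
  shows "\<exists>R\<ge>c. \<forall>\<^sub>F n in sequentially. (\<integral>\<^sup>+ x \<in> {x. R < norm x}. ennreal ((norm (u (\<sigma> n) x))\<^sup>2) \<partial>lebesgue) \<le> ennreal \<delta>"
proof -
  have "\<forall>\<^sub>F R in at_top. limsup (\<lambda>n. \<integral>\<^sup>+ x \<in> {x. R < norm x}. ennreal ((norm (u n x))\<^sup>2) \<partial>lebesgue) < ennreal \<delta>"
    by (rule order_tendstoD(2)[OF tail]) (use \<open>0 < \<delta>\<close> in simp)
  then have "\<forall>\<^sub>F R in at_top. limsup (\<lambda>n. \<integral>\<^sup>+ x \<in> {x. R < norm x}. ennreal ((norm (u n x))\<^sup>2) \<partial>lebesgue) < ennreal \<delta> \<and> c \<le> R"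
    using eventually_ge_at_top[of c] by (rule eventually_conj)
  from eventually_happens'[OF trivial_limit_at_top_linorder this]
  obtain R where R: "c \<le> R"
    "limsup (\<lambda>n. \<integral>\<^sup>+ x \<in> {x. R < norm x}. ennreal ((norm (u n x))\<^sup>2) \<partial>lebesgue) < ennreal \<delta>" by blast
  have "\<forall>\<^sub>F n in sequentially. (\<integral>\<^sup>+ x \<in> {x. R < norm x}. ennreal ((norm (u n x))\<^sup>2) \<partial>lebesgue) < ennreal \<delta>"
    by (rule Limsup_lessD[OF R(2)])
  then have "\<forall>\<^sub>F n in sequentially. (\<integral>\<^sup>+ x \<in> {x. R < norm x}. ennreal ((norm (u (\<sigma> n) x))\<^sup>2) \<partial>lebesgue) < ennreal \<delta>"
    by (rule eventually_subseq[OF assms(2)])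
  then have "\<forall>\<^sub>F n in sequentially. (\<integral>\<^sup>+ x \<in> {x. R < norm x}. ennreal ((norm (u (\<sigma> n) x))\<^sup>2) \<partial>lebesgue) \<le> ennreal \<delta>"
    by (rule eventually_mono) simp
  then show ?thesis using R(1) by blast
qed

theorem theorem1p10:
  fixes \<rho> :: "real \<Rightarrow> real"
    and u :: "nat \<Rightarrow> real^4 \<Rightarrow> 'a::{real_normed_field, euclidean_space}"
    and A\<^sub>0 :: real
  assumes rho_smooth: "smooth \<rho>"
    and rho_nonneg: "\<And>s. 0 \<le> \<rho> s"
    and rho_supp: "supp \<rho> \<subseteq> {-1..1}"
    and rho_mass: "(LINT s:{-1..1}|lebesgue. \<rho> s) = 1"
    and u_rad: "\<And>n. u n \<in> H2_rad"
    and u_bounded: "\<exists>M. \<forall>n. H2_norm (u n) \<le> M"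
    and u_weak: "weakly_null_H2 u"
    and A0_pos: "0 < A\<^sub>0"
    and u_orlicz: "limsup (\<lambda>n. orlicz_norm (u n)) = ennreal A\<^sub>0"
    and u_tail: "((\<lambda>R::real. limsup (\<lambda>n.
        \<integral>\<^sup>+ x \<in> {x. R < norm x}. ennreal ((norm (u n x))\<^sup>2) \<partial>lebesgue)) \<longlongrightarrow> 0) at_top"
  shows "\<exists>(\<alpha> :: nat \<Rightarrow> nat \<Rightarrow> real) (\<psi> :: nat \<Rightarrow> real \<Rightarrow> 'a) (\<sigma> :: nat \<Rightarrow> nat)
            (r :: nat \<Rightarrow> nat \<Rightarrow> real^4 \<Rightarrow> 'a).
      (\<forall>j\<ge>1. is_scale (\<alpha> j)) \<and>
      (\<forall>j\<ge>1. \<forall>k\<ge>1. j \<noteq> k \<longrightarrow> orthogonal_scales (\<alpha> j) (\<alpha> k)) \<and>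
      (\<forall>j\<ge>1. \<psi> j \<in> profiles) \<and>
      strict_mono \<sigma> \<and>
      (\<forall>l\<ge>1. \<forall>n. r l n \<in> borel_measurable lebesgue \<and>
         (AE x in lebesgue. u (\<sigma> n) x =
            (\<Sum>j=1..l. sqrt (\<alpha> j n / (8 * pi\<^sup>2)) *\<^sub>R
               convolution (\<psi> j) (\<lambda>s. \<alpha> j n * \<rho> (\<alpha> j n * s)) (- ln (norm x) / \<alpha> j n))
            + r l n x)) \<and>
      (\<lambda>l. limsup (\<lambda>n. orlicz_norm (r l n))) \<longlonglongrightarrow> 0"
proof -
  interpret mollifier \<rho> by unfold_locales (fact rho_smooth rho_nonneg rho_supp rho_mass)+
  have u_L2: "u n \<in> L2" for n using u_rad[of n] by (simp add: H2_rad_def H2_def)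
  have u_meas: "u n \<in> borel_measurable lebesgue" for n using u_L2[of n] by (simp add: L2_def)
  have \<kappa>: "0 < kappa TYPE('a)" "kappa TYPE('a) < \<infinity>"
    using kappa_nondegenerate[OF u_meas u_orlicz A0_pos] .
  obtain k where k: "kappa TYPE('a) = ennreal k" "0 \<le> k"
    using \<kappa>(2) by (cases "kappa TYPE('a)") auto
  have "\<forall>\<^sub>F n in sequentially. orlicz_norm (u n) < ennreal (2 * A\<^sub>0)"
    by (rule Limsup_lessD) (use A0_pos in \<open>simp add: u_orlicz ennreal_less_iff\<close>)
  then obtain N0 where N0: "\<And>n. N0 \<le> n \<Longrightarrow> orlicz_norm (u n) < ennreal (2 * A\<^sub>0)"
    by (auto simp: eventually_sequentially)
  define M2 where "M2 = (2 * A\<^sub>0)\<^sup>2 * k"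
  obtain M where M: "\<And>n. H2_norm (u n) \<le> M" using u_bounded by blast
  \<comment> \<open>The L2 bound through the Orlicz norm is available only once that norm is below
    \<open>2 * A\<^sub>0\<close>, so the first \<open>N0\<close> terms are dropped; the final
    subsequence \<open>\<sigma>'\<close> carries the shift.\<close>
  define w where "w n = u (n + N0)" for n
  have w_rad: "w n \<in> H2_rad" for n by (simp add: w_def u_rad)
  have w_L2: "(L2_norm (w n))\<^sup>2 \<le> M2" for n
    unfolding w_def M2_def by (rule L2_norm_le_orlicz[OF u_L2 N0 k]) simp
  have w_weak: "weakly_null_H2 w"
    using u_weak unfolding weakly_null_H2_def w_def by (auto intro: LIMSEQ_ignore_initial_segment)
  have loc: "radial_H2_function \<rho> (w n)" for n
    using w_rad[of n] mollifier_axioms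
    by (auto simp: H2_rad_def radial_H2_function_def H2_function_def H2_function_axioms_def radial_H2_function_axioms_def)
  then have loc': "H2_function \<rho> (w n)" for n by (simp add: radial_H2_function_def)
  define E where "E = (2 * M2 + 2 * M\<^sup>2) / (16 * pi\<^sup>2)"
  have E: "H2_function.energy (w n) \<le> E" for n
  proof -
    have "(H2_norm (w n))\<^sup>2 \<le> M\<^sup>2"
      unfolding w_def using M by (intro power_mono) (auto simp: H2_norm_def L2_norm_def)
    then have "(L2_norm (weak_laplacian (w n)))\<^sup>2 \<le> 2 * M2 + 2 * M\<^sup>2"
      using H2_weak_laplacian(2)[of "w n"] w_rad[of n] w_L2[of n] by (simp add: H2_rad_def)
    then show ?thesis unfolding H2_function.energy_def[OF loc'] E_def by (rule divide_right_mono) simp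
  qed
  have E0: "0 \<le> E" using order_trans[OF H2_function.energy_nonneg[OF loc'] E] .
  have M20: "0 \<le> M2" using k(2) by (simp add: M2_def)
  define K where "K = 2 * (real DIM('a) * E)"
  have K0: "0 \<le> K" using E0 by (simp add: K_def)
  define v where "v n = radial_H2_function.log_prof \<rho> (w n)" for n
  have v_eq: "AE x in lebesgue. w n x = v n (- ln (norm x))" for n
    unfolding v_def by (rule radial_H2_function.AE_eq_log_prof[OF loc])
  have vE: "energy_le K (v n)" for n
    unfolding v_def K_def
    by (rule energy_le_mono[OF radial_H2_function.log_prof_energy[OF loc]])
      (intro mult_left_mono E; simp)
  have v0: "(\<lambda>n. v n s) \<longlonglongrightarrow> 0" for s
    unfolding v_def radial_H2_function.log_prof_def[OF loc]
    by (rule weakly_null_imp_prof_tendsto_0[OF w_rad w_weak E w_L2])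
  define A where "A = sqrt (M2 + 2 * E) + sqrt (2 * E)"
  have v_bound: "norm (v n s) \<le> A" if "s \<le> 1" for n s
  proof -
    have neg: "norm (v n s) \<le> sqrt (M2 + 2 * E)" if "s \<le> 0" for s
      using radial_H2_function.log_prof_bound[OF loc that, of n] w_L2[of n] E[of n]
      unfolding v_def by (intro real_le_rsqrt) linarith
    show ?thesis
    proof (cases "s \<le> 0")
      case True
      then show ?thesis using neg[OF True] E0 unfolding A_def by (simp add: add_increasing2)
    next
      case False
      have "(norm (v n s - v n 0))\<^sup>2 \<le> 2 * H2_function.energy (w n) * (s - 0)"
        unfolding v_def by (rule radial_H2_function.log_prof_hoelder[OF loc]) (use False in simp)
      also have "\<dots> \<le> (2 * E) * 1"
        using E[of n] E0 that False H2_function.energy_nonneg[OF loc', of n] by (intro mult_mono) auto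
      finally have "norm (v n s - v n 0) \<le> sqrt (2 * E)" by (intro real_le_rsqrt) simp
      then show ?thesis using neg[of 0] norm_triangle_sub[of "v n s" "v n 0"] unfolding A_def by simp
    qed
  qed
  obtain a :: "nat \<Rightarrow> nat \<Rightarrow> real" and \<theta> :: "nat \<Rightarrow> real \<Rightarrow> 'a" and \<sigma> :: "nat \<Rightarrow> nat"
    where \<sigma>: "strict_mono \<sigma>" and a: "\<And>j. is_scale (a j)"
      and orth: "\<And>j k. j \<noteq> k \<Longrightarrow> orthogonal_scales (a j) (a k)"
      and \<theta>E: "\<And>j. energy_le K (\<theta> j)" and \<theta>0: "\<And>j s. s \<le> 0 \<Longrightarrow> \<theta> j s = 0"
      and approx: "\<And>\<epsilon>. 0 < \<epsilon> \<Longrightarrow> \<exists>l0. \<forall>l\<ge>l0. \<forall>\<^sub>F n in sequentially. \<forall>s\<ge>1.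
        norm (v (\<sigma> n) s - (\<Sum>j<l. sqrt (a j n) *\<^sub>R \<theta> j (s / a j n))) \<le> \<epsilon> * sqrt s"
    by (rule profile_extraction[OF vE v0]) (rule that)
  have a_pos: "0 < a j n" for j n using a[of j] by (simp add: is_scale_def)
  have \<theta>_cont: "continuous_on UNIV (\<theta> j)" for j by (rule profile_continuous[OF \<theta>E \<theta>0])
  define C where "C j n = convolution (\<theta> j) (\<lambda>s. a j n * \<rho> (a j n * s))" for j n
  have [measurable]: "C j n \<in> borel_measurable borel" for j n
    unfolding C_def by (rule convolution_measurable[OF \<theta>_cont a_pos])
  \<comment> \<open>The factor sqrt (8 pi^2) compensates the normalisation in the statement;
    \<open>j - 1\<close> appears because the decomposition is numbered from 1.\<close>
  define \<psi> where "\<psi> j s = sqrt (8 * pi\<^sup>2) *\<^sub>R \<theta> (j - 1) s" for j s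
  define \<alpha> where "\<alpha> j = a (j - 1)" for j
  define \<sigma>' where "\<sigma>' n = \<sigma> n + N0" for n
  define S where "S l n s = (\<Sum>j<l. sqrt (a j n) *\<^sub>R C j n (s / a j n))" for l n s
  define r where "r l n x = u (\<sigma>' n) x - S l n (- ln (norm x))" for l n x
  define R where "R l n s = v (\<sigma> n) s - S l n s" for l n s
  have \<sigma>': "strict_mono \<sigma>'" using \<sigma> by (simp add: \<sigma>'_def strict_mono_def)
  have S_eq: "(\<Sum>j=1..l. sqrt (\<alpha> j n / (8 * pi\<^sup>2)) *\<^sub>R
      convolution (\<psi> j) (\<lambda>s. \<alpha> j n * \<rho> (\<alpha> j n * s)) (s / \<alpha> j n)) = S l n s" for l n s
  proof -
    have "convolution (\<psi> (Suc j)) g y = sqrt (8 * pi\<^sup>2) *\<^sub>R convolution (\<theta> j) g y" for j g y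
      unfolding convolution_def \<psi>_def diff_Suc_1 scaleR_left_commute[of _ "sqrt (8 * pi\<^sup>2)"]
      by (rule integral_scaleR_right)
    then have "sqrt (\<alpha> (Suc j) n / (8 * pi\<^sup>2)) *\<^sub>R
      convolution (\<psi> (Suc j)) (\<lambda>s. \<alpha> (Suc j) n * \<rho> (\<alpha> (Suc j) n * s)) (s / \<alpha> (Suc j) n)
        = sqrt (a j n) *\<^sub>R C j n (s / a j n)" for j
      by (simp add: \<alpha>_def C_def real_sqrt_divide)
    then show ?thesis by (simp add: S_def sum.atLeast1_atMost_eq)
  qed
  have r_meas: "r l n \<in> borel_measurable lebesgue" for l n
  proof -
    have "(\<lambda>x::real^4. S l n (- ln (norm x))) \<in> borel_measurable borel" unfolding S_def by measurable
    then have [measurable]: "(\<lambda>x::real^4. S l n (- ln (norm x))) \<in> borel_measurable lebesgue"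
      by (simp add: measurable_completion)
    note [measurable] = u_meas
    show ?thesis unfolding r_def[abs_def] by measurable
  qed
  have r_eq: "AE x in lebesgue. r l n x = R l n (- ln (norm x))" for l n
    using v_eq[of "\<sigma> n"] by eventually_elim (simp add: r_def R_def w_def \<sigma>'_def)
  have R_lim: "(\<lambda>n. R l n s) \<longlonglongrightarrow> 0" for l s
  proof -
    have "(\<lambda>n. S l n s) \<longlonglongrightarrow> (\<Sum>j<l. 0)"
      unfolding S_def C_def by (intro tendsto_sum rescaled_convolution_tendsto_0[OF \<theta>E \<theta>0 a])
    moreover have "(\<lambda>n. v (\<sigma> n) s) \<longlonglongrightarrow> 0" using filterlim_compose[OF v0 filterlim_subseq[OF \<sigma>]] .
    ultimately show ?thesis unfolding R_def using tendsto_diff by fastforce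
  qed
  have R_far: "R l n s = v (\<sigma> n) s" if "s \<le> -1" for l n s
    using convolution_eq_0[OF \<theta>E \<theta>0 a_pos that] by (simp add: R_def S_def C_def)
  have tail: "\<exists>R. \<forall>\<^sub>F n in sequentially. (\<integral>\<^sup>+x\<in>{x. R < norm x}. ennreal ((norm (r l n x))\<^sup>2) \<partial>lebesgue) \<le> ennreal \<delta>"
    if \<delta>: "0 < \<delta>" for \<delta> l
  proof -
    \<comment> \<open>The condition \<open>exp 1 \<le> c\<close> places the region
      \<open>c < norm x\<close> in s <= -1, where all convolutions vanish.\<close>
    obtain c where c: "exp 1 \<le> c" "\<forall>\<^sub>F n in sequentially. (\<integral>\<^sup>+x\<in>{x. c < norm x}. ennreal ((norm (u (\<sigma>' n) x))\<^sup>2) \<partial>lebesgue) \<le> ennreal \<delta>"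
      using nn_integral_far_subsequence[OF u_tail \<sigma>' \<delta>] by blast
    have "(\<integral>\<^sup>+x\<in>{x. c < norm x}. ennreal ((norm (r l n x))\<^sup>2) \<partial>lebesgue)
        = (\<integral>\<^sup>+x\<in>{x. c < norm x}. ennreal ((norm (u (\<sigma>' n) x))\<^sup>2) \<partial>lebesgue)" for n
    proof (rule nn_integral_cong_AE)
      show "AE x in lebesgue. ennreal ((norm (r l n x))\<^sup>2) * indicator {x. c < norm x} x
          = ennreal ((norm (u (\<sigma>' n) x))\<^sup>2) * indicator {x. c < norm x} x"
        using r_eq[of l n] v_eq[of "\<sigma> n"]
      proof eventually_elim
        case (elim x)
        show ?case
        proof (cases "c < norm x")
          case True
          then have "exp 1 \<le> norm x" using c(1) by linarith
          then have "1 \<le> ln (norm x)" using ln_ge_iff[of "norm x" 1] by (smt (verit) exp_gt_zero)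
          then have "r l n x = u (\<sigma>' n) x" using elim R_far[of "- ln (norm x)"] by (simp add: w_def \<sigma>'_def)
          then show ?thesis by simp
        qed simp
      qed
    qed
    then show ?thesis using c(2) by (intro exI[of _ c]) simp
  qed
  have small: "\<exists>l0. \<forall>l\<ge>l0. limsup (\<lambda>n. orlicz_norm (r l n)) \<le> ennreal (sqrt 2 * \<epsilon>)" if \<epsilon>: "0 < \<epsilon>" for \<epsilon>
  proof -
    obtain l0 where l0: "\<And>l. l0 \<le> l \<Longrightarrow> \<forall>\<^sub>F n in sequentially. \<forall>s\<ge>1.
        norm (v (\<sigma> n) s - (\<Sum>j<l. sqrt (a j n) *\<^sub>R \<theta> j (s / a j n))) \<le> \<epsilon> * sqrt s"
      using approx[OF \<epsilon>] by blast
    show ?thesis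
    proof (intro exI allI impI)
      fix l assume "l0 \<le> l"
      obtain N where "\<forall>n\<ge>N. \<forall>s\<ge>1.
          norm (v (\<sigma> n) s - (\<Sum>j<l. sqrt (a j n) *\<^sub>R \<theta> j (s / a j n))) \<le> \<epsilon> * sqrt s"
        using l0[OF \<open>l0 \<le> l\<close>] unfolding eventually_sequentially by (rule exE)
      then have N: "norm (v (\<sigma> n) s - (\<Sum>j<l. sqrt (a j n) *\<^sub>R \<theta> j (s / a j n))) \<le> \<epsilon> * sqrt s"
        if "N \<le> n" "1 \<le> s" for n s using that by simp
      \<comment> \<open>Below s = 1 the function \<open>v\<close> is bounded by \<open>A\<close> and
        each rescaled convolution by 2 sqrt K; above s = 1 the replacement of profiles by
        convolutions costs at most l sqrt K.\<close>
      define B where "B = A + real l * (2 * sqrt K)"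
      have A0: "0 \<le> A" using M20 E0 by (simp add: A_def)
      have B0: "0 \<le> B" using A0 K0 by (simp add: B_def)
      have near: "norm (sqrt (a j n) *\<^sub>R C j n (s / a j n) - sqrt (a j n) *\<^sub>R \<theta> j (s / a j n)) \<le> sqrt K" for j n s
        unfolding C_def by (rule rescaled_convolution_near[OF \<theta>E \<theta>0 a_pos])
      have R_bound: "norm (R l n s) \<le> \<epsilon> * sqrt (max 0 s) + B" if "N \<le> n" for n s
      proof (cases "1 \<le> s")
        case True
        have "norm (S l n s - (\<Sum>j<l. sqrt (a j n) *\<^sub>R \<theta> j (s / a j n))) \<le> (\<Sum>j<l. sqrt K)"
          unfolding S_def sum_subtractf[symmetric] by (rule sum_norm_le[OF near])
        moreover have "real l * sqrt K \<le> B" using A0 K0 by (simp add: B_def)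
        ultimately show ?thesis
          using N[OF \<open>N \<le> n\<close> True] True
            norm_triangle_ineq4[of "v (\<sigma> n) s - (\<Sum>j<l. sqrt (a j n) *\<^sub>R \<theta> j (s / a j n))"
              "S l n s - (\<Sum>j<l. sqrt (a j n) *\<^sub>R \<theta> j (s / a j n))"]
          by (simp add: R_def max_def)
      next
        case False
        have "norm (S l n s) \<le> (\<Sum>j<l. 2 * sqrt K)"
          unfolding S_def
        proof (rule sum_norm_le)
          fix j
          have "norm (sqrt (a j n) *\<^sub>R \<theta> j (s / a j n)) \<le> sqrt K"
            by (rule rescaled_profile_bound[OF \<theta>E \<theta>0 a_pos]) (use False in auto)
          then show "norm (sqrt (a j n) *\<^sub>R C j n (s / a j n)) \<le> 2 * sqrt K"
            using near[of j n s] norm_triangle_sub[of "sqrt (a j n) *\<^sub>R C j n (s / a j n)" "sqrt (a j n) *\<^sub>R \<theta> j (s / a j n)"]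
            by linarith
        qed
        moreover have "0 \<le> \<epsilon> * sqrt (max 0 s)" using \<open>0 < \<epsilon>\<close> by simp
        ultimately show ?thesis
          using v_bound[of s "\<sigma> n"] False norm_triangle_ineq4[of "v (\<sigma> n) s" "S l n s"]
          by (simp add: R_def B_def)
      qed
      have "\<forall>\<^sub>F n in sequentially. orlicz_norm (r l (n + N)) \<le> ennreal (sqrt 2 * \<epsilon>)"
      \<comment> \<open>The index shift by \<open>N\<close> makes the pointwise bound valid for
        every index of the sequence.\<close>
      proof (rule orlicz_norm_eventually_small[OF \<kappa>(1) r_meas \<open>0 < \<epsilon>\<close> B0])
        show "AE x in lebesgue. norm (r l (n + N) x) \<le> \<epsilon> * sqrt (max 0 (- ln (norm x))) + B" for n
          using r_eq[of l "n + N"] by eventually_elim (use R_bound[of "n + N"] in simp)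
        have "AE x in lebesgue. \<forall>n. r l n x = R l n (- ln (norm x))"
          using r_eq by (simp add: AE_all_countable)
        then show "AE x in lebesgue. (\<lambda>n. r l (n + N) x) \<longlonglongrightarrow> 0"
        proof eventually_elim
          case (elim x)
          then show ?case using LIMSEQ_ignore_initial_segment[OF R_lim[of l "- ln (norm x)"], of N] by simp
        qed
        show "\<exists>R. \<forall>\<^sub>F n in sequentially. (\<integral>\<^sup>+x\<in>{x. R < norm x}. ennreal ((norm (r l (n + N) x))\<^sup>2) \<partial>lebesgue) \<le> ennreal \<delta>"
          if "0 < \<delta>" for \<delta>
          using tail[OF that, of l] by (auto dest: sequentially_offset[where k = N])
      qed
      then have "\<forall>\<^sub>F n in sequentially. orlicz_norm (r l n) \<le> ennreal (sqrt 2 * \<epsilon>)"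
        by (rule eventually_sequentially_seg[THEN iffD1])
      then show "limsup (\<lambda>n. orlicz_norm (r l n)) \<le> ennreal (sqrt 2 * \<epsilon>)" by (rule Limsup_bounded)
    qed
  qed
  have limit: "(\<lambda>l. limsup (\<lambda>n. orlicz_norm (r l n))) \<longlonglongrightarrow> 0"
  proof (rule order_tendstoI)
    fix c :: ennreal assume "0 < c"
    obtain e where e: "0 < e" "ennreal e < c"
    proof (cases c)
      case (real r)
      then show thesis using \<open>0 < c\<close> by (intro that[of "r / 2"]) (auto simp: ennreal_less_iff)
    next
      case top
      then show thesis by (intro that[of 1]) auto
    qed
    obtain l0 where "\<forall>l\<ge>l0. limsup (\<lambda>n. orlicz_norm (r l n)) \<le> ennreal (sqrt 2 * (e / sqrt 2))"
      using small[of "e / sqrt 2"] e(1) by auto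
    then have "\<forall>l\<ge>l0. limsup (\<lambda>n. orlicz_norm (r l n)) < c" using e(2) by (auto intro: le_less_trans)
    then show "\<forall>\<^sub>F l in sequentially. limsup (\<lambda>n. orlicz_norm (r l n)) < c"
      by (auto simp: eventually_sequentially)
  qed simp
  have prof: "\<psi> j \<in> profiles" for j
    unfolding \<psi>_def[abs_def]
    by (rule energy_le_imp_profile[OF energy_le_scaleR[OF \<theta>E]]) (simp add: \<theta>0)
  have scale: "is_scale (\<alpha> j)" for j using a by (simp add: \<alpha>_def[abs_def])
  have decomp: "AE x in lebesgue. u (\<sigma>' n) x = (\<Sum>j=1..l. sqrt (\<alpha> j n / (8 * pi\<^sup>2)) *\<^sub>R
      convolution (\<psi> j) (\<lambda>s. \<alpha> j n * \<rho> (\<alpha> j n * s)) (- ln (norm x) / \<alpha> j n)) + r l n x" for l n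
    unfolding S_eq by (simp add: r_def)
  show ?thesis
  proof (intro exI[of _ \<alpha>] exI[of _ \<psi>] exI[of _ \<sigma>'] exI[of _ r] conjI allI impI)
    fix j k :: nat assume "1 \<le> j" "1 \<le> k" "j \<noteq> k"
    then show "orthogonal_scales (\<alpha> j) (\<alpha> k)" unfolding \<alpha>_def by (intro orth) simp
  qed (rule scale prof decomp limit \<sigma>' r_meas)+
qed

end
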